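(* Let $d\ge3$ be an integer, $s\in\mathbb R$ and $j\in\mathbb N_0$. The generalized Funk--Radon transform $\mathcal S^{(j)}_d$ extends to a continuous operator $$\mathcal S^{(j)}_d\colon H^s(\mathbb S^{d-1})\to H^{s-j+\frac{d-2}{2}}(\mathbb S^{d-1}).$$ If $j<\frac{d-2}{2}$, then $\mathcal S^{(j)}_d\colon L^2(\mathbb S^{d-1})\to L^2(\mathbb S^{d-1})$ is compact. The nullspace of $\mathcal S^{(j)}_d$ (in $H^s(\mathbb S^{d-1})$) is the closed linear span $$\overline{\operatorname{span}}\left\{\mathscr Y_{n,d}(\mathbb S^{d-1}):\ n+j\text{ odd, or }(n\le j-d+1\text{ and }d\text{ odd})\right\}.$$ If $d$ is odd and $j\ge d-1$, the nullspace of $\mathcal S^{(j)}_d$ is the sum of the space of all polynomials (restricted to the sphere) of degree up to $j-d+1$ and the space of all odd functions if $j$ is even, respectively of all even functions if $j$ is odd. Otherwise, the nullspace of $\mathcal S^{(j)}_d$ consists of all odd functions if $j$ is even, respectively of all even functions if $j$ is odd.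
   Context: $\mathbb S^{d-1}=\{x\in\mathbb R^d:\|x\|=1\}$. For $f\in C^\infty(\mathbb S^{d-1})$, $\mathcal S^{(j)}_d f(\xi)=\int_{\mathbb S^{d-1}}\delta^{(j)}(\xi^\top\eta)f(\eta)\,d\eta$, where $\delta^{(j)}$ is the $j$-th derivative of the Dirac delta. This means precisely $$\mathcal S^{(j)}_d f(\xi)=(-1)^j\left(\frac{d}{dt}\right)^j\left[(1-t^2)^{-1/2}\int_{\{\eta\in\mathbb S^{d-1}:\,\xi^\top\eta=t\}}f(\eta)\,d\lambda(\eta)\right]_{t=0},$$ where $d\lambda$ is the standard $(d-2)$-dimensional surface measure on the sub-sphere. $\mathscr Y_{n,d}(\mathbb S^{d-1})$ is the space of restrictions to $\mathbb S^{d-1}$ of harmonic polynomials homogeneous of degree $n$ ($n\in\mathbb N_0$), with dimension $N_{n,d}$ and an $L^2(\mathbb S^{d-1})$-orthonormal basis $Y_{n,d}^k$, $k=1,\dots,N_{n,d}$. The Sobolev space $H^s(\mathbb S^{d-1})$, $s\in\mathbb R$, is the completion of $C^\infty(\mathbb S^{d-1})$ with respect to the norm $$\|f\|_{H^s(\mathbb S^{d-1})}^2=\sum_{n=0}^\infty\sum_{k=1}^{N_{n,d}}\left(n+\tfrac{d-2}{2}\right)^{2s}\left|\langle f,Y_{n,d}^k\rangle_{L^2(\mathbb S^{d-1})}\right|^2;$$ $H^0(\mathbb S^{d-1})=L^2(\mathbb S^{d-1})$. Even (odd) elements of $H^s$ are those invariant (changing sign) under $\xi\mapsto-\xi$, i.e.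 those whose expansion contains only $Y_{n,d}^k$ with $n$ even (odd). *)

theory Defs
  imports "HOL-Analysis.Analysis" "HOL-Library.Function_Algebras"
begin

global_interpretation cfun: vector_space "\<lambda>(c::complex) (f::'a \<Rightarrow> complex) x. c * f x"
  by unfold_locales (auto simp: fun_eq_iff algebra_simps)

text \<open>
  The dimension \<open>d\<close> is \<open>CARD('d)\<close>. A complex function on the unit sphere is represented by its
  extension by zero to the whole space, so that equality on the sphere is equality in HOL.
\<close>

definition on_sphere :: "(real^'d::finite \<Rightarrow> complex) \<Rightarrow> real^'d \<Rightarrow> complex" where
  "on_sphere f = (\<lambda>x. if x \<in> sphere 0 1 then f x else 0)"

subsection \<open>Surface measures\<close>

text \<open>
  The surface measure of a subset \<open>A\<close> of the unit sphere of an \<open>m\<close>-dimensional Euclidean space is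
  \<open>m\<close> times the Lebesgue measure of the cone \<open>{r *\<^sub>R a | a \<in> A, 0 < r \<le> 1}\<close>,
  which up to the origin is the preimage of \<open>A\<close> under \<open>sgn x = x /\<^sub>R norm x\<close> in the unit ball.
\<close>

definition sphere_measure :: "(real^'d) measure" where
  "sphere_measure =
     scale_measure (of_nat CARD('d)) (distr (restrict_space lborel (cball 0 1)) borel sgn)"

text \<open>
  For a unit vector \<open>\<xi>\<close>, the \<open>(d-1)\<close>-dimensional Lebesgue measure of a subset \<open>B\<close> of the hyperplane
  orthogonal to \<open>\<xi>\<close> is the \<open>d\<close>-dimensional Lebesgue measure of the cylinder
  \<open>{b + h *\<^sub>R \<xi> | b \<in> B, 0 \<le> h \<le> 1}\<close> of height one.
\<close>

definition hyperplane_measure :: "real^'d::finite \<Rightarrow> (real^'d) measure" where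
  "hyperplane_measure \<xi> =
     distr (restrict_space lborel {x. 0 \<le> \<xi> \<bullet> x \<and> \<xi> \<bullet> x \<le> 1}) borel (\<lambda>x. x - (\<xi> \<bullet> x) *\<^sub>R \<xi>)"

text \<open>
  For \<open>\<bar>t\<bar> < 1\<close> the set \<open>{\<eta> \<in> sphere 0 1. \<xi> \<bullet> \<eta> = t}\<close> is the image of the unit sphere of the hyperplane
  orthogonal to \<open>\<xi>\<close> under the dilation by \<open>sqrt (1 - t\<^sup>2)\<close> followed by the translation by \<open>t *\<^sub>R \<xi>\<close>;
  the dilation multiplies the \<open>(d-2)\<close>-dimensional surface measure by \<open>sqrt (1 - t\<^sup>2) ^ (d - 2)\<close>.
\<close>

definition subsphere_measure :: "real^'d::finite \<Rightarrow> real \<Rightarrow> (real^'d) measure" where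
  "subsphere_measure \<xi> t =
     scale_measure (ennreal (real (CARD('d) - 1) * sqrt (1 - t\<^sup>2) ^ (CARD('d) - 2)))
       (distr (restrict_space (hyperplane_measure \<xi>) (cball 0 1)) borel
          (\<lambda>x. t *\<^sub>R \<xi> + sqrt (1 - t\<^sup>2) *\<^sub>R sgn x))"

subsection \<open>Smooth functions and the generalized Funk--Radon transform\<close>

text \<open>For \<open>U\<close> open, \<open>Ck_on k f U\<close> means that \<open>f\<close> is \<open>k\<close> times continuously differentiable on \<open>U\<close>.\<close>

primrec Ck_on :: "nat \<Rightarrow> (real^'d::finite \<Rightarrow> complex) \<Rightarrow> (real^'d) set \<Rightarrow> bool" where
  "Ck_on 0 f U \<longleftrightarrow> continuous_on U f"
| "Ck_on (Suc k) f U \<longleftrightarrow>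
     (\<forall>x\<in>U. f differentiable (at x)) \<and> (\<forall>v. Ck_on k (\<lambda>x. frechet_derivative f (at x) v) U)"

definition smooth_sphere :: "(real^'d::finite \<Rightarrow> complex) set" where
  "smooth_sphere = {f. \<exists>U F. open U \<and> sphere 0 1 \<subseteq> U \<and> (\<forall>k. Ck_on k F U) \<and> f = on_sphere F}"

definition funk_radon :: "nat \<Rightarrow> (real^'d::finite \<Rightarrow> complex) \<Rightarrow> real^'d \<Rightarrow> complex" where
  "funk_radon j f = on_sphere (\<lambda>\<xi>. (-1) ^ j *
     ((\<lambda>g t. vector_derivative g (at t)) ^^ j)
       (\<lambda>t. (1 - t\<^sup>2) powr (-1/2) *\<^sub>R (\<integral>\<eta>. f \<eta> \<partial>subsphere_measure \<xi> t)) 0)"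

subsection \<open>Polynomials and spherical harmonics\<close>

definition cmonomial :: "('d::finite \<Rightarrow> nat) \<Rightarrow> real^'d \<Rightarrow> complex" where
  "cmonomial \<alpha> x = complex_of_real (\<Prod>i\<in>UNIV. (x $ i) ^ \<alpha> i)"

definition polys_upto :: "nat \<Rightarrow> (real^'d::finite \<Rightarrow> complex) set" where
  "polys_upto m = cfun.span {cmonomial \<alpha> | \<alpha>. (\<Sum>i\<in>UNIV. \<alpha> i) \<le> m}"

definition homogeneous_polys :: "nat \<Rightarrow> (real^'d::finite \<Rightarrow> complex) set" where
  "homogeneous_polys n = cfun.span {cmonomial \<alpha> | \<alpha>. (\<Sum>i\<in>UNIV. \<alpha> i) = n}"

definition laplacian :: "(real^'d::finite \<Rightarrow> complex) \<Rightarrow> real^'d \<Rightarrow> complex" where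
  "laplacian p x =
     (\<Sum>b\<in>Basis. frechet_derivative (\<lambda>y. frechet_derivative p (at y) b) (at x) b)"

definition spherical_harmonics :: "nat \<Rightarrow> (real^'d::finite \<Rightarrow> complex) set" where
  "spherical_harmonics n = on_sphere ` {p \<in> homogeneous_polys n. \<forall>x. laplacian p x = 0}"

definition sphere_inner :: "(real^'d::finite \<Rightarrow> complex) \<Rightarrow> (real^'d \<Rightarrow> complex) \<Rightarrow> complex" where
  "sphere_inner f g = (\<integral>x. f x * cnj (g x) \<partial>sphere_measure)"

definition harmonic_dim :: "'d::finite itself \<Rightarrow> nat \<Rightarrow> nat" where
  "harmonic_dim _ n = cfun.dim (spherical_harmonics n :: (real^'d \<Rightarrow> complex) set)"

definition harmonic_onb :: "(nat \<Rightarrow> nat \<Rightarrow> real^'d::finite \<Rightarrow> complex) \<Rightarrow> bool" where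
  "harmonic_onb Y \<longleftrightarrow> (\<forall>n.
     (\<forall>k\<in>{1..harmonic_dim TYPE('d) n}. \<forall>l\<in>{1..harmonic_dim TYPE('d) n}.
        sphere_inner (Y n k) (Y n l) = (if k = l then 1 else 0)) \<and>
     cfun.span (Y n ` {1..harmonic_dim TYPE('d) n}) = spherical_harmonics n)"

definition sobolev_norm ::
    "(nat \<Rightarrow> nat \<Rightarrow> real^'d::finite \<Rightarrow> complex) \<Rightarrow> real \<Rightarrow> (real^'d \<Rightarrow> complex) \<Rightarrow> real" where
  "sobolev_norm Y s f = sqrt (\<Sum>n. \<Sum>k=1..harmonic_dim TYPE('d) n.
     (real n + (real CARD('d) - 2) / 2) powr (2 * s) * (cmod (sphere_inner f (Y n k)))\<^sup>2)"

subsection \<open>Completion of a space of functions\<close>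

text \<open>
  The completion of a complex vector space \<open>V\<close> of functions with respect to a norm \<open>p\<close>: its
  elements are the classes of Cauchy sequences in \<open>V\<close> modulo null sequences.
\<close>

definition cauchy_seqs ::
    "('a \<Rightarrow> complex) set \<Rightarrow> (('a \<Rightarrow> complex) \<Rightarrow> real) \<Rightarrow> (nat \<Rightarrow> 'a \<Rightarrow> complex) set" where
  "cauchy_seqs V p =
     {X. (\<forall>i. X i \<in> V) \<and> (\<forall>e>0. \<exists>M. \<forall>i\<ge>M. \<forall>k\<ge>M. p (X i - X k) < e)}"

definition null_rel ::
    "('a \<Rightarrow> complex) set \<Rightarrow> (('a \<Rightarrow> complex) \<Rightarrow> real) \<Rightarrow> (nat \<Rightarrow> 'a \<Rightarrow> complex) rel" where
  "null_rel V p =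
     {(X, Z). X \<in> cauchy_seqs V p \<and> Z \<in> cauchy_seqs V p \<and> (\<lambda>i. p (X i - Z i)) \<longlonglongrightarrow> 0}"

definition fun_completion ::
    "('a \<Rightarrow> complex) set \<Rightarrow> (('a \<Rightarrow> complex) \<Rightarrow> real) \<Rightarrow> (nat \<Rightarrow> 'a \<Rightarrow> complex) set set" where
  "fun_completion V p = cauchy_seqs V p // null_rel V p"

definition cembed ::
    "('a \<Rightarrow> complex) set \<Rightarrow> (('a \<Rightarrow> complex) \<Rightarrow> real) \<Rightarrow> ('a \<Rightarrow> complex) \<Rightarrow>
     (nat \<Rightarrow> 'a \<Rightarrow> complex) set" where
  "cembed V p f = null_rel V p `` {\<lambda>_. f}"

definition cadd ::
    "('a \<Rightarrow> complex) set \<Rightarrow> (('a \<Rightarrow> complex) \<Rightarrow> real) \<Rightarrow> (nat \<Rightarrow> 'a \<Rightarrow> complex) set \<Rightarrow>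
     (nat \<Rightarrow> 'a \<Rightarrow> complex) set \<Rightarrow> (nat \<Rightarrow> 'a \<Rightarrow> complex) set" where
  "cadd V p A B = (\<Union>X\<in>A. \<Union>Z\<in>B. null_rel V p `` {\<lambda>i. X i + Z i})"

definition cscale ::
    "('a \<Rightarrow> complex) set \<Rightarrow> (('a \<Rightarrow> complex) \<Rightarrow> real) \<Rightarrow> complex \<Rightarrow>
     (nat \<Rightarrow> 'a \<Rightarrow> complex) set \<Rightarrow> (nat \<Rightarrow> 'a \<Rightarrow> complex) set" where
  "cscale V p c A = (\<Union>X\<in>A. null_rel V p `` {\<lambda>i x. c * X i x})"

text \<open>The value outside the completion is irrelevant, but \<^locale>\<open>Metric_space\<close> needs it to be nonnegative.\<close>

definition cdist ::
    "('a \<Rightarrow> complex) set \<Rightarrow> (('a \<Rightarrow> complex) \<Rightarrow> real) \<Rightarrow> (nat \<Rightarrow> 'a \<Rightarrow> complex) set \<Rightarrow>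
     (nat \<Rightarrow> 'a \<Rightarrow> complex) set \<Rightarrow> real" where
  "cdist V p A B =
     (if A \<in> fun_completion V p \<and> B \<in> fun_completion V p
      then THE r. \<forall>X\<in>A. \<forall>Z\<in>B. (\<lambda>i. p (X i - Z i)) \<longlonglongrightarrow> r else 0)"

definition ctopology ::
    "('a \<Rightarrow> complex) set \<Rightarrow> (('a \<Rightarrow> complex) \<Rightarrow> real) \<Rightarrow> (nat \<Rightarrow> 'a \<Rightarrow> complex) set topology" where
  "ctopology V p = Metric_space.mtopology (fun_completion V p) (cdist V p)"

text \<open>
  \<open>T\<close> is a continuous linear operator from the completion of \<open>V\<close> under \<open>p\<close> to that under \<open>q\<close>
  extending \<open>S : V \<rightarrow> V\<close>; it is \<open>undefined\<close> off its domain, so that it can be unique.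
\<close>

definition continuous_extension ::
    "('a \<Rightarrow> complex) set \<Rightarrow> (('a \<Rightarrow> complex) \<Rightarrow> real) \<Rightarrow> (('a \<Rightarrow> complex) \<Rightarrow> real) \<Rightarrow>
     (('a \<Rightarrow> complex) \<Rightarrow> ('a \<Rightarrow> complex)) \<Rightarrow>
     ((nat \<Rightarrow> 'a \<Rightarrow> complex) set \<Rightarrow> (nat \<Rightarrow> 'a \<Rightarrow> complex) set) \<Rightarrow> bool" where
  "continuous_extension V p q S T \<longleftrightarrow>
     T \<in> fun_completion V p \<rightarrow>\<^sub>E fun_completion V q \<and>
     (\<forall>A\<in>fun_completion V p. \<forall>B\<in>fun_completion V p. T (cadd V p A B) = cadd V q (T A) (T B)) \<and>
     (\<forall>c. \<forall>A\<in>fun_completion V p. T (cscale V p c A) = cscale V q c (T A)) \<and>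
     continuous_map (ctopology V p) (ctopology V q) T \<and>
     (\<forall>f\<in>V. S f \<in> V \<and> T (cembed V p f) = cembed V q (S f))"

definition even_part ::
    "(real^'d::finite \<Rightarrow> complex) set \<Rightarrow> ((real^'d \<Rightarrow> complex) \<Rightarrow> real) \<Rightarrow>
     (nat \<Rightarrow> real^'d \<Rightarrow> complex) set set" where
  "even_part V p = {A \<in> fun_completion V p. \<forall>X\<in>A. (\<lambda>i x. X i (- x)) \<in> A}"

definition odd_part ::
    "(real^'d::finite \<Rightarrow> complex) set \<Rightarrow> ((real^'d \<Rightarrow> complex) \<Rightarrow> real) \<Rightarrow>
     (nat \<Rightarrow> real^'d \<Rightarrow> complex) set set" where
  "odd_part V p = {A \<in> fun_completion V p. \<forall>X\<in>A. (\<lambda>i x. - X i (- x)) \<in> A}"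

subsection \<open>Operators on square-integrable functions\<close>

text \<open>Here functions are not identified when they agree almost everywhere.\<close>

definition l2_sphere :: "(real^'d::finite \<Rightarrow> complex) set" where
  "l2_sphere = {f \<in> borel_measurable borel. integrable sphere_measure (\<lambda>x. (cmod (f x))\<^sup>2)}"

definition l2_norm :: "(real^'d::finite \<Rightarrow> complex) \<Rightarrow> real" where
  "l2_norm f = sqrt (\<integral>x. (cmod (f x))\<^sup>2 \<partial>sphere_measure)"

definition l2_continuous_extension ::
    "((real^'d::finite \<Rightarrow> complex) \<Rightarrow> real^'d \<Rightarrow> complex) \<Rightarrow>
     ((real^'d \<Rightarrow> complex) \<Rightarrow> real^'d \<Rightarrow> complex) \<Rightarrow> bool" where
  "l2_continuous_extension S T \<longleftrightarrow>
     (\<forall>f\<in>l2_sphere. T f \<in> l2_sphere) \<and>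
     (\<forall>f\<in>l2_sphere. \<forall>g\<in>l2_sphere. AE x in sphere_measure. T (f + g) x = T f x + T g x) \<and>
     (\<forall>c. \<forall>f\<in>l2_sphere. AE x in sphere_measure. T (\<lambda>y. c * f y) x = c * T f x) \<and>
     (\<exists>C. \<forall>f\<in>l2_sphere. l2_norm (T f) \<le> C * l2_norm f) \<and>
     (\<forall>f\<in>smooth_sphere. AE x in sphere_measure. T f x = S f x)"

definition l2_compact :: "((real^'d::finite \<Rightarrow> complex) \<Rightarrow> real^'d \<Rightarrow> complex) \<Rightarrow> bool" where
  "l2_compact T \<longleftrightarrow>
     (\<forall>F :: nat \<Rightarrow> real^'d \<Rightarrow> complex.
        (\<forall>i. F i \<in> l2_sphere) \<and> (\<exists>C. \<forall>i. l2_norm (F i) \<le> C) \<longrightarrow>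
        (\<exists>g\<in>l2_sphere. \<exists>r. strict_mono r \<and> (\<lambda>i. l2_norm (T (F (r i)) - g)) \<longlonglongrightarrow> 0))"

end

theory Submission
  imports Defs "HOL-Library.Diagonal_Subsequence"
begin

text \<open>
  The transform commutes with rotations, so it multiplies the spherical harmonics of degree \<open>n\<close> by
  a number \<open>\<mu> n\<close> (Funk--Hecke).  For a harmonic polynomial \<open>p\<close> of degree \<open>n\<close>, the means of \<open>p\<close> and of its
  derivative in direction \<open>\<xi>\<close> over the parallels \<open>\<xi> \<bullet> x = t\<close>, weighted by \<open>(1 - t\<^sup>2) powr ((d - 3) / 2)\<close>,
  satisfy a linear first-order system in \<open>t\<close>.  Differentiating it at \<open>t = 0\<close> yields the recursion
  \<open>\<mu>\<^sub>j\<^sub>+\<^sub>2(n) = (j + 1 + n) (j - n - d + 3) \<mu>\<^sub>j(n)\<close>, whose first two terms are Wallis-type products.  Hence \<open>\<mu> n\<close>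
  is of order at most \<open>n powr (j - (d - 2) / 2)\<close>, which gives continuity and, when the exponent is negative,
  compactness; and \<open>\<mu> n\<close> vanishes exactly if \<open>n + j\<close> is odd or a factor \<open>i - n - d + 3\<close> with \<open>i \<le> j - 2\<close> of
  the parity of \<open>j\<close> does, which determines the nullspace.
\<close>

section \<open>Calculus of k times continuously differentiable functions\<close>

text \<open>The transform differentiates \<open>j\<close> times in the height \<open>t\<close>, so
  it is not continuous in the supremum norm, and uniform approximation by harmonics cannot be
  applied to it directly. Only the mean over a parallel at one fixed height is extended by density
  from harmonics to smooth functions; the derivatives in \<open>t\<close> are taken afterwards, when
  pairing with a harmonic has reduced the mean to a multiple of the mean of a polynomial. This needs
  means that are smooth jointly in \<open>t\<close> and \<xi>, hence the calculus of
  \<open>Ck\<close> and of integrals with a parameter. A Sobolev norm is an infinite sum, which says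
  nothing unless it converges. The decay of the coefficients of smooth functions comes from the
  symmetry of the spherical Laplacian, and that from the rotation invariance of the surface measure.
  An element of the completion is then handled through the limits of its coefficients, and each
  subspace in the statement through the set of degrees that it admits. The exponent (d - 3) / 2 is
  (d - 2) / 2 from the dilation of the subsphere, minus 1/2 from the factor in the definition of the
  transform.\<close>

primrec Ck :: "nat \<Rightarrow> ('a::euclidean_space \<Rightarrow> 'b::real_normed_vector) \<Rightarrow> 'a set \<Rightarrow> bool" where
  "Ck 0 f U \<longleftrightarrow> continuous_on U f"
| "Ck (Suc k) f U \<longleftrightarrow>
     (\<forall>x\<in>U. f differentiable (at x)) \<and> (\<forall>v. Ck k (\<lambda>x. frechet_derivative f (at x) v) U)"

text \<open>\<open>Ck_on\<close> speaks of complex functions on \<open>real^'d\<close> only. The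
  more general \<open>Ck\<close> also covers vector-valued maps such as \<open>sgn\<close>,
  \<open>rot\<close> and \<open>cap_point\<close>, and functions on products.\<close>

lemma Ck_on_eq_Ck: "Ck_on k f U = Ck k f U"
  by (induction k arbitrary: f) auto

lemma Ck_subset: "Ck k f U \<Longrightarrow> W \<subseteq> U \<Longrightarrow> Ck k f W"
  by (induction k arbitrary: f) (auto intro: continuous_on_subset)

lemma Ck_SucD: "Ck (Suc k) f U \<Longrightarrow> Ck k f U"
proof (induction k arbitrary: f)
  case 0
  then show ?case
    by (auto intro!: continuous_at_imp_continuous_on differentiable_imp_continuous_within)
next
  case (Suc k)
  then show ?case by (metis Ck.simps(2))
qed

lemma Ck_continuous: "Ck k f U \<Longrightarrow> continuous_on U f"
  by (induction k) (use Ck_SucD in auto)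

lemma Ck_derivative:
  "Ck (Suc k) f U \<Longrightarrow> x \<in> U \<Longrightarrow> (f has_derivative frechet_derivative f (at x)) (at x)"
  by (simp add: frechet_derivative_works[symmetric])

lemma frechet_derivative_cong_open:
  assumes "open U" "x \<in> U" "\<And>y. y \<in> U \<Longrightarrow> f y = g y"
  shows "frechet_derivative f (at x) = frechet_derivative g (at x)"
proof -
  have "(f has_derivative D) (at x) = (g has_derivative D) (at x)" for D
    using has_derivative_transform_within_open[of f D x UNIV U g]
      has_derivative_transform_within_open[of g D x UNIV U f] assms by auto
  then show ?thesis by (simp add: frechet_derivative_def)
qed

lemma Ck_cong:
  assumes "open U" "\<And>y. y \<in> U \<Longrightarrow> f y = g y" "Ck k f U"
  shows "Ck k g U"
  using assms(2,3)
proof (induction k arbitrary: f g)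
  case 0
  then show ?case by (simp cong: continuous_on_cong)
next
  case (Suc k)
  have "g differentiable (at x)" if "x \<in> U" for x
    using Ck_derivative[OF Suc.prems(2) that] Suc.prems(1) \<open>open U\<close> that
      has_derivative_transform_within_open[of f _ x UNIV U g] unfolding differentiable_def by blast
  moreover have "Ck k (\<lambda>x. frechet_derivative g (at x) v) U" for v
  proof (rule Suc.IH[of "\<lambda>x. frechet_derivative f (at x) v"])
    show "frechet_derivative f (at y) v = frechet_derivative g (at y) v" if "y \<in> U" for y
      using frechet_derivative_cong_open[OF \<open>open U\<close> that, of f g] Suc.prems(1) by simp
  qed (use Suc.prems in auto)
  ultimately show ?case by simp
qed

text \<open>A Frechet derivative depends only on the values near the point, so any explicit family
  of derivatives on the open set may stand in for \<open>frechet_derivative\<close> at all further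
  orders.\<close>

lemma CkI:
  assumes "open U" "\<And>x. x \<in> U \<Longrightarrow> (f has_derivative f' x) (at x)" "\<And>v. Ck k (\<lambda>x. f' x v) U"
  shows "Ck (Suc k) f U"
proof -
  have "Ck k (\<lambda>x. frechet_derivative f (at x) v) U" for v
    by (rule Ck_cong[OF assms(1) _ assms(3)[of v]]) (simp add: frechet_derivative_at[OF assms(2)])
  then show ?thesis using assms(2) by (auto simp: differentiable_def)
qed

text \<open>For gluing: the parallels are parametrised smoothly only away from one exceptional
  direction of the pole, so smoothness of the means is first known locally.\<close>

lemma Ck_local:
  assumes "\<And>x. x \<in> U \<Longrightarrow> \<exists>W. open W \<and> x \<in> W \<and> Ck k f W"
  shows "Ck k f U"
  using assms
proof (induction k arbitrary: f)
  case 0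
  then show ?case
    by (auto intro!: continuous_at_imp_continuous_on) (metis continuous_on_eq_continuous_at)
next
  case (Suc k)
  show ?case
    unfolding Ck.simps
  proof (intro conjI ballI allI)
    fix x assume "x \<in> U"
    then show "f differentiable (at x)" using Suc.prems by fastforce
  next
    fix v show "Ck k (\<lambda>x. frechet_derivative f (at x) v) U"
      by (rule Suc.IH) (use Suc.prems in fastforce)
  qed
qed

lemma Ck_const: "open U \<Longrightarrow> Ck k (\<lambda>x. c) U"
  by (induction k arbitrary: c) (auto intro!: CkI[where f' = "\<lambda>_ _. 0"] simp del: Ck.simps(2))

lemma Ck_linear: "open U \<Longrightarrow> bounded_linear f \<Longrightarrow> Ck k f U"
proof (induction k)
  case 0
  then show ?case by (simp add: linear_continuous_on)
next
  case (Suc k)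
  then show ?case
    by (intro CkI[where f' = "\<lambda>_. f"]) (auto intro: bounded_linear_imp_has_derivative Ck_const)
qed

lemma Ck_add:
  assumes "open U" "Ck k f U" "Ck k g U"
  shows "Ck k (\<lambda>x. f x + g x) U"
  using assms(2,3)
proof (induction k arbitrary: f g)
  case 0
  then show ?case by (auto intro: continuous_on_add)
next
  case (Suc k)
  show ?case
    by (rule CkI[OF assms(1) has_derivative_add[OF Ck_derivative[OF Suc.prems(1)]
          Ck_derivative[OF Suc.prems(2)]]]) (use Suc in auto)
qed

lemma Ck_sum:
  assumes "open U" "finite I" "\<And>i. i \<in> I \<Longrightarrow> Ck k (f i) U"
  shows "Ck k (\<lambda>x. \<Sum>i\<in>I. f i x) U"
  using assms(2,3) by (induction I) (auto intro!: Ck_add Ck_const assms(1))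

lemma (in bounded_bilinear) Ck:
  assumes "open U" "Ck k f U" "Ck k g U"
  shows "Ck k (\<lambda>x. prod (f x) (g x)) U"
  using assms(2,3)
proof (induction k arbitrary: f g)
  case 0
  then show ?case by (auto intro: continuous_on)
next
  case (Suc k)
  show ?case
    by (rule CkI[OF assms(1) FDERIV[OF Ck_derivative[OF Suc.prems(1)]
          Ck_derivative[OF Suc.prems(2)]]])
      (use Suc.IH Suc.prems Ck_SucD[OF Suc.prems(1)] Ck_SucD[OF Suc.prems(2)] in
        \<open>auto intro!: Ck_add assms(1)\<close>)
qed

lemmas Ck_mult = bounded_bilinear.Ck[OF bounded_bilinear_mult]
lemmas Ck_scaleR = bounded_bilinear.Ck[OF bounded_bilinear_scaleR]
lemmas Ck_inner = bounded_bilinear.Ck[OF bounded_bilinear_inner]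

lemma (in bounded_linear) Ck_comp:
  assumes "open U" "Ck k g U"
  shows "Ck k (\<lambda>x. f (g x)) U"
  using assms(2)
proof (induction k arbitrary: g)
  case 0
  then show ?case by (auto intro: continuous_on)
next
  case (Suc k)
  show ?case
    by (rule CkI[OF assms(1) has_derivative[OF Ck_derivative[OF Suc.prems(1)]]]) (use Suc in auto)
qed

lemma Ck_uminus: "open U \<Longrightarrow> Ck k g U \<Longrightarrow> Ck k (\<lambda>x. - g x) U"
  by (rule bounded_linear.Ck_comp[OF bounded_linear_minus[OF bounded_linear_ident]])

lemma Ck_diff: "open U \<Longrightarrow> Ck k f U \<Longrightarrow> Ck k g U \<Longrightarrow> Ck k (\<lambda>x. f x - g x) U"
  using Ck_add[of U k f "\<lambda>x. - g x"] Ck_uminus[of U k g] by simp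

lemma Ck_Pair:
  assumes "open U" "Ck k f U" "Ck k g U"
  shows "Ck k (\<lambda>x. (f x, g x)) U"
proof -
  have 1: "bounded_linear (\<lambda>a. (a, 0))" "bounded_linear (\<lambda>a. (0, a))"
    by (intro bounded_linear_Pair bounded_linear_ident bounded_linear_zero)+
  show ?thesis
    using Ck_add[OF assms(1) bounded_linear.Ck_comp[OF 1(1) assms(1,2)]
        bounded_linear.Ck_comp[OF 1(2) assms(1,3)]] by simp
qed

text \<open>Differentiation lowers the exponent by one, so the induction has to run over all
  exponents at once. Square roots, reciprocals and \<open>sgn\<close> are all reduced to this
  case.\<close>

lemma Ck_powr:
  fixes g :: "'a::euclidean_space \<Rightarrow> real"
  assumes "open U" "Ck k g U" "\<And>x. x \<in> U \<Longrightarrow> g x > 0"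
  shows "Ck k (\<lambda>x. g x powr a) U"
  using assms(2)
proof (induction k arbitrary: a)
  case 0
  then show ?case using assms(3) by (fastforce intro!: continuous_on_powr continuous_on_const)
next
  case (Suc k)
  have d: "((\<lambda>x. g x powr a) has_derivative
      (\<lambda>h. frechet_derivative g (at x) h * (a * g x powr (a - 1)))) (at x)" if "x \<in> U" for x
  proof -
    have "((\<lambda>y. y powr a) has_real_derivative a * g x powr (a - 1)) (at (g x))"
      using assms(3)[OF that] by (auto intro!: derivative_eq_intros)
    from has_derivative_compose[OF Ck_derivative[OF Suc.prems that] this[unfolded has_field_derivative_def]]
    show ?thesis by (simp add: mult.commute)
  qed
  show ?case
    by (rule CkI[OF assms(1) d])
      (use Suc.IH[OF Ck_SucD[OF Suc.prems]] Suc.prems in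
        \<open>auto intro!: Ck_mult Ck_const assms(1)\<close>)
qed

text \<open>The chain rule applies the derivative of \<open>f\<close> to a vector that varies with
  the point, whereas the induction hypothesis concerns a fixed direction. Expanding that vector in
  \<open>Basis\<close> leaves fixed directions with smooth scalar coefficients.\<close>

lemma Ck_compose:
  fixes f :: "'b::euclidean_space \<Rightarrow> 'c::real_normed_vector"
    and g :: "'a::euclidean_space \<Rightarrow> 'b"
  assumes "open U" "Ck k f W" "Ck k g U" "g ` U \<subseteq> W"
  shows "Ck k (\<lambda>x. f (g x)) U"
  using assms(2,3)
proof (induction k arbitrary: f)
  case 0
  then show ?case using assms(4) by (auto intro: continuous_on_compose2)
next
  case (Suc k)
  have d: "((\<lambda>x. f (g x)) has_derivative
      (\<lambda>h. \<Sum>b\<in>Basis. (frechet_derivative g (at x) h \<bullet> b) *\<^sub>R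
           frechet_derivative f (at (g x)) b)) (at x)" if "x \<in> U" for x
  proof -
    have gx: "g x \<in> W" using assms(4) that by auto
    note D = Ck_derivative[OF Suc.prems(1) gx]
    interpret L: linear "frechet_derivative f (at (g x))"
      using D by (simp add: has_derivative_bounded_linear bounded_linear.linear)
    have "frechet_derivative f (at (g x)) y =
        (\<Sum>b\<in>Basis. (y \<bullet> b) *\<^sub>R frechet_derivative f (at (g x)) b)" for y
      by (subst (1) euclidean_representation[of y, symmetric]) (simp only: L.sum L.scaleR)
    then have "(f has_derivative (\<lambda>y. \<Sum>b\<in>Basis. (y \<bullet> b) *\<^sub>R
        frechet_derivative f (at (g x)) b)) (at (g x))"
      by (rule has_derivative_eq_rhs[OF D ext])
    from has_derivative_compose[OF Ck_derivative[OF Suc.prems(2) that] this]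
    show ?thesis .
  qed
  show ?case
    by (rule CkI[OF assms(1) d])
      (use Suc.IH Suc.prems Ck_SucD[OF Suc.prems(2)] in
        \<open>auto intro!: Ck_sum Ck_scaleR Ck_inner Ck_const assms(1)\<close>)
qed

section \<open>Integrals over a compact set that depend on a parameter\<close>

lemma integrable_continuous_compact:
  fixes g :: "'a::euclidean_space \<Rightarrow> 'b::{banach, second_countable_topology}"
  assumes "finite_measure M" "sets M = sets borel" "compact K" "continuous_on K g"
  shows "integrable M (\<lambda>x. indicator K x *\<^sub>R g x)"
proof -
  interpret finite_measure M by fact
  obtain B where B: "\<And>x. x \<in> K \<Longrightarrow> norm (g x) \<le> B"
    using compact_imp_bounded[OF compact_continuous_image[OF assms(4,3)]]
    by (auto simp: bounded_iff)
  have "(\<lambda>x. indicator K x *\<^sub>R g x) \<in> borel_measurable borel"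
    using assms(3,4) by (intro borel_measurable_continuous_on_indicator) (auto simp: compact_imp_closed)
  then have "(\<lambda>x. indicator K x *\<^sub>R g x) \<in> borel_measurable M"
    using assms(2) by (simp cong: measurable_cong_sets)
  moreover have "norm (indicator K x *\<^sub>R g x) \<le> max B 0" for x
    using B[of x] by (auto simp: indicator_def)
  ultimately show ?thesis by (intro integrable_const_bound[where B = "max B 0"]) auto
qed

lemma norm_integral_compact_le:
  fixes g :: "'a::euclidean_space \<Rightarrow> 'b::{banach, second_countable_topology}"
  assumes "finite_measure M" "sets M = sets borel" "compact K" "\<And>x. x \<in> K \<Longrightarrow> norm (g x) \<le> e" "0 \<le> e"
  shows "norm (\<integral>x. indicator K x *\<^sub>R g x \<partial>M) \<le> e * measure M (space M)"
proof -
  interpret finite_measure M by fact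
  have "norm (\<integral>x. indicator K x *\<^sub>R g x \<partial>M) \<le> (\<integral>x. e \<partial>M)"
  proof (cases "integrable M (\<lambda>x. indicator K x *\<^sub>R g x)")
    case True
    then show ?thesis
      by (intro integral_norm_bound[THEN order_trans] integral_mono integrable_norm)
        (use assms(4,5) in \<open>auto simp: indicator_def\<close>)
  next
    case False
    then show ?thesis using assms(5) by (simp add: not_integrable_integral_eq)
  qed
  then show ?thesis by (simp add: mult.commute)
qed

text \<open>Compactness of \<open>K\<close> makes the continuity of the partial derivative uniform
  in \<open>w\<close>; the mean value inequality then bounds the linearisation error uniformly, and
  the finite measure integrates the bound. The measure is arbitrary because both the equator and the
  whole sphere are needed.\<close>

lemma has_derivative_parametric:
  fixes f :: "'a::euclidean_space \<times> 'c::euclidean_space \<Rightarrow> 'b::{banach, second_countable_topology}"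
  assumes M: "finite_measure M" "sets M = sets borel" and K: "compact K" "K \<subseteq> W"
    and U: "open U" and f: "Ck (Suc 0) f (U \<times> W)" and x0: "x0 \<in> U"
  shows "((\<lambda>x. \<integral>w. indicator K w *\<^sub>R f (x, w) \<partial>M) has_derivative
      (\<lambda>h. \<integral>w. indicator K w *\<^sub>R frechet_derivative f (at (x0, w)) (h, 0) \<partial>M)) (at x0)"
proof -
  interpret finite_measure M by fact
  define D where "D x w h = frechet_derivative f (at (x, w)) (h, 0)" for x w h
  have df: "((\<lambda>x. f (x, w)) has_derivative D x w) (at x)" if "x \<in> U" "w \<in> K" for x w
  proof -
    have "((\<lambda>x. (x, w)) has_derivative (\<lambda>h. (h, 0))) (at x)"
      by (auto intro!: derivative_eq_intros)
    from has_derivative_compose[OF this Ck_derivative[OF f]] show ?thesis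
      using that K by (auto simp: D_def[abs_def])
  qed
  have contD: "continuous_on (U \<times> K) (\<lambda>(x, w). D x w h)" for h
    using f K unfolding D_def
    by (auto simp: split_beta' intro: continuous_on_subset[where s = "U \<times> W"])
  have contf: "continuous_on (U \<times> K) f"
    using Ck_continuous[OF f] K by (auto intro: continuous_on_subset)
  have int: "integrable M (\<lambda>w. indicator K w *\<^sub>R g (x, w))"
    if "continuous_on (U \<times> K) g" "x \<in> U" for x and g :: "'a \<times> 'c \<Rightarrow> 'b"
    by (rule integrable_continuous_compact[OF M K(1)])
      (use that in \<open>auto intro!: continuous_on_compose2[OF that(1)] continuous_intros\<close>)
  have intD: "integrable M (\<lambda>w. indicator K w *\<^sub>R D x w h)" if "x \<in> U" for x h
    using int[OF contD that] by simp
  have linD: "linear (D x w)" if "x \<in> U" "w \<in> K" for x w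
    using df[OF that] by (simp add: has_derivative_bounded_linear bounded_linear.linear)
  let ?F = "\<lambda>h. \<integral>w. indicator K w *\<^sub>R D x0 w h \<partial>M"
  have lin: "linear ?F"
  proof
    fix h k
    have "?F (h + k) = (\<integral>w. indicator K w *\<^sub>R D x0 w h + indicator K w *\<^sub>R D x0 w k \<partial>M)"
      by (intro Bochner_Integration.integral_cong)
        (auto simp: indicator_def linear_add[OF linD] x0)
    then show "?F (h + k) = ?F h + ?F k"
      using x0 by (simp add: intD)
  next
    fix r :: real and h
    have "?F (r *\<^sub>R h) = (\<integral>w. r *\<^sub>R (indicator K w *\<^sub>R D x0 w h) \<partial>M)"
      by (intro Bochner_Integration.integral_cong)
        (auto simp: indicator_def linear_scale[OF linD] x0)
    then show "?F (r *\<^sub>R h) = r *\<^sub>R ?F h" by (simp only: integral_scaleR_right)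
  qed
  have main: "\<exists>d>0. \<forall>h. norm h < d \<longrightarrow> norm ((\<integral>w. indicator K w *\<^sub>R f (x0 + h, w) \<partial>M) -
      (\<integral>w. indicator K w *\<^sub>R f (x0, w) \<partial>M) - ?F h) \<le> e * norm h" if "e > 0" for e
  proof -
    \<comment> \<open>The error is summed over DIM('a) basis directions and multiplied by the total
      mass; the summand 1 keeps the quotient meaningful for a null measure.\<close>
    define e' where "e' = e / (measure M (space M) + 1) / real DIM('a)"
    have e': "e' > 0" using \<open>e > 0\<close> unfolding e'_def
      by (intro divide_pos_pos add_nonneg_pos) auto
    \<comment> \<open>One neighbourhood for each basis direction; their finite intersection serves
      all directions, which gives an operator norm bound.\<close>
    have "\<exists>X. x0 \<in> X \<and> open X \<and> (\<forall>x\<in>X \<inter> U. \<forall>w\<in>K. dist (D x w b) (D x0 w b) \<le> e')" for b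
      by (rule continuous_on_prod_compactE[OF contD K(1) x0 e', of b]) auto
    then obtain X where X: "\<And>b. x0 \<in> X b" "\<And>b. open (X b)"
      "\<And>b x w. x \<in> X b \<Longrightarrow> x \<in> U \<Longrightarrow> w \<in> K \<Longrightarrow> dist (D x w b) (D x0 w b) \<le> e'" by (metis IntI)
    have "open (U \<inter> (\<Inter>b\<in>Basis. X b))" using U X(2) by (auto intro!: open_INT)
    moreover have "x0 \<in> U \<inter> (\<Inter>b\<in>Basis. X b)" using x0 X(1) by auto
    ultimately obtain d where d: "d > 0" "ball x0 d \<subseteq> U \<inter> (\<Inter>b\<in>Basis. X b)"
      by (meson openE)
    have on: "onorm (\<lambda>h. D x w h - D x0 w h) \<le> e' * DIM('a)" if "x \<in> ball x0 d" "w \<in> K" for x w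
    proof (rule onorm_bound)
      have xU: "x \<in> U" using that d(2) by auto
      interpret A: linear "\<lambda>h. D x w h - D x0 w h"
        by (intro linear_compose_sub linD that xU x0)
      fix h :: 'a
      have "D x w h - D x0 w h = (\<Sum>b\<in>Basis. (h \<bullet> b) *\<^sub>R (D x w b - D x0 w b))"
        by (subst (1 2) euclidean_representation[of h, symmetric])
          (use A.sum A.scaleR in \<open>simp add: linear_sum[OF linD] linear_scale[OF linD] that xU x0 sum_subtractf[symmetric] scaleR_diff_right\<close>)
      also have "norm \<dots> \<le> (\<Sum>b\<in>(Basis::'a set). norm h * e')"
      proof (rule order_trans[OF norm_sum sum_mono])
        fix b :: 'a assume b: "b \<in> Basis"
        have "norm (D x w b - D x0 w b) \<le> e'"
          using X(3)[of x b w] subsetD[OF d(2) that(1)] that b by (auto simp: dist_norm)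
        with b show "norm ((h \<bullet> b) *\<^sub>R (D x w b - D x0 w b)) \<le> norm h * e'"
          by (auto simp: Basis_le_norm intro!: mult_mono)
      qed
      finally show "norm (D x w h - D x0 w h) \<le> e' * DIM('a) * norm h" by (simp add: mult_ac)
    qed (use e' in auto)
    have "norm ((\<integral>w. indicator K w *\<^sub>R f (x0 + h, w) \<partial>M) -
      (\<integral>w. indicator K w *\<^sub>R f (x0, w) \<partial>M) - ?F h) \<le> e * norm h" if h: "norm h < d" for h
    proof -
      have hU: "x0 + h \<in> U" using d h by (force simp: dist_norm)
      have "(\<integral>w. indicator K w *\<^sub>R f (x0 + h, w) \<partial>M) -
          (\<integral>w. indicator K w *\<^sub>R f (x0, w) \<partial>M) - ?F h =
          (\<integral>w. indicator K w *\<^sub>R (f (x0 + h, w) - f (x0, w) - D x0 w h) \<partial>M)"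
        using int[OF contf] hU x0 intD[OF x0] by (simp add: algebra_simps scaleR_diff_right)
      also have "norm \<dots> \<le> norm h * (e' * DIM('a)) * measure M (space M)"
      proof (rule norm_integral_compact_le[OF M K(1)])
        fix w assume w: "w \<in> K"
        have "norm (f (x0 + h, w) - f (x0, w) - D x0 w (x0 + h - x0))
            \<le> norm (x0 + h - x0) * (e' * DIM('a))"
        proof (rule differentiable_bound_linearization[where S = "ball x0 d" and f' = "\<lambda>x. D x w"
              and f = "\<lambda>x. f (x, w)"])
          fix t :: real assume "t \<in> {0..1}"
          then have "\<bar>t\<bar> * norm h < d" using h
            by (intro le_less_trans[OF mult_left_le_one_le]) auto
          then show "x0 + t *\<^sub>R (x0 + h - x0) \<in> ball x0 d" by (simp add: dist_norm)
        next
          fix x assume x: "x \<in> ball x0 d"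
          then have "x \<in> U" using d(2) by auto
          then show "((\<lambda>x. f (x, w)) has_derivative D x w) (at x within ball x0 d)"
            using df w by (blast intro: has_derivative_at_withinI)
          show "onorm (D x w - D x0 w) \<le> e' * DIM('a)"
            using on[OF x w] by (simp add: fun_diff_def)
        qed (use d in auto)
        then show "norm (f (x0 + h, w) - f (x0, w) - D x0 w h) \<le> norm h * (e' * DIM('a))" by simp
      qed (use e' in auto)
      also have "\<dots> = e * (measure M (space M) / (measure M (space M) + 1)) * norm h"
      proof -
        have "e' * DIM('a) = e / (measure M (space M) + 1)" by (simp add: e'_def)
        then show ?thesis by (simp add: mult_ac)
      qed
      also have "\<dots> \<le> e * norm h"
        using \<open>e > 0\<close> by (intro mult_right_mono mult_left_le) (auto simp: divide_le_eq add_nonneg_pos)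
      finally show ?thesis .
    qed
    with d(1) show ?thesis by blast
  qed
  show ?thesis
    unfolding has_derivative_at_alt D_def[symmetric]
  proof (intro conjI allI impI)
    show "bounded_linear ?F" using lin by (simp add: linear_conv_bounded_linear)
    fix e :: real assume "e > 0"
    from main[OF this] obtain d where d: "d > 0" "\<And>h. norm h < d \<Longrightarrow> norm ((\<integral>w. indicator K w *\<^sub>R f (x0 + h, w) \<partial>M) -
      (\<integral>w. indicator K w *\<^sub>R f (x0, w) \<partial>M) - ?F h) \<le> e * norm h" by blast
    show "\<exists>d>0. \<forall>y. norm (y - x0) < d \<longrightarrow> norm ((\<integral>w. indicator K w *\<^sub>R f (y, w) \<partial>M) -
      (\<integral>w. indicator K w *\<^sub>R f (x0, w) \<partial>M) - ?F (y - x0)) \<le> e * norm (y - x0)"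
      using d(1) d(2)[of "y - x0" for y] by (intro exI[of _ d]) auto
  qed
qed

text \<open>Each directional derivative of the integral is again an integral of the same kind, so
  the induction repeats. The compact \<open>K\<close> lies in an open \<open>W\<close> because the
  integrands are smooth only off some closed set, such as the origin for \<open>sgn\<close>.\<close>

lemma Ck_parametric_integral:
  fixes f :: "'a::euclidean_space \<times> 'c::euclidean_space \<Rightarrow> 'b::{banach, second_countable_topology}"
  assumes M: "finite_measure M" "sets M = sets borel" and K: "compact K" "K \<subseteq> W"
    and U: "open U" and W: "open W" and f: "Ck k f (U \<times> W)"
  shows "Ck k (\<lambda>x. \<integral>w. indicator K w *\<^sub>R f (x, w) \<partial>M) U"
  using f
proof (induction k arbitrary: f)
  case 0
  interpret finite_measure M by fact
  have contf: "continuous_on (U \<times> K) f"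
    using 0 K by (auto intro: continuous_on_subset)
  have int: "integrable M (\<lambda>w. indicator K w *\<^sub>R f (x, w))" if "x \<in> U" for x
    by (rule integrable_continuous_compact[OF M K(1)])
      (use that in \<open>auto intro!: continuous_on_compose2[OF contf] continuous_intros\<close>)
  have "\<exists>X. open X \<and> x0 \<in> X \<and> (\<forall>x\<in>X \<inter> U. dist (\<integral>w. indicator K w *\<^sub>R f (x, w) \<partial>M)
      (\<integral>w. indicator K w *\<^sub>R f (x0, w) \<partial>M) < e)" if x0: "x0 \<in> U" and "e > 0" for x0 e
  proof -
    define e' where "e' = e / (measure M (space M) + 1)"
    have e': "e' > 0" using \<open>e > 0\<close> by (auto simp: e'_def intro!: divide_pos_pos add_nonneg_pos)
    from continuous_on_prod_compactE[OF contf K(1) x0 e'] obtain X where X: "x0 \<in> X" "open X"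
      "\<forall>x\<in>X \<inter> U. \<forall>w\<in>K. dist (f (x, w)) (f (x0, w)) \<le> e'" by metis
    have "dist (\<integral>w. indicator K w *\<^sub>R f (x, w) \<partial>M) (\<integral>w. indicator K w *\<^sub>R f (x0, w) \<partial>M) < e"
      if "x \<in> X \<inter> U" for x
    proof -
      have "(\<integral>w. indicator K w *\<^sub>R f (x, w) \<partial>M) - (\<integral>w. indicator K w *\<^sub>R f (x0, w) \<partial>M) =
          (\<integral>w. indicator K w *\<^sub>R (f (x, w) - f (x0, w)) \<partial>M)"
        using int x0 that by (simp add: scaleR_diff_right)
      moreover have "norm \<dots> \<le> e' * measure M (space M)"
        by (rule norm_integral_compact_le[OF M K(1)]) (use X that e' in \<open>auto simp: dist_norm\<close>)
      moreover have "e' * measure M (space M) < e"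
        using \<open>e > 0\<close> by (simp add: e'_def divide_less_eq add_nonneg_pos)
      ultimately show ?thesis by (simp add: dist_norm)
    qed
    with X show ?thesis by blast
  qed
  then show ?case
    unfolding Ck.simps continuous_on_def tendsto_iff eventually_at_topological by fast
next
  case (Suc k)
  have f1: "Ck (Suc 0) f (U \<times> W)"
    using Suc.prems by (simp add: Ck_continuous[of k])
  show ?case
    by (rule CkI[OF U has_derivative_parametric[OF M K U f1]])
      (use Suc.IH[of "\<lambda>z. frechet_derivative f (at z) (h, 0)" for h] Suc.prems in auto)
qed

section \<open>Rotation invariance of the surface measures\<close>

lemma lborel_distr_plus': "distr lborel borel (\<lambda>x. x + c) = (lborel :: 'a::euclidean_space measure)"
proof -
  have "(\<lambda>x. x + c) = (+) c" by (auto simp: fun_eq_iff add.commute)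
  then show ?thesis by (simp add: lborel_distr_plus)
qed

text \<open>
  The image measure is translation invariant, and Fubini's theorem applied to
  \<open>indicator A x * indicator B (x + y)\<close> shows that it is a multiple of the Lebesgue measure;
  the unit ball \<open>B\<close> is preserved.
\<close>

lemma lborel_distr_orthogonal:
  fixes T :: "'a::euclidean_space \<Rightarrow> 'a"
  assumes T: "orthogonal_transformation T"
  shows "distr lborel borel T = lborel"
proof (rule measure_eqI)
  have lin: "linear T" using T by (rule orthogonal_transformation_linear)
  have mT[measurable]: "T \<in> borel_measurable borel"
    using lin by (intro borel_measurable_continuous_onI linear_continuous_on)
      (simp add: linear_conv_bounded_linear)
  define M where "M = distr lborel borel T"
  have sM[measurable_cong, simp]: "sets M = sets borel" and spM[simp]: "space M = UNIV"
    by (simp_all add: M_def)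
  have inv: "distr M borel (\<lambda>x. x + a) = M" for a
  proof -
    obtain b where b: "a = T b" using orthogonal_transformation_surj[OF T] by (auto simp: surj_def)
    have "distr M borel (\<lambda>x. x + a) = distr (distr lborel borel (\<lambda>x. x + b)) borel T"
      unfolding M_def
      by (subst (1 2) distr_distr) (auto simp: comp_def b linear_add[OF lin])
    then show ?thesis by (simp add: lborel_distr_plus' M_def)
  qed
  have vim: "T -` ball 0 1 = ball 0 1" using T by (auto simp: orthogonal_transformation)
  have MB: "emeasure M (ball 0 1) = emeasure lborel (ball 0 (1::real) :: 'a set)"
    unfolding M_def by (subst emeasure_distr) (simp_all add: vim)
  have sf: "sigma_finite_measure M"
  proof
    have "emeasure M (ball 0 (real n)) = emeasure lborel (ball 0 (real n) :: 'a set)" for n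
    proof -
      have "T -` ball 0 (real n) = ball 0 (real n)" using T by (auto simp: orthogonal_transformation)
      then show ?thesis unfolding M_def by (subst emeasure_distr) simp_all
    qed
    moreover have "(\<Union>n. ball 0 (real n) :: 'a set) = UNIV"
      by (auto simp: reals_Archimedean2)
    moreover have "emeasure lborel (ball 0 (real n) :: 'a set) \<noteq> top" for n
      using emeasure_lborel_ball_finite[of "0::'a" "real n"] by auto
    ultimately show "\<exists>A. countable A \<and> A \<subseteq> sets M \<and> \<Union>A = space M \<and> (\<forall>a\<in>A. emeasure M a \<noteq> \<infinity>)"
      by (intro exI[of _ "range (\<lambda>n. ball 0 (real n))"]) auto
  qed
  show "sets (distr lborel borel T) = sets lborel" by simp
  fix A assume "A \<in> sets (distr lborel borel T)"
  then have A[measurable]: "A \<in> sets borel" by simp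
  interpret M: sigma_finite_measure M by fact
  interpret P: pair_sigma_finite M lborel
    by (intro pair_sigma_finite.intro sf sigma_finite_lborel)
  let ?B = "ball 0 1 :: 'a set" let ?L = "lborel :: 'a measure"
  have [measurable]: "?B \<in> sets borel" by simp
  have "emeasure M A * emeasure ?L ?B = (\<integral>\<^sup>+x. indicator A x * emeasure ?L ?B \<partial>M)"
    by (simp add: nn_integral_multc)
  also have "\<dots> = (\<integral>\<^sup>+x. (\<integral>\<^sup>+y. indicator A x * indicator ?B (x + y) \<partial>?L) \<partial>M)"
  proof (rule nn_integral_cong)
    fix x
    have "(\<integral>\<^sup>+y. indicator ?B (x + y) \<partial>?L) = (\<integral>\<^sup>+y. indicator ?B y \<partial>distr ?L borel ((+) x))"
      by (subst nn_integral_distr) auto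
    then show "indicator A x * emeasure ?L ?B = (\<integral>\<^sup>+y. indicator A x * indicator ?B (x + y) \<partial>?L)"
      by (simp add: nn_integral_cmult lborel_distr_plus)
  qed
  also have "\<dots> = (\<integral>\<^sup>+y. (\<integral>\<^sup>+x. indicator A x * indicator ?B (x + y) \<partial>M) \<partial>?L)"
    by (rule P.Fubini'[symmetric]) measurable
  also have "\<dots> = (\<integral>\<^sup>+y. (\<integral>\<^sup>+x. indicator A (x - y) * indicator ?B x \<partial>M) \<partial>?L)"
  proof (rule nn_integral_cong)
    fix y
    have "(\<integral>\<^sup>+x. indicator A (x - y) * indicator ?B x \<partial>M)
        = (\<integral>\<^sup>+x. indicator A (x - y) * indicator ?B x \<partial>distr M borel (\<lambda>x. x + y))"
      by (simp add: inv)
    also have "\<dots> = (\<integral>\<^sup>+x. indicator A x * indicator ?B (x + y) \<partial>M)"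
      by (subst nn_integral_distr) auto
    finally show "(\<integral>\<^sup>+x. indicator A x * indicator ?B (x + y) \<partial>M) =
        (\<integral>\<^sup>+x. indicator A (x - y) * indicator ?B x \<partial>M)" by simp
  qed
  also have "\<dots> = (\<integral>\<^sup>+x. (\<integral>\<^sup>+y. indicator A (x - y) * indicator ?B x \<partial>?L) \<partial>M)"
    by (rule P.Fubini') measurable
  also have "\<dots> = (\<integral>\<^sup>+x. emeasure ?L A * indicator ?B x \<partial>M)"
  proof (rule nn_integral_cong)
    fix x
    have "(\<integral>\<^sup>+y. indicator A (x - y) \<partial>?L) = (\<integral>\<^sup>+y. indicator A y \<partial>distr ?L borel (\<lambda>y. x - y))"
      by (subst nn_integral_distr) auto
    also have "distr ?L borel (\<lambda>y. x - y) = ?L"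
      using lborel_affine[of "-1" x] by (simp add: density_1)
    finally show "(\<integral>\<^sup>+y. indicator A (x - y) * indicator ?B x \<partial>?L) = emeasure ?L A * indicator ?B x"
      by (simp add: nn_integral_multc)
  qed
  also have "\<dots> = emeasure ?L A * emeasure ?L ?B"
    by (simp add: nn_integral_cmult MB)
  finally have "emeasure M A * emeasure ?L ?B = emeasure ?L A * emeasure ?L ?B" .
  moreover have "emeasure ?L ?B \<noteq> 0" "emeasure ?L ?B \<noteq> top"
    using content_ball_pos[of 1 "0::'a"] emeasure_lborel_ball_finite[of "0::'a" 1]
    by (auto simp: measure_def less_top[symmetric])
  ultimately show "emeasure (distr lborel borel T) A = emeasure lborel A"
    unfolding M_def by (auto simp: ennreal_mult_cancel_left mult.commute[of _ "emeasure lborel (ball 0 1)"])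
qed

lemma orthogonal_transformation_measurable:
  fixes T :: "'a::euclidean_space \<Rightarrow> 'a"
  assumes "orthogonal_transformation T"
  shows "T \<in> borel_measurable borel"
  using orthogonal_transformation_linear[OF assms]
  by (intro borel_measurable_continuous_onI linear_continuous_on)
    (simp add: linear_conv_bounded_linear)

lemma orthogonal_transformation_sgn:
  fixes T :: "'a::euclidean_space \<Rightarrow> 'a"
  assumes "orthogonal_transformation T"
  shows "sgn (T x) = T (sgn x)"
  using assms by (simp add: sgn_div_norm orthogonal_transformation orthogonal_transformation_scaleR)

lemma emeasure_lborel_orthogonal_vimage:
  fixes T :: "'a::euclidean_space \<Rightarrow> 'a"
  assumes "orthogonal_transformation T" "A \<in> sets borel"
  shows "emeasure lborel (T -` A) = emeasure lborel A"
proof -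
  have "emeasure (distr lborel borel T) A = emeasure lborel (T -` A)"
    using orthogonal_transformation_measurable[OF assms(1)] assms(2) by (subst emeasure_distr) auto
  then show ?thesis by (simp add: lborel_distr_orthogonal[OF assms(1)])
qed

subsection \<open>The unit sphere\<close>

lemma sets_sphere_measure [simp, measurable_cong]: "sets sphere_measure = sets borel"
  by (simp add: sphere_measure_def)

lemma space_sphere_measure [simp]: "space sphere_measure = UNIV"
  by (simp add: sphere_measure_def space_scale_measure)

lemma measurable_sgn_euclidean [measurable]: "(sgn :: 'a::euclidean_space \<Rightarrow> 'a) \<in> borel_measurable borel"
  unfolding sgn_div_norm[abs_def] by measurable

lemma emeasure_sphere_measure:
  fixes A :: "(real^'d::finite) set"
  assumes [measurable]: "A \<in> sets borel"
  shows "emeasure sphere_measure A = of_nat CARD('d) * emeasure lborel (cball 0 1 \<inter> sgn -` A)"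
proof -
  have "sgn \<in> restrict_space lborel (cball 0 1 :: (real^'d) set) \<rightarrow>\<^sub>M borel"
    by (intro measurable_restrict_space1) simp
  then show ?thesis
    unfolding sphere_measure_def emeasure_scale_measure
    by (subst emeasure_distr) (auto simp: space_restrict_space emeasure_restrict_space Int_commute)
qed

lemma finite_sphere_measure: "finite_measure (sphere_measure :: (real^'d::finite) measure)"
proof
  have "emeasure lborel (cball 0 1 :: (real^'d) set) < \<infinity>"
    by (rule emeasure_lborel_cball_finite)
  then show "emeasure (sphere_measure :: (real^'d) measure) (space sphere_measure) \<noteq> \<infinity>"
    by (auto simp: emeasure_sphere_measure ennreal_mult_eq_top_iff)
qed

text \<open>An orthogonal map commutes with \<open>sgn\<close> and preserves the ball, so invariance
  is inherited from the Lebesgue measure of the cone.\<close>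

lemma sphere_measure_invariant:
  fixes T :: "real^'d::finite \<Rightarrow> real^'d"
  assumes T: "orthogonal_transformation T"
  shows "distr sphere_measure borel T = sphere_measure"
proof (rule measure_eqI)
  note [measurable] = orthogonal_transformation_measurable[OF T]
  fix A assume "A \<in> sets (distr sphere_measure borel T)"
  then have [measurable]: "A \<in> sets borel" by simp
  have "cball 0 1 \<inter> sgn -` T -` A = T -` (cball 0 1 \<inter> sgn -` A)"
    using T by (auto simp: orthogonal_transformation_sgn orthogonal_transformation)
  moreover have "cball 0 1 \<inter> sgn -` A \<in> sets (borel :: (real^'d) measure)"
    by (metis sets.Int borel_closed closed_cball measurable_sets_borel measurable_sgn_euclidean \<open>A \<in> sets borel\<close>)
  moreover have "T -` A \<in> sets borel"
    by (metis measurable_sets_borel orthogonal_transformation_measurable[OF T] \<open>A \<in> sets borel\<close>)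
  ultimately show "emeasure (distr sphere_measure borel T) A = emeasure sphere_measure A"
    using emeasure_lborel_orthogonal_vimage[OF T, of "cball 0 1 \<inter> sgn -` A"]
    by (subst emeasure_distr) (auto simp: emeasure_sphere_measure)
qed simp

subsection \<open>The unit sphere of a hyperplane\<close>

text \<open>The surface measure of the unit sphere of the hyperplane orthogonal to \<open>\<xi>\<close>, without the factor
  \<open>CARD('d) - 1\<close> that comes from integrating the radius.\<close>

definition equator_measure :: "real^'d::finite \<Rightarrow> (real^'d) measure" where
  "equator_measure \<xi> = distr (restrict_space (hyperplane_measure \<xi>) (cball 0 1)) borel sgn"

lemma sets_equator_measure [simp, measurable_cong]: "sets (equator_measure \<xi>) = sets borel"
  by (simp add: equator_measure_def)

lemma space_equator_measure [simp]: "space (equator_measure \<xi>) = UNIV"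
  by (simp add: equator_measure_def)

text \<open>The preimage of \<open>A\<close> under the projection to the hyperplane followed by
  \<open>sgn\<close>: a cylinder of height one over a cone. It turns statements about
  \<open>equator_measure\<close> into statements about Lebesgue measure.\<close>

definition slab :: "real^'d::finite \<Rightarrow> (real^'d) set \<Rightarrow> (real^'d) set" where
  "slab \<xi> A = {x. 0 \<le> \<xi> \<bullet> x \<and> \<xi> \<bullet> x \<le> 1 \<and> norm (x - (\<xi> \<bullet> x) *\<^sub>R \<xi>) \<le> 1 \<and> sgn (x - (\<xi> \<bullet> x) *\<^sub>R \<xi>) \<in> A}"

lemma slab_borel:
  assumes [measurable]: "A \<in> sets borel"
  shows "slab \<xi> A \<in> sets borel"
  unfolding slab_def by measurable

lemma emeasure_equator_measure:
  fixes A :: "(real^'d::finite) set"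
  assumes A[measurable]: "A \<in> sets borel"
  shows "emeasure (equator_measure \<xi>) A = emeasure lborel (slab \<xi> A)"
proof -
  let ?S = "{x. 0 \<le> \<xi> \<bullet> x \<and> \<xi> \<bullet> x \<le> 1}" let ?P = "\<lambda>x. x - (\<xi> \<bullet> x) *\<^sub>R \<xi>"
  have S[measurable]: "?S \<in> sets borel" by measurable
  have P: "?P \<in> restrict_space lborel ?S \<rightarrow>\<^sub>M borel"
    by (intro measurable_restrict_space1) simp
  have sg: "sgn \<in> restrict_space (hyperplane_measure \<xi>) (cball 0 1) \<rightarrow>\<^sub>M borel"
    by (intro measurable_restrict_space1) (simp add: hyperplane_measure_def)
  have "sgn -` A \<in> sets (borel :: (real^'d) measure)"
    by (metis measurable_sets_borel measurable_sgn_euclidean A)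
  then have m: "sgn -` A \<inter> cball 0 1 \<in> sets (borel :: (real^'d) measure)" by simp
  have "emeasure (equator_measure \<xi>) A = emeasure (hyperplane_measure \<xi>) (sgn -` A \<inter> cball 0 1)"
    unfolding equator_measure_def using m
    by (subst emeasure_distr[OF sg A])
      (auto simp: space_restrict_space emeasure_restrict_space hyperplane_measure_def)
  also have "\<dots> = emeasure (restrict_space lborel ?S) (?P -` (sgn -` A \<inter> cball 0 1) \<inter> ?S)"
    unfolding hyperplane_measure_def by (subst emeasure_distr[OF P m]) (simp add: space_restrict_space)
  also have "\<dots> = emeasure lborel (?P -` (sgn -` A \<inter> cball 0 1) \<inter> ?S)"
    using S by (subst emeasure_restrict_space) auto
  also have "?P -` (sgn -` A \<inter> cball 0 1) \<inter> ?S = slab \<xi> A"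
    by (auto simp: slab_def)
  finally show ?thesis .
qed

lemma finite_equator_measure:
  fixes \<xi> :: "real^'d::finite"
  assumes "norm \<xi> = 1"
  shows "finite_measure (equator_measure \<xi>)"
proof
  have "slab \<xi> UNIV \<subseteq> cball 0 2"
  proof
    fix x assume x: "x \<in> slab \<xi> UNIV"
    have "norm x \<le> norm (x - (\<xi> \<bullet> x) *\<^sub>R \<xi>) + norm ((\<xi> \<bullet> x) *\<^sub>R \<xi>)"
      by (metis add.commute diff_add_cancel norm_triangle_ineq)
    with x assms show "x \<in> cball 0 2" by (auto simp: slab_def)
  qed
  then have "emeasure lborel (slab \<xi> UNIV) \<le> emeasure lborel (cball 0 2 :: (real^'d) set)"
    by (intro emeasure_mono) auto
  also have "\<dots> < \<infinity>" by (rule emeasure_lborel_cball_finite)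
  finally show "emeasure (equator_measure \<xi>) (space (equator_measure \<xi>)) \<noteq> \<infinity>"
    by (simp add: emeasure_equator_measure)
qed

definition equator_mass :: "real^'d::finite \<Rightarrow> real" where
  "equator_mass \<xi> = measure (equator_measure \<xi>) UNIV"

text \<open>A ball around half of \<xi> fits into the slab. Positivity ensures that the multipliers
  have no zeros besides those of \<open>funk_mult\<close>.\<close>

lemma equator_mass_pos:
  fixes \<xi> :: "real^'d::finite"
  assumes "norm \<xi> = 1"
  shows "equator_mass \<xi> > 0"
proof -
  interpret finite_measure "equator_measure \<xi>" by (rule finite_equator_measure[OF assms])
  let ?U = "{x. 0 < \<xi> \<bullet> x} \<inter> {x. \<xi> \<bullet> x < 1} \<inter> {x. norm (x - (\<xi> \<bullet> x) *\<^sub>R \<xi>) < 1}"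
  have "open ?U"
    by (intro open_Int open_Collect_less continuous_intros)
  moreover have "(1/2) *\<^sub>R \<xi> \<in> ?U" using assms by (auto simp: dot_square_norm)
  ultimately obtain e where e: "e > 0" "ball ((1/2) *\<^sub>R \<xi>) e \<subseteq> ?U" by (meson openE)
  have "0 < emeasure lborel (ball ((1/2) *\<^sub>R \<xi>) e)"
    using content_ball_pos[OF e(1), of "(1/2) *\<^sub>R \<xi>"] by (simp add: measure_def enn2real_positive_iff)
  also have "\<dots> \<le> emeasure lborel (slab \<xi> UNIV)"
    using e(2) by (intro emeasure_mono) (force simp: slab_def, simp add: slab_borel)
  also have "\<dots> = ennreal (equator_mass \<xi>)"
    by (simp add: equator_mass_def emeasure_eq_measure[symmetric] emeasure_equator_measure)
  finally show ?thesis by (simp)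
qed

text \<open>\<open>sgn\<close> of a nonzero projection is a unit vector orthogonal to \<xi>. The
  exceptional points project to 0, hence lie on the line through \<xi>, which is contained in the
  null hyperplane orthogonal to \<open>u\<close>; such a \<open>u\<close> exists from dimension two
  on.\<close>

lemma AE_equator_measure:
  fixes \<xi> :: "real^'d::finite"
  assumes "norm \<xi> = 1" "CARD('d) \<ge> 2"
  shows "AE x in equator_measure \<xi>. x \<in> sphere 0 1 \<and> \<xi> \<bullet> x = 0"
proof (rule AE_I')
  let ?N = "- {x :: real^'d. x \<in> sphere 0 1 \<and> \<xi> \<bullet> x = 0}"
  have N: "?N \<in> sets borel" by measurable
  have "\<xi> \<noteq> 0" using assms(1) by auto
  obtain u where u: "u \<noteq> 0" "\<xi> \<bullet> u = 0"
    using assms(2) by (rule_tac orthogonal_to_vector_exists[of \<xi>]) (auto simp: orthogonal_def)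
  have "slab \<xi> ?N \<subseteq> {x. u \<bullet> x = 0}"
  proof
    fix x assume x: "x \<in> slab \<xi> ?N"
    have "\<xi> \<bullet> sgn (x - (\<xi> \<bullet> x) *\<^sub>R \<xi>) = 0"
      using assms(1) by (simp add: sgn_div_norm inner_diff_right dot_square_norm)
    with x have "norm (sgn (x - (\<xi> \<bullet> x) *\<^sub>R \<xi>)) \<noteq> 1" by (auto simp: slab_def)
    then have "x = (\<xi> \<bullet> x) *\<^sub>R \<xi>" by (auto simp: norm_sgn split: if_splits)
    then have "u \<bullet> x = (\<xi> \<bullet> x) * (u \<bullet> \<xi>)" by (metis inner_scaleR_right)
    then show "x \<in> {x. u \<bullet> x = 0}" using u by (simp add: inner_commute)
  qed
  moreover have "{x. u \<bullet> x = 0} \<in> null_sets lborel"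
    using u(1) negligible_hyperplane[of u 0]
    by (auto simp: negligible_iff_null_sets null_sets_completion_iff)
  ultimately have "slab \<xi> ?N \<in> null_sets lborel"
    using slab_borel[OF N] by (auto intro: null_sets_subset)
  then show "?N \<in> null_sets (equator_measure \<xi>)"
    using N by (auto simp: null_sets_def emeasure_equator_measure)
qed auto

text \<open>The map carries the slab of \<xi> to the slab of \<open>T \<xi>\<close>. Rotations that
  fix \<xi> thus preserve its equator measure, and other maps transport one equator to
  another.\<close>

lemma equator_measure_orthogonal:
  fixes T :: "real^'d::finite \<Rightarrow> real^'d"
  assumes T: "orthogonal_transformation T"
  shows "distr (equator_measure \<xi>) borel T = equator_measure (T \<xi>)"
proof (rule measure_eqI)
  note mT[measurable] = orthogonal_transformation_measurable[OF T]
  note lin = orthogonal_transformation_linear[OF T]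
  fix A assume "A \<in> sets (distr (equator_measure \<xi>) borel T)"
  then have A[measurable]: "A \<in> sets borel" by simp
  have P: "T x - (\<xi> \<bullet> x) *\<^sub>R T \<xi> = T (x - (\<xi> \<bullet> x) *\<^sub>R \<xi>)" for x
    using lin by (simp add: linear_diff linear_scale)
  have dot: "T a \<bullet> T b = a \<bullet> b" for a b using T by (simp add: orthogonal_transformation_def)
  have nrm: "norm (T a) = norm a" for a using T by (simp add: orthogonal_transformation)
  have "slab \<xi> (T -` A) = T -` slab (T \<xi>) A"
    unfolding slab_def vimage_def mem_Collect_eq dot P nrm orthogonal_transformation_sgn[OF T] ..
  moreover have "T -` A \<in> sets borel" by (metis measurable_sets_borel mT A)
  ultimately show "emeasure (distr (equator_measure \<xi>) borel T) A = emeasure (equator_measure (T \<xi>)) A"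
    by (subst emeasure_distr)
      (auto simp: emeasure_equator_measure emeasure_lborel_orthogonal_vimage[OF T] slab_borel)
qed simp

lemma integral_scale_measure:
  fixes f :: "'a \<Rightarrow> 'b::{banach, second_countable_topology}"
  assumes [measurable]: "f \<in> borel_measurable M" and "c \<ge> 0"
  shows "(\<integral>x. f x \<partial>scale_measure (ennreal c) M) = c *\<^sub>R (\<integral>x. f x \<partial>M)"
proof -
  have "scale_measure (ennreal c) M = density M (\<lambda>_. ennreal c)"
    by (rule measure_eqI) (auto simp: emeasure_density_const)
  then show ?thesis using assms by (simp add: integral_density)
qed

lemma integral_subsphere_measure:
  fixes f :: "real^'d::finite \<Rightarrow> complex"
  assumes [measurable]: "f \<in> borel_measurable borel" and t: "\<bar>t\<bar> \<le> 1"
  shows "(\<integral>x. f x \<partial>subsphere_measure \<xi> t) =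
    (real (CARD('d) - 1) * sqrt (1 - t\<^sup>2) ^ (CARD('d) - 2)) *\<^sub>R
      (\<integral>x. f (t *\<^sub>R \<xi> + sqrt (1 - t\<^sup>2) *\<^sub>R x) \<partial>equator_measure \<xi>)"
proof -
  have sg: "sgn \<in> restrict_space (hyperplane_measure \<xi>) (cball 0 1) \<rightarrow>\<^sub>M borel"
    by (intro measurable_restrict_space1) (simp add: hyperplane_measure_def)
  have "t\<^sup>2 \<le> 1" using t by (simp add: abs_square_le_1)
  then have nn: "0 \<le> real (CARD('d) - 1) * sqrt (1 - t\<^sup>2) ^ (CARD('d) - 2)" by simp
  have "distr (restrict_space (hyperplane_measure \<xi>) (cball 0 1)) borel
          (\<lambda>x. t *\<^sub>R \<xi> + sqrt (1 - t\<^sup>2) *\<^sub>R sgn x) =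
        distr (equator_measure \<xi>) borel (\<lambda>x. t *\<^sub>R \<xi> + sqrt (1 - t\<^sup>2) *\<^sub>R x)"
    unfolding equator_measure_def by (subst distr_distr[OF _ sg]) (auto simp: comp_def)
  then have "(\<integral>x. f x \<partial>subsphere_measure \<xi> t) = (\<integral>x. f x \<partial>scale_measure
      (ennreal (real (CARD('d) - 1) * sqrt (1 - t\<^sup>2) ^ (CARD('d) - 2)))
      (distr (equator_measure \<xi>) borel (\<lambda>x. t *\<^sub>R \<xi> + sqrt (1 - t\<^sup>2) *\<^sub>R x)))"
    by (simp only: subsphere_measure_def)
  also have "\<dots> = (real (CARD('d) - 1) * sqrt (1 - t\<^sup>2) ^ (CARD('d) - 2)) *\<^sub>R
      (\<integral>x. f x \<partial>distr (equator_measure \<xi>) borel (\<lambda>x. t *\<^sub>R \<xi> + sqrt (1 - t\<^sup>2) *\<^sub>R x))"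
    by (rule integral_scale_measure[OF _ nn]) simp
  also have "(\<integral>x. f x \<partial>distr (equator_measure \<xi>) borel (\<lambda>x. t *\<^sub>R \<xi> + sqrt (1 - t\<^sup>2) *\<^sub>R x)) =
      (\<integral>x. f (t *\<^sub>R \<xi> + sqrt (1 - t\<^sup>2) *\<^sub>R x) \<partial>equator_measure \<xi>)"
    by (rule integral_distr) simp_all
  finally show ?thesis .
qed

section \<open>Homogeneous polynomials\<close>

abbreviation dirderiv :: "'a::real_normed_vector \<Rightarrow> ('a \<Rightarrow> 'b::real_normed_vector) \<Rightarrow> 'a \<Rightarrow> 'b" where
  "dirderiv v f \<equiv> (\<lambda>x. frechet_derivative f (at x) v)"

lemma frechet_derivative_eqI: "(f has_derivative f') (at x) \<Longrightarrow> frechet_derivative f (at x) v = f' v"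
  using frechet_derivative_at by metis

lemma dirderiv_add:
  assumes "f differentiable (at x)" "g differentiable (at x)"
  shows "frechet_derivative (\<lambda>x. f x + g x) (at x) v =
    frechet_derivative f (at x) v + frechet_derivative g (at x) v"
  using assms by (intro frechet_derivative_eqI) (auto intro!: has_derivative_add simp: frechet_derivative_works)

lemma dirderiv_mult:
  fixes f g :: "'a::real_normed_vector \<Rightarrow> complex"
  assumes "f differentiable (at x)" "g differentiable (at x)"
  shows "frechet_derivative (\<lambda>x. f x * g x) (at x) v =
    frechet_derivative f (at x) v * g x + f x * frechet_derivative g (at x) v"
  using frechet_derivative_eqI[OF has_derivative_mult[OF assms[unfolded frechet_derivative_works]], of v]
  by (simp add: add.commute)

lemma dirderiv_sum:
  assumes "\<And>i. i \<in> I \<Longrightarrow> f i differentiable (at x)"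
  shows "frechet_derivative (\<lambda>x. \<Sum>i\<in>I. f i x) (at x) v = (\<Sum>i\<in>I. frechet_derivative (f i) (at x) v)"
  using assms by (intro frechet_derivative_eqI has_derivative_sum) (auto simp: frechet_derivative_works)

lemma dirderiv_linear_sum:
  assumes "f differentiable (at x)"
  shows "frechet_derivative f (at x) (\<Sum>i\<in>I. c i *\<^sub>R w i) = (\<Sum>i\<in>I. c i *\<^sub>R frechet_derivative f (at x) (w i))"
proof -
  interpret linear "frechet_derivative f (at x)"
    using assms by (rule linear_frechet_derivative)
  show ?thesis by (simp add: sum scaleR)
qed

lemma differentiable_of_real_inner [simp, intro]:
  "(\<lambda>x. complex_of_real (u \<bullet> x)) differentiable (at x)"
  unfolding differentiable_def by (auto intro!: derivative_eq_intros)

lemma dirderiv_of_real_inner [simp]: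
  "frechet_derivative (\<lambda>x. complex_of_real (u \<bullet> x)) (at x) v = complex_of_real (u \<bullet> v)"
  by (rule frechet_derivative_eqI) (auto intro!: derivative_eq_intros)

lemma homogeneous_polys_add:
  "f \<in> homogeneous_polys n \<Longrightarrow> g \<in> homogeneous_polys n \<Longrightarrow> (\<lambda>x. f x + g x) \<in> homogeneous_polys n"
  using cfun.span_add[of f _ g] by (simp add: homogeneous_polys_def plus_fun_def)

lemma homogeneous_polys_scale:
  "f \<in> homogeneous_polys n \<Longrightarrow> (\<lambda>x. c * f x) \<in> homogeneous_polys n"
  unfolding homogeneous_polys_def by (rule cfun.span_scale)

lemma homogeneous_polys_zero: "(\<lambda>x. 0) \<in> homogeneous_polys n"
  using cfun.span_zero by (simp add: homogeneous_polys_def zero_fun_def)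

lemma homogeneous_polys_sum:
  "(\<And>i. i \<in> I \<Longrightarrow> f i \<in> homogeneous_polys n) \<Longrightarrow> (\<lambda>x. \<Sum>i\<in>I. f i x) \<in> homogeneous_polys n"
  by (induction I rule: infinite_finite_induct) (auto intro: homogeneous_polys_zero homogeneous_polys_add)

lemma homogeneous_polys_monomial: "(\<Sum>i\<in>UNIV. \<alpha> i) = n \<Longrightarrow> cmonomial \<alpha> \<in> homogeneous_polys n"
  unfolding homogeneous_polys_def by (rule cfun.span_base) auto

lemma homogeneous_polys_one: "(\<lambda>x. 1) \<in> homogeneous_polys 0"
  using homogeneous_polys_monomial[of "\<lambda>_. 0" 0] by (simp add: cmonomial_def[abs_def])

lemma cmonomial_Suc:
  "cmonomial (\<alpha>(i := Suc (\<alpha> i))) = (\<lambda>x. complex_of_real (x $ i) * cmonomial \<alpha> x)"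
proof
  fix x :: "real^'a"
  have "(\<Prod>k\<in>UNIV. (x $ k) ^ (\<alpha>(i := Suc (\<alpha> i))) k) =
      (x $ i) ^ Suc (\<alpha> i) * (\<Prod>k\<in>UNIV - {i}. (x $ k) ^ \<alpha> k)"
    by (subst prod.remove[of _ i]) auto
  also have "\<dots> = x $ i * (\<Prod>k\<in>UNIV. (x $ k) ^ \<alpha> k)"
    by (subst prod.remove[of UNIV i]) auto
  finally show "cmonomial (\<alpha>(i := Suc (\<alpha> i))) x = complex_of_real (x $ i) * cmonomial \<alpha> x"
    by (simp add: cmonomial_def)
qed

lemma homogeneous_polys_span_induct [consumes 1, case_names add scale zero monomial]:
  assumes "f \<in> homogeneous_polys n"
    and "\<And>f g. f \<in> homogeneous_polys n \<Longrightarrow> g \<in> homogeneous_polys n \<Longrightarrow> P f \<Longrightarrow> P g \<Longrightarrow> P (\<lambda>x. f x + g x)"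
    and "\<And>c f. f \<in> homogeneous_polys n \<Longrightarrow> P f \<Longrightarrow> P (\<lambda>x. c * f x)"
    and "P (\<lambda>x. 0)"
    and "\<And>\<alpha>. (\<Sum>i\<in>UNIV. \<alpha> i) = n \<Longrightarrow> P (cmonomial \<alpha>)"
  shows "P f"
proof -
  have "f \<in> homogeneous_polys n \<and> P f"
    using assms(1) unfolding homogeneous_polys_def
  proof (induction rule: cfun.span_induct_alt)
    case base
    then show ?case using assms(4) homogeneous_polys_zero
      by (simp add: homogeneous_polys_def zero_fun_def)
  next
    case (step c m g)
    then have m: "m \<in> homogeneous_polys n" "P m"
      using assms(5) homogeneous_polys_monomial by auto
    have g: "g \<in> homogeneous_polys n" "P g"
      using step(2) by (simp_all add: homogeneous_polys_def)
    have "P (\<lambda>x. c * m x + g x)" "(\<lambda>x. c * m x + g x) \<in> homogeneous_polys n"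
      by (rule assms(2)[OF homogeneous_polys_scale[OF m(1)] g(1) assms(3)[OF m] g(2)])
        (rule homogeneous_polys_add[OF homogeneous_polys_scale[OF m(1)] g(1)])
    then show ?case by (simp add: homogeneous_polys_def plus_fun_def)
  qed
  then show ?thesis by simp
qed

lemma homogeneous_polys_coord:
  assumes "f \<in> homogeneous_polys n"
  shows "(\<lambda>x. complex_of_real (x $ i) * f x) \<in> homogeneous_polys (Suc n)"
  using assms
proof (induction rule: homogeneous_polys_span_induct)
  case (add f g)
  then show ?case by (simp add: distrib_left homogeneous_polys_add)
next
  case (scale c f)
  then show ?case by (simp add: mult.left_commute homogeneous_polys_scale)
next
  case zero
  then show ?case by (simp add: homogeneous_polys_zero)
next
  case (monomial \<alpha>)
  have "(\<Sum>k\<in>UNIV. (\<alpha>(i := Suc (\<alpha> i))) k) = Suc n"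
    using monomial by (simp add: sum.remove[of UNIV i])
  from homogeneous_polys_monomial[OF this] show ?case by (simp only: cmonomial_Suc)
qed

text \<open>A monomial is built by one coordinate factor at a time. The degree varies along the way,
  so \<open>P\<close> takes it as an argument; the inductive step for derivatives is then a product
  rule with one linear factor.\<close>

lemma homogeneous_polys_induct [consumes 1, case_names add scale zero one coord]:
  assumes "f \<in> homogeneous_polys n"
    and "\<And>n f g. f \<in> homogeneous_polys n \<Longrightarrow> g \<in> homogeneous_polys n \<Longrightarrow> P n f \<Longrightarrow> P n g \<Longrightarrow>
      P n (\<lambda>x. f x + g x)"
    and "\<And>n c f. f \<in> homogeneous_polys n \<Longrightarrow> P n f \<Longrightarrow> P n (\<lambda>x. c * f x)"
    and "\<And>n. P n (\<lambda>x. 0)"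
    and "P 0 (\<lambda>x. 1)"
    and "\<And>n i f. f \<in> homogeneous_polys n \<Longrightarrow> P n f \<Longrightarrow> P (Suc n) (\<lambda>x. complex_of_real (x $ i) * f x)"
  shows "P n f"
proof -
  have mono: "P n (cmonomial \<alpha>)" if "(\<Sum>i\<in>UNIV. \<alpha> i) = n" for \<alpha> n
    using that
  proof (induction n arbitrary: \<alpha>)
    case 0
    then have "cmonomial \<alpha> = (\<lambda>x. 1)" by (simp add: cmonomial_def[abs_def])
    with assms(5) show ?case by simp
  next
    case (Suc n)
    then obtain i where i: "\<alpha> i \<noteq> 0" by (metis sum.neutral nat.distinct(1))
    define \<beta> where "\<beta> = \<alpha>(i := \<alpha> i - 1)"
    have \<alpha>: "\<alpha> = \<beta>(i := Suc (\<beta> i))" using i by (auto simp: \<beta>_def)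
    have s: "(\<Sum>k\<in>UNIV. \<beta> k) = n"
      using Suc.prems i by (simp add: \<beta>_def sum.remove[of UNIV i])
    have "P (Suc n) (\<lambda>x. complex_of_real (x $ i) * cmonomial \<beta> x)"
      by (rule assms(6)[OF homogeneous_polys_monomial[OF s] Suc.IH[OF s]])
    then show ?case by (subst \<alpha>) (simp only: cmonomial_Suc)
  qed
  show ?thesis
    using assms(1) by (rule homogeneous_polys_span_induct) (use assms mono in auto)
qed

lemma homogeneous_polys_inner:
  assumes "f \<in> homogeneous_polys n"
  shows "(\<lambda>x. complex_of_real (u \<bullet> x) * f x) \<in> homogeneous_polys (Suc n)"
proof -
  have "(\<lambda>x. \<Sum>i\<in>UNIV. complex_of_real (u $ i) * (complex_of_real (x $ i) * f x)) \<in> homogeneous_polys (Suc n)"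
    by (intro homogeneous_polys_sum homogeneous_polys_scale homogeneous_polys_coord assms)
  then show ?thesis by (simp add: inner_vec_def sum_distrib_right mult.assoc)
qed

lemma homogeneous_polys_norm2:
  assumes "f \<in> homogeneous_polys n"
  shows "(\<lambda>x. complex_of_real ((norm x)\<^sup>2) * f x) \<in> homogeneous_polys (n + 2)"
proof -
  have "(\<lambda>x. \<Sum>i\<in>UNIV. complex_of_real (x $ i) * (complex_of_real (x $ i) * f x)) \<in> homogeneous_polys (Suc (Suc n))"
    by (intro homogeneous_polys_sum homogeneous_polys_coord assms)
  then show ?thesis
    by (simp add: power2_norm_eq_inner inner_vec_def sum_distrib_right mult.assoc)
qed

lemma homogeneous_polys_0_const:
  assumes "f \<in> homogeneous_polys 0"
  shows "\<exists>c. f = (\<lambda>x. c)"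
proof -
  have "n = 0 \<longrightarrow> (\<exists>c. f = (\<lambda>x. c))" if "f \<in> homogeneous_polys n" for n and f :: "real^'a \<Rightarrow> complex"
    using that by (induction rule: homogeneous_polys_induct) auto
  with assms show ?thesis by blast
qed

lemma coord_eq_inner: "x $ i = axis i 1 \<bullet> x"
  by (simp add: inner_axis')

lemma homogeneous_polys_derivative:
  assumes "f \<in> homogeneous_polys n"
  shows "(\<forall>x. f differentiable (at x)) \<and> (\<forall>v. dirderiv v f \<in> homogeneous_polys (n - 1))"
  using assms
proof (induction rule: homogeneous_polys_induct)
  case (add n f g)
  then show ?case by (auto simp: dirderiv_add intro!: homogeneous_polys_add)
next
  case (scale n c f)
  then show ?case by (auto simp: dirderiv_mult frechet_derivative_const intro!: homogeneous_polys_scale)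
next
  case (zero n)
  then show ?case by (auto simp: frechet_derivative_const intro!: homogeneous_polys_zero)
next
  case one
  then show ?case by (auto simp: frechet_derivative_const intro!: homogeneous_polys_zero)
next
  case (coord n i f)
  have d: "f differentiable (at x)" for x using coord by auto
  have "dirderiv v (\<lambda>x. complex_of_real (x $ i) * f x) =
      (\<lambda>x. complex_of_real (v $ i) * f x + complex_of_real (x $ i) * dirderiv v f x)" for v
    using d unfolding coord_eq_inner by (simp add: dirderiv_mult)
  moreover have "(\<lambda>x. complex_of_real (x $ i) * dirderiv v f x) \<in> homogeneous_polys n" for v
  \<comment> \<open>The truncated \<open>n - 1\<close> matters here: multiplying the derivative by a
    coordinate would raise degree 0 to 1, but for \<open>n = 0\<close> the derivative
    vanishes.\<close>
  proof (cases n)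
    case 0
    then have "dirderiv v f x = 0" for x
      using homogeneous_polys_0_const[of f] coord by (auto simp: frechet_derivative_const)
    then show ?thesis by (simp add: homogeneous_polys_zero)
  next
    case (Suc k)
    with homogeneous_polys_coord[of "dirderiv v f" k i] coord show ?thesis by auto
  qed
  moreover have "(\<lambda>x. complex_of_real (x $ i) * f x) differentiable (at x)" for x
    using d unfolding coord_eq_inner by auto
  ultimately show ?case
    using coord by (auto intro!: homogeneous_polys_add homogeneous_polys_scale)
qed

lemma homogeneous_polys_differentiable: "f \<in> homogeneous_polys n \<Longrightarrow> f differentiable (at x)"
  using homogeneous_polys_derivative by blast

lemma homogeneous_polys_dirderiv: "f \<in> homogeneous_polys n \<Longrightarrow> dirderiv v f \<in> homogeneous_polys (n - 1)"
  using homogeneous_polys_derivative by blast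

lemma homogeneous_polys_0_dirderiv: "f \<in> homogeneous_polys 0 \<Longrightarrow> dirderiv v f x = 0"
  using homogeneous_polys_0_const[of f] by (auto simp: frechet_derivative_const)

lemma dirderiv_inner_mult:
  assumes "f \<in> homogeneous_polys n"
  shows "dirderiv v (\<lambda>x. complex_of_real (u \<bullet> x) * f x) x =
      complex_of_real (u \<bullet> v) * f x + complex_of_real (u \<bullet> x) * dirderiv v f x"
  using homogeneous_polys_differentiable[OF assms] by (simp add: dirderiv_mult)

lemma dirderiv_cmult:
  assumes "f \<in> homogeneous_polys n"
  shows "dirderiv v (\<lambda>x. c * f x) x = c * dirderiv v f x"
  using homogeneous_polys_differentiable[OF assms] by (simp add: dirderiv_mult frechet_derivative_const)

lemma dirderiv_add':
  assumes "f \<in> homogeneous_polys n" "g \<in> homogeneous_polys m"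
  shows "dirderiv v (\<lambda>x. f x + g x) x = dirderiv v f x + dirderiv v g x"
  using homogeneous_polys_differentiable[OF assms(1)] homogeneous_polys_differentiable[OF assms(2)]
  by (simp add: dirderiv_add)

lemma homogeneous_polys_homogeneous:
  assumes "f \<in> homogeneous_polys n"
  shows "f (r *\<^sub>R x) = complex_of_real r ^ n * f x"
  using assms by (induction rule: homogeneous_polys_induct) (auto simp: algebra_simps)

lemma euler_identity:
  assumes "f \<in> homogeneous_polys n"
  shows "frechet_derivative f (at x) x = of_nat n * f x"
  using assms
proof (induction rule: homogeneous_polys_induct)
  case (coord n i f)
  then show ?case
    using dirderiv_inner_mult[OF coord(1), where v = x and u = "axis i 1" and x = x]
    by (simp add: coord_eq_inner[symmetric]) (simp add: algebra_simps)
qed (auto simp: dirderiv_add dirderiv_mult homogeneous_polys_differentiable frechet_derivative_const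
    algebra_simps)

lemma dirderiv_commute:
  assumes "f \<in> homogeneous_polys n"
  shows "dirderiv u (dirderiv v f) x = dirderiv v (dirderiv u f) x"
  using assms
proof (induction arbitrary: x rule: homogeneous_polys_induct)
  case (add n f g)
  note H = homogeneous_polys_dirderiv[OF add(1)] homogeneous_polys_dirderiv[OF add(2)]
  show ?case using add by (simp add: dirderiv_add'[OF add(1,2)] dirderiv_add'[OF H])
next
  case (scale n c f)
  note H = homogeneous_polys_dirderiv[OF scale(1)]
  show ?case using scale by (simp add: dirderiv_cmult[OF scale(1)] dirderiv_cmult[OF H])
next
  case (coord n i f)
  note H = homogeneous_polys_dirderiv[OF coord(1)]
  have "dirderiv u (dirderiv v (\<lambda>x. complex_of_real (axis i 1 \<bullet> x) * f x)) x =
    complex_of_real (axis i 1 \<bullet> v) * dirderiv u f x +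
      (complex_of_real (axis i 1 \<bullet> u) * dirderiv v f x +
       complex_of_real (axis i 1 \<bullet> x) * dirderiv u (dirderiv v f) x)" for u v
    unfolding dirderiv_inner_mult[OF coord(1)]
      dirderiv_add'[OF homogeneous_polys_scale[OF coord(1)] homogeneous_polys_inner[OF H]]
      dirderiv_cmult[OF coord(1)] dirderiv_inner_mult[OF H] ..
  with coord(2) show ?case unfolding coord_eq_inner by simp
qed (simp_all add: frechet_derivative_const)

lemma homogeneous_polys_mult:
  assumes "f \<in> homogeneous_polys n" "g \<in> homogeneous_polys m"
  shows "(\<lambda>x. f x * g x) \<in> homogeneous_polys (n + m)"
  using assms(1)
proof (induction rule: homogeneous_polys_induct)
  case (add n f g)
  then show ?case by (simp add: distrib_right homogeneous_polys_add)
next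
  case (scale n c f)
  then show ?case by (simp add: mult.assoc homogeneous_polys_scale)
next
  case (coord n i f)
  then show ?case by (simp add: mult.assoc homogeneous_polys_coord)
qed (simp_all add: homogeneous_polys_zero assms(2))

section \<open>The Laplacian and spherical harmonics\<close>

lemma laplacian_eq: "laplacian p = (\<lambda>x. \<Sum>b\<in>Basis. dirderiv b (dirderiv b p) x)"
  by (simp add: laplacian_def fun_eq_iff)

lemma laplacian_mem: "f \<in> homogeneous_polys n \<Longrightarrow> laplacian f \<in> homogeneous_polys (n - 2)"
  using homogeneous_polys_dirderiv[OF homogeneous_polys_dirderiv[of f n]]
  by (auto simp: laplacian_eq intro!: homogeneous_polys_sum simp: numeral_2_eq_2)

lemma laplacian_add:
  assumes "f \<in> homogeneous_polys n" "g \<in> homogeneous_polys m"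
  shows "laplacian (\<lambda>x. f x + g x) = (\<lambda>x. laplacian f x + laplacian g x)"
  using assms by (simp add: laplacian_eq dirderiv_add'[OF assms]
      dirderiv_add'[OF homogeneous_polys_dirderiv[OF assms(1)] homogeneous_polys_dirderiv[OF assms(2)]] sum.distrib)

lemma laplacian_cmult:
  assumes "f \<in> homogeneous_polys n"
  shows "laplacian (\<lambda>x. c * f x) = (\<lambda>x. c * laplacian f x)"
  using assms by (simp add: laplacian_eq dirderiv_cmult[OF assms]
      dirderiv_cmult[OF homogeneous_polys_dirderiv[OF assms(1)]] sum_distrib_left)

lemma laplacian_low_degree:
  assumes "f \<in> homogeneous_polys n" "n < 2"
  shows "laplacian f = (\<lambda>x. 0)"
proof -
  have "dirderiv v f \<in> homogeneous_polys 0" for v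
    using homogeneous_polys_dirderiv[OF assms(1), of v] assms(2) by (cases n) auto
  then show ?thesis by (simp add: laplacian_eq homogeneous_polys_0_dirderiv)
qed

lemma laplacian_dirderiv:
  assumes "f \<in> homogeneous_polys n"
  shows "laplacian (dirderiv v f) = dirderiv v (laplacian f)"
proof -
  have "dirderiv b (dirderiv b (dirderiv v f)) x = dirderiv v (dirderiv b (dirderiv b f)) x" for b x
    unfolding dirderiv_commute[OF assms, where u = b and v = v]
    by (rule dirderiv_commute[OF homogeneous_polys_dirderiv[OF assms]])
  then show ?thesis
    using homogeneous_polys_differentiable[OF homogeneous_polys_dirderiv[OF homogeneous_polys_dirderiv[OF assms]]]
    by (simp add: laplacian_eq dirderiv_sum)
qed

lemma dirderiv_norm2_mult:
  fixes f :: "real^'d::finite \<Rightarrow> complex"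
  assumes "f \<in> homogeneous_polys n"
  shows "dirderiv v (\<lambda>x. complex_of_real ((norm x)\<^sup>2) * f x) x =
      2 * (complex_of_real (v \<bullet> x) * f x) + complex_of_real ((norm x)\<^sup>2) * dirderiv v f x"
proof -
  have d: "((\<lambda>x. complex_of_real ((norm x)\<^sup>2)) has_derivative (\<lambda>h. complex_of_real (2 * (h \<bullet> x)))) (at x)"
    unfolding power2_norm_eq_inner
    by (auto intro!: derivative_eq_intros simp: inner_commute)
  then have "(\<lambda>x. complex_of_real ((norm x)\<^sup>2)) differentiable (at x)" by (auto simp: differentiable_def)
  from dirderiv_mult[OF this homogeneous_polys_differentiable[OF assms], of v] show ?thesis
    unfolding frechet_derivative_eqI[OF d] by simp
qed

lemma dirderiv_basis_sum:
  assumes "f differentiable (at x)"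
  shows "(\<Sum>b\<in>Basis. complex_of_real (b \<bullet> y) * dirderiv b f x) = frechet_derivative f (at x) y"
  using dirderiv_linear_sum[OF assms, of "\<lambda>b. b \<bullet> y" "\<lambda>b. b" Basis]
  by (simp add: inner_commute[of _ y] euclidean_representation scaleR_conv_of_real)

text \<open>The mixed terms add up to four times the Euler operator, which contributes 4n, and each
  of the d second derivatives of the squared norm contributes 2.\<close>

lemma laplacian_norm2_mult:
  fixes f :: "real^'d::finite \<Rightarrow> complex"
  assumes "f \<in> homogeneous_polys n"
  shows "laplacian (\<lambda>x. complex_of_real ((norm x)\<^sup>2) * f x) =
      (\<lambda>x. complex_of_real ((norm x)\<^sup>2) * laplacian f x + (4 * of_nat n + 2 * of_nat CARD('d)) * f x)"
proof
  fix x
  note H = homogeneous_polys_dirderiv[OF assms]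
  have "dirderiv b (dirderiv b (\<lambda>x. complex_of_real ((norm x)\<^sup>2) * f x)) x =
      2 * f x + 4 * (complex_of_real (b \<bullet> x) * dirderiv b f x) + complex_of_real ((norm x)\<^sup>2) * dirderiv b (dirderiv b f) x"
    if "b \<in> Basis" for b
    unfolding dirderiv_norm2_mult[OF assms]
      dirderiv_add'[OF homogeneous_polys_scale[OF homogeneous_polys_inner[OF assms]] homogeneous_polys_norm2[OF H]]
      dirderiv_cmult[OF homogeneous_polys_inner[OF assms]] dirderiv_inner_mult[OF assms] dirderiv_norm2_mult[OF H]
    using that by (simp add: algebra_simps scaleR_conv_of_real inner_same_Basis)
  then have "laplacian (\<lambda>x. complex_of_real ((norm x)\<^sup>2) * f x) x =
     (\<Sum>b\<in>(Basis :: (real^'d) set). 2 * f x + 4 * (complex_of_real (b \<bullet> x) * dirderiv b f x) +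
       complex_of_real ((norm x)\<^sup>2) * dirderiv b (dirderiv b f) x)"
    unfolding laplacian_eq by (intro sum.cong) auto
  also have "\<dots> = 2 * of_nat CARD('d) * f x + 4 * (of_nat n * f x) + complex_of_real ((norm x)\<^sup>2) * laplacian f x"
    using dirderiv_basis_sum[OF homogeneous_polys_differentiable[OF assms], of x x] euler_identity[OF assms, of x]
    by (simp add: sum.distrib sum_distrib_left[symmetric] laplacian_eq)
  finally show "laplacian (\<lambda>x. complex_of_real ((norm x)\<^sup>2) * f x) x =
      complex_of_real ((norm x)\<^sup>2) * laplacian f x + (4 * of_nat n + 2 * of_nat CARD('d)) * f x"
    by (simp add: algebra_simps)
qed

section \<open>Decomposition of polynomials on the sphere into harmonics\<close>

lemma iterated_laplacian_mem:
  "f \<in> homogeneous_polys n \<Longrightarrow> (laplacian ^^ k) f \<in> homogeneous_polys (n - 2 * k)"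
proof (induction k)
  case (Suc k)
  then show ?case using laplacian_mem[of "(laplacian ^^ k) f" "n - 2 * k"] by simp
qed simp

lemma iterated_laplacian_add_cmult:
  assumes "f \<in> homogeneous_polys n" "g \<in> homogeneous_polys n"
  shows "(laplacian ^^ k) (\<lambda>x. f x + c * g x) = (\<lambda>x. (laplacian ^^ k) f x + c * (laplacian ^^ k) g x)"
proof (induction k)
  case (Suc k)
  note H = iterated_laplacian_mem[OF assms(1), of k] iterated_laplacian_mem[OF assms(2), of k]
  show ?case
    by (simp add: Suc laplacian_add[OF H(1) homogeneous_polys_scale[OF H(2)]] laplacian_cmult[OF H(2)])
qed simp

lemma norm_pow_mult_mem:
  assumes "h \<in> homogeneous_polys m"
  shows "(\<lambda>x. complex_of_real ((norm x)\<^sup>2) ^ k * h x) \<in> homogeneous_polys (m + 2 * k)"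
proof (induction k)
  case (Suc k)
  from homogeneous_polys_norm2[OF this] show ?case by (simp add: mult.assoc)
qed (use assms in simp)

lemma laplacian_norm_pow_mult:
  fixes h :: "real^'d::finite \<Rightarrow> complex"
  assumes h: "h \<in> homogeneous_polys m" "laplacian h = (\<lambda>x. 0)"
  shows "\<exists>c>0. laplacian (\<lambda>x. complex_of_real ((norm x)\<^sup>2) ^ Suc k * h x) =
    (\<lambda>x. complex_of_real c * (complex_of_real ((norm x)\<^sup>2) ^ k * h x))"
proof (induction k)
  case 0
  show ?case
    using laplacian_norm2_mult[OF h(1)] h(2)
    by (intro exI[of _ "4 * real m + 2 * real CARD('d)"]) (auto simp: add_nonneg_pos)
next
  case (Suc k)
  then obtain c where c: "c > 0" "laplacian (\<lambda>x. complex_of_real ((norm x)\<^sup>2) ^ Suc k * h x) =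
    (\<lambda>x. complex_of_real c * (complex_of_real ((norm x)\<^sup>2) ^ k * h x))" by blast
  have "laplacian (\<lambda>x. complex_of_real ((norm x)\<^sup>2) ^ Suc (Suc k) * h x) =
     (\<lambda>x. complex_of_real (c + 4 * real (m + 2 * Suc k) + 2 * real CARD('d)) *
       (complex_of_real ((norm x)\<^sup>2) ^ Suc k * h x))"
    using laplacian_norm2_mult[OF norm_pow_mult_mem[OF h(1), of "Suc k"]] unfolding c(2)
    by (simp add: mult.assoc fun_eq_iff) (simp add: algebra_simps)
  with c(1) show ?case
    by (intro exI[of _ "c + 4 * real (m + 2 * Suc k) + 2 * real CARD('d)"]) (auto intro!: add_pos_nonneg)
qed

text \<open>Every application of the Laplacian removes one factor of the squared norm at the price
  of a positive constant. Since the product of these constants is not zero, the harmonic part of top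
  order can be divided off.\<close>

lemma iterated_laplacian_norm_pow_mult:
  assumes h: "h \<in> homogeneous_polys m" "laplacian h = (\<lambda>x. 0)"
  shows "\<exists>c>0. (laplacian ^^ k) (\<lambda>x. complex_of_real ((norm x)\<^sup>2) ^ k * h x) = (\<lambda>x. complex_of_real c * h x)"
proof (induction k)
  case 0
  show ?case by (intro exI[of _ 1]) simp
next
  case (Suc k)
  then obtain c where c: "c > 0" "(laplacian ^^ k) (\<lambda>x. complex_of_real ((norm x)\<^sup>2) ^ k * h x) =
    (\<lambda>x. complex_of_real c * h x)" by blast
  obtain c' where c': "c' > 0" "laplacian (\<lambda>x. complex_of_real ((norm x)\<^sup>2) ^ Suc k * h x) =
    (\<lambda>x. complex_of_real c' * (complex_of_real ((norm x)\<^sup>2) ^ k * h x))"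
    using laplacian_norm_pow_mult[OF h] by blast
  note H = norm_pow_mult_mem[OF h(1), of k]
  have "(laplacian ^^ Suc k) (\<lambda>x. complex_of_real ((norm x)\<^sup>2) ^ Suc k * h x) =
    (laplacian ^^ k) (\<lambda>x. 0 + complex_of_real c' * (complex_of_real ((norm x)\<^sup>2) ^ k * h x))"
    by (simp only: funpow_Suc_right comp_def c'(2) add_0)
  also have "\<dots> = (\<lambda>x. (laplacian ^^ k) (\<lambda>x. 0) x + complex_of_real c' * (complex_of_real c * h x))"
    by (simp only: iterated_laplacian_add_cmult[OF homogeneous_polys_zero H] c(2))
  also have "(laplacian ^^ k) (\<lambda>x. 0) = (\<lambda>x::real^'a. 0)"
    by (induction k) (simp_all add: laplacian_low_degree[of _ 0] homogeneous_polys_zero)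
  finally have eq: "(laplacian ^^ Suc k) (\<lambda>x. complex_of_real ((norm x)\<^sup>2) ^ Suc k * h x) =
    (\<lambda>x. 0 + complex_of_real c' * (complex_of_real c * h x))" .
  show ?case
  proof (rule exI[of _ "c' * c"], rule conjI)
    show "0 < c' * c" using c(1) c'(1) by simp
    show "(laplacian ^^ Suc k) (\<lambda>x. complex_of_real ((norm x)\<^sup>2) ^ Suc k * h x) =
        (\<lambda>x. complex_of_real (c' * c) * h x)"
      unfolding eq add_0_left of_real_mult mult.assoc ..
  qed
qed

lemma on_sphere_add: "on_sphere (\<lambda>x. f x + g x) = on_sphere f + on_sphere g"
  by (auto simp: on_sphere_def fun_eq_iff)

lemma on_sphere_cmult: "on_sphere (\<lambda>x. c * f x) = (\<lambda>x. c * on_sphere f x)"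
  by (auto simp: on_sphere_def fun_eq_iff)

lemma on_sphere_zero: "on_sphere (\<lambda>x. 0) = 0"
  by (auto simp: on_sphere_def fun_eq_iff)

text \<open>The induction is on the number of Laplacians that annihilate \<open>q\<close>. With
  \<open>k + 1\<close> of them, the polynomial \<open>?h\<close> is harmonic; subtracting a multiple
  of \<open>?h\<close> times the k-th power of the squared norm leaves something annihilated by
  \<open>k\<close> of them, and on the sphere the subtracted term is a multiple of \<open>?h\<close>
  itself.\<close>

lemma on_sphere_homogeneous_poly:
  assumes "q \<in> homogeneous_polys n" "(laplacian ^^ k) q = (\<lambda>x. 0)"
  shows "on_sphere q \<in> cfun.span (\<Union>m\<in>{..n}. spherical_harmonics m)"
  using assms
proof (induction k arbitrary: q)
  case 0
  then have "q = (\<lambda>x. 0)" by simp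
  then show ?case by (simp only: on_sphere_zero cfun.span_zero)
next
  case (Suc k)
  let ?h = "(laplacian ^^ k) q"
  have h: "?h \<in> homogeneous_polys (n - 2 * k)" "laplacian ?h = (\<lambda>x. 0)"
    using Suc.prems iterated_laplacian_mem by auto
  show ?case
  proof (cases "2 * k \<le> n")
    case True
    obtain c where c: "c > 0" "(laplacian ^^ k) (\<lambda>x. complex_of_real ((norm x)\<^sup>2) ^ k * ?h x) =
      (\<lambda>x. complex_of_real c * ?h x)"
      using iterated_laplacian_norm_pow_mult[OF h] by blast
    have m: "(\<lambda>x. complex_of_real ((norm x)\<^sup>2) ^ k * ?h x) \<in> homogeneous_polys n"
      using norm_pow_mult_mem[OF h(1), of k] True by simp
    define q' where "q' = (\<lambda>x. q x + complex_of_real (- 1 / c) * (complex_of_real ((norm x)\<^sup>2) ^ k * ?h x))"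
    have q': "q' \<in> homogeneous_polys n"
      unfolding q'_def by (intro homogeneous_polys_add homogeneous_polys_scale m Suc.prems)
    have lq': "(laplacian ^^ k) q' = (\<lambda>x. 0)"
      unfolding q'_def iterated_laplacian_add_cmult[OF Suc.prems(1) m] c(2)
      using c(1) by simp
    have "on_sphere q = on_sphere (\<lambda>x. q' x + complex_of_real (1 / c) * ?h x)"
      using c(1) by (auto simp: on_sphere_def q'_def)
    also have "\<dots> = on_sphere q' + (\<lambda>x. complex_of_real (1 / c) * on_sphere ?h x)"
      by (simp only: on_sphere_add on_sphere_cmult)
    also have "\<dots> \<in> cfun.span (\<Union>m\<in>{..n}. spherical_harmonics m)"
    proof (rule cfun.span_add[OF Suc.IH[OF q' lq'] cfun.span_scale[OF cfun.span_base]])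
      have "on_sphere ?h \<in> spherical_harmonics (n - 2 * k)"
        using h by (auto simp: spherical_harmonics_def)
      then show "on_sphere ?h \<in> (\<Union>m\<in>{..n}. spherical_harmonics m)" by auto
    qed
    finally show ?thesis .
  next
    case False
    \<comment> \<open>The degree is used up before \<open>k\<close> Laplacians have been applied, so
      \<open>k\<close> of them already annihilate \<open>q\<close>.\<close>
    then obtain k' where k': "k = Suc k'" by (cases k) auto
    have "laplacian ((laplacian ^^ k') q) = (\<lambda>x. 0)"
      using False by (intro laplacian_low_degree[OF iterated_laplacian_mem[OF Suc.prems(1)]]) (simp add: k')
    then show ?thesis using Suc.IH[OF Suc.prems(1)] by (simp add: k')
  qed
qed

lemma on_sphere_homogeneous_polys:
  assumes "q \<in> homogeneous_polys n"
  shows "on_sphere q \<in> cfun.span (\<Union>m\<in>{..n}. spherical_harmonics m)"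
proof (rule on_sphere_homogeneous_poly[OF assms])
  show "(laplacian ^^ Suc n) q = (\<lambda>x. 0)"
    using laplacian_low_degree[OF iterated_laplacian_mem[OF assms, of n]] by simp
qed

lemma span_on_sphere_image:
  assumes "f \<in> cfun.span A" "\<And>g. g \<in> A \<Longrightarrow> on_sphere g \<in> cfun.span B"
  shows "on_sphere f \<in> cfun.span B"
  using assms(1)
proof (induction rule: cfun.span_induct_alt)
  case base
  have "on_sphere (0 :: real^'a \<Rightarrow> complex) = 0" by (auto simp: on_sphere_def fun_eq_iff)
  then show ?case by (simp only: cfun.span_zero)
next
  case (step c x y)
  have "on_sphere ((\<lambda>z. c * x z) + y) = (\<lambda>z. c * on_sphere x z) + on_sphere y"
    by (auto simp: on_sphere_def fun_eq_iff)
  also have "\<dots> \<in> cfun.span B"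
    by (rule cfun.span_add[OF cfun.span_scale[OF assms(2)[OF step(1)]] step(2)])
  finally show ?case .
qed

lemma on_sphere_polys_upto:
  assumes "q \<in> polys_upto m"
  shows "on_sphere q \<in> cfun.span (\<Union>n\<in>{..m}. spherical_harmonics n)"
  using assms unfolding polys_upto_def
proof (rule span_on_sphere_image)
  fix g :: "real^'a \<Rightarrow> complex" assume "g \<in> {cmonomial \<alpha> |\<alpha>. sum \<alpha> UNIV \<le> m}"
  then obtain \<alpha> where \<alpha>: "g = cmonomial \<alpha>" "sum \<alpha> UNIV \<le> m" by blast
  have "on_sphere g \<in> cfun.span (\<Union>n\<in>{..sum \<alpha> UNIV}. spherical_harmonics n)"
    unfolding \<alpha> by (intro on_sphere_homogeneous_polys homogeneous_polys_monomial) simp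
  also have "\<dots> \<subseteq> cfun.span (\<Union>n\<in>{..m}. spherical_harmonics n)"
    using \<alpha>(2) by (intro cfun.span_mono UN_mono) auto
  finally show "on_sphere g \<in> cfun.span (\<Union>n\<in>{..m}. spherical_harmonics n)" .
qed

lemma spherical_harmonics_polys_upto:
  assumes "n \<le> m" "Y \<in> spherical_harmonics n"
  shows "Y \<in> on_sphere ` polys_upto m"
proof -
  have "homogeneous_polys n \<subseteq> polys_upto m"
    unfolding homogeneous_polys_def polys_upto_def using assms(1) by (intro cfun.span_mono) auto
  then show ?thesis using assms(2) by (auto simp: spherical_harmonics_def)
qed

lemma span_homogeneous_polys_mult:
  assumes "f \<in> cfun.span (\<Union>n. homogeneous_polys n)" "g \<in> cfun.span (\<Union>n. homogeneous_polys n)"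
  shows "(\<lambda>x. f x * g x) \<in> cfun.span (\<Union>n. homogeneous_polys n)"
proof -
  have 1: "(\<lambda>x. f x * g x) \<in> cfun.span (\<Union>n. homogeneous_polys n)" if "g \<in> homogeneous_polys m" for g m
    using assms(1)
  proof (induction rule: cfun.span_induct_alt)
    case base
    show ?case using cfun.span_zero by (simp add: zero_fun_def)
  next
    case (step c x y)
    then obtain n where "x \<in> homogeneous_polys n" by auto
    then have "(\<lambda>z. x z * g z) \<in> cfun.span (\<Union>n. homogeneous_polys n)"
      using homogeneous_polys_mult[OF _ that] by (intro cfun.span_base) auto
    from cfun.span_add[OF cfun.span_scale[OF this, of c] step(2)]
    show ?case by (simp add: plus_fun_def algebra_simps)
  qed
  show ?thesis
    using assms(2)
  proof (induction rule: cfun.span_induct_alt)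
    case base
    show ?case using cfun.span_zero by (simp add: zero_fun_def)
  next
    case (step c x y)
    then obtain n where "x \<in> homogeneous_polys n" by auto
    from cfun.span_add[OF cfun.span_scale[OF 1[OF this], of c] step(2)]
    show ?case by (simp add: plus_fun_def algebra_simps)
  qed
qed

text \<open>Translates the polynomials of the Stone-Weierstrass theorem into spans of monomials; a
  bounded linear functional is the inner product with a vector \<open>u\<close>.\<close>

lemma real_polynomial_function_in_span:
  fixes r :: "real^'d::finite \<Rightarrow> real"
  assumes "real_polynomial_function r"
  shows "(\<lambda>x. complex_of_real (r x)) \<in> cfun.span (\<Union>n. homogeneous_polys n)"
  using assms
proof (induction rule: real_polynomial_function.induct)
  case (linear f)
  then interpret linear f by (simp add: bounded_linear.linear)
  define u where "u = (\<Sum>b\<in>Basis. f b *\<^sub>R b)"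
  have f: "f x = u \<bullet> x" for x
  proof -
    have "f x = f (\<Sum>b\<in>Basis. (x \<bullet> b) *\<^sub>R b)" by (simp add: euclidean_representation)
    also have "\<dots> = (\<Sum>b\<in>Basis. (x \<bullet> b) *\<^sub>R f b)" by (simp only: sum scaleR)
    also have "\<dots> = u \<bullet> x"
      unfolding u_def inner_sum_left by (simp add: inner_commute mult.commute)
    finally show ?thesis .
  qed
  have "(\<lambda>x. complex_of_real (u \<bullet> x) * 1) \<in> homogeneous_polys (Suc 0)"
    by (intro homogeneous_polys_inner homogeneous_polys_one)
  then show ?case by (intro cfun.span_base) (auto simp: f)
next
  case (const c)
  have "(\<lambda>x. complex_of_real c * 1) \<in> homogeneous_polys 0"
    by (intro homogeneous_polys_scale homogeneous_polys_one)
  then show ?case by (intro cfun.span_base) auto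
next
  case (add f g)
  from cfun.span_add[OF add.IH] show ?case by (simp add: plus_fun_def)
next
  case (mult f g)
  from span_homogeneous_polys_mult[OF mult.IH] show ?case by simp
qed

text \<open>Stone-Weierstrass approximates real and imaginary parts by polynomials, and a polynomial
  restricted to the sphere is a finite sum of harmonics.\<close>

lemma harmonics_dense:
  fixes f :: "real^'d::finite \<Rightarrow> complex"
  assumes "continuous_on (sphere 0 1) f" "e > 0"
  shows "\<exists>g \<in> cfun.span (\<Union>n. spherical_harmonics n). \<forall>x\<in>sphere 0 1. cmod (f x - g x) < e"
proof -
  obtain r where r: "real_polynomial_function r" "\<And>x. x \<in> sphere 0 1 \<Longrightarrow> \<bar>Re (f x) - r x\<bar> < e/2"
    using Stone_Weierstrass_real_polynomial_function[of "sphere 0 1" "\<lambda>x. Re (f x)" "e/2"] assms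
    by (auto intro: continuous_intros)
  obtain i where i: "real_polynomial_function i" "\<And>x. x \<in> sphere 0 1 \<Longrightarrow> \<bar>Im (f x) - i x\<bar> < e/2"
    using Stone_Weierstrass_real_polynomial_function[of "sphere 0 1" "\<lambda>x. Im (f x)" "e/2"] assms
    by (auto intro: continuous_intros)
  define q where "q = (\<lambda>x. complex_of_real (r x) + \<i> * complex_of_real (i x))"
  have "q \<in> cfun.span (\<Union>n. homogeneous_polys n)"
    using cfun.span_add[OF real_polynomial_function_in_span[OF r(1)]
        cfun.span_scale[OF real_polynomial_function_in_span[OF i(1)], of \<i>]]
    by (simp add: q_def plus_fun_def)
  then have "on_sphere q \<in> cfun.span (\<Union>n. spherical_harmonics n)"
  proof (rule span_on_sphere_image)
    fix g :: "real^'d \<Rightarrow> complex" assume "g \<in> (\<Union>n. homogeneous_polys n)"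
    then obtain n where "g \<in> homogeneous_polys n" by auto
    from on_sphere_homogeneous_polys[OF this]
    show "on_sphere g \<in> cfun.span (\<Union>n. spherical_harmonics n)"
      using cfun.span_mono[of "\<Union>m\<in>{..n}. spherical_harmonics m" "\<Union>n. spherical_harmonics n"] by blast
  qed
  moreover have "cmod (f x - on_sphere q x) < e" if "x \<in> sphere 0 1" for x
  proof -
    have "cmod (f x - on_sphere q x) \<le> \<bar>Re (f x - q x)\<bar> + \<bar>Im (f x - q x)\<bar>"
      using that cmod_le[of "f x - q x"] by (simp add: on_sphere_def)
    also have "\<dots> < e/2 + e/2"
      using r(2)[OF that] i(2)[OF that] by (intro add_strict_mono) (auto simp: q_def)
    finally show ?thesis by simp
  qed
  ultimately show ?thesis by blast
qed

section \<open>Completion of a seminormed space of functions\<close>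

text \<open>The laws are required on \<open>V\<close> only: elsewhere a Sobolev norm is the
  \<open>suminf\<close> of a possibly divergent series.\<close>

locale seminormed_functions =
  fixes V :: "('a \<Rightarrow> complex) set" and p :: "('a \<Rightarrow> complex) \<Rightarrow> real"
  assumes zero_mem: "0 \<in> V"
    and add_mem: "f \<in> V \<Longrightarrow> g \<in> V \<Longrightarrow> f + g \<in> V"
    and scale_mem: "f \<in> V \<Longrightarrow> (\<lambda>x. c * f x) \<in> V"
    and nonneg: "f \<in> V \<Longrightarrow> 0 \<le> p f"
    and triangle: "f \<in> V \<Longrightarrow> g \<in> V \<Longrightarrow> p (f + g) \<le> p f + p g"
    and homogeneous: "f \<in> V \<Longrightarrow> p (\<lambda>x. c * f x) = cmod c * p f"
begin

lemma p_zero: "p 0 = 0"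
  using homogeneous[OF zero_mem, of 0] by (simp add: zero_fun_def)

lemma diff_mem: "f \<in> V \<Longrightarrow> g \<in> V \<Longrightarrow> f - g \<in> V"
  using add_mem[OF _ scale_mem[of g "-1"], of f] by (simp add: fun_eq_iff plus_fun_def fun_diff_def)

lemma p_minus_commute:
  assumes "f \<in> V" "g \<in> V"
  shows "p (f - g) = p (g - f)"
proof -
  have "f - g = (\<lambda>x. - 1 * (g - f) x)" by (auto simp: fun_eq_iff)
  with homogeneous[OF diff_mem[OF assms(2,1)], of "-1"] show ?thesis by simp
qed

lemma p_diff_triangle:
  assumes "f \<in> V" "g \<in> V" "h \<in> V"
  shows "p (f - h) \<le> p (f - g) + p (g - h)"
  using triangle[OF diff_mem[OF assms(1,2)] diff_mem[OF assms(2,3)]] by simp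

abbreviation "C \<equiv> cauchy_seqs V p"
abbreviation "R \<equiv> null_rel V p"

definition cls :: "(nat \<Rightarrow> 'a \<Rightarrow> complex) \<Rightarrow> (nat \<Rightarrow> 'a \<Rightarrow> complex) set" where
  "cls X = R `` {X}"

lemma cauchy_mem: "X \<in> C \<Longrightarrow> X i \<in> V"
  by (simp add: cauchy_seqs_def)

lemma cauchyD: "X \<in> C \<Longrightarrow> e > 0 \<Longrightarrow> \<exists>M. \<forall>i\<ge>M. \<forall>k\<ge>M. p (X i - X k) < e"
  by (simp add: cauchy_seqs_def)

lemma p_diff_diff:
  assumes "f \<in> V" "g \<in> V" "f' \<in> V" "g' \<in> V"
  shows "\<bar>p (f - g) - p (f' - g')\<bar> \<le> p (f - f') + p (g - g')"
  using p_diff_triangle[of f f' g] p_diff_triangle[of f' g' g]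
    p_diff_triangle[of f' f g'] p_diff_triangle[of f g g'] p_minus_commute[of f f']
    p_minus_commute[of g g'] assms by linarith

lemma convergent_dist:
  assumes "X \<in> C" "Z \<in> C"
  shows "convergent (\<lambda>i. p (X i - Z i))"
proof (rule Cauchy_convergent, rule metric_CauchyI)
  fix e :: real assume "e > 0"
  then obtain M N where M: "\<forall>i\<ge>M. \<forall>k\<ge>M. p (X i - X k) < e/2"
    and N: "\<forall>i\<ge>N. \<forall>k\<ge>N. p (Z i - Z k) < e/2"
    using cauchyD[OF assms(1)] cauchyD[OF assms(2)] by (meson half_gt_zero)
  have "dist (p (X m - Z m)) (p (X n - Z n)) < e" if "m \<ge> max M N" "n \<ge> max M N" for m n
    using p_diff_diff[of "X m" "Z m" "X n" "Z n"] cauchy_mem assms M N that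
    by (fastforce simp: dist_real_def)
  then show "\<exists>M. \<forall>m\<ge>M. \<forall>n\<ge>M. dist (p (X m - Z m)) (p (X n - Z n)) < e" by blast
qed

lemma tendsto_dist_trans:
  assumes "X \<in> C" "Y \<in> C" "Z \<in> C" "(\<lambda>i. p (X i - Y i)) \<longlonglongrightarrow> 0" "(\<lambda>i. p (Y i - Z i)) \<longlonglongrightarrow> 0"
  shows "(\<lambda>i. p (X i - Z i)) \<longlonglongrightarrow> 0"
  by (rule tendsto_sandwich[OF _ _ tendsto_const tendsto_add_zero[OF assms(4,5)]])
    (use assms cauchy_mem in \<open>auto intro!: nonneg diff_mem p_diff_triangle always_eventually\<close>)

lemma null_rel_iff:
  assumes "X \<in> C" "Z \<in> C"
  shows "(X, Z) \<in> R \<longleftrightarrow> (\<lambda>i. p (X i - Z i)) \<longlonglongrightarrow> 0"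
  using assms by (simp add: null_rel_def)

lemma equiv_null_rel: "equiv C R"
proof (rule equivI)
  show "R \<subseteq> C \<times> C" by (auto simp: null_rel_def)
  show "refl_on C R" by (auto simp: refl_on_def null_rel_def p_zero)
  show "sym R"
    using p_minus_commute cauchy_mem unfolding sym_def null_rel_def by auto
  show "trans R"
    using tendsto_dist_trans unfolding trans_def null_rel_def by blast
qed

lemma cls_in_completion: "X \<in> C \<Longrightarrow> cls X \<in> fun_completion V p"
  by (simp add: cls_def fun_completion_def quotientI)

lemma completion_cases:
  assumes "A \<in> fun_completion V p"
  obtains X where "X \<in> C" "A = cls X"
  using assms by (auto simp: cls_def fun_completion_def elim: quotientE)

lemma mem_cls: "X \<in> C \<Longrightarrow> X \<in> cls X"
  unfolding cls_def by (rule equiv_class_self[OF equiv_null_rel])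

lemma cls_memD: "Z \<in> cls X \<Longrightarrow> Z \<in> C \<and> cls Z = cls X"
  using equiv_class_eq_iff[OF equiv_null_rel, of X Z] by (auto simp: cls_def)

lemma mem_cls_iff: "X \<in> C \<Longrightarrow> Z \<in> cls X \<longleftrightarrow> Z \<in> C \<and> (\<lambda>i. p (X i - Z i)) \<longlonglongrightarrow> 0"
  by (auto simp: cls_def null_rel_def)

lemma cls_eq_iff: "X \<in> C \<Longrightarrow> Z \<in> C \<Longrightarrow> cls X = cls Z \<longleftrightarrow> (\<lambda>i. p (X i - Z i)) \<longlonglongrightarrow> 0"
  unfolding cls_def by (simp add: eq_equiv_class_iff[OF equiv_null_rel] null_rel_iff)

text \<open>All pairs of representatives have the same limit of distances, so the description by
  \<open>THE\<close> in \<open>cdist\<close> denotes it; later limits are computed with any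
  convenient representatives.\<close>

lemma tendsto_cdist:
  assumes "X \<in> C" "Z \<in> C"
  shows "(\<lambda>i. p (X i - Z i)) \<longlonglongrightarrow> cdist V p (cls X) (cls Z)"
proof -
  obtain r where r: "(\<lambda>i. p (X i - Z i)) \<longlonglongrightarrow> r"
    using convergent_dist[OF assms] by (auto simp: convergent_def)
  have *: "(\<lambda>i. p (X' i - Z' i)) \<longlonglongrightarrow> r" if "X' \<in> cls X" "Z' \<in> cls Z" for X' Z'
  proof -
    have X': "X' \<in> C" "(\<lambda>i. p (X i - X' i)) \<longlonglongrightarrow> 0" and Z': "Z' \<in> C" "(\<lambda>i. p (Z i - Z' i)) \<longlonglongrightarrow> 0"
      using that mem_cls_iff assms by auto
    have "(\<lambda>i. p (X i - Z i) - p (X' i - Z' i)) \<longlonglongrightarrow> 0"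
      by (rule Lim_null_comparison[OF _ tendsto_add_zero[OF X'(2) Z'(2)]])
        (use p_diff_diff cauchy_mem assms X' Z' in auto)
    from tendsto_diff[OF r this] show ?thesis by simp
  qed
  have "cdist V p (cls X) (cls Z) = r"
    unfolding cdist_def using assms
    by (auto simp: cls_in_completion intro!: the_equality * dest!: bspec[OF _ mem_cls]
        intro: LIMSEQ_unique[OF _ r])
  with r show ?thesis by simp
qed

lemma Metric_space_completion: "Metric_space (fun_completion V p) (cdist V p)"
proof
  have nn: "0 \<le> cdist V p (cls X) (cls Z)" if "X \<in> C" "Z \<in> C" for X Z
    by (rule LIMSEQ_le_const[OF tendsto_cdist[OF that]])
      (use that in \<open>auto intro!: exI[of _ 0] nonneg diff_mem cauchy_mem[of X] cauchy_mem[of Z]\<close>)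
  show "0 \<le> cdist V p A B" for A B
    by (cases "A \<in> fun_completion V p \<and> B \<in> fun_completion V p")
      (auto elim!: completion_cases simp: nn, auto simp: cdist_def)
  have "cdist V p (cls X) (cls Z) = cdist V p (cls Z) (cls X)" if "X \<in> C" "Z \<in> C" for X Z
  proof -
    have "p (X i - Z i) = p (Z i - X i)" for i using that cauchy_mem p_minus_commute by auto
    then show ?thesis
      using LIMSEQ_unique tendsto_cdist[OF that] tendsto_cdist[OF that(2,1)] by auto
  qed
  then show "cdist V p A B = cdist V p B A" for A B
    by (cases "A \<in> fun_completion V p \<and> B \<in> fun_completion V p")
      (auto elim!: completion_cases, auto simp: cdist_def)
  fix A B assume AB: "A \<in> fun_completion V p" "B \<in> fun_completion V p"
  then obtain X Z where XZ: "X \<in> C" "Z \<in> C" "A = cls X" "B = cls Z" by (metis completion_cases)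
  show "cdist V p A B = 0 \<longleftrightarrow> A = B"
    using tendsto_cdist[OF XZ(1,2)] LIMSEQ_unique unfolding XZ cls_eq_iff[OF XZ(1,2)] by metis
  fix D assume "D \<in> fun_completion V p"
  then obtain W where W: "W \<in> C" "D = cls W" by (metis completion_cases)
  show "cdist V p A D \<le> cdist V p A B + cdist V p B D"
    unfolding XZ W
    by (rule LIMSEQ_le[OF tendsto_cdist tendsto_add[OF tendsto_cdist tendsto_cdist]])
      (use XZ W cauchy_mem p_diff_triangle in auto)
qed

sublocale M: Metric_space "fun_completion V p" "cdist V p"
  by (rule Metric_space_completion)

lemma ctopology_eq: "ctopology V p = M.mtopology"
  by (simp add: ctopology_def)

lemma const_cauchy: "f \<in> V \<Longrightarrow> (\<lambda>_. f) \<in> C"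
  by (simp add: cauchy_seqs_def p_zero)

lemma cembed_eq: "cembed V p f = cls (\<lambda>_. f)"
  by (simp add: cembed_def cls_def)

lemma cembed_in: "f \<in> V \<Longrightarrow> cembed V p f \<in> fun_completion V p"
  by (simp add: cembed_eq cls_in_completion const_cauchy)

lemma cauchy_add:
  assumes "X \<in> C" "Z \<in> C"
  shows "(\<lambda>i. X i + Z i) \<in> C"
  unfolding cauchy_seqs_def
proof (intro CollectI conjI allI impI)
  show "X i + Z i \<in> V" for i using assms by (auto intro: add_mem cauchy_mem)
  fix e :: real assume "e > 0"
  then obtain M N where M: "\<forall>i\<ge>M. \<forall>k\<ge>M. p (X i - X k) < e/2"
    and N: "\<forall>i\<ge>N. \<forall>k\<ge>N. p (Z i - Z k) < e/2"
    using cauchyD[OF assms(1)] cauchyD[OF assms(2)] by (meson half_gt_zero)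
  have "p (X i + Z i - (X k + Z k)) < e" if "i \<ge> max M N" "k \<ge> max M N" for i k
  proof -
    have "p (X i + Z i - (X k + Z k)) = p ((X i - X k) + (Z i - Z k))"
      by (simp add: algebra_simps)
    also have "\<dots> \<le> p (X i - X k) + p (Z i - Z k)"
      using assms by (intro triangle diff_mem cauchy_mem)
    also have "\<dots> < e/2 + e/2" using M N that by (intro add_strict_mono) auto
    finally show ?thesis by simp
  qed
  then show "\<exists>M. \<forall>i\<ge>M. \<forall>k\<ge>M. p (X i + Z i - (X k + Z k)) < e" by blast
qed

lemma cauchy_bounded_image:
  assumes "X \<in> C" "\<And>f. f \<in> V \<Longrightarrow> S f \<in> V"
    and "\<And>f g. f \<in> V \<Longrightarrow> g \<in> V \<Longrightarrow> q (S f - S g) \<le> B * p (f - g)" "B \<ge> 0"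
  shows "(\<lambda>i. S (X i)) \<in> cauchy_seqs V q"
  unfolding cauchy_seqs_def
proof (intro CollectI conjI allI impI)
  show "S (X i) \<in> V" for i using assms by (auto intro: cauchy_mem)
  fix e :: real assume "e > 0"
  then obtain M where M: "\<forall>i\<ge>M. \<forall>k\<ge>M. p (X i - X k) < e/(B + 1)"
    using cauchyD[OF assms(1), of "e/(B + 1)"] assms(4) by (auto simp: add_nonneg_pos)
  have "q (S (X i) - S (X k)) < e" if "i \<ge> M" "k \<ge> M" for i k
  proof -
    have "q (S (X i) - S (X k)) \<le> B * p (X i - X k)"
      using assms by (auto intro: cauchy_mem)
    also have "\<dots> \<le> B * (e/(B + 1))"
      using M that assms(4) by (intro mult_left_mono) (auto simp: less_imp_le)
    also have "\<dots> < e" using \<open>e > 0\<close> assms(4) by (simp add: divide_less_eq field_simps)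
    finally show ?thesis .
  qed
  then show "\<exists>M. \<forall>i\<ge>M. \<forall>k\<ge>M. q (S (X i) - S (X k)) < e" by blast
qed

lemma p_scale_diff:
  assumes "f \<in> V" "g \<in> V"
  shows "p ((\<lambda>x. c * f x) - (\<lambda>x. c * g x)) = cmod c * p (f - g)"
proof -
  have "(\<lambda>x. c * f x) - (\<lambda>x. c * g x) = (\<lambda>x. (c::complex) * (f - g) x)"
    by (auto simp: fun_eq_iff algebra_simps)
  then show ?thesis using homogeneous[OF diff_mem[OF assms], of c] by simp
qed

lemma cauchy_scale:
  assumes "X \<in> C"
  shows "(\<lambda>i x. c * X i x) \<in> C"
  by (rule cauchy_bounded_image[OF assms, of "\<lambda>f x. c * f x" p "cmod c"])
    (auto simp: scale_mem p_scale_diff)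

lemma cadd_cls:
  assumes "X \<in> C" "Z \<in> C"
  shows "cadd V p (cls X) (cls Z) = cls (\<lambda>i. X i + Z i)"
proof -
  have "cls (\<lambda>i. X' i + Z' i) = cls (\<lambda>i. X i + Z i)" if "X' \<in> cls X" "Z' \<in> cls Z" for X' Z'
  proof -
    have X': "X' \<in> C" "(\<lambda>i. p (X i - X' i)) \<longlonglongrightarrow> 0" and Z': "Z' \<in> C" "(\<lambda>i. p (Z i - Z' i)) \<longlonglongrightarrow> 0"
      using that mem_cls_iff assms by auto
    have "p (X i + Z i - (X' i + Z' i)) \<le> p (X i - X' i) + p (Z i - Z' i)" for i
      using triangle[of "X i - X' i" "Z i - Z' i"] assms X' Z' diff_mem cauchy_mem
      by (simp add: algebra_simps)
    then have "(\<lambda>i. p (X i + Z i - (X' i + Z' i))) \<longlonglongrightarrow> 0"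
      using assms X' Z'
      by (intro tendsto_sandwich[OF _ _ tendsto_const tendsto_add_zero[OF X'(2) Z'(2)]])
        (auto intro!: always_eventually nonneg diff_mem add_mem cauchy_mem[of X] cauchy_mem[of X']
          cauchy_mem[of Z] cauchy_mem[of Z'])
    then show ?thesis
      using cls_eq_iff[OF cauchy_add[OF assms] cauchy_add[OF X'(1) Z'(1)]] by simp
  qed
  then have "cadd V p (cls X) (cls Z) = (\<Union>X'\<in>cls X. \<Union>Z'\<in>cls Z. cls (\<lambda>i. X i + Z i))"
    unfolding cadd_def cls_def[symmetric] by simp
  then show ?thesis using mem_cls assms by auto
qed

lemma cscale_cls:
  assumes "X \<in> C"
  shows "cscale V p c (cls X) = cls (\<lambda>i x. c * X i x)"
proof -
  have "cls (\<lambda>i x. c * X' i x) = cls (\<lambda>i x. c * X i x)" if "X' \<in> cls X" for X'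
  proof -
    have X': "X' \<in> C" "(\<lambda>i. p (X' i - X i)) \<longlonglongrightarrow> 0"
      using that mem_cls_iff assms p_minus_commute cauchy_mem by auto
    have "(\<lambda>i. p ((\<lambda>x. c * X' i x) - (\<lambda>x. c * X i x))) = (\<lambda>i. cmod c * p (X' i - X i))"
      using assms X' by (auto simp: p_scale_diff cauchy_mem)
    then show ?thesis
      using tendsto_mult_right_zero[OF X'(2), of "cmod c"] assms X'
      by (simp add: cls_eq_iff cauchy_scale)
  qed
  then have "cscale V p c (cls X) = (\<Union>X'\<in>cls X. cls (\<lambda>i x. c * X i x))"
    unfolding cscale_def cls_def[symmetric] by simp
  then show ?thesis using mem_cls assms by auto
qed

lemma cdist_cembed_less:
  assumes "X \<in> C" "e > 0"
  shows "\<exists>M. \<forall>i\<ge>M. cdist V p (cls X) (cembed V p (X i)) < e"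
proof -
  obtain M where M: "\<forall>i\<ge>M. \<forall>k\<ge>M. p (X i - X k) < e/2"
    using cauchyD[OF assms(1), of "e/2"] assms(2) by auto
  have "cdist V p (cls X) (cembed V p (X i)) \<le> e/2" if "i \<ge> M" for i
    unfolding cembed_eq
    by (rule LIMSEQ_le_const2[OF tendsto_cdist[OF assms(1) const_cauchy]])
      (use assms(1) cauchy_mem M that in \<open>auto intro!: exI[of _ M] less_imp_le\<close>)
  then show ?thesis using assms(2) by force
qed

end

locale bounded_operator =
  V: seminormed_functions V p + W: seminormed_functions V q
  for V :: "('a \<Rightarrow> complex) set" and p q +
  fixes S :: "('a \<Rightarrow> complex) \<Rightarrow> 'a \<Rightarrow> complex" and B :: real
  assumes S_mem: "f \<in> V \<Longrightarrow> S f \<in> V"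
    and S_add: "f \<in> V \<Longrightarrow> g \<in> V \<Longrightarrow> S (f + g) = S f + S g"
    and S_scale: "f \<in> V \<Longrightarrow> S (\<lambda>x. c * f x) = (\<lambda>x. c * S f x)"
    and S_bounded: "f \<in> V \<Longrightarrow> q (S f) \<le> B * p f"
    and B_nonneg: "B \<ge> 0"
begin

lemma S_diff: "f \<in> V \<Longrightarrow> g \<in> V \<Longrightarrow> S (f - g) = S f - S g"
  using S_add[of f "\<lambda>x. -1 * g x"] S_scale[of g "-1"] V.scale_mem[of g "-1"]
  by (simp add: fun_eq_iff plus_fun_def fun_diff_def)

lemma S_cauchy: "X \<in> V.C \<Longrightarrow> (\<lambda>i. S (X i)) \<in> W.C"
  by (rule V.cauchy_bounded_image[where B = B])
    (auto simp: S_mem B_nonneg S_diff[symmetric] intro!: S_bounded V.diff_mem)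

lemma S_cls_cong:
  assumes "X \<in> V.C" "X' \<in> V.cls X"
  shows "W.cls (\<lambda>i. S (X' i)) = W.cls (\<lambda>i. S (X i))"
proof -
  have X': "X' \<in> V.C" "(\<lambda>i. p (X i - X' i)) \<longlonglongrightarrow> 0"
    using assms V.mem_cls_iff by auto
  have "(\<lambda>i. q (S (X i) - S (X' i))) \<longlonglongrightarrow> 0"
    by (rule tendsto_sandwich[OF _ _ tendsto_const tendsto_mult_right_zero[OF X'(2), of B]])
      (use assms X' V.cauchy_mem in \<open>auto intro!: always_eventually W.nonneg W.diff_mem S_mem
        simp: S_diff[symmetric] intro!: S_bounded V.diff_mem\<close>)
  then show ?thesis using W.cls_eq_iff S_cauchy assms X' by metis
qed

text \<open>By \<open>S_cls_cong\<close> the union runs over copies of one class, which avoids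
  choosing a representative. The value \<open>undefined\<close> matches the extensional function
  space of \<open>continuous_extension\<close>, on which uniqueness depends.\<close>

definition extension where
  "extension A = (if A \<in> fun_completion V p then \<Union>X\<in>A. W.cls (\<lambda>i. S (X i)) else undefined)"

lemma extension_cls:
  assumes "X \<in> V.C"
  shows "extension (V.cls X) = W.cls (\<lambda>i. S (X i))"
proof -
  have "extension (V.cls X) = (\<Union>X'\<in>V.cls X. W.cls (\<lambda>i. S (X i)))"
    using S_cls_cong[OF assms] V.cls_in_completion[OF assms] by (simp add: extension_def)
  then show ?thesis using V.mem_cls[OF assms] by auto
qed

lemma extension_dist:
  assumes "A \<in> fun_completion V p" "A' \<in> fun_completion V p"
  shows "cdist V q (extension A) (extension A') \<le> B * cdist V p A A'"
proof -
  obtain X X' where X: "X \<in> V.C" "A = V.cls X" "X' \<in> V.C" "A' = V.cls X'"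
    using assms by (metis V.completion_cases)
  show ?thesis
    unfolding X extension_cls[OF X(1)] extension_cls[OF X(3)]
    by (rule LIMSEQ_le[OF W.tendsto_cdist tendsto_mult_left[OF V.tendsto_cdist]])
      (use X S_cauchy V.cauchy_mem S_bounded V.diff_mem in \<open>auto simp: S_diff[symmetric]\<close>)
qed

lemma continuous_extension_extension: "continuous_extension V p q S extension"
  unfolding continuous_extension_def
proof (intro conjI ballI allI)
  have im: "extension A \<in> fun_completion V q" if "A \<in> fun_completion V p" for A
    using that by (auto elim!: V.completion_cases simp: extension_cls W.cls_in_completion S_cauchy)
  then show "extension \<in> fun_completion V p \<rightarrow>\<^sub>E fun_completion V q"
    by (auto simp: extension_def)
  show "continuous_map (ctopology V p) (ctopology V q) extension"
    unfolding V.ctopology_eq W.ctopology_eq V.M.metric_continuous_map[OF W.Metric_space_completion]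
  proof (intro conjI ballI allI impI)
    fix A and e :: real assume A: "A \<in> fun_completion V p" "e > 0"
    have "cdist V q (extension A) (extension A') < e"
      if "A' \<in> fun_completion V p" "cdist V p A A' < e/(B + 1)" for A'
    proof -
      have "cdist V q (extension A) (extension A') \<le> B * cdist V p A A'"
        by (rule extension_dist[OF A(1) that(1)])
      also have "\<dots> \<le> B * (e/(B + 1))" using that(2) B_nonneg by (intro mult_left_mono) auto
      also have "\<dots> < e" using \<open>e > 0\<close> B_nonneg by (simp add: divide_less_eq field_simps)
      finally show ?thesis .
    qed
    then show "\<exists>d>0. \<forall>x. x \<in> fun_completion V p \<and> cdist V p A x < d \<longrightarrow>
        cdist V q (extension A) (extension x) < e"
      using A(2) B_nonneg by (intro exI[of _ "e/(B + 1)"]) auto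
  qed (use im in auto)
  fix A A' assume "A \<in> fun_completion V p" "A' \<in> fun_completion V p"
  then obtain X X' where X: "X \<in> V.C" "A = V.cls X" "X' \<in> V.C" "A' = V.cls X'"
    by (metis V.completion_cases)
  then show "extension (cadd V p A A') = cadd V q (extension A) (extension A')"
    by (simp add: V.cadd_cls extension_cls V.cauchy_add W.cadd_cls S_cauchy S_add V.cauchy_mem)
next
  fix c A assume "A \<in> fun_completion V p"
  then obtain X where X: "X \<in> V.C" "A = V.cls X"
    by (metis V.completion_cases)
  then show "extension (cscale V p c A) = cscale V q c (extension A)"
    by (simp add: V.cscale_cls extension_cls V.cauchy_scale W.cscale_cls S_cauchy S_scale V.cauchy_mem)
next
  fix f assume "f \<in> V"
  then show "S f \<in> V" "extension (cembed V p f) = cembed V q (S f)"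
    by (simp_all add: S_mem V.cembed_eq W.cembed_eq extension_cls V.const_cauchy)
qed

text \<open>Both sides are limits of the embedded functions \<open>S (X i)\<close>: the left one by
  continuity of \<open>T\<close> along the constant sequences of \<open>X i\<close>, the right one
  by construction.\<close>

lemma continuous_extension_cls:
  assumes T: "continuous_extension V p q S T" and X: "X \<in> V.C"
  shows "T (V.cls X) = W.cls (\<lambda>i. S (X i))"
proof (rule ccontr)
  let ?A = "V.cls X"
  assume ne: "T ?A \<noteq> W.cls (\<lambda>i. S (X i))"
  have A: "?A \<in> fun_completion V p" using X by (rule V.cls_in_completion)
  have TA: "T ?A \<in> fun_completion V q" using T A by (auto simp: continuous_extension_def)
  have EA: "W.cls (\<lambda>i. S (X i)) \<in> fun_completion V q" using X by (simp add: W.cls_in_completion S_cauchy)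
  \<comment> \<open>Half of the distance: a common approximant closer than this to both points
    contradicts the triangle inequality.\<close>
  define e where "e = cdist V q (T ?A) (W.cls (\<lambda>i. S (X i))) / 2"
  have e: "e > 0" using ne TA EA W.M.zero W.M.nonneg[of "T ?A" "W.cls (\<lambda>i. S (X i))"]
    unfolding e_def by (auto simp: less_le)
  have "continuous_map V.M.mtopology W.M.mtopology T"
    using T by (simp add: continuous_extension_def V.ctopology_eq W.ctopology_eq)
  from iffD1[OF V.M.metric_continuous_map[OF W.Metric_space_completion] this, THEN conjunct2,
      rule_format, OF A e]
  obtain d where d: "d > 0" "\<And>x. x \<in> fun_completion V p \<Longrightarrow> cdist V p ?A x < d \<Longrightarrow>
      cdist V q (T ?A) (T x) < e" by blast
  obtain M where M: "\<forall>i\<ge>M. cdist V p ?A (cembed V p (X i)) < d"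
    using V.cdist_cembed_less[OF X d(1)] by blast
  obtain N where N: "\<forall>i\<ge>N. cdist V q (W.cls (\<lambda>i. S (X i))) (cembed V q (S (X i))) < e"
    using W.cdist_cembed_less[OF S_cauchy[OF X] e] by blast
  let ?i = "max M N"
  have Xi: "X ?i \<in> V" using X by (rule V.cauchy_mem)
  have "cdist V q (T ?A) (cembed V q (S (X ?i))) < e"
    using d(2)[OF V.cembed_in[OF Xi]] M T Xi by (simp add: continuous_extension_def)
  moreover have "cdist V q (cembed V q (S (X ?i))) (W.cls (\<lambda>i. S (X i))) < e"
    using N[rule_format, of ?i]
      W.M.commute[of "cembed V q (S (X ?i))" "W.cls (\<lambda>i. S (X i))"] by simp
  ultimately show False
    using W.M.triangle[OF TA W.cembed_in[OF S_mem[OF Xi]] EA] by (simp add: e_def)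
qed

lemma ex1_continuous_extension: "\<exists>!T. continuous_extension V p q S T"
proof (rule ex1I)
  show "continuous_extension V p q S extension" by (rule continuous_extension_extension)
  fix T assume T: "continuous_extension V p q S T"
  show "T = extension"
  proof
    fix A show "T A = extension A"
    proof (cases "A \<in> fun_completion V p")
      case True
      then show ?thesis
        by (auto elim!: V.completion_cases simp: extension_cls continuous_extension_cls[OF T])
    next
      case False
      then show ?thesis
        using T continuous_extension_extension
        by (metis (no_types, lifting) PiE_arb continuous_extension_def)
    qed
  qed
qed

end

section \<open>Smooth functions on the sphere and rotation generators\<close>

lemma Ck_sgn:
  assumes "open U" "0 \<notin> U"
  shows "Ck k (sgn :: 'a::euclidean_space \<Rightarrow> 'a) U"
proof (rule Ck_cong[OF assms(1)])
  show "Ck k (\<lambda>x::'a. (x \<bullet> x) powr (- 1/2) *\<^sub>R x) U"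
    using assms by (intro Ck_scaleR Ck_powr Ck_inner Ck_linear bounded_linear_ident) auto
  fix x :: 'a assume "x \<in> U"
  then have "x \<noteq> 0" using assms by auto
  then show "(x \<bullet> x) powr (- 1/2) *\<^sub>R x = sgn x"
    by (simp add: sgn_div_norm powr_minus norm_eq_sqrt_inner powr_half_sqrt)
qed

text \<open>The extension that is constant along rays is smooth off the origin whenever any smooth
  extension exists. This canonical choice replaces the existential quantifier over \<open>U\<close>
  and \<open>F\<close>.\<close>

lemma smooth_sphere_iff:
  fixes f :: "real^'d::finite \<Rightarrow> complex"
  shows "f \<in> smooth_sphere \<longleftrightarrow> (\<forall>k. Ck k (\<lambda>x. f (sgn x)) (- {0})) \<and> f = on_sphere f"
proof
  assume "f \<in> smooth_sphere"
  then obtain U F where U: "open U" "sphere 0 1 \<subseteq> U" "\<And>k. Ck k F U" "f = on_sphere F"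
    by (auto simp: smooth_sphere_def Ck_on_eq_Ck)
  have s: "sgn x \<in> sphere 0 1" if "x \<noteq> 0" for x :: "real^'d" using that by (simp add: norm_sgn)
  have "sgn ` (- {0}) \<subseteq> U" using subsetD[OF U(2) s] by blast
  then have "Ck k (\<lambda>x. F (sgn x)) (- {0})" for k
    by (intro Ck_compose[OF _ U(3) Ck_sgn]) auto
  then have "Ck k (\<lambda>x. f (sgn x)) (- {0})" for k
    by (rule Ck_cong[rotated 2]) (auto simp: U(4) on_sphere_def norm_sgn)
  then show "(\<forall>k. Ck k (\<lambda>x. f (sgn x)) (- {0})) \<and> f = on_sphere f"
    by (auto simp: U(4) on_sphere_def)
next
  assume f: "(\<forall>k. Ck k (\<lambda>x. f (sgn x)) (- {0})) \<and> f = on_sphere f"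
  have "on_sphere f = on_sphere (\<lambda>x. f (sgn x))"
    by (auto simp: on_sphere_def sgn_div_norm)
  with f show "f \<in> smooth_sphere"
    unfolding smooth_sphere_def Ck_on_eq_Ck
    by (intro CollectI exI[of _ "- {0}"] exI[of _ "\<lambda>x. f (sgn x)"]) auto
qed

lemma smooth_sphere_Ck: "f \<in> smooth_sphere \<Longrightarrow> Ck k (\<lambda>x. f (sgn x)) (- {0})"
  by (simp add: smooth_sphere_iff)

lemma smooth_sphere_outside: "f \<in> smooth_sphere \<Longrightarrow> x \<notin> sphere 0 1 \<Longrightarrow> f x = 0"
  unfolding smooth_sphere_iff on_sphere_def by metis

lemma smooth_sphere_on_sphere:
  fixes F :: "real^'d::finite \<Rightarrow> complex"
  assumes "\<And>k. Ck k F (- {0})"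
  shows "on_sphere F \<in> smooth_sphere"
  unfolding smooth_sphere_def Ck_on_eq_Ck
  using assms by (intro CollectI exI[of _ "- {0}"] exI[of _ F]) auto

lemma smooth_sphere_zero: "(0 :: real^'d::finite \<Rightarrow> complex) \<in> smooth_sphere"
  using smooth_sphere_on_sphere[of "\<lambda>x::real^'d. 0", OF Ck_const[OF open_Compl[OF closed_singleton]]]
  by (simp add: on_sphere_zero)

lemma smooth_sphere_add:
  "f \<in> smooth_sphere \<Longrightarrow> g \<in> smooth_sphere \<Longrightarrow> (f + g :: real^'d::finite \<Rightarrow> complex) \<in> smooth_sphere"
  by (auto simp: smooth_sphere_iff on_sphere_def fun_eq_iff intro!: Ck_add; metis add_0)

lemma smooth_sphere_scale:
  "f \<in> smooth_sphere \<Longrightarrow> (\<lambda>x. c * f x :: complex) \<in> smooth_sphere"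
  by (auto simp: smooth_sphere_iff on_sphere_def fun_eq_iff intro!: Ck_mult Ck_const; metis mult_zero_right)

lemma smooth_sphere_reflect:
  fixes f :: "real^'d::finite \<Rightarrow> complex"
  assumes "f \<in> smooth_sphere"
  shows "(\<lambda>x. f (- x)) \<in> smooth_sphere"
  unfolding smooth_sphere_iff
proof (intro conjI allI)
  fix k
  have "Ck k (\<lambda>x. f (sgn (- x))) (- {0})"
    by (rule Ck_compose[OF _ smooth_sphere_Ck[OF assms, of k], of _ uminus])
      (auto intro!: Ck_linear bounded_linear_minus[OF bounded_linear_ident])
  then show "Ck k (\<lambda>x. f (- sgn x)) (- {0})" by (simp add: sgn_minus)
  show "(\<lambda>x. f (- x)) = on_sphere (\<lambda>x. f (- x))"
    using smooth_sphere_outside[OF assms] by (auto simp: on_sphere_def fun_eq_iff)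
qed

lemma continuous_on_smooth_sphere:
  assumes "f \<in> smooth_sphere"
  shows "continuous_on (sphere 0 1) f"
proof -
  have "continuous_on (sphere 0 1) (\<lambda>x. f (sgn x))"
    using smooth_sphere_Ck[OF assms, of 0] by (auto intro: continuous_on_subset)
  then show ?thesis by (rule continuous_on_eq) (auto simp: sgn_div_norm)
qed

lemma borel_measurable_on_sphere:
  fixes f :: "real^'d::finite \<Rightarrow> complex"
  assumes "continuous_on (sphere 0 1) f"
  shows "on_sphere f \<in> borel_measurable borel"
proof -
  have "(\<lambda>x. indicator (sphere 0 1) x *\<^sub>R f x) \<in> borel_measurable borel"
    using assms by (intro borel_measurable_continuous_on_indicator) auto
  also have "(\<lambda>x. indicator (sphere 0 1) x *\<^sub>R f x) = on_sphere f"
    by (auto simp: on_sphere_def)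
  finally show ?thesis .
qed

lemma borel_measurable_smooth_sphere:
  "f \<in> smooth_sphere \<Longrightarrow> f \<in> borel_measurable borel"
  using borel_measurable_on_sphere[OF continuous_on_smooth_sphere[of f]]
  by (simp add: smooth_sphere_iff)

lemma Ck_homogeneous_poly:
  assumes "f \<in> homogeneous_polys n" "open U"
  shows "Ck k f U"
  using assms(1)
proof (induction k arbitrary: f n)
  case 0
  then show ?case
    by (auto intro!: continuous_at_imp_continuous_on differentiable_imp_continuous_within
        homogeneous_polys_differentiable)
next
  case (Suc k)
  then show ?case by (auto intro: homogeneous_polys_differentiable homogeneous_polys_dirderiv)
qed

lemma on_sphere_poly_smooth: "f \<in> homogeneous_polys n \<Longrightarrow> on_sphere f \<in> smooth_sphere"
  by (rule smooth_sphere_on_sphere) (auto intro: Ck_homogeneous_poly)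

lemma spherical_harmonics_smooth: "Y \<in> spherical_harmonics n \<Longrightarrow> Y \<in> smooth_sphere"
  by (auto simp: spherical_harmonics_def on_sphere_poly_smooth)

lemma span_smooth_sphere: "A \<subseteq> smooth_sphere \<Longrightarrow> cfun.span A \<subseteq> smooth_sphere"
  by (rule cfun.span_minimal)
    (auto simp: cfun.subspace_def smooth_sphere_zero smooth_sphere_add smooth_sphere_scale)

subsection \<open>Rotations in a coordinate plane\<close>

text \<open>For orthonormal \<open>u\<close> and \<open>v\<close> this rotates their plane by the
  angle \<theta>, from \<open>u\<close> towards \<open>v\<close>, and fixes the orthogonal
  complement. The explicit formula makes smoothness in \<theta> and \<open>x\<close> together
  evident.\<close>

definition rot :: "'a::euclidean_space \<Rightarrow> 'a \<Rightarrow> real \<Rightarrow> 'a \<Rightarrow> 'a" where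
  "rot u v \<theta> x = x + (cos \<theta> - 1) *\<^sub>R ((u \<bullet> x) *\<^sub>R u + (v \<bullet> x) *\<^sub>R v) +
     sin \<theta> *\<^sub>R ((u \<bullet> x) *\<^sub>R v - (v \<bullet> x) *\<^sub>R u)"

lemma orthogonal_transformation_rot:
  fixes u v :: "'a::euclidean_space"
  assumes "norm u = 1" "norm v = 1" "u \<bullet> v = 0"
  shows "orthogonal_transformation (rot u v \<theta>)"
  unfolding orthogonal_transformation
proof (intro conjI allI)
  show "linear (rot u v \<theta>)"
    by (rule linearI) (simp_all add: rot_def algebra_simps inner_add_right)
  fix x
  have uv: "u \<bullet> u = 1" "v \<bullet> v = 1" "u \<bullet> v = 0" "v \<bullet> u = 0"
    using assms by (simp_all add: dot_square_norm inner_commute)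
  define c where "c = cos \<theta> - 1"
  define s where "s = sin \<theta>"
  let ?y = "c *\<^sub>R ((u \<bullet> x) *\<^sub>R u + (v \<bullet> x) *\<^sub>R v) + s *\<^sub>R ((u \<bullet> x) *\<^sub>R v - (v \<bullet> x) *\<^sub>R u)"
  have xy: "x \<bullet> ?y = c * ((u \<bullet> x)\<^sup>2 + (v \<bullet> x)\<^sup>2)"
    by (simp add: inner_add_right inner_diff_right inner_commute[of x] power2_eq_square algebra_simps)
  have yy: "?y \<bullet> ?y = (c\<^sup>2 + s\<^sup>2) * ((u \<bullet> x)\<^sup>2 + (v \<bullet> x)\<^sup>2)"
    by (simp add: inner_add_right inner_diff_right inner_add_left inner_diff_left uv power2_eq_square algebra_simps)
  have "rot u v \<theta> x \<bullet> rot u v \<theta> x = (x + ?y) \<bullet> (x + ?y)"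
    by (simp add: rot_def add.assoc c_def s_def)
  also have "\<dots> = x \<bullet> x + 2 * (x \<bullet> ?y) + ?y \<bullet> ?y"
  proof -
    have "(x + y) \<bullet> (x + y) = x \<bullet> x + 2 * (x \<bullet> y) + y \<bullet> y" for y
      by (simp add: inner_add_left inner_add_right inner_commute)
    then show ?thesis .
  qed
  also have "\<dots> = x \<bullet> x + (2 * c + c\<^sup>2 + s\<^sup>2) * ((u \<bullet> x)\<^sup>2 + (v \<bullet> x)\<^sup>2)"
    unfolding xy yy by (simp add: algebra_simps)
  also have "2 * c + c\<^sup>2 + s\<^sup>2 = 0"
    using sin_cos_squared_add[of \<theta>] by (simp add: c_def s_def power2_eq_square algebra_simps)
  finally show "norm (rot u v \<theta> x) = norm x" by (simp add: norm_eq_sqrt_inner)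
qed

lemma Ck_sin_cos: "Ck k sin (UNIV :: real set) \<and> Ck k cos (UNIV :: real set)"
proof (induction k)
  case 0
  show ?case by (auto intro: continuous_on_sin continuous_on_cos continuous_on_id)
next
  case (Suc k)
  have "Ck (Suc k) sin (UNIV :: real set)"
    by (rule CkI[OF open_UNIV DERIV_sin[unfolded has_field_derivative_def]])
      (use Suc in \<open>auto intro!: Ck_mult Ck_const\<close>)
  moreover have "Ck (Suc k) cos (UNIV :: real set)"
    by (rule CkI[OF open_UNIV DERIV_cos[unfolded has_field_derivative_def]])
      (intro Ck_mult Ck_const Ck_uminus open_UNIV conjunct1[OF Suc])
  ultimately show ?case by blast
qed

lemma Ck_rot: "Ck k (\<lambda>(\<theta>, x). rot u v \<theta> x) (UNIV :: (real \<times> 'a::euclidean_space) set)"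
proof -
  have f: "Ck k (\<lambda>z. fst z) (UNIV :: (real \<times> 'a) set)" "Ck k (\<lambda>z. snd z) (UNIV :: (real \<times> 'a) set)"
    by (auto intro: Ck_linear bounded_linear_fst bounded_linear_snd)
  have sc: "Ck k (\<lambda>z. sin (fst z)) (UNIV :: (real \<times> 'a) set)" "Ck k (\<lambda>z. cos (fst z)) (UNIV :: (real \<times> 'a) set)"
    using Ck_sin_cos[of k] by (auto intro: Ck_compose[OF _ _ f(1)])
  show ?thesis
    unfolding rot_def split_beta'
    by (intro Ck_add Ck_diff Ck_scaleR Ck_inner Ck_const f sc) auto
qed

abbreviation sphere_integral :: "'a::euclidean_space measure \<Rightarrow> ('a \<Rightarrow> complex) \<Rightarrow> complex" where
  "sphere_integral M g \<equiv> (\<integral>x. indicator (sphere 0 1) x *\<^sub>R g x \<partial>M)"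

definition rot_deriv :: "'a::euclidean_space \<Rightarrow> 'a \<Rightarrow> ('a \<Rightarrow> complex) \<Rightarrow> 'a \<Rightarrow> complex" where
  "rot_deriv u v F x = complex_of_real (u \<bullet> x) * dirderiv v F x - complex_of_real (v \<bullet> x) * dirderiv u F x"

lemma rot_deriv_eq:
  assumes "F differentiable (at x)"
  shows "frechet_derivative F (at x) ((u \<bullet> x) *\<^sub>R v - (v \<bullet> x) *\<^sub>R u) = rot_deriv u v F x"
proof -
  interpret linear "frechet_derivative F (at x)" using assms by (rule linear_frechet_derivative)
  show ?thesis by (simp add: rot_deriv_def diff scaleR scaleR_conv_of_real)
qed

lemma Ck_rot_deriv:
  assumes "Ck (Suc k) F U" "open U"
  shows "Ck k (rot_deriv u v F) U"
proof -
  have "Ck k (\<lambda>x. complex_of_real (w \<bullet> x)) U" for w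
    by (intro Ck_linear assms bounded_linear_of_real[THEN bounded_linear_compose] bounded_linear_inner_right)
  then have "Ck k (\<lambda>x. rot_deriv u v F x) U"
    unfolding rot_deriv_def using assms by (intro Ck_diff Ck_mult) auto
  then show ?thesis by simp
qed

text \<open>By invariance the integral of the rotated function is constant in the angle;
  differentiating under the integral at angle 0 produces the generator \<open>rot_deriv\<close>.
  This is the source of every integration by parts, both on the sphere and on a parallel.\<close>

lemma sphere_integral_rot_deriv:
  fixes F :: "'a::euclidean_space \<Rightarrow> complex"
  assumes M: "finite_measure M" "sets M = sets borel"
    and inv: "\<And>\<theta>. distr M borel (rot u v \<theta>) = M"
    and uv: "norm u = 1" "norm v = 1" "u \<bullet> v = 0"
    and F: "Ck (Suc 0) F (- {0})"
  shows "sphere_integral M (rot_deriv u v F) = 0"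
proof -
  interpret finite_measure M by fact
  let ?f = "\<lambda>z. F (case z of (\<theta>, x) \<Rightarrow> rot u v \<theta> x)"
  note ort = orthogonal_transformation_rot[OF uv]
  have n: "norm (rot u v \<theta> x) = norm x" for \<theta> x using ort[of \<theta>] by (simp add: orthogonal_transformation)
  have sub: "(\<lambda>(\<theta>, x). rot u v \<theta> x) ` (UNIV \<times> - {0}) \<subseteq> - {0}"
  proof -
    have "x = 0" if "rot u v \<theta> x = 0" for \<theta> x using n[of \<theta> x] that by simp
    then show ?thesis by auto
  qed
  have f: "Ck (Suc 0) ?f (UNIV \<times> (- {0}))"
  proof -
    have o: "open ((UNIV :: real set) \<times> (- {0 :: 'a}))" by (auto intro: open_Times)
    have r: "Ck (Suc 0) (\<lambda>(\<theta>, x). rot u v \<theta> x) ((UNIV :: real set) \<times> (- {0}))"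
      by (rule Ck_subset[OF Ck_rot]) simp
    have "Ck (Suc 0) (\<lambda>z. F ((\<lambda>(\<theta>, x). rot u v \<theta> x) z)) ((UNIV :: real set) \<times> (- {0}))"
      by (rule Ck_compose[OF o F r sub])
    then show ?thesis by simp
  qed
  have const: "sphere_integral M (\<lambda>x. ?f (\<theta>, x)) = sphere_integral M F" for \<theta>
  proof -
    have mF: "(\<lambda>x. indicator (sphere 0 1) x *\<^sub>R F x) \<in> borel_measurable borel"
      by (rule borel_measurable_continuous_on_indicator)
        (auto intro: continuous_on_subset[OF Ck_continuous[OF F]])
    have "sphere_integral M F = (\<integral>x. indicator (sphere 0 1) x *\<^sub>R F x \<partial>distr M borel (rot u v \<theta>))"
      by (simp add: inv)
    also have "\<dots> = (\<integral>x. indicator (sphere 0 1) (rot u v \<theta> x) *\<^sub>R F (rot u v \<theta> x) \<partial>M)"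
      using orthogonal_transformation_measurable[OF ort] mF
      by (intro integral_distr) (auto simp: M(2) cong: measurable_cong_sets)
    also have "(\<lambda>x. indicator (sphere 0 1) (rot u v \<theta> x) *\<^sub>R F (rot u v \<theta> x)) =
       (\<lambda>x. indicator (sphere 0 1) x *\<^sub>R F (rot u v \<theta> x))"
      by (auto simp: indicator_def n)
    finally show ?thesis by simp
  qed
  have "((\<lambda>\<theta>. sphere_integral M (\<lambda>x. ?f (\<theta>, x))) has_derivative
      (\<lambda>h. \<integral>x. indicator (sphere 0 1) x *\<^sub>R frechet_derivative ?f (at (0, x)) (h, 0) \<partial>M)) (at 0)"
    by (rule has_derivative_parametric[OF M _ _ _ f]) auto
  then have "((\<lambda>\<theta>::real. sphere_integral M F) has_derivative
      (\<lambda>h. \<integral>x. indicator (sphere 0 1) x *\<^sub>R frechet_derivative ?f (at (0, x)) (h, 0) \<partial>M)) (at 0)"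
    unfolding const .
  from has_derivative_unique[OF this has_derivative_const]
  have "(\<integral>x. indicator (sphere 0 1) x *\<^sub>R frechet_derivative ?f (at (0, x)) (1, 0) \<partial>M) = 0"
    by (rule fun_cong)
  also have "(\<integral>x. indicator (sphere 0 1) x *\<^sub>R frechet_derivative ?f (at (0, x)) (1, 0) \<partial>M) =
      sphere_integral M (rot_deriv u v F)"
  proof (rule Bochner_Integration.integral_cong[OF refl])
    fix x
    have "frechet_derivative ?f (at (0, x)) (1, 0) = rot_deriv u v F x" if "x \<in> sphere 0 1"
    proof -
      have x: "x \<in> - {0}" using that by auto
      have "((\<lambda>\<theta>::real. (\<theta>, x)) has_derivative (\<lambda>h. (h, 0))) (at 0)"
        by (auto intro!: derivative_eq_intros)
      from has_derivative_compose[OF this Ck_derivative[OF f]] x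
      have 1: "((\<lambda>\<theta>. F (rot u v \<theta> x)) has_derivative (\<lambda>h. frechet_derivative ?f (at (0, x)) (h, 0))) (at 0)"
        by auto
      have "((\<lambda>\<theta>. rot u v \<theta> x) has_derivative (\<lambda>h. h *\<^sub>R ((u \<bullet> x) *\<^sub>R v - (v \<bullet> x) *\<^sub>R u))) (at 0)"
        unfolding rot_def by (auto intro!: derivative_eq_intros)
      from has_derivative_compose[OF this, of F "frechet_derivative F (at x)"] Ck_derivative[OF F x]
      have 2: "((\<lambda>\<theta>. F (rot u v \<theta> x)) has_derivative
          (\<lambda>h. frechet_derivative F (at x) (h *\<^sub>R ((u \<bullet> x) *\<^sub>R v - (v \<bullet> x) *\<^sub>R u)))) (at 0)"
        by (simp add: rot_def)
      from fun_cong[OF has_derivative_unique[OF 1 2], of 1] show ?thesis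
        using rot_deriv_eq[of F x u v] F x by simp
    qed
    then show "indicator (sphere 0 1) x *\<^sub>R frechet_derivative ?f (at (0, x)) (1, 0) =
        indicator (sphere 0 1) x *\<^sub>R rot_deriv u v F x" by (auto simp: indicator_def)
  qed
  finally show ?thesis .
qed

lemma rot_deriv_mult:
  assumes "F differentiable (at x)" "G differentiable (at x)"
  shows "rot_deriv u v (\<lambda>x. F x * G x) x = rot_deriv u v F x * G x + F x * rot_deriv u v G x"
  using assms by (simp add: rot_deriv_def dirderiv_mult algebra_simps)

lemma rot_deriv_cnj:
  assumes "F differentiable (at x)"
  shows "rot_deriv u v (\<lambda>x. cnj (F x)) x = cnj (rot_deriv u v F x)"
proof -
  have "((\<lambda>x. cnj (F x)) has_derivative (\<lambda>h. cnj (frechet_derivative F (at x) h))) (at x)"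
    using assms by (intro has_derivative_cnj) (simp add: frechet_derivative_works)
  from frechet_derivative_eqI[OF this] show ?thesis by (simp add: rot_deriv_def)
qed

section \<open>Second-order rotation generators on polynomials\<close>

lemma rot_deriv_rot_deriv_poly:
  fixes p :: "real^'d::finite \<Rightarrow> complex"
  assumes p: "p \<in> homogeneous_polys n" and uv: "u \<bullet> u = 1" "v \<bullet> v = 1"
  shows "rot_deriv u v (rot_deriv u v p) x =
    complex_of_real (u \<bullet> x) ^ 2 * dirderiv v (dirderiv v p) x
    - 2 * (complex_of_real (u \<bullet> x) * (complex_of_real (v \<bullet> x) * dirderiv u (dirderiv v p) x))
    + complex_of_real (v \<bullet> x) ^ 2 * dirderiv u (dirderiv u p) x
    + complex_of_real (u \<bullet> v) * (complex_of_real (u \<bullet> x) * dirderiv v p x + complex_of_real (v \<bullet> x) * dirderiv u p x)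
    - complex_of_real (u \<bullet> x) * dirderiv u p x - complex_of_real (v \<bullet> x) * dirderiv v p x"
proof -
  note H = homogeneous_polys_dirderiv[OF p]
  have L: "rot_deriv u v p = (\<lambda>x. complex_of_real (u \<bullet> x) * dirderiv v p x + (- 1) * (complex_of_real (v \<bullet> x) * dirderiv u p x))"
    by (auto simp: rot_deriv_def fun_eq_iff)
  have D: "dirderiv w (rot_deriv u v p) x = complex_of_real (u \<bullet> w) * dirderiv v p x +
      complex_of_real (u \<bullet> x) * dirderiv w (dirderiv v p) x - (complex_of_real (v \<bullet> w) * dirderiv u p x +
      complex_of_real (v \<bullet> x) * dirderiv w (dirderiv u p) x)" for w
    unfolding L dirderiv_add'[OF homogeneous_polys_inner[OF H] homogeneous_polys_scale[OF homogeneous_polys_inner[OF H]]]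
      dirderiv_cmult[OF homogeneous_polys_inner[OF H]] dirderiv_inner_mult[OF H] by simp
  have vu: "v \<bullet> u = u \<bullet> v" by (simp add: inner_commute)
  have c: "dirderiv v (dirderiv u p) x = dirderiv u (dirderiv v p) x" by (rule dirderiv_commute[OF p])
  show ?thesis
    unfolding rot_deriv_def[of u v "rot_deriv u v p"] D uv vu c
    by (simp add: algebra_simps power2_eq_square)
qed

text \<open>The factor 2 arises because each plane occurs for two ordered pairs. \<open>B\<close> is
  any finite orthonormal family: the full basis yields the Laplacian of the sphere, a basis without
  \<xi> that of a parallel.\<close>

lemma sum_rot_deriv_rot_deriv_poly:
  fixes p :: "real^'d::finite \<Rightarrow> complex"
  assumes p: "p \<in> homogeneous_polys n" and B: "finite B"
    and ortho: "\<And>u v. u \<in> B \<Longrightarrow> v \<in> B \<Longrightarrow> u \<bullet> v = (if u = v then 1 else 0)"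
  shows "(\<Sum>u\<in>B. \<Sum>v\<in>B. rot_deriv u v (rot_deriv u v p) x) =
    2 * (complex_of_real (\<Sum>u\<in>B. (u \<bullet> x)\<^sup>2) * (\<Sum>v\<in>B. dirderiv v (dirderiv v p) x)
      - (\<Sum>u\<in>B. \<Sum>v\<in>B. complex_of_real (u \<bullet> x) * (complex_of_real (v \<bullet> x) * dirderiv u (dirderiv v p) x))
      - (of_nat (card B) - 1) * (\<Sum>u\<in>B. complex_of_real (u \<bullet> x) * dirderiv u p x))"
proof -
  have "(\<Sum>u\<in>B. \<Sum>v\<in>B. rot_deriv u v (rot_deriv u v p) x) = (\<Sum>u\<in>B. \<Sum>v\<in>B.
    complex_of_real (u \<bullet> x) ^ 2 * dirderiv v (dirderiv v p) x
    - 2 * (complex_of_real (u \<bullet> x) * (complex_of_real (v \<bullet> x) * dirderiv u (dirderiv v p) x))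
    + complex_of_real (v \<bullet> x) ^ 2 * dirderiv u (dirderiv u p) x
    + (if u = v then 2 * (complex_of_real (u \<bullet> x) * dirderiv u p x) else 0)
    - complex_of_real (u \<bullet> x) * dirderiv u p x - complex_of_real (v \<bullet> x) * dirderiv v p x)"
    using ortho by (intro sum.cong refl, subst rot_deriv_rot_deriv_poly[OF p]) auto
  also have "\<dots> = (\<Sum>u\<in>B. \<Sum>v\<in>B. complex_of_real (u \<bullet> x) ^ 2 * dirderiv v (dirderiv v p) x)
    - 2 * (\<Sum>u\<in>B. \<Sum>v\<in>B. complex_of_real (u \<bullet> x) * (complex_of_real (v \<bullet> x) * dirderiv u (dirderiv v p) x))
    + (\<Sum>u\<in>B. \<Sum>v\<in>B. complex_of_real (v \<bullet> x) ^ 2 * dirderiv u (dirderiv u p) x)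
    + 2 * (\<Sum>u\<in>B. complex_of_real (u \<bullet> x) * dirderiv u p x)
    - (\<Sum>u\<in>B. \<Sum>v\<in>B. complex_of_real (u \<bullet> x) * dirderiv u p x)
    - (\<Sum>u\<in>B. \<Sum>v\<in>B. complex_of_real (v \<bullet> x) * dirderiv v p x)"
    using B by (simp only: sum.distrib sum_subtractf sum_distrib_left[symmetric] sum.delta' sum.delta)
      (simp add: sum_distrib_left)
  also have "(\<Sum>u\<in>B. \<Sum>v\<in>B. complex_of_real (u \<bullet> x) ^ 2 * dirderiv v (dirderiv v p) x) =
      complex_of_real (\<Sum>u\<in>B. (u \<bullet> x)\<^sup>2) * (\<Sum>v\<in>B. dirderiv v (dirderiv v p) x)"
    by (simp add: sum_product)
  also have "(\<Sum>u\<in>B. \<Sum>v\<in>B. complex_of_real (v \<bullet> x) ^ 2 * dirderiv u (dirderiv u p) x) =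
      complex_of_real (\<Sum>u\<in>B. (u \<bullet> x)\<^sup>2) * (\<Sum>v\<in>B. dirderiv v (dirderiv v p) x)"
    by (subst sum.swap) (simp add: sum_product)
  finally show ?thesis by (simp add: sum_distrib_left[symmetric] algebra_simps)
qed

definition orthonormal_basis :: "'a::euclidean_space set \<Rightarrow> bool" where
  "orthonormal_basis B \<longleftrightarrow> finite B \<and> (\<forall>u\<in>B. \<forall>v\<in>B. u \<bullet> v = (if u = v then 1 else 0)) \<and>
     (\<forall>x. (\<Sum>b\<in>B. (b \<bullet> x) *\<^sub>R b) = x) \<and> card B = DIM('a)"

lemma orthonormal_basis_Basis: "orthonormal_basis Basis"
  by (auto simp: orthonormal_basis_def inner_Basis inner_commute[of _ x for x] euclidean_representation)

lemma orthonormal_basis_exists: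
  fixes \<xi> :: "'a::euclidean_space"
  assumes "norm \<xi> = 1"
  shows "\<exists>B. orthonormal_basis B \<and> \<xi> \<in> B"
proof -
  obtain B where B: "\<xi> \<in> B" "pairwise orthogonal B" "\<And>x. x \<in> B \<Longrightarrow> norm x = 1"
      "independent B" "card B = DIM('a)" "span B = UNIV"
    using vector_in_orthonormal_basis[OF assms] by metis
  have "finite B" using B(5) by (metis DIM_positive card.infinite less_irrefl)
  have "(\<Sum>b\<in>B. (b \<bullet> x) *\<^sub>R b) = x" for x
    using orthonormal_basis_expand[OF B(2,3) _ \<open>finite B\<close>, of x] B(6) by (simp add: inner_commute)
  moreover have "u \<bullet> v = (if u = v then 1 else 0)" if "u \<in> B" "v \<in> B" for u v
    using B(2,3) that by (auto simp: pairwise_def orthogonal_def dot_square_norm)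
  ultimately show ?thesis using B \<open>finite B\<close> unfolding orthonormal_basis_def by blast
qed

lemma orthonormal_basis_dirderiv:
  fixes f :: "'a::euclidean_space \<Rightarrow> complex"
  assumes "orthonormal_basis B" "f differentiable (at x)"
  shows "(\<Sum>b\<in>B. complex_of_real (b \<bullet> y) * dirderiv b f x) = frechet_derivative f (at x) y"
  using dirderiv_linear_sum[OF assms(2), of "\<lambda>b. b \<bullet> y" "\<lambda>b. b" B] assms(1)
  by (simp add: orthonormal_basis_def scaleR_conv_of_real)

lemma orthonormal_basis_norm2:
  assumes "orthonormal_basis B"
  shows "(\<Sum>b\<in>B. (b \<bullet> x)\<^sup>2) = (norm x)\<^sup>2"
proof -
  have "x \<bullet> x = (\<Sum>b\<in>B. (b \<bullet> x) *\<^sub>R b) \<bullet> x" using assms by (simp add: orthonormal_basis_def)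
  also have "\<dots> = (\<Sum>b\<in>B. (b \<bullet> x)\<^sup>2)" unfolding inner_sum_left by (simp add: power2_eq_square)
  finally show ?thesis by (simp add: power2_norm_eq_inner)
qed

text \<open>Expanding each standard direction in \<open>B\<close> yields coefficients that sum to
  the inner products of members of \<open>B\<close>, hence to Kronecker deltas. This allows a basis
  that contains \<xi>.\<close>

lemma laplacian_orthonormal_basis:
  fixes p :: "real^'d::finite \<Rightarrow> complex"
  assumes p: "p \<in> homogeneous_polys n" and B: "orthonormal_basis B"
  shows "(\<Sum>b\<in>B. dirderiv b (dirderiv b p) x) = laplacian p x"
proof -
  note d1 = homogeneous_polys_differentiable[OF p]
  note d2 = homogeneous_polys_differentiable[OF homogeneous_polys_dirderiv[OF p]]
  have *: "dirderiv b (dirderiv b p) x = (\<Sum>c\<in>B. \<Sum>e\<in>B. complex_of_real ((c \<bullet> b) * (e \<bullet> b)) * dirderiv c (dirderiv e p) x)"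
    for b
  proof -
    have "dirderiv b p = (\<lambda>x. \<Sum>e\<in>B. complex_of_real (e \<bullet> b) * dirderiv e p x)"
      using orthonormal_basis_dirderiv[OF B d1] by simp
    then have "dirderiv b (dirderiv b p) x = dirderiv b (\<lambda>x. \<Sum>e\<in>B. complex_of_real (e \<bullet> b) * dirderiv e p x) x"
      by simp
    also have "\<dots> = (\<Sum>e\<in>B. complex_of_real (e \<bullet> b) * dirderiv b (dirderiv e p) x)"
      using d2 by (subst dirderiv_sum) (auto simp: dirderiv_cmult[OF homogeneous_polys_dirderiv[OF p]])
    also have "\<dots> = (\<Sum>e\<in>B. complex_of_real (e \<bullet> b) * (\<Sum>c\<in>B. complex_of_real (c \<bullet> b) * dirderiv c (dirderiv e p) x))"
      by (simp only: orthonormal_basis_dirderiv[OF B d2])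
    finally show ?thesis
      by (simp add: sum_distrib_left mult_ac) (subst sum.swap, simp add: mult_ac)
  qed
  have "laplacian p x = (\<Sum>b\<in>Basis. \<Sum>c\<in>B. \<Sum>e\<in>B. complex_of_real ((c \<bullet> b) * (e \<bullet> b)) * dirderiv c (dirderiv e p) x)"
    unfolding laplacian_eq by (intro sum.cong refl *)
  also have "\<dots> = (\<Sum>c\<in>B. \<Sum>e\<in>B. complex_of_real (\<Sum>b\<in>Basis. (c \<bullet> b) * (e \<bullet> b)) * dirderiv c (dirderiv e p) x)"
    by (simp only: sum.swap[of _ Basis] of_real_sum sum_distrib_right)
  also have "\<dots> = (\<Sum>c\<in>B. \<Sum>e\<in>B. if c = e then dirderiv c (dirderiv e p) x else 0)"
  proof (intro sum.cong refl)
    fix c e assume "c \<in> B" "e \<in> B"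
    then show "complex_of_real (\<Sum>b\<in>Basis. (c \<bullet> b) * (e \<bullet> b)) * dirderiv c (dirderiv e p) x =
        (if c = e then dirderiv c (dirderiv e p) x else 0)"
      using B by (simp add: euclidean_inner[of c e, symmetric] orthonormal_basis_def)
  qed
  also have "\<dots> = (\<Sum>b\<in>B. dirderiv b (dirderiv b p) x)"
    using B by (simp add: orthonormal_basis_def)
  finally show ?thesis by simp
qed

lemma second_euler_identity:
  fixes p :: "real^'d::finite \<Rightarrow> complex"
  assumes p: "p \<in> homogeneous_polys n" and B: "orthonormal_basis B"
  shows "(\<Sum>u\<in>B. \<Sum>v\<in>B. complex_of_real (u \<bullet> x) * (complex_of_real (v \<bullet> x) * dirderiv u (dirderiv v p) x)) =
    of_nat n * (of_nat n - 1) * p x"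
proof -
  note d1 = homogeneous_polys_differentiable[OF p]
  note d2 = homogeneous_polys_differentiable[OF homogeneous_polys_dirderiv[OF p]]
  have "(\<Sum>u\<in>B. \<Sum>v\<in>B. complex_of_real (u \<bullet> x) * (complex_of_real (v \<bullet> x) * dirderiv u (dirderiv v p) x)) =
      (\<Sum>v\<in>B. complex_of_real (v \<bullet> x) * (\<Sum>u\<in>B. complex_of_real (u \<bullet> x) * dirderiv u (dirderiv v p) x))"
    by (subst sum.swap) (simp add: sum_distrib_left mult_ac)
  also have "\<dots> = (\<Sum>v\<in>B. complex_of_real (v \<bullet> x) * (of_nat (n - 1) * dirderiv v p x))"
    by (simp only: orthonormal_basis_dirderiv[OF B d2] euler_identity[OF homogeneous_polys_dirderiv[OF p]])
  also have "\<dots> = of_nat (n - 1) * (\<Sum>v\<in>B. complex_of_real (v \<bullet> x) * dirderiv v p x)"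
    by (simp add: sum_distrib_left mult_ac)
  also have "\<dots> = of_nat (n - 1) * (of_nat n * p x)"
    by (simp only: orthonormal_basis_dirderiv[OF B d1] euler_identity[OF p])
  finally show ?thesis by (cases n) auto
qed

text \<open>For a harmonic polynomial only the two Euler terms survive, and n(n - 1) + (d - 1)n =
  n(n + d - 2) is the eigenvalue of the negative spherical Laplacian, doubled here by the ordered
  pairs.\<close>

lemma sum_rot_deriv_rot_deriv_Basis:
  fixes p :: "real^'d::finite \<Rightarrow> complex"
  assumes p: "p \<in> homogeneous_polys n" and harm: "\<And>x. laplacian p x = 0"
  shows "(\<Sum>u\<in>Basis. \<Sum>v\<in>Basis. rot_deriv u v (rot_deriv u v p) x) = - 2 * (of_nat n * (of_nat n + of_nat CARD('d) - 2)) * p x"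
proof -
  note B = orthonormal_basis_Basis[where ?'a = "real^'d"]
  show ?thesis
    by (subst sum_rot_deriv_rot_deriv_poly[OF p])
      (use B in \<open>simp_all add: orthonormal_basis_def laplacian_orthonormal_basis[OF p B] harm
        second_euler_identity[OF p B] orthonormal_basis_dirderiv[OF B homogeneous_polys_differentiable[OF p]]
        euler_identity[OF p] algebra_simps\<close>)
qed

section \<open>The Funk--Hecke formula\<close>

definition cap_point :: "'a::euclidean_space \<Rightarrow> real \<Rightarrow> 'a \<Rightarrow> 'a" where
  "cap_point \<xi> t w = t *\<^sub>R \<xi> + sqrt (1 - t\<^sup>2) *\<^sub>R w"

text \<open>Not normalised: the mean of a constant is that constant times
  \<open>equator_mass \<xi>\<close>. The factor \<open>CARD('d) - 1\<close> of the surface measure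
  and the dilation factor are left out as well.\<close>

definition sphere_mean :: "(real^'d::finite \<Rightarrow> complex) \<Rightarrow> real^'d \<Rightarrow> real \<Rightarrow> complex" where
  "sphere_mean g \<xi> t = (\<integral>w. g (cap_point \<xi> t w) \<partial>equator_measure \<xi>)"

lemma abs_less_1_sq: "\<bar>t\<bar> < 1 \<Longrightarrow> t\<^sup>2 < (1::real)"
  by (simp add: abs_square_less_1)

lemma cap_point_sphere:
  assumes "norm \<xi> = 1" "\<bar>t\<bar> < 1" "w \<in> sphere 0 1" "\<xi> \<bullet> w = 0"
  shows "cap_point \<xi> t w \<in> sphere 0 1" "\<xi> \<bullet> cap_point \<xi> t w = t"
proof -
  have "cap_point \<xi> t w \<bullet> cap_point \<xi> t w = t\<^sup>2 * (\<xi> \<bullet> \<xi>) + (sqrt (1 - t\<^sup>2))\<^sup>2 * (w \<bullet> w)"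
    using assms(4) by (simp add: cap_point_def inner_add_left inner_add_right inner_commute[of w \<xi>] power2_eq_square)
  also have "\<dots> = 1" using assms abs_less_1_sq[OF assms(2)] by (simp add: dot_square_norm)
  finally show "cap_point \<xi> t w \<in> sphere 0 1" by (simp add: norm_eq_sqrt_inner)
  show "\<xi> \<bullet> cap_point \<xi> t w = t" using assms by (simp add: cap_point_def inner_add_right dot_square_norm)
qed

lemma cap_point_measurable [measurable]: "cap_point \<xi> t \<in> borel_measurable borel"
  unfolding cap_point_def[abs_def] by measurable

lemma measurable_cap:
  "f \<in> borel_measurable borel \<Longrightarrow> (\<lambda>w. f (cap_point \<xi> t w)) \<in> borel_measurable (equator_measure \<xi>)"
  using measurable_compose[OF cap_point_measurable, of f borel \<xi> t]
  by (simp cong: measurable_cong_sets)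

lemma measurable_indicator_cap:
  fixes f :: "real^'d::finite \<Rightarrow> complex"
  assumes "f \<in> borel_measurable borel"
  shows "(\<lambda>w. indicator (sphere 0 1) w *\<^sub>R f (cap_point \<xi> t w)) \<in> borel_measurable (equator_measure \<xi>)"
  by (intro borel_measurable_scaleR measurable_cap assms borel_measurable_indicator) simp

lemma AE_cap_point:
  fixes \<xi> :: "real^'d::finite"
  assumes "norm \<xi> = 1" "\<bar>t\<bar> < 1" "CARD('d) \<ge> 2"
  shows "AE w in equator_measure \<xi>. w \<in> sphere 0 1 \<and> cap_point \<xi> t w \<in> sphere 0 1 \<and> \<xi> \<bullet> cap_point \<xi> t w = t"
  using AE_equator_measure[OF assms(1,3)] by eventually_elim (use cap_point_sphere[OF assms(1,2)] in auto)

lemma Ck_cap_point_gen: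
  fixes X :: "'a::euclidean_space \<Rightarrow> 'b::euclidean_space" and T :: "'a \<Rightarrow> real"
  assumes "open U" "Ck k T U" "Ck k X U" "Ck k Z U" "\<And>x. x \<in> U \<Longrightarrow> \<bar>T x\<bar> < 1"
  shows "Ck k (\<lambda>x. cap_point (X x) (T x) (Z x)) U"
proof (rule Ck_cong[OF assms(1)])
  show "Ck k (\<lambda>x. T x *\<^sub>R X x + (1 - T x * T x) powr (1/2) *\<^sub>R Z x) U"
  proof (intro Ck_add Ck_scaleR Ck_powr Ck_diff Ck_mult Ck_const assms)
    fix x assume "x \<in> U"
    then show "0 < 1 - T x * T x" using abs_less_1_sq[OF assms(5)] by (simp add: power2_eq_square)
  qed
  fix x assume "x \<in> U"
  then show "T x *\<^sub>R X x + (1 - T x * T x) powr (1/2) *\<^sub>R Z x = cap_point (X x) (T x) (Z x)"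
    using abs_less_1_sq[OF assms(5)] by (simp add: cap_point_def powr_half_sqrt power2_eq_square less_imp_le)
qed

abbreviation "I1 \<equiv> {- 1 <..< 1 :: real}"

text \<open>The equator measure lives on the unit sphere, so inserting the indicator changes
  nothing; the integral over a compact set is the form in which it can be differentiated.\<close>

lemma sphere_mean_poly:
  fixes p :: "real^'d::finite \<Rightarrow> complex"
  assumes "norm \<xi> = 1" "\<bar>t\<bar> < 1" "CARD('d) \<ge> 2" "p \<in> homogeneous_polys n"
  shows "sphere_mean p \<xi> t = sphere_integral (equator_measure \<xi>) (\<lambda>w. p (cap_point \<xi> t w))"
  unfolding sphere_mean_def
proof (rule integral_cong_AE)
  have "p \<in> borel_measurable borel"
    using Ck_continuous[OF Ck_homogeneous_poly[OF assms(4) open_UNIV]]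
    by (rule borel_measurable_continuous_onI)
  then show "(\<lambda>w. p (cap_point \<xi> t w)) \<in> borel_measurable (equator_measure \<xi>)"
    "(\<lambda>w. indicator (sphere 0 1) w *\<^sub>R p (cap_point \<xi> t w)) \<in> borel_measurable (equator_measure \<xi>)"
    by (rule measurable_cap, rule measurable_indicator_cap)
  show "AE w in equator_measure \<xi>. p (cap_point \<xi> t w) =
      indicator (sphere 0 1) w *\<^sub>R p (cap_point \<xi> t w)"
    using AE_cap_point[OF assms(1-3)] by eventually_elim auto
qed

lemma integrable_cap_poly:
  fixes p :: "real^'d::finite \<Rightarrow> complex"
  assumes "norm \<xi> = 1" "p \<in> homogeneous_polys n"
  shows "integrable (equator_measure \<xi>) (\<lambda>w. indicator (sphere 0 1) w *\<^sub>R p (cap_point \<xi> t w))"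
proof (rule integrable_continuous_compact[OF finite_equator_measure[OF assms(1)]])
  have "continuous_on UNIV p" using Ck_continuous[OF Ck_homogeneous_poly[OF assms(2) open_UNIV]] .
  then show "continuous_on (sphere 0 1) (\<lambda>w. p (cap_point \<xi> t w))"
    by (rule continuous_on_compose2) (auto simp: cap_point_def intro!: continuous_intros)
qed auto

lemma Ck_poly_cap:
  assumes "p \<in> homogeneous_polys n"
  shows "Ck k (\<lambda>z. p (cap_point \<xi> (fst z) (snd z))) (I1 \<times> UNIV)"
proof (rule Ck_compose[OF _ Ck_homogeneous_poly[OF assms open_UNIV]])
  show "Ck k (\<lambda>z. cap_point \<xi> (fst z) (snd z)) (I1 \<times> UNIV)"
    by (intro Ck_cap_point_gen Ck_linear bounded_linear_fst bounded_linear_snd Ck_const)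
      (auto intro!: open_Times)
qed (auto intro!: open_Times)

lemma Ck_sphere_mean_poly:
  fixes p :: "real^'d::finite \<Rightarrow> complex"
  assumes "norm \<xi> = 1" "CARD('d) \<ge> 2" "p \<in> homogeneous_polys n"
  shows "Ck k (sphere_mean p \<xi>) I1"
proof (rule Ck_cong)
  show "Ck k (\<lambda>t. \<integral>w. indicator (sphere 0 1) w *\<^sub>R (\<lambda>z. p (cap_point \<xi> (fst z) (snd z))) (t, w) \<partial>equator_measure \<xi>) I1"
    by (rule Ck_parametric_integral[OF finite_equator_measure[OF assms(1)] _ _ _ _ _ Ck_poly_cap[OF assms(3)]]) auto
  fix t assume "t \<in> I1"
  then show "(\<integral>w. indicator (sphere 0 1) w *\<^sub>R (\<lambda>z. p (cap_point \<xi> (fst z) (snd z))) (t, w) \<partial>equator_measure \<xi>) =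
      sphere_mean p \<xi> t"
    using sphere_mean_poly[OF assms(1) _ assms(2,3), of t] by (auto simp: abs_less_iff)
qed auto

text \<open>The cap point \<open>x\<close> moves with velocity \<xi> - (t / c) w, where c = sqrt (1
  - t * t). Eliminating w = (x - t \<xi>) / c leaves only the derivative in direction \<xi> and the
  radial one, which Euler's identity evaluates as \<open>n\<close> times the polynomial.\<close>

lemma sphere_mean_derivative:
  fixes p :: "real^'d::finite \<Rightarrow> complex"
  assumes \<xi>: "norm \<xi> = 1" and t: "\<bar>t\<bar> < 1" and d: "CARD('d) \<ge> 2" and p: "p \<in> homogeneous_polys n"
  shows "(sphere_mean p \<xi> has_vector_derivative
    (sphere_mean (dirderiv \<xi> p) \<xi> t - of_nat n * complex_of_real t * sphere_mean p \<xi> t) / complex_of_real (1 - t\<^sup>2)) (at t)"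
proof -
  let ?c = "sqrt (1 - t\<^sup>2)" let ?M = "equator_measure \<xi>"
  have c: "?c > 0" "?c\<^sup>2 = 1 - t\<^sup>2" using abs_less_1_sq[OF t] by auto
  have t': "t \<in> I1" using t by auto
  let ?f = "\<lambda>z. p (cap_point \<xi> (fst z) (snd z))"
  let ?q = "\<lambda>w. (dirderiv \<xi> p (cap_point \<xi> t w) - of_nat n * complex_of_real t * p (cap_point \<xi> t w)) / complex_of_real (1 - t\<^sup>2)"
  have D1: "((\<lambda>t. \<integral>w. indicator (sphere 0 1) w *\<^sub>R ?f (t, w) \<partial>?M) has_derivative
      (\<lambda>h. \<integral>w. indicator (sphere 0 1) w *\<^sub>R frechet_derivative ?f (at (t, w)) (h, 0) \<partial>?M)) (at t)"
    by (rule has_derivative_parametric[OF finite_equator_measure[OF \<xi>] _ _ _ _ Ck_poly_cap[OF p] t']) auto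
  have fd: "frechet_derivative ?f (at (t, w)) (h, 0) = h *\<^sub>R ?q w" for w h
  proof -
    let ?x = "cap_point \<xi> t w"
    have pd: "(p has_derivative frechet_derivative p (at ?x)) (at ?x)"
      using homogeneous_polys_differentiable[OF p] by (simp add: frechet_derivative_works)
    interpret L: linear "frechet_derivative p (at ?x)"
      using pd by (simp add: has_derivative_bounded_linear bounded_linear.linear)
    have "((\<lambda>\<theta>::real. (\<theta>, w)) has_derivative (\<lambda>h. (h, 0))) (at t)"
      by (auto intro!: derivative_eq_intros)
    from has_derivative_compose[OF this Ck_derivative[OF Ck_poly_cap[OF p, where k = "Suc 0"]]] t'
    have 1: "((\<lambda>\<theta>. p (cap_point \<xi> \<theta> w)) has_derivative (\<lambda>h. frechet_derivative ?f (at (t, w)) (h, 0))) (at t)"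
      by auto
    have "((\<lambda>\<theta>. cap_point \<xi> \<theta> w) has_derivative (\<lambda>h. h *\<^sub>R (\<xi> - (t / ?c) *\<^sub>R w))) (at t)"
      unfolding cap_point_def using abs_less_1_sq[OF t]
      by (auto intro!: derivative_eq_intros simp: algebra_simps divide_simps)
    from has_derivative_compose[OF this pd]
    have 2: "((\<lambda>\<theta>. p (cap_point \<xi> \<theta> w)) has_derivative
        (\<lambda>h. frechet_derivative p (at ?x) (h *\<^sub>R (\<xi> - (t / ?c) *\<^sub>R w)))) (at t)" .
    have w: "w = (1 / ?c) *\<^sub>R (?x - t *\<^sub>R \<xi>)" using c(1) by (simp add: cap_point_def)
    have dw: "frechet_derivative p (at ?x) w = complex_of_real (1 / ?c) *
        (of_nat n * p ?x - complex_of_real t * dirderiv \<xi> p ?x)"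
    proof -
      have "frechet_derivative p (at ?x) w = frechet_derivative p (at ?x) ((1 / ?c) *\<^sub>R (?x - t *\<^sub>R \<xi>))"
        by (rule arg_cong[OF w])
      then show ?thesis
        by (simp only: L.scaleR L.diff euler_identity[OF p]) (simp add: scaleR_conv_of_real)
    qed
    have "frechet_derivative p (at ?x) (\<xi> - (t / ?c) *\<^sub>R w) =
        dirderiv \<xi> p ?x - complex_of_real (t / ?c) * (complex_of_real (1 / ?c) *
        (of_nat n * p ?x - complex_of_real t * dirderiv \<xi> p ?x))"
      by (simp only: L.diff L.scaleR dw) (simp only: scaleR_conv_of_real)
    also have "\<dots> = dirderiv \<xi> p ?x - complex_of_real (t / ?c\<^sup>2) *
        (of_nat n * p ?x - complex_of_real t * dirderiv \<xi> p ?x)"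
      by (simp only: mult.assoc[symmetric] of_real_mult[symmetric] times_divide_times_eq
          power2_eq_square mult_1_right)
    also have "\<dots> = (dirderiv \<xi> p ?x * complex_of_real (1 - t\<^sup>2) - complex_of_real t *
        (of_nat n * p ?x - complex_of_real t * dirderiv \<xi> p ?x)) / complex_of_real (1 - t\<^sup>2)"
    proof -
      have "complex_of_real (1 - t\<^sup>2) \<noteq> 0" using abs_less_1_sq[OF t] by (simp only: of_real_eq_0_iff)
      then show ?thesis
        unfolding c(2) by (simp add: diff_divide_distrib del: of_real_diff of_real_power)
    qed
    also have "\<dots> = ?q w"
      by (rule arg_cong2[where f = "(/)"]) (simp_all add: algebra_simps power2_eq_square)
    finally show ?thesis
      using fun_cong[OF has_derivative_unique[OF 1 2], of h] by (simp only: L.scaleR)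
  qed
  have "((\<lambda>t. \<integral>w. indicator (sphere 0 1) w *\<^sub>R ?f (t, w) \<partial>?M) has_derivative
      (\<lambda>h. \<integral>w. indicator (sphere 0 1) w *\<^sub>R (h *\<^sub>R ?q w) \<partial>?M)) (at t)"
    using D1 unfolding fd .
  also have "(\<lambda>h. \<integral>w. indicator (sphere 0 1) w *\<^sub>R (h *\<^sub>R ?q w) \<partial>?M) =
    (\<lambda>h. h *\<^sub>R (\<integral>w. indicator (sphere 0 1) w *\<^sub>R ?q w \<partial>?M))"
  proof
    fix h
    have "(\<integral>w. indicator (sphere 0 1) w *\<^sub>R (h *\<^sub>R ?q w) \<partial>?M) = (\<integral>w. h *\<^sub>R (indicator (sphere 0 1) w *\<^sub>R ?q w) \<partial>?M)"
      by (simp only: scaleR_left_commute)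
    then show "(\<integral>w. indicator (sphere 0 1) w *\<^sub>R (h *\<^sub>R ?q w) \<partial>?M) = h *\<^sub>R (\<integral>w. indicator (sphere 0 1) w *\<^sub>R ?q w \<partial>?M)"
      by (simp only: integral_scaleR_right)
  qed
  also have "(\<integral>w. indicator (sphere 0 1) w *\<^sub>R ?q w \<partial>?M) =
    (\<integral>w. (indicator (sphere 0 1) w *\<^sub>R dirderiv \<xi> p (cap_point \<xi> t w) - of_nat n * complex_of_real t * (indicator (sphere 0 1) w *\<^sub>R p (cap_point \<xi> t w))) / complex_of_real (1 - t\<^sup>2) \<partial>?M)"
    by (intro Bochner_Integration.integral_cong refl) (simp add: indicator_def)
  also have "\<dots> = (sphere_mean (dirderiv \<xi> p) \<xi> t - of_nat n * complex_of_real t * sphere_mean p \<xi> t) / complex_of_real (1 - t\<^sup>2)"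
  proof -
    have lin: "(\<integral>x. (f x - b * g x) / c \<partial>?M) = ((\<integral>x. f x \<partial>?M) - b * (\<integral>x. g x \<partial>?M)) / c"
      if "integrable ?M f" "integrable ?M g" for f g :: "real^'d \<Rightarrow> complex" and b c
      using that by simp
    show ?thesis
      unfolding sphere_mean_poly[OF \<xi> t d p] sphere_mean_poly[OF \<xi> t d homogeneous_polys_dirderiv[OF p]]
      by (rule lin[OF integrable_cap_poly[OF \<xi> homogeneous_polys_dirderiv[OF p]] integrable_cap_poly[OF \<xi> p]])
  qed
  finally have "((\<lambda>t. \<integral>w. indicator (sphere 0 1) w *\<^sub>R ?f (t, w) \<partial>?M) has_vector_derivative
      (sphere_mean (dirderiv \<xi> p) \<xi> t - of_nat n * complex_of_real t * sphere_mean p \<xi> t) / complex_of_real (1 - t\<^sup>2)) (at t)"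
    by (simp add: has_vector_derivative_def)
  then show ?thesis
    by (rule has_vector_derivative_transform_within_open[OF _ _ t'])
      (use sphere_mean_poly[OF \<xi> _ d p] in \<open>auto simp: abs_less_iff\<close>)
qed

text \<open>
  The spherical Laplacian of the parallel \<open>\<xi> \<bullet> x = t\<close> integrates to zero; for harmonic \<open>p\<close> this
  determines the mean of the second derivative in direction \<open>\<xi>\<close>.
\<close>

lemma sphere_mean_second_derivative:
  fixes p :: "real^'d::finite \<Rightarrow> complex"
  assumes \<xi>: "norm \<xi> = 1" and t: "\<bar>t\<bar> < 1" and d: "CARD('d) \<ge> 2" and p: "p \<in> homogeneous_polys n"
    and harm: "\<And>x. laplacian p x = 0"
  shows "sphere_mean (dirderiv \<xi> (dirderiv \<xi> p)) \<xi> t =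
    - of_nat n * (of_nat n + of_nat CARD('d) - 3) * sphere_mean p \<xi> t
    + (2 * of_nat n + of_nat CARD('d) - 4) * complex_of_real t * sphere_mean (dirderiv \<xi> p) \<xi> t"
proof -
  let ?\<nu> = "equator_measure \<xi>"
  note q = homogeneous_polys_dirderiv[OF p, of \<xi>]
  note r = homogeneous_polys_dirderiv[OF q, of \<xi>]
  \<comment> \<open>The measure is moved to the parallel itself, where the rotations in planes
    orthogonal to \<xi> act directly on the argument of \<open>p\<close> and leave the measure
    invariant.\<close>
  define M where "M = distr ?\<nu> borel (cap_point \<xi> t)"
  have sM[simp, measurable_cong]: "sets M = sets borel" by (simp add: M_def)
  have cm: "cap_point \<xi> t \<in> measurable ?\<nu> borel" by measurable
  interpret N: finite_measure ?\<nu> by (rule finite_equator_measure[OF \<xi>])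
  have fM: "finite_measure M" unfolding M_def using cm by (rule N.finite_measure_distr)
  have AEM: "AE x in M. x \<in> sphere 0 1 \<and> \<xi> \<bullet> x = t"
    unfolding M_def using AE_cap_point[OF \<xi> t d] cm
    by (subst AE_distr_iff) (auto elim: eventually_mono)
  have contH: "continuous_on A h" if "h \<in> homogeneous_polys m" for h m and A :: "(real^'d) set"
    using Ck_continuous[OF Ck_homogeneous_poly[OF that open_UNIV]] continuous_on_subset by blast
  have mean: "sphere_mean h \<xi> t = sphere_integral M h" if h: "h \<in> homogeneous_polys m" for h m
  proof -
    have mh: "(\<lambda>x. indicator (sphere 0 1) x *\<^sub>R h x) \<in> borel_measurable borel"
      by (rule borel_measurable_continuous_on_indicator) (auto intro: contH[OF h])
    have mh': "h \<in> borel_measurable borel"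
      by (rule borel_measurable_continuous_onI[OF contH[OF h]])
    have "sphere_integral M h = (\<integral>w. indicator (sphere 0 1) (cap_point \<xi> t w) *\<^sub>R h (cap_point \<xi> t w) \<partial>?\<nu>)"
      unfolding M_def using cm mh by (rule integral_distr)
    also have "\<dots> = sphere_mean h \<xi> t"
      unfolding sphere_mean_def
    proof (rule integral_cong_AE)
      show "AE w in ?\<nu>. indicator (sphere 0 1) (cap_point \<xi> t w) *\<^sub>R h (cap_point \<xi> t w) = h (cap_point \<xi> t w)"
        using AE_cap_point[OF \<xi> t d] by eventually_elim auto
    qed (rule measurable_cap[OF mh], rule measurable_cap[OF mh'])
    finally show ?thesis by simp
  qed
  obtain B where B: "orthonormal_basis B" "\<xi> \<in> B" using orthonormal_basis_exists[OF \<xi>] by blast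
  define B' where "B' = B - {\<xi>}"
  have fB: "finite B" and cB: "card B = CARD('d)" using B(1) by (auto simp: orthonormal_basis_def)
  have ortho: "u \<bullet> v = (if u = v then 1 else 0)" if "u \<in> B" "v \<in> B" for u v
    using B(1) that by (simp add: orthonormal_basis_def)
  have split: "(\<Sum>b\<in>B. g b) = g \<xi> + (\<Sum>b\<in>B'. g b)" for g :: "_ \<Rightarrow> 'z::comm_monoid_add"
    unfolding B'_def using fB B(2) by (rule sum.remove)
  have cB': "complex_of_nat (card B') = of_nat CARD('d) - 1"
    using fB B(2) cB d by (simp add: B'_def of_nat_diff)
  have inv: "distr M borel (rot u v \<theta>) = M" if uv: "u \<in> B'" "v \<in> B'" "u \<noteq> v" for u v \<theta>
  proof -
    have o: "orthogonal_transformation (rot u v \<theta>)"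
      using ortho[of u u] ortho[of v v] ortho[of u v] uv
      by (intro orthogonal_transformation_rot) (auto simp: B'_def norm_eq_sqrt_inner)
    note [measurable] = orthogonal_transformation_measurable[OF o]
    have "u \<bullet> \<xi> = 0" "v \<bullet> \<xi> = 0" using ortho[of u \<xi>] ortho[of v \<xi>] uv B(2) by (auto simp: B'_def)
    then have fix\<xi>: "rot u v \<theta> \<xi> = \<xi>" by (simp add: rot_def)
    have "rot u v \<theta> (cap_point \<xi> t w) = cap_point \<xi> t (rot u v \<theta> w)" for w
      unfolding cap_point_def using orthogonal_transformation_linear[OF o]
      by (simp add: linear_add linear_scale fix\<xi>)
    then have "distr M borel (rot u v \<theta>) = distr (distr ?\<nu> borel (rot u v \<theta>)) borel (cap_point \<xi> t)"
      unfolding M_def by (subst (1 2) distr_distr) (auto simp: comp_def)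
    then show ?thesis by (simp add: equator_measure_orthogonal[OF o] fix\<xi> M_def)
  qed
  have CkL: "Ck k (rot_deriv u v p) (- {0})" for k u v
    by (rule Ck_rot_deriv[OF Ck_homogeneous_poly[OF p]]) auto
  have zero: "sphere_integral M (rot_deriv u v (rot_deriv u v p)) = 0" if uv: "u \<in> B'" "v \<in> B'" for u v
  proof (cases "u = v")
    case True
    then have "rot_deriv u v (rot_deriv u v p) = (\<lambda>x. 0)" by (simp add: rot_deriv_def fun_eq_iff)
    then show ?thesis by simp
  next
    case False
    then show ?thesis
      using ortho[of u u] ortho[of v v] ortho[of u v] uv
      by (intro sphere_integral_rot_deriv[OF fM _ inv _ _ _ CkL]) (auto simp: B'_def norm_eq_sqrt_inner)
  qed
  have intg: "integrable M (\<lambda>x. indicator (sphere 0 1) x *\<^sub>R g x)" if "continuous_on (sphere 0 1) g"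
    for g :: "real^'d \<Rightarrow> complex"
    by (rule integrable_continuous_compact[OF fM]) (use that in auto)
  have contLL: "continuous_on (sphere 0 1) (rot_deriv u v (rot_deriv u v p))" for u v
    by (rule continuous_on_subset[OF Ck_continuous[OF Ck_rot_deriv[OF CkL]]]) auto
  let ?R = "\<lambda>x. 2 * (- (dirderiv \<xi> (dirderiv \<xi> p) x) - of_nat n * (of_nat n + of_nat CARD('d) - 3) * p x
      + (2 * of_nat n + of_nat CARD('d) - 4) * complex_of_real t * dirderiv \<xi> p x)"
  have point: "(\<Sum>u\<in>B'. \<Sum>v\<in>B'. rot_deriv u v (rot_deriv u v p) x) = ?R x" if x: "x \<in> sphere 0 1" "\<xi> \<bullet> x = t" for x
  proof -
    let ?T = "complex_of_real t" let ?p = "p x" let ?q = "dirderiv \<xi> p x" let ?r = "dirderiv \<xi> (dirderiv \<xi> p) x"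
    let ?n = "of_nat n :: complex"
    note dp = homogeneous_polys_differentiable[OF p]
    note dq = homogeneous_polys_differentiable[OF homogeneous_polys_dirderiv[OF p]]
    \<comment> \<open>Each sum over \<open>B'\<close> in the formula for the rotation generators is
      a known sum over the full basis with the \<xi> terms split off. In the total the terms with t
      * t times the second derivative cancel.\<close>
    have s1: "(\<Sum>u\<in>B'. (u \<bullet> x)\<^sup>2) = 1 - t\<^sup>2"
      using orthonormal_basis_norm2[OF B(1), of x] x split[of "\<lambda>u. (u \<bullet> x)\<^sup>2"] by simp
    have s2: "(\<Sum>v\<in>B'. dirderiv v (dirderiv v p) x) = - ?r"
      using laplacian_orthonormal_basis[OF p B(1), of x] harm split[of "\<lambda>v. dirderiv v (dirderiv v p) x"]
      by (simp add: eq_neg_iff_add_eq_0 add.commute)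
    have s3: "(\<Sum>u\<in>B'. complex_of_real (u \<bullet> x) * dirderiv u p x) = ?n * ?p - ?T * ?q"
      using orthonormal_basis_dirderiv[OF B(1) dp, of x x] split[of "\<lambda>u. complex_of_real (u \<bullet> x) * dirderiv u p x"]
        x euler_identity[OF p, of x] by (simp add: algebra_simps)
    \<comment> \<open>Truncation at \<open>n = 0\<close> is harmless because the derivative of a
      constant vanishes.\<close>
    have e: "of_nat (n - 1) * ?q = (?n - 1) * ?q"
      using homogeneous_polys_0_dirderiv[of p] p by (cases n) auto
    have s4: "(\<Sum>u\<in>B'. complex_of_real (u \<bullet> x) * dirderiv u (dirderiv \<xi> p) x) = (?n - 1) * ?q - ?T * ?r"
      using orthonormal_basis_dirderiv[OF B(1), of "dirderiv \<xi> p" x x, OF homogeneous_polys_differentiable[OF q]]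
        split[of "\<lambda>u. complex_of_real (u \<bullet> x) * dirderiv u (dirderiv \<xi> p) x"]
        x euler_identity[OF q, of x] e by (simp add: algebra_simps)
    have s5: "(\<Sum>v\<in>B'. complex_of_real (v \<bullet> x) * dirderiv \<xi> (dirderiv v p) x) = (?n - 1) * ?q - ?T * ?r"
    proof -
      have "(\<Sum>v\<in>B'. complex_of_real (v \<bullet> x) * dirderiv \<xi> (dirderiv v p) x) =
          (\<Sum>v\<in>B'. complex_of_real (v \<bullet> x) * dirderiv v (dirderiv \<xi> p) x)"
        by (intro sum.cong refl arg_cong2[where f = "(*)"] dirderiv_commute[OF p])
      with s4 show ?thesis by (rule trans[rotated])
    qed
    have "?n * (?n - 1) * ?p = (\<Sum>u\<in>B. complex_of_real (u \<bullet> x) * (\<Sum>v\<in>B. complex_of_real (v \<bullet> x) * dirderiv u (dirderiv v p) x))"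
      using second_euler_identity[OF p B(1), of x] by (simp add: sum_distrib_left)
    also have "\<dots> = ?T * (?T * ?r + ((?n - 1) * ?q - ?T * ?r)) +
        (\<Sum>u\<in>B'. complex_of_real (u \<bullet> x) * (?T * dirderiv u (dirderiv \<xi> p) x +
          (\<Sum>v\<in>B'. complex_of_real (v \<bullet> x) * dirderiv u (dirderiv v p) x)))"
      by (simp only: split x(2) s5)
    also have "\<dots> = ?T * (?T * ?r + ((?n - 1) * ?q - ?T * ?r)) + ?T * ((?n - 1) * ?q - ?T * ?r) +
       (\<Sum>u\<in>B'. \<Sum>v\<in>B'. complex_of_real (u \<bullet> x) * (complex_of_real (v \<bullet> x) * dirderiv u (dirderiv v p) x))"
      unfolding s4[symmetric] by (simp add: distrib_left sum.distrib sum_distrib_left mult_ac)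
    finally have s6: "(\<Sum>u\<in>B'. \<Sum>v\<in>B'. complex_of_real (u \<bullet> x) * (complex_of_real (v \<bullet> x) * dirderiv u (dirderiv v p) x)) =
        ?n * (?n - 1) * ?p - 2 * ?T * (?n - 1) * ?q + ?T\<^sup>2 * ?r"
      by (simp add: algebra_simps power2_eq_square)
    have fB': "finite B'" using fB by (simp add: B'_def)
    have ortho': "u \<bullet> v = (if u = v then 1 else 0)" if "u \<in> B'" "v \<in> B'" for u v
      using ortho[of u v] that by (simp add: B'_def)
    have "(\<Sum>u\<in>B'. \<Sum>v\<in>B'. rot_deriv u v (rot_deriv u v p) x) =
      2 * (complex_of_real (\<Sum>u\<in>B'. (u \<bullet> x)\<^sup>2) * (\<Sum>v\<in>B'. dirderiv v (dirderiv v p) x)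
      - (\<Sum>u\<in>B'. \<Sum>v\<in>B'. complex_of_real (u \<bullet> x) * (complex_of_real (v \<bullet> x) * dirderiv u (dirderiv v p) x))
      - (of_nat (card B') - 1) * (\<Sum>u\<in>B'. complex_of_real (u \<bullet> x) * dirderiv u p x))"
      by (rule sum_rot_deriv_rot_deriv_poly[OF p fB']) (rule ortho')
    then show ?thesis
      unfolding s1 s2 s3 s6 cB' by (simp add: algebra_simps power2_eq_square)
  qed
  have "0 = (\<Sum>u\<in>B'. \<Sum>v\<in>B'. sphere_integral M (rot_deriv u v (rot_deriv u v p)))" by (simp add: zero)
  also have "\<dots> = sphere_integral M (\<lambda>x. \<Sum>u\<in>B'. \<Sum>v\<in>B'. rot_deriv u v (rot_deriv u v p) x)"
  proof -
    have "sphere_integral M (\<lambda>x. \<Sum>u\<in>B'. \<Sum>v\<in>B'. rot_deriv u v (rot_deriv u v p) x) =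
      (\<integral>x. (\<Sum>u\<in>B'. \<Sum>v\<in>B'. indicator (sphere 0 1) x *\<^sub>R rot_deriv u v (rot_deriv u v p) x) \<partial>M)"
      by (simp only: scaleR_sum_right)
    also have "\<dots> = (\<Sum>u\<in>B'. \<integral>x. (\<Sum>v\<in>B'. indicator (sphere 0 1) x *\<^sub>R rot_deriv u v (rot_deriv u v p) x) \<partial>M)"
      by (intro Bochner_Integration.integral_sum Bochner_Integration.integrable_sum intg contLL)
    also have "\<dots> = (\<Sum>u\<in>B'. \<Sum>v\<in>B'. sphere_integral M (rot_deriv u v (rot_deriv u v p)))"
      by (intro sum.cong refl Bochner_Integration.integral_sum intg contLL)
    finally show ?thesis by simp
  qed
  also have "\<dots> = sphere_integral M ?R"
  proof (rule integral_cong_AE)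
    show "AE x in M. indicator (sphere 0 1) x *\<^sub>R (\<Sum>u\<in>B'. \<Sum>v\<in>B'. rot_deriv u v (rot_deriv u v p) x) =
        indicator (sphere 0 1) x *\<^sub>R ?R x"
      using AEM by eventually_elim (simp only: point)
    show "(\<lambda>x. indicator (sphere 0 1) x *\<^sub>R (\<Sum>u\<in>B'. \<Sum>v\<in>B'. rot_deriv u v (rot_deriv u v p) x)) \<in> borel_measurable M"
      by (rule borel_measurable_integrable[OF intg]) (intro continuous_intros contLL)
    show "(\<lambda>x. indicator (sphere 0 1) x *\<^sub>R ?R x) \<in> borel_measurable M"
      by (rule borel_measurable_integrable[OF intg]) (intro continuous_intros contH[OF p] contH[OF q] contH[OF r])
  qed
  also have "sphere_integral M ?R = (\<integral>x. 2 * (- (indicator (sphere 0 1) x *\<^sub>R dirderiv \<xi> (dirderiv \<xi> p) x)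
      - of_nat n * (of_nat n + of_nat CARD('d) - 3) * (indicator (sphere 0 1) x *\<^sub>R p x)
      + (2 * of_nat n + of_nat CARD('d) - 4) * complex_of_real t * (indicator (sphere 0 1) x *\<^sub>R dirderiv \<xi> p x)) \<partial>M)"
    by (intro Bochner_Integration.integral_cong refl) (simp add: indicator_def)
  also have "\<dots> = 2 * (- sphere_mean (dirderiv \<xi> (dirderiv \<xi> p)) \<xi> t
      - of_nat n * (of_nat n + of_nat CARD('d) - 3) * sphere_mean p \<xi> t
      + (2 * of_nat n + of_nat CARD('d) - 4) * complex_of_real t * sphere_mean (dirderiv \<xi> p) \<xi> t)"
  proof -
    have lin: "(\<integral>x. k * (- f x - b * g x + c * h x) \<partial>M) =
        k * (- (\<integral>x. f x \<partial>M) - b * (\<integral>x. g x \<partial>M) + c * (\<integral>x. h x \<partial>M))"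
      if "integrable M f" "integrable M g" "integrable M h" for f g h :: "real^'d \<Rightarrow> complex" and k b c
      using that by simp
    show ?thesis
      unfolding mean[OF p] mean[OF q] mean[OF r]
      by (rule lin[OF intg[OF contH[OF r]] intg[OF contH[OF p]] intg[OF contH[OF q]]])
  qed
  finally have "- sphere_mean (dirderiv \<xi> (dirderiv \<xi> p)) \<xi> t
      - of_nat n * (of_nat n + of_nat CARD('d) - 3) * sphere_mean p \<xi> t
      + (2 * of_nat n + of_nat CARD('d) - 4) * complex_of_real t * sphere_mean (dirderiv \<xi> p) \<xi> t = 0"
    by (metis mult_eq_0_iff zero_neq_numeral)
  then show ?thesis by (simp add: algebra_simps)
qed

section \<open>The multipliers\<close>

abbreviation iter_deriv :: "nat \<Rightarrow> (real \<Rightarrow> complex) \<Rightarrow> real \<Rightarrow> complex" where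
  "iter_deriv j g \<equiv> ((\<lambda>g t. vector_derivative g (at t)) ^^ j) g"

lemma vector_derivative_cong_open:
  fixes g h :: "real \<Rightarrow> complex"
  assumes "open U" "t \<in> U" "\<And>x. x \<in> U \<Longrightarrow> g x = h x"
  shows "vector_derivative g (at t) = vector_derivative h (at t)"
  using assms by (intro vector_derivative_cong_eq eventually_nhds_in_open[THEN eventually_mono]) auto

lemma iter_deriv_cong:
  assumes "open U" "\<And>x. x \<in> U \<Longrightarrow> g x = h x" "t \<in> U"
  shows "iter_deriv j g t = iter_deriv j h t"
  using assms(3)
proof (induction j arbitrary: t)
  case 0
  then show ?case using assms(2) by simp
next
  case (Suc j)
  then show ?case using vector_derivative_cong_open[OF assms(1) Suc.prems Suc.IH] by simp
qed

lemma Ck_has_vector_derivative: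
  fixes g :: "real \<Rightarrow> complex"
  assumes "Ck (Suc k) g U" "t \<in> U"
  shows "(g has_vector_derivative vector_derivative g (at t)) (at t)"
    "vector_derivative g (at t) = frechet_derivative g (at t) 1"
proof -
  have D: "(g has_derivative frechet_derivative g (at t)) (at t)" by (rule Ck_derivative[OF assms])
  interpret linear "frechet_derivative g (at t)"
    by (rule bounded_linear.linear[OF has_derivative_bounded_linear[OF D]])
  have "frechet_derivative g (at t) = (\<lambda>h. h *\<^sub>R frechet_derivative g (at t) 1)"
  proof
    fix h show "frechet_derivative g (at t) h = h *\<^sub>R frechet_derivative g (at t) 1"
      using scaleR[of h 1] by simp
  qed
  then have V: "(g has_vector_derivative frechet_derivative g (at t) 1) (at t)"
    using D by (metis has_vector_derivative_def)
  then show "vector_derivative g (at t) = frechet_derivative g (at t) 1" by (rule vector_derivative_at)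
  with V show "(g has_vector_derivative vector_derivative g (at t)) (at t)" by simp
qed

lemma Ck_iter_deriv:
  fixes g :: "real \<Rightarrow> complex"
  assumes "\<And>k. Ck k g U" "open U"
  shows "Ck k (iter_deriv j g) U"
proof (induction j arbitrary: k)
  case 0
  then show ?case using assms(1) by simp
next
  case (Suc j)
  have "Ck k (\<lambda>t. frechet_derivative (iter_deriv j g) (at t) 1) U" using Suc[of "Suc k"] by simp
  then have "Ck k (\<lambda>t. vector_derivative (iter_deriv j g) (at t)) U"
    by (rule Ck_cong[OF assms(2), rotated]) (simp add: Ck_has_vector_derivative(2)[OF Suc[of "Suc 0"]])
  then show ?case by simp
qed

lemma iter_deriv_has_vector_derivative:
  assumes "\<And>k. Ck k g U" "open U" "t \<in> U"
  shows "(iter_deriv j g has_vector_derivative iter_deriv (Suc j) g t) (at t)"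
proof -
  have "Ck (Suc 0) (iter_deriv j g) U" by (rule Ck_iter_deriv[OF assms(1,2)])
  from Ck_has_vector_derivative(1)[OF this assms(3)] show ?thesis unfolding funpow.simps comp_def .
qed

lemma iter_deriv_cmult:
  assumes "\<And>k. Ck k g U" "open U" "t \<in> U"
  shows "iter_deriv j (\<lambda>t. c * g t) t = c * iter_deriv j g t"
  using assms(3)
proof (induction j arbitrary: t)
  case (Suc j)
  have "vector_derivative (iter_deriv j (\<lambda>t. c * g t)) (at t) = vector_derivative (\<lambda>t. c * iter_deriv j g t) (at t)"
    by (rule vector_derivative_cong_open[OF assms(2) Suc.prems Suc.IH])
  also have "\<dots> = c * iter_deriv (Suc j) g t"
    by (intro vector_derivative_at has_vector_derivative_mult_right iter_deriv_has_vector_derivative[OF assms(1,2) Suc.prems])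
  finally show ?case by simp
qed simp

text \<open>This is \<open>eq\<close> differentiated \<open>j\<close> times. The weight 1 - t * t
  has only two nonzero derivatives, which give 2jt and j(j - 1); the linear factor
  \<open>c * t\<close> adds ct and jc. For \<open>j = 0\<close> the truncated index in the last term
  is multiplied by 0.\<close>

lemma leibniz_first_order:
  fixes A B :: "nat \<Rightarrow> real \<Rightarrow> complex"
  assumes I: "open I"
    and A: "\<And>j t. t \<in> I \<Longrightarrow> (A j has_vector_derivative A (Suc j) t) (at t)"
    and B: "\<And>j t. t \<in> I \<Longrightarrow> (B j has_vector_derivative B (Suc j) t) (at t)"
    and eq: "\<And>t. t \<in> I \<Longrightarrow> complex_of_real (1 - t\<^sup>2) * A 1 t = B 0 t + c * complex_of_real t * A 0 t"
    and t: "t \<in> I"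
  shows "complex_of_real (1 - t\<^sup>2) * A (Suc j) t = B j t + (2 * of_nat j + c) * complex_of_real t * A j t
    + of_nat j * (of_nat j - 1 + c) * A (j - 1) t"
  using t
proof (induction j arbitrary: t)
  case 0
  then show ?case using eq by simp
next
  case (Suc j)
  have d1: "((\<lambda>t. complex_of_real (1 - t\<^sup>2) * A (Suc j) t) has_vector_derivative
      (complex_of_real (1 - t\<^sup>2) * A (Suc (Suc j)) t + complex_of_real (- 2 * t) * A (Suc j) t)) (at t)"
    by (rule has_vector_derivative_mult[OF _ A[OF Suc.prems]])
      (auto intro!: derivative_eq_intros simp: has_vector_derivative_def fun_eq_iff scaleR_conv_of_real)
  have dA: "((\<lambda>t. of_nat j * (of_nat j - 1 + c) * A (j - 1) t) has_vector_derivative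
      of_nat j * (of_nat j - 1 + c) * A j t) (at t)"
  proof (cases j)
    case (Suc i)
    show ?thesis unfolding Suc using A[OF Suc.prems, of i] by (intro has_vector_derivative_mult_right) simp
  qed simp
  have d2: "((\<lambda>t. complex_of_real t * A j t) has_vector_derivative
      (complex_of_real t * A (Suc j) t + 1 * A j t)) (at t)"
    by (rule has_vector_derivative_mult[OF _ A[OF Suc.prems]])
      (auto intro!: derivative_eq_intros simp: has_vector_derivative_def fun_eq_iff scaleR_conv_of_real)
  have d3: "((\<lambda>t. B j t + (2 * of_nat j + c) * (complex_of_real t * A j t)
    + of_nat j * (of_nat j - 1 + c) * A (j - 1) t) has_vector_derivative
     (B (Suc j) t + (2 * of_nat j + c) * (complex_of_real t * A (Suc j) t + 1 * A j t)
      + of_nat j * (of_nat j - 1 + c) * A j t)) (at t)"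
    by (intro has_vector_derivative_add has_vector_derivative_mult_right B[OF Suc.prems] d2 dA)
  have "((\<lambda>t. complex_of_real (1 - t\<^sup>2) * A (Suc j) t) has_vector_derivative
     (B (Suc j) t + (2 * of_nat j + c) * (complex_of_real t * A (Suc j) t + 1 * A j t)
      + of_nat j * (of_nat j - 1 + c) * A j t)) (at t)"
  proof (rule has_vector_derivative_transform_within_open[OF d3 I Suc.prems])
    fix y assume "y \<in> I"
    from Suc.IH[OF this] show "B j y + (2 * of_nat j + c) * (complex_of_real y * A j y)
      + of_nat j * (of_nat j - 1 + c) * A (j - 1) y = complex_of_real (1 - y\<^sup>2) * A (Suc j) y"
      by (simp only: mult.assoc)
  qed
  from vector_derivative_unique_at[OF d1 this] show ?case
    by (simp add: algebra_simps)
qed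

text \<open>At \<open>t = 0\<close> every term with a factor \<open>t\<close> drops out, leaving two
  coupled recursions. In the application \<open>N\<close> is n + d - 3, while \<open>W\<close> and
  \<open>V\<close> list the derivatives of the weighted means of \<open>p\<close> and of its
  derivative in direction \<xi>.\<close>

lemma gegenbauer_system:
  fixes W V :: "nat \<Rightarrow> real \<Rightarrow> complex"
  assumes I: "open I" "0 \<in> I"
    and W: "\<And>j t. t \<in> I \<Longrightarrow> (W j has_vector_derivative W (Suc j) t) (at t)"
    and V: "\<And>j t. t \<in> I \<Longrightarrow> (V j has_vector_derivative V (Suc j) t) (at t)"
    and eW: "\<And>t. t \<in> I \<Longrightarrow> complex_of_real (1 - t\<^sup>2) * W 1 t = V 0 t + (- N) * complex_of_real t * W 0 t"
    and eV: "\<And>t. t \<in> I \<Longrightarrow> complex_of_real (1 - t\<^sup>2) * V 1 t = (- n * N) * W 0 t + n * complex_of_real t * V 0 t"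
  shows "W (Suc (Suc j)) 0 = (of_nat j + 1 + n) * (of_nat j - N) * W j 0"
proof -
  have rW: "W (Suc j) 0 = V j 0 + of_nat j * (of_nat j - 1 - N) * W (j - 1) 0" for j
    using leibniz_first_order[OF I(1) W V eW I(2), of j] by simp
  have rV: "V (Suc j) 0 = (- n * N) * W j 0 + of_nat j * (of_nat j - 1 + n) * V (j - 1) 0" for j
    using leibniz_first_order[OF I(1) V has_vector_derivative_mult_right[OF W] eV I(2), of j] by simp
  \<comment> \<open>This closed form decouples the system. The recursion for \<open>V\<close> goes
    back by two, and there \<open>rW\<close> reassembles the hypothesis for \<open>i\<close> into a
    multiple of \<open>W j 0\<close>.\<close>
  have V1: "V (Suc j) 0 = n * (of_nat j - N) * W j 0" for j
  proof (induction j rule: less_induct)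
    case (less j)
    consider "j = 0" | "j = 1" | i where "j = Suc (Suc i)" by (metis One_nat_def not0_implies_Suc)
    then show ?case
    proof cases
      case 1
      then show ?thesis using rV[of 0] by simp
    next
      case 2
      then show ?thesis using rV[of 1] rW[of 0] by (simp add: algebra_simps)
    next
      case 3
      have a: "V (Suc i) 0 = n * (of_nat i - N) * W i 0" using less 3 by simp
      have b: "W j 0 = (of_nat i + 1 + n) * (of_nat i - N) * W i 0"
        using rW[of "Suc i"] unfolding a 3 by (simp add: algebra_simps)
      have "V (Suc j) 0 = (- n * N) * W j 0 + of_nat j * (of_nat j - 1 + n) * (n * (of_nat i - N) * W i 0)"
        using rV[of j] 3 a by simp
      also have "of_nat j * (of_nat j - 1 + n) * (n * (of_nat i - N) * W i 0) = of_nat j * n * W j 0"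
        unfolding b by (simp add: 3 algebra_simps)
      finally show ?thesis by (simp add: algebra_simps)
    qed
  qed
  show ?thesis using rW[of "Suc j"] unfolding V1 by (simp add: algebra_simps)
qed

text \<open>Up to the factor \<open>p \<xi>\<close> and the total mass of the equator, \<open>funk_mult d n j\<close> is the \<open>j\<close>-th derivative
  at \<open>t = 0\<close> of the weighted mean of a harmonic polynomial \<open>p\<close> of degree \<open>n\<close> over the parallel at height \<open>t\<close>.
  The recursion in \<open>j\<close> is that of \<open>gegenbauer_system\<close>.\<close>

definition legendre_prod :: "nat \<Rightarrow> nat \<Rightarrow> real" where
  "legendre_prod d k = (\<Prod>i<k. (2 * real i + 1) / (2 * real i + real d - 1))"

fun funk_mult :: "nat \<Rightarrow> nat \<Rightarrow> nat \<Rightarrow> real" where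
  "funk_mult d n 0 = (if even n then (- 1) ^ (n div 2) * legendre_prod d (n div 2) else 0)"
| "funk_mult d n (Suc 0) = (if odd n then (- 1) ^ (n div 2) * legendre_prod d (n div 2) * real n else 0)"
| "funk_mult d n (Suc (Suc j)) = (real j + 1 + real n) * (real j - (real n + real d - 3)) * funk_mult d n j"

lemma legendre_prod_pos: "d \<ge> 2 \<Longrightarrow> legendre_prod d k > 0"
  unfolding legendre_prod_def by (intro prod_pos divide_pos_pos ballI) auto

text \<open>The first factor of the recursion is positive and the second vanishes exactly for j + 3
  = n + d, which for even n + j forces \<open>d\<close> to be odd. Once it has occurred, a zero
  persists for all larger orders of the same parity, whence an inequality and not an equation for
  \<open>n\<close>.\<close>

lemma funk_mult_eq_0_iff:
  assumes "d \<ge> 3"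
  shows "funk_mult d n j = 0 \<longleftrightarrow> odd (n + j) \<or> (int n \<le> int j - int d + 1 \<and> odd d)"
  using assms
proof (induction d n j rule: funk_mult.induct)
  case (1 d n)
  then show ?case using legendre_prod_pos[of d "n div 2"] by auto
next
  case (2 d n)
  then have "n \<noteq> 0" if "odd n" using that by (cases n) auto
  then show ?case using 2 legendre_prod_pos[of d "n div 2"] by auto
next
  case (3 d n j)
  have "real j + 1 + real n \<noteq> 0" by linarith
  moreover have "real j - (real n + real d - 3) = 0 \<longleftrightarrow> j + 3 = n + d" by linarith
  ultimately have "funk_mult d n (Suc (Suc j)) = 0 \<longleftrightarrow>
      j + 3 = n + d \<or> odd (n + j) \<or> (int n \<le> int j - int d + 1 \<and> odd d)"
    using 3 by simp
  also have "\<dots> \<longleftrightarrow> odd (n + Suc (Suc j)) \<or> (int n \<le> int (Suc (Suc j)) - int d + 1 \<and> odd d)"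
    by presburger
  finally show ?case .
qed

text \<open>Each factor is 1 - \<delta> / z with z = k + (d - 1) / 2, hence at most exp (- \<delta>
  / z), which in turn is at most the power \<delta> of z / (z + 1) because ln (1 + 1/z) is at most
  1/z. These powers telescope.\<close>

lemma legendre_prod_bound:
  assumes d: "d \<ge> 3"
  shows "legendre_prod d k \<le> ((real d - 1) / (2 * real k + real d - 1)) powr ((real d - 2) / 2)"
proof (induction k)
  case 0
  then show ?case using d by (simp add: legendre_prod_def)
next
  case (Suc k)
  let ?\<delta> = "(real d - 2) / 2" let ?z = "(2 * real k + real d - 1) / 2"
  have z: "?z > 0" using d by simp
  have "(2 * real k + 1) / (2 * real k + real d - 1) = 1 + - (?\<delta> / ?z)"
    using d by (simp add: field_simps)
  also have "\<dots> \<le> exp (- (?\<delta> / ?z))" by (rule exp_ge_add_one_self)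
  also have "\<dots> \<le> exp (?\<delta> * - ln (1 + 1 / ?z))"
    using mult_left_mono[OF ln_add_one_self_le_self[of "1 / ?z"], of ?\<delta>] z d by simp
  also have "- ln (1 + 1 / ?z) = ln ((2 * real k + real d - 1) / (2 * real (Suc k) + real d - 1))"
    using d by (simp add: ln_inverse[symmetric] field_simps)
  also have "exp (?\<delta> * \<dots>) = ((2 * real k + real d - 1) / (2 * real (Suc k) + real d - 1)) powr ?\<delta>"
    using d by (simp add: powr_def)
  finally have "legendre_prod d (Suc k) \<le> ((real d - 1) / (2 * real k + real d - 1)) powr ?\<delta> *
      ((2 * real k + real d - 1) / (2 * real (Suc k) + real d - 1)) powr ?\<delta>"
    using mult_mono[OF Suc.IH, of "(2 * real k + 1) / (2 * real k + real d - 1)"] d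
    by (simp add: legendre_prod_def)
  also have "\<dots> = ((real d - 1) / (2 * real k + real d - 1) *
      ((2 * real k + real d - 1) / (2 * real (Suc k) + real d - 1))) powr ?\<delta>"
    using d by (subst powr_mult) auto
  also have "(real d - 1) / (2 * real k + real d - 1) *
      ((2 * real k + real d - 1) / (2 * real (Suc k) + real d - 1)) = (real d - 1) / (2 * real (Suc k) + real d - 1)"
    using d by simp
  finally show ?case .
qed

lemma legendre_prod_decay:
  assumes d: "d \<ge> 3"
  shows "legendre_prod d (n div 2) \<le>
    (real d - 1) powr ((real d - 2) / 2) * (real n + (real d - 2) / 2) powr (- ((real d - 2) / 2))"
proof -
  let ?\<delta> = "(real d - 2) / 2" let ?k = "n div 2"
  have "real n \<le> 2 * real ?k + 1" by linarith
  then have le: "real n + ?\<delta> \<le> 2 * real ?k + real d - 1" using d by (simp add: field_simps)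
  have "legendre_prod d ?k \<le> ((real d - 1) / (2 * real ?k + real d - 1)) powr ?\<delta>"
    by (rule legendre_prod_bound[OF d])
  also have "\<dots> \<le> ((real d - 1) / (real n + ?\<delta>)) powr ?\<delta>"
    using d le by (intro powr_mono2 divide_left_mono mult_pos_pos add_nonneg_pos) auto
  also have "\<dots> = (real d - 1) powr ?\<delta> * (real n + ?\<delta>) powr (- ?\<delta>)"
    using d by (subst powr_divide) (auto simp only: powr_minus divide_inverse)
  finally show ?thesis .
qed

text \<open>Two more derivatives contribute two factors that are linear in \<open>n\<close>, so the
  exponent grows by 2; the initial exponents are the decay of the Wallis-type product and, for order
  one, that plus 1.\<close>

lemma funk_mult_bound:
  assumes "d \<ge> 3"
  shows "\<exists>C\<ge>0. \<forall>n. \<bar>funk_mult d n j\<bar> \<le> C * (real n + (real d - 2) / 2) powr (real j - (real d - 2) / 2)"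
proof -
  let ?\<delta> = "(real d - 2) / 2" let ?Q = "(real d - 1) powr ?\<delta>"
  have \<delta>: "?\<delta> \<ge> 1/2" using assms by simp
  have base: "\<bar>funk_mult d n 0\<bar> \<le> ?Q * (real n + ?\<delta>) powr (- ?\<delta>)"
    "\<bar>funk_mult d n 1\<bar> \<le> ?Q * (real n + ?\<delta>) powr (1 - ?\<delta>)" for n
  proof -
    have q: "0 < legendre_prod d (n div 2)" using assms by (intro legendre_prod_pos) simp
    show "\<bar>funk_mult d n 0\<bar> \<le> ?Q * (real n + ?\<delta>) powr (- ?\<delta>)"
      using legendre_prod_decay[OF assms, of n] q by (auto simp: abs_mult power_abs)
    have "\<bar>funk_mult d n 1\<bar> \<le> legendre_prod d (n div 2) * real n"
      using q by (auto simp: abs_mult power_abs)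
    also have "\<dots> \<le> (?Q * (real n + ?\<delta>) powr (- ?\<delta>)) * (real n + ?\<delta>)"
      using legendre_prod_decay[OF assms, of n] q \<delta> by (intro mult_mono) auto
    also have "\<dots> = ?Q * (real n + ?\<delta>) powr (1 - ?\<delta>)"
    proof -
      have "x powr (- a) * x = x powr (1 - a)" if "x > 0" for x a :: real
        using that by (simp add: powr_diff powr_minus divide_inverse)
      from this[of "real n + ?\<delta>" "?\<delta>"] \<delta> show ?thesis by (simp only: mult.assoc)
    qed
    finally show "\<bar>funk_mult d n 1\<bar> \<le> ?Q * (real n + ?\<delta>) powr (1 - ?\<delta>)" .
  qed
  show ?thesis
  proof (induction j rule: less_induct)
    case (less j)
    consider "j = 0" | "j = 1" | i where "j = Suc (Suc i)" by (metis One_nat_def not0_implies_Suc)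
    then show ?case
    proof cases
      case 1
      then show ?thesis using base(1) by (intro exI[of _ ?Q]) auto
    next
      case 2
      then show ?thesis using base(2) by (intro exI[of _ ?Q]) auto
    next
      case 3
      then obtain C where C: "C \<ge> 0" "\<And>n. \<bar>funk_mult d n i\<bar> \<le> C * (real n + ?\<delta>) powr (real i - ?\<delta>)"
        using less[of i] by auto
      \<comment> \<open>As x is at least 1/2, a constant is at most twice itself times x; together
        with n \<le> x this gives both linear bounds.\<close>
      define A where "A = 2 * real i + 3"
      define B where "B = 2 * (real i + real d) + 1"
      have "\<bar>funk_mult d n j\<bar> \<le> (A * B * C) * (real n + ?\<delta>) powr (real j - ?\<delta>)" for n
      proof -
        define x where "x = real n + ?\<delta>"
        have x: "x \<ge> 1/2" "x \<ge> real n" using \<delta> of_nat_0_le_iff[of n] unfolding x_def by linarith+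
        have "(real i + 1) * 1 \<le> (real i + 1) * (2 * x)" using x by (intro mult_left_mono) auto
        then have a: "\<bar>real i + 1 + real n\<bar> \<le> A * x" using x by (simp add: A_def algebra_simps)
        have "(real i + real d) * 1 \<le> (real i + real d) * (2 * x)" using x by (intro mult_left_mono) auto
        then have b: "\<bar>real i - (real n + real d - 3)\<bar> \<le> B * x"
          using x assms by (simp add: B_def algebra_simps)
        have "\<bar>funk_mult d n j\<bar> = \<bar>real i + 1 + real n\<bar> * \<bar>real i - (real n + real d - 3)\<bar> * \<bar>funk_mult d n i\<bar>"
          by (simp add: 3 abs_mult)
        also have "\<dots> \<le> (A * x) * (B * x) * (C * x powr (real i - ?\<delta>))"
          using a b C(2)[of n] x C(1) by (intro mult_mono) (auto simp: x_def[symmetric] A_def B_def)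
        also have "\<dots> = (A * B * C) * (x powr 2 * x powr (real i - ?\<delta>))"
          using x by (simp add: power2_eq_square powr_numeral)
        also have "x powr 2 * x powr (real i - ?\<delta>) = x powr (real j - ?\<delta>)"
          by (simp add: powr_add[symmetric] 3 add_diff_eq)
        finally show ?thesis by (simp add: x_def)
      qed
      moreover have "A * B * C \<ge> 0" using C by (simp add: A_def B_def)
      ultimately show ?thesis by blast
    qed
  qed
qed

section \<open>Means of spherical harmonics\<close>

lemma dirderiv_harmonic:
  assumes "p \<in> homogeneous_polys n" "\<And>x. laplacian p x = 0"
  shows "laplacian (dirderiv v p) x = 0"
proof -
  have "laplacian p = (\<lambda>x. 0)" using assms(2) by auto
  then show ?thesis using laplacian_dirderiv[OF assms(1), of v] by (simp add: frechet_derivative_const)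
qed

text \<open>For d = 3 this is the Legendre polynomial of degree \<open>n\<close> at 0, in general
  the Gegenbauer polynomial normalised to the value 1 at 1.\<close>

definition equator_mult :: "nat \<Rightarrow> nat \<Rightarrow> real" where
  "equator_mult d n = (if even n then (- 1) ^ (n div 2) * legendre_prod d (n div 2) else 0)"

text \<open>At height 0 the formula for the second derivative loses its first-order term. The second
  derivative in direction \<xi> is harmonic of degree n - 2 and, by Euler's identity used twice,
  takes the value n(n - 1) p(\<xi>) at \<xi>; so the mean descends by two degrees. In degree 1 it
  vanishes since d - 2 is not 0.\<close>

lemma sphere_mean_equator:
  fixes p :: "real^'d::finite \<Rightarrow> complex"
  assumes \<xi>: "norm \<xi> = 1" and d: "CARD('d) \<ge> 3" and p: "p \<in> homogeneous_polys n"
    and harm: "\<And>x. laplacian p x = 0"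
  shows "sphere_mean p \<xi> 0 = complex_of_real (equator_mult CARD('d) n * equator_mass \<xi>) * p \<xi>"
  using p harm
proof (induction n arbitrary: p rule: less_induct)
  case (less n)
  note p = less.prems(1) and harm = less.prems(2)
  let ?q = "dirderiv \<xi> p" let ?r = "dirderiv \<xi> ?q" let ?d = "CARD('d)"
  note q = homogeneous_polys_dirderiv[OF p, of \<xi>]
  note r = homogeneous_polys_dirderiv[OF q, of \<xi>]
  have rec: "sphere_mean ?r \<xi> 0 = - of_nat n * (of_nat n + of_nat ?d - 3) * sphere_mean p \<xi> 0"
    using sphere_mean_second_derivative[OF \<xi> _ _ p harm, of 0] d by simp
  consider "n = 0" | "n = 1" | k where "n = Suc (Suc k)" by (metis One_nat_def not0_implies_Suc)
  then show ?case
  proof cases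
    case 1
    then obtain c where c: "p = (\<lambda>x. c)" using homogeneous_polys_0_const p by blast
    have "sphere_mean p \<xi> 0 = complex_of_real (equator_mass \<xi>) * c"
      by (simp add: sphere_mean_def c equator_mass_def scaleR_conv_of_real)
    with 1 show ?thesis by (simp add: equator_mult_def legendre_prod_def c)
  next
    case 2
    then have "?r x = 0" for x using homogeneous_polys_0_dirderiv[of ?q] q by simp
    then have "sphere_mean ?r \<xi> 0 = 0" by (simp add: sphere_mean_def)
    moreover have "complex_of_nat ?d - 2 \<noteq> 0"
    proof -
      have "complex_of_nat ?d \<noteq> of_nat 2" using d unfolding of_nat_eq_iff by simp
      then show ?thesis by simp
    qed
    ultimately show ?thesis using rec 2 by (simp add: equator_mult_def)
  next
    case 3
    have rk: "?r \<in> homogeneous_polys k" using r 3 by simp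
    have rh: "laplacian ?r x = 0" for x by (rule dirderiv_harmonic[OF q dirderiv_harmonic[OF p harm]])
    have r\<xi>: "?r \<xi> = of_nat (k + 1) * (of_nat n * p \<xi>)"
      using euler_identity[OF q, of \<xi>] euler_identity[OF p, of \<xi>] 3 by simp
    have IH: "sphere_mean ?r \<xi> 0 = complex_of_real (equator_mult ?d k * equator_mass \<xi>) * ?r \<xi>"
      by (rule less.IH[OF _ rk rh]) (simp add: 3)
    define D where "D = real k + real ?d - 1"
    have D: "D > 0" using d by (simp add: D_def)
    have Dc: "complex_of_nat n + of_nat ?d - 3 = complex_of_real D" by (simp add: D_def 3)
    have e: "equator_mult ?d n * D = - (equator_mult ?d k * (real k + 1))"
    proof (cases "even k")
      case True
      then obtain i where i: "k = 2 * i" by auto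
      have "D = 2 * real i + real ?d - 1" by (simp add: D_def i)
      then show ?thesis using D True
        by (simp add: equator_mult_def 3 i legendre_prod_def)
    next
      case False
      then show ?thesis by (simp add: equator_mult_def 3)
    qed
    have "of_nat n * complex_of_real D * sphere_mean p \<xi> 0 =
        - (complex_of_real (equator_mult ?d k * (real k + 1)) * (complex_of_real (equator_mass \<xi>) * (of_nat n * p \<xi>)))"
      using rec unfolding Dc IH r\<xi> by (simp add: algebra_simps)
    also have "\<dots> = complex_of_real (equator_mult ?d n * D) * (complex_of_real (equator_mass \<xi>) * (of_nat n * p \<xi>))"
      unfolding e by simp
    also have "\<dots> = of_nat n * complex_of_real D * (complex_of_real (equator_mult ?d n * equator_mass \<xi>) * p \<xi>)"
      by (simp add: mult_ac)
    finally show ?thesis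
      using D 3 by (metis mult_cancel_left mult_eq_0_iff of_nat_eq_0_iff of_real_eq_0_iff less_irrefl nat.distinct(1))
  qed
qed

subsection \<open>Taylor expansion of a polynomial\<close>

lemma dirderiv_funpow_mem:
  assumes "p \<in> homogeneous_polys n"
  shows "((dirderiv v) ^^ k) p \<in> homogeneous_polys (n - k)"
proof (induction k)
  case (Suc k)
  from homogeneous_polys_dirderiv[OF this, of v] show ?case by simp
qed (use assms in simp)

lemma dirderiv_funpow_harmonic:
  assumes "p \<in> homogeneous_polys n" "\<And>x. laplacian p x = 0"
  shows "laplacian (((dirderiv v) ^^ k) p) x = 0"
proof (induction k arbitrary: x)
  case (Suc k)
  from dirderiv_harmonic[OF dirderiv_funpow_mem[OF assms(1)] this, of v] show ?case by simp
qed (use assms in simp)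

lemma dirderiv_funpow_self:
  assumes "p \<in> homogeneous_polys n" "k \<le> n"
  shows "((dirderiv v) ^^ k) p v = of_nat (\<Prod>i<k. n - i) * p v"
  using assms(2)
proof (induction k)
  case (Suc k)
  then show ?case
    using euler_identity[OF dirderiv_funpow_mem[OF assms(1), where v = v and k = k], of v]
    by (simp add: mult_ac)
qed simp

text \<open>By the induction on the degree both sides have the same derivative in \<open>z\<close>,
  and they agree at \<open>z = 0\<close>.\<close>

lemma poly_taylor:
  fixes p :: "real^'d::finite \<Rightarrow> complex"
  assumes "p \<in> homogeneous_polys n"
  shows "p (y + z *\<^sub>R v) = (\<Sum>k\<le>n. complex_of_real (z ^ k / fact k) * ((dirderiv v) ^^ k) p y)"
  using assms
proof (induction n arbitrary: p z)
  case 0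
  then show ?case using homogeneous_polys_0_const[of p] by auto
next
  case (Suc n)
  note q = homogeneous_polys_dirderiv[OF Suc.prems, of v]
  let ?h = "\<lambda>z. p (y + z *\<^sub>R v) - (\<Sum>k\<le>Suc n. complex_of_real (z ^ k / fact k) * ((dirderiv v) ^^ k) p y)"
  have d1: "((\<lambda>z. p (y + z *\<^sub>R v)) has_vector_derivative dirderiv v p (y + z *\<^sub>R v)) (at z)" for z
  proof -
    have pd: "(p has_derivative frechet_derivative p (at (y + z *\<^sub>R v))) (at (y + z *\<^sub>R v))"
      using homogeneous_polys_differentiable[OF Suc.prems] by (simp add: frechet_derivative_works)
    have "((\<lambda>z. y + z *\<^sub>R v) has_derivative (\<lambda>h. h *\<^sub>R v)) (at z)"
      by (auto intro!: derivative_eq_intros)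
    from has_derivative_compose[OF this pd] show ?thesis
      using linear_scale[OF bounded_linear.linear[OF has_derivative_bounded_linear[OF pd]]]
      by (simp add: has_vector_derivative_def)
  qed
  have d2: "((\<lambda>z. \<Sum>k\<le>Suc n. complex_of_real (z ^ k / fact k) * ((dirderiv v) ^^ k) p y) has_vector_derivative
      (\<Sum>k\<le>n. complex_of_real (z ^ k / fact k) * ((dirderiv v) ^^ k) (dirderiv v p) y)) (at z)" for z
  proof -
    have t: "((\<lambda>z. complex_of_real (z ^ k / fact k) * c) has_vector_derivative
        complex_of_real (real k * z ^ (k - 1) / fact k) * c) (at z)" for k and c :: complex
      by (intro has_vector_derivative_mult_left has_vector_derivative_of_real)
        (auto intro!: derivative_eq_intros simp: has_real_derivative_iff_has_vector_derivative[symmetric])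
    have "((\<lambda>z. \<Sum>k\<le>Suc n. complex_of_real (z ^ k / fact k) * ((dirderiv v) ^^ k) p y) has_vector_derivative
      (\<Sum>k\<le>Suc n. complex_of_real (real k * z ^ (k - 1) / fact k) * ((dirderiv v) ^^ k) p y)) (at z)"
      by (intro has_vector_derivative_sum t)
    also have "(\<Sum>k\<le>Suc n. complex_of_real (real k * z ^ (k - 1) / fact k) * ((dirderiv v) ^^ k) p y) =
      (\<Sum>k\<le>n. complex_of_real (real (Suc k) * z ^ k / fact (Suc k)) * ((dirderiv v) ^^ (Suc k)) p y)"
      by (subst sum.atMost_Suc_shift) simp
    also have "\<dots> = (\<Sum>k\<le>n. complex_of_real (z ^ k / fact k) * ((dirderiv v) ^^ k) (dirderiv v p) y)"
    proof (intro sum.cong refl arg_cong2[where f = "(*)"])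
      fix k
      show "complex_of_real (real (Suc k) * z ^ k / fact (Suc k)) = complex_of_real (z ^ k / fact k)"
        by (simp only: of_real_eq_iff) (simp add: field_simps del: of_nat_Suc)
      show "((dirderiv v) ^^ (Suc k)) p y = ((dirderiv v) ^^ k) (dirderiv v p) y"
        by (simp only: funpow_Suc_right comp_def)
    qed
    finally show ?thesis .
  qed
  have "(?h has_vector_derivative 0) (at z)" for z
    using has_vector_derivative_diff[OF d1 d2, of z] Suc.IH[OF q[simplified], of z] by simp
  then obtain c where c: "\<And>z. ?h z = c"
    using has_vector_derivative_zero_constant[of UNIV ?h] by auto
  have "c = ?h 0" by (simp only: c)
  also have "\<dots> = 0" by (subst sum.atMost_Suc_shift) (simp add: power_0_left)
  finally show ?case using c[of z] by simp
qed

lemma equator_mass_unique: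
  fixes \<xi> \<zeta> :: "real^'d::finite"
  assumes "norm \<xi> = 1" "norm \<zeta> = 1"
  shows "equator_mass \<xi> = equator_mass \<zeta>"
proof -
  obtain T where T: "orthogonal_transformation T" "T \<xi> = \<zeta>"
    using orthogonal_transformation_exists_1[OF assms] by blast
  have "measure (distr (equator_measure \<xi>) borel T) UNIV = measure (equator_measure \<xi>) UNIV"
    using orthogonal_transformation_measurable[OF T(1)]
    by (subst measure_distr) (auto cong: measurable_cong_sets)
  then show ?thesis by (simp add: equator_mass_def equator_measure_orthogonal[OF T(1)] T(2))
qed

text \<open>A point at height \<open>t\<close> is a multiple of an equatorial point shifted along
  \<xi>. Homogeneity and Taylor expansion in direction \<xi> reduce its mean to equatorial means of
  iterated derivatives of \<open>p\<close>, which are again harmonic and whose values at \<xi> are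
  multiples of p(\<xi>). Only the existence of a constant common to all \<open>p\<close> and \<xi>
  is used later.\<close>

lemma funk_hecke:
  fixes \<zeta> :: "real^'d::finite"
  assumes d: "CARD('d) \<ge> 3" and t: "\<bar>t\<bar> < 1" and \<zeta>: "norm \<zeta> = 1"
  shows "\<exists>c. \<forall>p \<xi>. p \<in> homogeneous_polys n \<longrightarrow> (\<forall>x. laplacian p x = 0) \<longrightarrow> norm (\<xi> :: real^'d) = 1 \<longrightarrow>
    sphere_mean p \<xi> t = c * p \<xi>"
proof -
  let ?c = "sqrt (1 - t\<^sup>2)" let ?d = "CARD('d)"
  have c: "?c > 0" using abs_less_1_sq[OF t] by simp
  define C where "C = complex_of_real ?c ^ n * (\<Sum>k\<le>n. complex_of_real ((t / ?c) ^ k / fact k) *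
    (complex_of_real (equator_mult ?d (n - k) * equator_mass \<zeta>) * of_nat (\<Prod>i<k. n - i)))"
  have "sphere_mean p \<xi> t = C * p \<xi>"
    if p: "p \<in> homogeneous_polys n" and harm: "\<forall>x. laplacian p x = 0" and \<xi>: "norm \<xi> = 1"
    for p and \<xi> :: "real^'d"
  proof -
    let ?D = "\<lambda>k. ((dirderiv \<xi>) ^^ k) p"
    note Dk = dirderiv_funpow_mem[OF p, where v = \<xi>]
    have d2: "CARD('d) \<ge> 2" using d by simp
    have cap: "p (cap_point \<xi> t w) = complex_of_real ?c ^ n *
        (\<Sum>k\<le>n. complex_of_real ((t / ?c) ^ k / fact k) * ?D k (cap_point \<xi> 0 w))" for w
    proof -
      have "cap_point \<xi> t w = ?c *\<^sub>R (w + (t / ?c) *\<^sub>R \<xi>)" using c by (simp add: cap_point_def algebra_simps)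
      then show ?thesis
        by (simp only: homogeneous_polys_homogeneous[OF p] poly_taylor[OF p]) (simp add: cap_point_def)
    qed
    have int: "integrable (equator_measure \<xi>) (\<lambda>w. indicator (sphere 0 1) w *\<^sub>R ?D k (cap_point \<xi> 0 w))" for k
      by (rule integrable_cap_poly[OF \<xi> Dk])
    have "sphere_mean p \<xi> t = (\<integral>w. complex_of_real ?c ^ n * (\<Sum>k\<le>n. complex_of_real ((t / ?c) ^ k / fact k) *
        (indicator (sphere 0 1) w *\<^sub>R ?D k (cap_point \<xi> 0 w))) \<partial>equator_measure \<xi>)"
      unfolding sphere_mean_poly[OF \<xi> t d2 p] cap
      by (intro Bochner_Integration.integral_cong refl) (simp add: indicator_def)
    also have "\<dots> = complex_of_real ?c ^ n * (\<Sum>k\<le>n. complex_of_real ((t / ?c) ^ k / fact k) *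
        sphere_integral (equator_measure \<xi>) (\<lambda>w. ?D k (cap_point \<xi> 0 w)))"
      using int by (simp only: integral_mult_right_zero Bochner_Integration.integral_sum integrable_mult_right)
    also have "\<dots> = complex_of_real ?c ^ n * (\<Sum>k\<le>n. complex_of_real ((t / ?c) ^ k / fact k) *
        (complex_of_real (equator_mult ?d (n - k) * equator_mass \<xi>) * ?D k \<xi>))"
    proof -
      have "sphere_integral (equator_measure \<xi>) (\<lambda>w. ?D k (cap_point \<xi> 0 w)) =
          complex_of_real (equator_mult ?d (n - k) * equator_mass \<xi>) * ?D k \<xi>" for k
        using sphere_mean_equator[OF \<xi> d Dk dirderiv_funpow_harmonic[OF p], of k] harm
          sphere_mean_poly[OF \<xi> _ d2 Dk, of 0 k] by simp
      then show ?thesis by simp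
    qed
    also have "\<dots> = C * p \<xi>"
      unfolding C_def equator_mass_unique[OF \<xi> \<zeta>] sum_distrib_left sum_distrib_right
      by (intro sum.cong refl) (simp add: dirderiv_funpow_self[OF p] mult_ac)
    finally show ?thesis .
  qed
  then show ?thesis by blast
qed

text \<open>The weight \<open>(1 - t\<^sup>2) powr ((d - 3) / 2)\<close> turns the pair of means of \<open>p\<close> and its \<open>\<xi>\<close>-derivative into
  a solution of a symmetric first-order system, see \<open>gegenbauer_system\<close>.\<close>

definition cap_weight :: "nat \<Rightarrow> real \<Rightarrow> real" where
  "cap_weight d t = (1 - t\<^sup>2) powr ((real d - 3) / 2)"

lemma cap_weight_derivative:
  assumes "\<bar>t\<bar> < 1"
  shows "(cap_weight d has_real_derivative - (real d - 3) * t * cap_weight d t / (1 - t\<^sup>2)) (at t)"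
proof -
  let ?\<alpha> = "(real d - 3) / 2"
  have s: "1 - t\<^sup>2 > 0" using abs_less_1_sq[OF assms] by simp
  have "((\<lambda>t. (1 - t\<^sup>2) powr ?\<alpha>) has_real_derivative ?\<alpha> * (1 - t\<^sup>2) powr (?\<alpha> - 1) * (- 2 * t)) (at t)"
    using s by (auto intro!: derivative_eq_intros)
  moreover have "(1 - t\<^sup>2) powr (?\<alpha> - 1) = (1 - t\<^sup>2) powr ?\<alpha> / (1 - t\<^sup>2)"
    using s by (simp only: powr_diff powr_one)
  moreover have "D / 2 * (P / S) * (- 2 * t) = - D * t * P / S" for D P S :: real by simp
  ultimately show ?thesis
    unfolding cap_weight_def[abs_def] by (metis DERIV_cong)
qed

lemma Ck_cap_weight: "Ck k (cap_weight d) I1"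
proof -
  have "Ck k (\<lambda>t. (1 - t * t) powr ((real d - 3) / 2)) I1"
  proof (intro Ck_powr Ck_diff Ck_const Ck_mult Ck_linear bounded_linear_ident)
    fix t :: real assume "t \<in> I1"
    then have "t\<^sup>2 < 1" using abs_less_1_sq[of t] by auto
    then show "0 < 1 - t * t" by (simp add: power2_eq_square)
  qed auto
  then show ?thesis by (simp add: cap_weight_def[abs_def] power2_eq_square)
qed

lemma Ck_of_real: "open U \<Longrightarrow> Ck k f U \<Longrightarrow> Ck k (\<lambda>x. complex_of_real (f x)) U"
  by (rule bounded_linear.Ck_comp[OF bounded_linear_of_real])

text \<open>The logarithmic derivative of the weight adds d - 3 to the coefficient \<open>n\<close>
  of \<open>sphere_mean_derivative\<close> and reduces the coefficient 2n + d - 4 of the second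
  derivative to \<open>n\<close>; this is the system of \<open>gegenbauer_system\<close>. Its
  initial values are equatorial means of \<open>p\<close> and of its derivative.\<close>

lemma iter_deriv_sphere_mean:
  fixes p :: "real^'d::finite \<Rightarrow> complex"
  assumes \<xi>: "norm \<xi> = 1" and d: "CARD('d) \<ge> 3" and p: "p \<in> homogeneous_polys n"
    and harm: "\<And>x. laplacian p x = 0"
  shows "iter_deriv j (\<lambda>t. complex_of_real (cap_weight CARD('d) t) * sphere_mean p \<xi> t) 0 =
    complex_of_real (funk_mult CARD('d) n j * equator_mass \<xi>) * p \<xi>"
proof -
  let ?d = "CARD('d)" let ?n = "complex_of_nat n" let ?N = "?n + of_nat ?d - 3"
  have d2: "CARD('d) \<ge> 2" using d by simp
  let ?q = "dirderiv \<xi> p"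
  note q = homogeneous_polys_dirderiv[OF p, of \<xi>]
  let ?a = "\<lambda>t. complex_of_real (cap_weight ?d t)"
  define w where "w = (\<lambda>t. ?a t * sphere_mean p \<xi> t)"
  define v where "v = (\<lambda>t. ?a t * sphere_mean ?q \<xi> t)"
  have Ckw: "Ck k w I1" for k unfolding w_def
    by (intro Ck_mult Ck_of_real Ck_cap_weight Ck_sphere_mean_poly[OF \<xi> d2 p]) auto
  have Ckv: "Ck k v I1" for k unfolding v_def
    by (intro Ck_mult Ck_of_real Ck_cap_weight Ck_sphere_mean_poly[OF \<xi> d2 q]) auto
  have W: "(iter_deriv j w has_vector_derivative iter_deriv (Suc j) w t) (at t)" if "t \<in> I1" for j t
    by (rule iter_deriv_has_vector_derivative[OF Ckw _ that]) auto
  have V: "(iter_deriv j v has_vector_derivative iter_deriv (Suc j) v t) (at t)" if "t \<in> I1" for j t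
    by (rule iter_deriv_has_vector_derivative[OF Ckv _ that]) auto
  have prodrule: "((\<lambda>t. ?a t * sphere_mean h \<xi> t) has_vector_derivative
      ?a t * ((sphere_mean (dirderiv \<xi> h) \<xi> t - (of_nat m + of_nat ?d - 3) * complex_of_real t * sphere_mean h \<xi> t)
        / complex_of_real (1 - t\<^sup>2))) (at t)"
    if t: "t \<in> I1" and h: "h \<in> homogeneous_polys m" for t h m
  proof -
    have t1: "\<bar>t\<bar> < 1" using t by auto
    have "(?a has_vector_derivative complex_of_real (- (real ?d - 3) * t * cap_weight ?d t / (1 - t\<^sup>2))) (at t)"
      using cap_weight_derivative[OF t1] by (intro has_vector_derivative_of_real)
        (simp add: has_real_derivative_iff_has_vector_derivative)
    from has_vector_derivative_mult[OF this sphere_mean_derivative[OF \<xi> t1 d2 h]]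
    show ?thesis
      by (rule has_vector_derivative_eq_rhs) (simp add: diff_divide_distrib add_divide_distrib algebra_simps)
  qed
  have eq1: "complex_of_real (1 - t\<^sup>2) * iter_deriv 1 w t = iter_deriv 0 v t + (- ?N) * complex_of_real t * iter_deriv 0 w t"
    if t: "t \<in> I1" for t
  proof -
    have "\<bar>t\<bar> < 1" using t by auto
    from abs_less_1_sq[OF this] have s: "complex_of_real (1 - t\<^sup>2) \<noteq> 0"
      by (simp only: of_real_eq_0_iff)
    have "iter_deriv 1 w t = ?a t * ((sphere_mean ?q \<xi> t - ?N * complex_of_real t * sphere_mean p \<xi> t) / complex_of_real (1 - t\<^sup>2))"
      using vector_derivative_at[OF prodrule[OF t p]] by (simp add: w_def)
    then have "complex_of_real (1 - t\<^sup>2) * iter_deriv 1 w t = ?a t * (sphere_mean ?q \<xi> t - ?N * complex_of_real t * sphere_mean p \<xi> t)"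
      using s by (simp del: of_real_diff of_real_power)
    then show ?thesis by (simp add: w_def v_def algebra_simps)
  qed
  have eq2: "complex_of_real (1 - t\<^sup>2) * iter_deriv 1 v t = (- ?n * ?N) * iter_deriv 0 w t + ?n * complex_of_real t * iter_deriv 0 v t"
    if t: "t \<in> I1" for t
  proof -
    have t1: "\<bar>t\<bar> < 1" using t by auto
    have s: "complex_of_real (1 - t\<^sup>2) \<noteq> 0" using abs_less_1_sq[OF t1] by (simp only: of_real_eq_0_iff)
    \<comment> \<open>The derivative of \<open>p\<close> has truncated degree \<open>n - 1\<close>;
      it vanishes for \<open>n = 0\<close>, so the subtraction may be carried out in the complex
      numbers.\<close>
    have e: "of_nat (n - 1) * sphere_mean ?q \<xi> t = (?n - 1) * sphere_mean ?q \<xi> t"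
    proof (cases n)
      case 0
      then have "?q x = 0" for x using homogeneous_polys_0_dirderiv[of p] p by simp
      then have "sphere_mean ?q \<xi> t = 0" by (simp add: sphere_mean_def)
      then show ?thesis by simp
    qed simp
    have "iter_deriv 1 v t = ?a t * ((sphere_mean (dirderiv \<xi> ?q) \<xi> t - (of_nat (n - 1) + of_nat ?d - 3) * complex_of_real t * sphere_mean ?q \<xi> t) / complex_of_real (1 - t\<^sup>2))"
      using vector_derivative_at[OF prodrule[OF t q]] by (simp add: v_def)
    then have "complex_of_real (1 - t\<^sup>2) * iter_deriv 1 v t = ?a t * (sphere_mean (dirderiv \<xi> ?q) \<xi> t
        - (of_nat (n - 1) + of_nat ?d - 3) * complex_of_real t * sphere_mean ?q \<xi> t)"
      using s by (simp del: of_real_diff of_real_power)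
    also have "\<dots> = ?a t * (sphere_mean (dirderiv \<xi> ?q) \<xi> t
        - complex_of_real t * (of_nat (n - 1) * sphere_mean ?q \<xi> t) - (of_nat ?d - 3) * complex_of_real t * sphere_mean ?q \<xi> t)"
      by (simp add: algebra_simps)
    finally show ?thesis
      unfolding e sphere_mean_second_derivative[OF \<xi> t1 d2 p harm]
      by (simp add: w_def v_def algebra_simps)
  qed
  have rec: "iter_deriv (Suc (Suc j)) w 0 = (of_nat j + 1 + ?n) * (of_nat j - ?N) * iter_deriv j w 0" for j
    by (rule gegenbauer_system[where I = I1 and W = "\<lambda>j. iter_deriv j w" and V = "\<lambda>j. iter_deriv j v",
          OF _ _ W V eq1 eq2]) auto
  have w0: "iter_deriv 0 w 0 = complex_of_real (funk_mult ?d n 0 * equator_mass \<xi>) * p \<xi>"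
    using sphere_mean_equator[OF \<xi> d p harm] by (simp add: w_def cap_weight_def equator_mult_def)
  have w1: "iter_deriv 1 w 0 = complex_of_real (funk_mult ?d n 1 * equator_mass \<xi>) * p \<xi>"
  proof -
    have "iter_deriv 1 w 0 = sphere_mean ?q \<xi> 0" using eq1[of 0] by (simp add: v_def cap_weight_def)
    also have "\<dots> = complex_of_real (equator_mult ?d (n - 1) * equator_mass \<xi>) * (of_nat n * p \<xi>)"
      using sphere_mean_equator[OF \<xi> d q dirderiv_harmonic[OF p harm]] euler_identity[OF p, of \<xi>] by simp
    also have "\<dots> = complex_of_real (funk_mult ?d n 1 * equator_mass \<xi>) * p \<xi>"
    proof (cases "n = 0")
      case False
      have "equator_mult ?d (n - 1) * real n = funk_mult ?d n 1"
        using False by (auto simp: equator_mult_def elim!: oddE evenE)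
      then show ?thesis
        by (simp only: of_real_mult[symmetric] \<open>equator_mult ?d (n - 1) * real n = funk_mult ?d n 1\<close>[symmetric])
          (simp only: of_real_mult of_real_of_nat_eq mult_ac)
    qed simp
    finally show ?thesis .
  qed
  have "iter_deriv j w 0 = complex_of_real (funk_mult ?d n j * equator_mass \<xi>) * p \<xi>"
  proof (induction j rule: less_induct)
    case (less j)
    consider "j = 0" | "j = 1" | i where "j = Suc (Suc i)" by (metis One_nat_def not0_implies_Suc)
    then show ?case
    proof cases
      case 1
      with w0 show ?thesis by simp
    next
      case 2
      with w1 show ?thesis by simp
    next
      case 3
      with less[of i] show ?thesis unfolding 3 rec by simp
    qed
  qed
  then show ?thesis by (simp only: w_def)
qed

section \<open>Weighted square sums\<close>

text \<open>Arrays of coefficients are measured without reference to functions, because limits of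
  coefficients must be estimated before any function is known to have them. Only entries with
  \<open>k\<close> in \<open>{1..N n}\<close> count.\<close>

definition wterm :: "(nat \<Rightarrow> nat) \<Rightarrow> (nat \<Rightarrow> real) \<Rightarrow> (nat \<Rightarrow> nat \<Rightarrow> complex) \<Rightarrow> nat \<Rightarrow> real" where
  "wterm N w a n = (\<Sum>k=1..N n. w n * (cmod (a n k))\<^sup>2)"

definition wnorm :: "(nat \<Rightarrow> nat) \<Rightarrow> (nat \<Rightarrow> real) \<Rightarrow> (nat \<Rightarrow> nat \<Rightarrow> complex) \<Rightarrow> real" where
  "wnorm N w a = sqrt (\<Sum>n. wterm N w a n)"

definition wpart :: "(nat \<Rightarrow> nat) \<Rightarrow> (nat \<Rightarrow> real) \<Rightarrow> (nat \<Rightarrow> nat \<Rightarrow> complex) \<Rightarrow> nat \<Rightarrow> real" where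
  "wpart N w a m = sqrt (\<Sum>n<m. wterm N w a n)"

locale weights =
  fixes N :: "nat \<Rightarrow> nat" and w :: "nat \<Rightarrow> real"
  assumes w_nonneg: "w n \<ge> 0"
begin

abbreviation "wfin a \<equiv> summable (wterm N w a)"

lemma wterm_nonneg: "wterm N w a n \<ge> 0"
  unfolding wterm_def by (intro sum_nonneg mult_nonneg_nonneg w_nonneg) auto

lemma wpart_nonneg: "wpart N w a m \<ge> 0"
  by (simp add: wpart_def sum_nonneg wterm_nonneg)

lemma wnorm_nonneg: "wfin a \<Longrightarrow> wnorm N w a \<ge> 0"
  by (simp add: wnorm_def suminf_nonneg wterm_nonneg)

lemma wpart_L2_set:
  "wpart N w a m = L2_set (\<lambda>(n, k). sqrt (w n) * cmod (a n k)) (Sigma {..<m} (\<lambda>n. {1..N n}))"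
  unfolding wpart_def L2_set_def wterm_def
  by (subst sum.Sigma) (auto simp: power_mult_distrib w_nonneg intro!: sum.cong)

lemma wpart_triangle:
  "wpart N w (\<lambda>n k. a n k + b n k) m \<le> wpart N w a m + wpart N w b m"
proof -
  have "wpart N w (\<lambda>n k. a n k + b n k) m \<le> L2_set (\<lambda>(n, k). sqrt (w n) * cmod (a n k) + sqrt (w n) * cmod (b n k))
      (Sigma {..<m} (\<lambda>n. {1..N n}))"
    unfolding wpart_L2_set
    by (intro L2_set_mono) (auto simp: distrib_left[symmetric] w_nonneg intro!: mult_left_mono norm_triangle_ineq)
  also have "\<dots> \<le> wpart N w a m + wpart N w b m"
    unfolding wpart_L2_set
    using L2_set_triangle_ineq[of "\<lambda>(n, k). sqrt (w n) * cmod (a n k)" "\<lambda>(n, k). sqrt (w n) * cmod (b n k)"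
        "Sigma {..<m} (\<lambda>n. {1..N n})"] by (simp add: split_beta')
  finally show ?thesis .
qed

lemma wpart_le_wnorm: "wfin a \<Longrightarrow> wpart N w a m \<le> wnorm N w a"
  unfolding wpart_def wnorm_def
  by (intro real_sqrt_le_mono sum_le_suminf) (auto simp: wterm_nonneg)

lemma wfinI:
  assumes "\<And>m. wpart N w a m \<le> B"
  shows "wfin a"
proof (rule bounded_imp_summable[of _ "B\<^sup>2"])
  fix n
  have "(\<Sum>k<Suc n. wterm N w a k) = (wpart N w a (Suc n))\<^sup>2"
    by (simp add: wpart_def sum_nonneg wterm_nonneg)
  also have "\<dots> \<le> B\<^sup>2" by (intro power_mono assms wpart_nonneg)
  finally show "(\<Sum>k\<le>n. wterm N w a k) \<le> B\<^sup>2" by (simp add: lessThan_Suc_atMost)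
qed (rule wterm_nonneg)

lemma wpart_tendsto: "wfin a \<Longrightarrow> wpart N w a \<longlonglongrightarrow> wnorm N w a"
  unfolding wpart_def[abs_def] wnorm_def by (intro tendsto_real_sqrt summable_LIMSEQ)

lemma wnorm_leI:
  assumes "\<And>m. wpart N w a m \<le> B"
  shows "wnorm N w a \<le> B"
  by (rule LIMSEQ_le_const2[OF wpart_tendsto[OF wfinI[OF assms]]]) (use assms in auto)

lemma wnorm_add:
  assumes "wfin a" "wfin b"
  shows "wfin (\<lambda>n k. a n k + b n k)" "wnorm N w (\<lambda>n k. a n k + b n k) \<le> wnorm N w a + wnorm N w b"
proof -
  have "wpart N w (\<lambda>n k. a n k + b n k) m \<le> wnorm N w a + wnorm N w b" for m
    using wpart_triangle[of a b m] wpart_le_wnorm[OF assms(1), of m] wpart_le_wnorm[OF assms(2), of m] by linarith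
  then show "wfin (\<lambda>n k. a n k + b n k)" "wnorm N w (\<lambda>n k. a n k + b n k) \<le> wnorm N w a + wnorm N w b"
    by (auto intro: wfinI wnorm_leI)
qed

lemma wnorm_cmult:
  assumes "wfin a"
  shows "wfin (\<lambda>n k. c * a n k)" "wnorm N w (\<lambda>n k. c * a n k) = cmod c * wnorm N w a"
proof -
  have t: "wterm N w (\<lambda>n k. c * a n k) = (\<lambda>n. (cmod c)\<^sup>2 * wterm N w a n)"
    by (auto simp: wterm_def norm_mult power_mult_distrib sum_distrib_left mult_ac)
  show "wfin (\<lambda>n k. c * a n k)" using assms by (simp add: t summable_mult)
  show "wnorm N w (\<lambda>n k. c * a n k) = cmod c * wnorm N w a"
    using assms by (simp add: wnorm_def t suminf_mult real_sqrt_mult)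
qed

lemma wnorm_diff:
  assumes "wfin a" "wfin b"
  shows "wfin (\<lambda>n k. a n k - b n k)" "wnorm N w (\<lambda>n k. a n k - b n k) \<le> wnorm N w a + wnorm N w b"
  using wnorm_add[OF assms(1) wnorm_cmult(1)[OF assms(2), of "-1"]] wnorm_cmult(2)[OF assms(2), of "-1"]
  by simp_all

lemma wnorm_component:
  assumes "wfin a" "k \<in> {1..N n}"
  shows "sqrt (w n) * cmod (a n k) \<le> wnorm N w a"
proof -
  have "sqrt (w n) * cmod (a n k) = (\<lambda>(n, k). sqrt (w n) * cmod (a n k)) (n, k)" by simp
  also have "\<dots> \<le> wpart N w a (Suc n)"
    unfolding wpart_L2_set
    by (rule member_le_L2_set) (use assms(2) in auto)
  also have "\<dots> \<le> wnorm N w a" by (rule wpart_le_wnorm[OF assms(1)])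
  finally show ?thesis .
qed

text \<open>A partial sum involves finitely many entries and so passes to the limit; the bound on
  all partial sums then gives both finiteness and the estimate.\<close>

lemma wnorm_fatou:
  assumes lim: "\<And>n k. k \<in> {1..N n} \<Longrightarrow> (\<lambda>i. X i n k) \<longlonglongrightarrow> a n k"
    and le: "\<And>i. i \<ge> M \<Longrightarrow> wfin (X i) \<and> wnorm N w (X i) \<le> B"
  shows "wfin a" "wnorm N w a \<le> B"
proof -
  have "wpart N w a m \<le> B" for m
  proof (rule LIMSEQ_le_const2)
    show "(\<lambda>i. wpart N w (X i) m) \<longlonglongrightarrow> wpart N w a m"
      unfolding wpart_def wterm_def by (intro tendsto_intros lim)
    show "\<exists>M. \<forall>i\<ge>M. wpart N w (X i) m \<le> B"
      using le wpart_le_wnorm order_trans by blast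
  qed
  then show "wfin a" "wnorm N w a \<le> B" by (auto intro: wfinI wnorm_leI)
qed

end

lemma wpart_mono:
  assumes "\<And>n. w n \<ge> 0" "\<And>n k. k \<in> {1..N n} \<Longrightarrow> w' n * (cmod (b n k))\<^sup>2 \<le> C\<^sup>2 * (w n * (cmod (a n k))\<^sup>2)" "C \<ge> 0"
  shows "wpart N w' b m \<le> C * wpart N w a m"
proof -
  have "(\<Sum>n<m. wterm N w' b n) \<le> C\<^sup>2 * (\<Sum>n<m. wterm N w a n)"
    unfolding wterm_def sum_distrib_left by (intro sum_mono assms)
  then have "wpart N w' b m \<le> sqrt (C\<^sup>2 * (\<Sum>n<m. wterm N w a n))"
    unfolding wpart_def by (rule real_sqrt_le_mono)
  then show ?thesis using assms(3) by (simp add: wpart_def real_sqrt_mult)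
qed

lemma wnorm_mono:
  assumes "\<And>n. w n \<ge> 0" "\<And>n. w' n \<ge> 0"
    and "\<And>n k. k \<in> {1..N n} \<Longrightarrow> w' n * (cmod (b n k))\<^sup>2 \<le> C\<^sup>2 * (w n * (cmod (a n k))\<^sup>2)" "C \<ge> 0"
    and "summable (wterm N w a)"
  shows "summable (wterm N w' b)" "wnorm N w' b \<le> C * wnorm N w a"
proof -
  interpret w: weights N w by unfold_locales (rule assms)
  interpret w': weights N w' by unfold_locales (rule assms)
  have "wpart N w' b m \<le> C * wnorm N w a" for m
  proof -
    have "wpart N w' b m \<le> C * wpart N w a m" by (rule wpart_mono[OF assms(1,3,4)])
    also have "\<dots> \<le> C * wnorm N w a" by (rule mult_left_mono[OF w.wpart_le_wnorm[OF assms(5)] assms(4)])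
    finally show ?thesis .
  qed
  then show "summable (wterm N w' b)" "wnorm N w' b \<le> C * wnorm N w a"
    by (auto intro: w'.wfinI w'.wnorm_leI)
qed

section \<open>Square-integrable functions on the sphere\<close>

lemma l2_measurable [measurable_dest]: "f \<in> l2_sphere \<Longrightarrow> f \<in> borel_measurable borel"
  by (simp add: l2_sphere_def)

lemma l2_measurable_sphere: "f \<in> l2_sphere \<Longrightarrow> f \<in> borel_measurable sphere_measure"
  by (simp add: l2_sphere_def cong: measurable_cong_sets)

lemma l2_integrable_square: "f \<in> l2_sphere \<Longrightarrow> integrable sphere_measure (\<lambda>x. (cmod (f x))\<^sup>2)"
  by (simp add: l2_sphere_def)

lemma borel_measurable_cnj: "f \<in> borel_measurable M \<Longrightarrow> (\<lambda>x. cnj (f x)) \<in> borel_measurable M"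
  by (rule measurable_compose[OF _ borel_measurable_continuous_onI[of cnj]]) (auto intro: continuous_intros)

lemma l2_integrable_mult:
  fixes f g :: "real^'d::finite \<Rightarrow> complex"
  assumes "f \<in> l2_sphere" "g \<in> l2_sphere"
  shows "integrable sphere_measure (\<lambda>x. f x * cnj (g x))"
proof (rule Bochner_Integration.integrable_bound)
  show "integrable sphere_measure (\<lambda>x. (cmod (f x))\<^sup>2 + (cmod (g x))\<^sup>2)"
    using assms by (simp add: l2_integrable_square)
  show "(\<lambda>x. f x * cnj (g x)) \<in> borel_measurable sphere_measure"
    using assms[THEN l2_measurable_sphere] by (intro borel_measurable_times borel_measurable_cnj)
  have "cmod (f x) * cmod (g x) \<le> (cmod (f x))\<^sup>2 + (cmod (g x))\<^sup>2" for x
  proof -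
    have "2 * (cmod (f x) * cmod (g x)) \<le> (cmod (f x))\<^sup>2 + (cmod (g x))\<^sup>2"
      using sum_squares_bound[of "cmod (f x)" "cmod (g x)"] by (simp add: mult.assoc)
    then show ?thesis using mult_nonneg_nonneg[OF norm_ge_zero norm_ge_zero, of "f x" "g x"] by linarith
  qed
  then show "AE x in sphere_measure. norm (f x * cnj (g x)) \<le> norm ((cmod (f x))\<^sup>2 + (cmod (g x))\<^sup>2)"
    by (auto simp: norm_mult)
qed

lemma l2_scale:
  assumes "f \<in> l2_sphere"
  shows "(\<lambda>x. c * f x) \<in> l2_sphere"
  using assms by (auto simp: l2_sphere_def norm_mult power_mult_distrib)

lemma l2_add:
  fixes f g :: "real^'d::finite \<Rightarrow> complex"
  assumes "f \<in> l2_sphere" "g \<in> l2_sphere"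
  shows "(\<lambda>x. f x + g x) \<in> l2_sphere"
proof -
  have "integrable sphere_measure (\<lambda>x. (cmod (f x + g x))\<^sup>2)"
  proof (rule Bochner_Integration.integrable_bound)
    show "integrable sphere_measure (\<lambda>x. 2 * ((cmod (f x))\<^sup>2 + (cmod (g x))\<^sup>2))"
      using assms by (simp add: l2_integrable_square)
    show "(\<lambda>x. (cmod (f x + g x))\<^sup>2) \<in> borel_measurable sphere_measure"
      using assms[THEN l2_measurable_sphere] by measurable
    have "(cmod (f x + g x))\<^sup>2 \<le> 2 * ((cmod (f x))\<^sup>2 + (cmod (g x))\<^sup>2)" for x
    proof -
      have "(cmod (f x + g x))\<^sup>2 \<le> (cmod (f x) + cmod (g x))\<^sup>2" by (intro power_mono norm_triangle_ineq) auto
      also have "\<dots> \<le> 2 * ((cmod (f x))\<^sup>2 + (cmod (g x))\<^sup>2)"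
        using sum_squares_bound[of "cmod (f x)" "cmod (g x)"] by (simp add: power2_sum)
      finally show ?thesis .
    qed
    then show "AE x in sphere_measure. norm ((cmod (f x + g x))\<^sup>2) \<le> norm (2 * ((cmod (f x))\<^sup>2 + (cmod (g x))\<^sup>2))"
      by (auto simp: abs_of_nonneg)
  qed
  then show ?thesis using assms by (auto simp: l2_sphere_def)
qed

lemma l2_zero: "(\<lambda>x. 0) \<in> l2_sphere"
  by (simp add: l2_sphere_def)

lemma l2_diff: "f \<in> l2_sphere \<Longrightarrow> g \<in> l2_sphere \<Longrightarrow> (\<lambda>x. f x - g x) \<in> l2_sphere"
  using l2_add[OF _ l2_scale[of g "-1"], of f] by simp

lemma l2_sum: "(\<And>i. i \<in> I \<Longrightarrow> f i \<in> l2_sphere) \<Longrightarrow> (\<lambda>x. \<Sum>i\<in>I. f i x) \<in> l2_sphere"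
  by (induction I rule: infinite_finite_induct) (auto intro: l2_zero l2_add)

lemma smooth_sphere_l2:
  fixes f :: "real^'d::finite \<Rightarrow> complex"
  assumes "f \<in> smooth_sphere"
  shows "f \<in> l2_sphere"
proof -
  have "integrable sphere_measure (\<lambda>x. indicator (sphere 0 1) x *\<^sub>R (cmod (f x))\<^sup>2)"
    by (intro integrable_continuous_compact finite_sphere_measure continuous_intros
        continuous_on_smooth_sphere[OF assms]) auto
  also have "(\<lambda>x. indicator (sphere 0 1) x *\<^sub>R (cmod (f x))\<^sup>2) = (\<lambda>x. (cmod (f x))\<^sup>2)"
    using smooth_sphere_outside[OF assms] by (auto simp: fun_eq_iff indicator_def)
  finally show ?thesis using borel_measurable_smooth_sphere[OF assms] by (simp add: l2_sphere_def)
qed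

lemma sphere_inner_add_left:
  assumes "f \<in> l2_sphere" "g \<in> l2_sphere" "h \<in> l2_sphere"
  shows "sphere_inner (\<lambda>x. f x + g x) h = sphere_inner f h + sphere_inner g h"
  using l2_integrable_mult[OF assms(1,3)] l2_integrable_mult[OF assms(2,3)]
  by (simp add: sphere_inner_def distrib_right)

lemma sphere_inner_scale_left: "sphere_inner (\<lambda>x. c * f x) h = c * sphere_inner f h"
  by (simp add: sphere_inner_def mult.assoc)

lemma sphere_inner_commute: "sphere_inner g f = cnj (sphere_inner f g)"
proof -
  have "cnj (sphere_inner f g) = (\<integral>x. cnj (f x * cnj (g x)) \<partial>sphere_measure)"
    unfolding sphere_inner_def by (rule Bochner_Integration.integral_cnj[symmetric])
  then show ?thesis by (simp add: sphere_inner_def mult.commute)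
qed

lemma sphere_inner_diff_left:
  assumes "f \<in> l2_sphere" "g \<in> l2_sphere" "h \<in> l2_sphere"
  shows "sphere_inner (\<lambda>x. f x - g x) h = sphere_inner f h - sphere_inner g h"
  using l2_integrable_mult[OF assms(1,3)] l2_integrable_mult[OF assms(2,3)]
  by (simp add: sphere_inner_def left_diff_distrib)

lemma sphere_inner_sum_left:
  assumes "\<And>i. i \<in> I \<Longrightarrow> f i \<in> l2_sphere" "h \<in> l2_sphere"
  shows "sphere_inner (\<lambda>x. \<Sum>i\<in>I. c i * f i x) h = (\<Sum>i\<in>I. c i * sphere_inner (f i) h)"
  using assms(1)
proof (induction I rule: infinite_finite_induct)
  case (insert i I)
  have s: "(\<lambda>x. \<Sum>i\<in>I. c i * f i x) \<in> l2_sphere" using insert.prems by (auto intro!: l2_sum l2_scale)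
  have "sphere_inner (\<lambda>x. c i * f i x + (\<Sum>i\<in>I. c i * f i x)) h =
      c i * sphere_inner (f i) h + sphere_inner (\<lambda>x. \<Sum>i\<in>I. c i * f i x) h"
    using sphere_inner_add_left[OF l2_scale s assms(2), of "f i" "c i"] insert.prems
    by (simp add: sphere_inner_scale_left)
  with insert show ?case by simp
qed (simp_all add: sphere_inner_def)

lemma sphere_inner_self: "sphere_inner f f = complex_of_real ((l2_norm f)\<^sup>2)"
proof -
  have "sphere_inner f f = (\<integral>x. complex_of_real ((cmod (f x))\<^sup>2) \<partial>sphere_measure)"
    unfolding sphere_inner_def by (simp only: complex_norm_square)
  also have "\<dots> = complex_of_real (\<integral>x. (cmod (f x))\<^sup>2 \<partial>sphere_measure)"
    by (rule integral_complex_of_real)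
  finally show ?thesis by (simp add: l2_norm_def)
qed

lemma l2_norm_nonneg: "l2_norm f \<ge> 0"
  by (simp add: l2_norm_def)

lemma l2_norm_cong_AE:
  assumes "f \<in> l2_sphere" "g \<in> l2_sphere" "AE x in sphere_measure. f x = g x"
  shows "l2_norm f = l2_norm g"
  unfolding l2_norm_def using assms
  by (intro arg_cong[where f = sqrt] integral_cong_AE) (auto dest!: l2_measurable_sphere elim: eventually_mono)

text \<open>Completing the square. The numbers \<open>a i\<close> are free: the Fourier coefficients
  give Bessel's inequality, and \<open>f = 0\<close> gives the norm of a finite sum.\<close>

lemma l2_norm_diff_orthonormal:
  fixes f :: "real^'d::finite \<Rightarrow> complex"
  assumes I: "finite I" and f: "f \<in> l2_sphere" and e: "\<And>i. i \<in> I \<Longrightarrow> e i \<in> l2_sphere"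
    and ortho: "\<And>i j. i \<in> I \<Longrightarrow> j \<in> I \<Longrightarrow> sphere_inner (e i) (e j) = (if i = j then 1 else 0)"
  shows "(l2_norm (\<lambda>x. f x - (\<Sum>i\<in>I. a i * e i x)))\<^sup>2 =
    (l2_norm f)\<^sup>2 - (\<Sum>i\<in>I. (cmod (sphere_inner f (e i)))\<^sup>2) + (\<Sum>i\<in>I. (cmod (sphere_inner f (e i) - a i))\<^sup>2)"
proof -
  let ?s = "\<lambda>x. \<Sum>i\<in>I. a i * e i x" let ?c = "\<lambda>i. sphere_inner f (e i)"
  have s: "?s \<in> l2_sphere" by (intro l2_sum l2_scale e)
  have fs: "(\<lambda>x. f x - ?s x) \<in> l2_sphere" by (intro l2_diff f s)
  have se: "sphere_inner ?s (e i) = a i" if "i \<in> I" for i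
  proof -
    have "sphere_inner ?s (e i) = (\<Sum>j\<in>I. a j * (if j = i then 1 else 0))"
      using that by (simp add: sphere_inner_sum_left[OF e e] ortho)
    then show ?thesis using I that by (simp add: if_distrib cong: if_cong)
  qed
  have sg: "sphere_inner ?s g = (\<Sum>i\<in>I. a i * cnj (sphere_inner g (e i)))" if "g \<in> l2_sphere" for g
    using sphere_inner_sum_left[OF e that, where I = I and c = a] sphere_inner_commute[of _ g] by simp
  have "complex_of_real ((l2_norm (\<lambda>x. f x - ?s x))\<^sup>2) = sphere_inner (\<lambda>x. f x - ?s x) (\<lambda>x. f x - ?s x)"
    by (rule sphere_inner_self[symmetric])
  also have "\<dots> = sphere_inner f (\<lambda>x. f x - ?s x) - sphere_inner ?s (\<lambda>x. f x - ?s x)"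
    by (rule sphere_inner_diff_left[OF f s fs])
  also have "sphere_inner f (\<lambda>x. f x - ?s x) = cnj (sphere_inner f f - sphere_inner ?s f)"
    by (subst sphere_inner_commute) (simp add: sphere_inner_diff_left[OF f s f])
  also have "sphere_inner ?s (\<lambda>x. f x - ?s x) = (\<Sum>i\<in>I. a i * cnj (?c i - a i))"
    unfolding sg[OF fs] by (intro sum.cong refl) (simp add: sphere_inner_diff_left[OF f s e] se)
  also have "cnj (sphere_inner f f - sphere_inner ?s f) = complex_of_real ((l2_norm f)\<^sup>2) - (\<Sum>i\<in>I. cnj (a i) * ?c i)"
    unfolding sg[OF f] sphere_inner_self by simp
  finally have "complex_of_real ((l2_norm (\<lambda>x. f x - ?s x))\<^sup>2) =
      complex_of_real ((l2_norm f)\<^sup>2) - (\<Sum>i\<in>I. cnj (a i) * ?c i + a i * cnj (?c i - a i))"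
    by (simp add: sum.distrib)
  also have "(\<Sum>i\<in>I. cnj (a i) * ?c i + a i * cnj (?c i - a i)) =
      (\<Sum>i\<in>I. complex_of_real ((cmod (?c i))\<^sup>2 - (cmod (?c i - a i))\<^sup>2))"
  proof (intro sum.cong refl)
    fix i
    show "cnj (a i) * ?c i + a i * cnj (?c i - a i) = complex_of_real ((cmod (?c i))\<^sup>2 - (cmod (?c i - a i))\<^sup>2)"
      by (simp add: complex_norm_square algebra_simps del: of_real_power)
  qed
  also have "complex_of_real ((l2_norm f)\<^sup>2) - \<dots> = complex_of_real ((l2_norm f)\<^sup>2 -
      (\<Sum>i\<in>I. (cmod (?c i))\<^sup>2 - (cmod (?c i - a i))\<^sup>2))" by simp
  finally show ?thesis unfolding of_real_eq_iff by (simp add: sum_subtractf)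
qed

lemma bessel:
  fixes f :: "real^'d::finite \<Rightarrow> complex"
  assumes "finite I" "f \<in> l2_sphere" "\<And>i. i \<in> I \<Longrightarrow> e i \<in> l2_sphere"
    and "\<And>i j. i \<in> I \<Longrightarrow> j \<in> I \<Longrightarrow> sphere_inner (e i) (e j) = (if i = j then 1 else 0)"
  shows "(\<Sum>i\<in>I. (cmod (sphere_inner f (e i)))\<^sup>2) \<le> (l2_norm f)\<^sup>2"
  using l2_norm_diff_orthonormal[OF assms, of "\<lambda>i. sphere_inner f (e i)"]
    zero_le_power2[of "l2_norm (\<lambda>x. f x - (\<Sum>i\<in>I. sphere_inner f (e i) * e i x))"] by simp

section \<open>Symmetry of the spherical Laplacian\<close>

lemma sphere_inner_on_sphere:
  "sphere_inner (on_sphere F) (on_sphere G) = sphere_integral sphere_measure (\<lambda>x. F x * cnj (G x))"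
  unfolding sphere_inner_def on_sphere_def
  by (intro Bochner_Integration.integral_cong refl) (auto simp: indicator_def)

lemma integrable_sphere_continuous:
  fixes g :: "real^'d::finite \<Rightarrow> complex"
  shows "continuous_on (sphere 0 1) g \<Longrightarrow> integrable sphere_measure (\<lambda>x. indicator (sphere 0 1) x *\<^sub>R g x)"
  by (intro integrable_continuous_compact finite_sphere_measure) auto

lemma Ck_cont_sphere:
  fixes F :: "real^'d::finite \<Rightarrow> complex"
  shows "Ck k F (- {0}) \<Longrightarrow> continuous_on (sphere 0 1) F"
  by (drule Ck_continuous, erule continuous_on_subset) auto

lemma rot_deriv_same: "rot_deriv u u F x = 0"
  by (simp add: rot_deriv_def)

lemma sphere_measure_rot_deriv:
  fixes F :: "real^'d::finite \<Rightarrow> complex"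
  assumes uv: "u \<in> Basis" "v \<in> Basis" and F: "Ck (Suc 0) F (- {0})"
  shows "sphere_integral sphere_measure (rot_deriv u v F) = 0"
proof (cases "u = v")
  case True
  then show ?thesis by (simp add: rot_deriv_same)
next
  case False
  have n: "norm u = 1" "norm v = 1" "u \<bullet> v = 0" using uv False by (auto simp: inner_not_same_Basis)
  show ?thesis
    by (rule sphere_integral_rot_deriv[OF finite_sphere_measure _ _ n F])
      (simp_all add: sphere_measure_invariant orthogonal_transformation_rot[OF n])
qed

lemma rot_deriv_by_parts:
  fixes F G :: "real^'d::finite \<Rightarrow> complex"
  assumes uv: "u \<in> Basis" "v \<in> Basis" and F: "Ck (Suc 0) F (- {0})" and G: "Ck (Suc 0) G (- {0})"
  shows "sphere_integral sphere_measure (\<lambda>x. rot_deriv u v F x * G x) =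
    - sphere_integral sphere_measure (\<lambda>x. F x * rot_deriv u v G x)"
proof -
  have o: "open (- {0 :: real^'d})" by auto
  have cF: "continuous_on (sphere 0 1) (rot_deriv u v F)" "continuous_on (sphere 0 1) F"
    using Ck_cont_sphere[OF Ck_rot_deriv[OF F o]] Ck_cont_sphere[OF F] by auto
  have cG: "continuous_on (sphere 0 1) (rot_deriv u v G)" "continuous_on (sphere 0 1) G"
    using Ck_cont_sphere[OF Ck_rot_deriv[OF G o]] Ck_cont_sphere[OF G] by auto
  have "0 = sphere_integral sphere_measure (rot_deriv u v (\<lambda>x. F x * G x))"
    by (rule sphere_measure_rot_deriv[OF uv Ck_mult[OF o F G], symmetric])
  also have "\<dots> = (\<integral>x. indicator (sphere 0 1) x *\<^sub>R (rot_deriv u v F x * G x) + indicator (sphere 0 1) x *\<^sub>R (F x * rot_deriv u v G x) \<partial>sphere_measure)"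
  proof (intro Bochner_Integration.integral_cong refl)
    fix x :: "real^'d"
    show "indicator (sphere 0 1) x *\<^sub>R rot_deriv u v (\<lambda>x. F x * G x) x =
        indicator (sphere 0 1) x *\<^sub>R (rot_deriv u v F x * G x) + indicator (sphere 0 1) x *\<^sub>R (F x * rot_deriv u v G x)"
    proof (cases "x \<in> sphere 0 1")
      case True
      then have "x \<in> - {0}" by auto
      with F G have "F differentiable (at x)" "G differentiable (at x)" by auto
      then show ?thesis by (simp add: rot_deriv_mult scaleR_add_right)
    qed simp
  qed
  also have "\<dots> = sphere_integral sphere_measure (\<lambda>x. rot_deriv u v F x * G x) + sphere_integral sphere_measure (\<lambda>x. F x * rot_deriv u v G x)"
    using cF cG by (intro Bochner_Integration.integral_add integrable_sphere_continuous continuous_intros)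
  finally show ?thesis by (simp add: eq_neg_iff_add_eq_0)
qed

lemma Ck_cnj: "open U \<Longrightarrow> Ck k f U \<Longrightarrow> Ck k (\<lambda>x. cnj (f x)) U"
  by (rule bounded_linear.Ck_comp[OF bounded_linear_cnj])

text \<open>On functions that are homogeneous of degree zero this is \<open>- norm x ^ 2\<close> times the Laplacian, so on the
  sphere it is the negative of the Laplace--Beltrami operator.\<close>

definition angular_laplacian :: "(real^'d::finite \<Rightarrow> complex) \<Rightarrow> real^'d \<Rightarrow> complex" where
  "angular_laplacian F x = (- 1/2) * (\<Sum>u\<in>Basis. \<Sum>v\<in>Basis. rot_deriv u v (rot_deriv u v F) x)"

lemma Ck_angular_laplacian:
  assumes "\<And>k. Ck k F (- {0})"
  shows "Ck k (angular_laplacian F) (- {0 :: real^'d::finite})"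
proof -
  have "Ck k (\<lambda>x. (- 1/2) * (\<Sum>u\<in>Basis. \<Sum>v\<in>Basis. rot_deriv u v (rot_deriv u v F) x)) (- {0})"
    by (intro Ck_mult Ck_const Ck_sum Ck_rot_deriv assms) auto
  then show ?thesis by (simp add: angular_laplacian_def[abs_def])
qed

text \<open>Two integrations by parts in each coordinate plane move both generators to the
  polynomial, which is an eigenfunction with a real eigenvalue. \<open>F\<close> need only be smooth
  off the origin, so it may be constant along rays.\<close>

lemma angular_laplacian_symmetric_harmonic:
  fixes F p :: "real^'d::finite \<Rightarrow> complex"
  assumes F: "\<And>k. Ck k F (- {0})" and p: "p \<in> homogeneous_polys n" and harm: "\<And>x. laplacian p x = 0"
  shows "sphere_inner (on_sphere (angular_laplacian F)) (on_sphere p) =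
    of_nat n * (of_nat n + of_nat CARD('d) - 2) * sphere_inner (on_sphere F) (on_sphere p)"
proof -
  let ?\<mu> = "sphere_measure :: (real^'d) measure"
  have o: "open (- {0 :: real^'d})" by auto
  have Ckp: "Ck k p (- {0})" for k by (rule Ck_homogeneous_poly[OF p o])
  have Cp: "Ck k (\<lambda>x. cnj (p x)) (- {0})" for k by (rule Ck_cnj[OF o Ckp])

  have Ck1: "Ck k (rot_deriv u v p) (- {0})" for k u v by (rule Ck_rot_deriv[OF Ckp o])
  have L1: "rot_deriv u v (\<lambda>x. cnj (p x)) = (\<lambda>x. cnj (rot_deriv u v p x))" for u v
    by (rule ext) (rule rot_deriv_cnj, rule homogeneous_polys_differentiable[OF p])
  have L2: "rot_deriv u v (\<lambda>x. cnj (rot_deriv u v p x)) x = cnj (rot_deriv u v (rot_deriv u v p) x)" if "norm x = 1" for u v x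
  proof (rule rot_deriv_cnj)
    have "x \<in> - {0}" using that by auto
    with Ck1[of "Suc 0" u v] show "rot_deriv u v p differentiable at x" by auto
  qed
  have parts: "sphere_integral ?\<mu> (\<lambda>x. rot_deriv u v (rot_deriv u v F) x * cnj (p x)) =
      sphere_integral ?\<mu> (\<lambda>x. F x * cnj (rot_deriv u v (rot_deriv u v p) x))" if uv: "u \<in> Basis" "v \<in> Basis" for u v
  proof -
    have "sphere_integral ?\<mu> (\<lambda>x. rot_deriv u v (rot_deriv u v F) x * cnj (p x)) =
        - sphere_integral ?\<mu> (\<lambda>x. rot_deriv u v F x * rot_deriv u v (\<lambda>x. cnj (p x)) x)"
      by (rule rot_deriv_by_parts[OF uv Ck_rot_deriv[OF F o] Cp])
    also have "\<dots> = sphere_integral ?\<mu> (\<lambda>x. F x * rot_deriv u v (rot_deriv u v (\<lambda>x. cnj (p x))) x)"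
      using rot_deriv_by_parts[OF uv F Ck_rot_deriv[OF Cp o], of u v] by simp
    also have "\<dots> = sphere_integral ?\<mu> (\<lambda>x. F x * cnj (rot_deriv u v (rot_deriv u v p) x))"
      unfolding L1 by (intro Bochner_Integration.integral_cong refl) (auto simp: indicator_def L2)
    finally show ?thesis .
  qed
  have ci: "integrable ?\<mu> (\<lambda>x. indicator (sphere 0 1) x *\<^sub>R (rot_deriv u v (rot_deriv u v F) x * cnj (p x)))"
    "integrable ?\<mu> (\<lambda>x. indicator (sphere 0 1) x *\<^sub>R (F x * cnj (rot_deriv u v (rot_deriv u v p) x)))" for u v
    by (intro integrable_sphere_continuous continuous_intros Ck_cont_sphere[OF Ck_rot_deriv[OF Ck_rot_deriv[OF F o] o]]
        Ck_cont_sphere[OF Ckp] Ck_cont_sphere[OF F] Ck_cont_sphere[OF Ck_rot_deriv[OF Ck1 o]])+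
  have "sphere_inner (on_sphere (angular_laplacian F)) (on_sphere p) = (\<integral>x. (- 1/2) * (\<Sum>u\<in>Basis. \<Sum>v\<in>Basis.
      indicator (sphere 0 1) x *\<^sub>R (rot_deriv u v (rot_deriv u v F) x * cnj (p x))) \<partial>?\<mu>)"
    unfolding sphere_inner_on_sphere angular_laplacian_def
    by (intro Bochner_Integration.integral_cong refl) (simp add: sum_distrib_right scaleR_sum_right[symmetric] mult.assoc)
  also have "\<dots> = (- 1/2) * (\<Sum>u\<in>Basis. \<Sum>v\<in>Basis. sphere_integral ?\<mu> (\<lambda>x. rot_deriv u v (rot_deriv u v F) x * cnj (p x)))"
    by (simp only: integral_mult_right_zero Bochner_Integration.integral_sum ci Bochner_Integration.integrable_sum)
  also have "\<dots> = (- 1/2) * (\<Sum>u\<in>Basis. \<Sum>v\<in>Basis. sphere_integral ?\<mu> (\<lambda>x. F x * cnj (rot_deriv u v (rot_deriv u v p) x)))"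
    by (simp only: parts cong: sum.cong)
  also have "\<dots> = (\<integral>x. (- 1/2) * (\<Sum>u\<in>Basis. \<Sum>v\<in>Basis.
      indicator (sphere 0 1) x *\<^sub>R (F x * cnj (rot_deriv u v (rot_deriv u v p) x))) \<partial>?\<mu>)"
    by (simp only: integral_mult_right_zero Bochner_Integration.integral_sum ci Bochner_Integration.integrable_sum)
  also have "\<dots> = (\<integral>x. (of_nat n * (of_nat n + of_nat CARD('d) - 2)) * (indicator (sphere 0 1) x *\<^sub>R (F x * cnj (p x))) \<partial>?\<mu>)"
  proof (intro Bochner_Integration.integral_cong refl)
    fix x :: "real^'d"
    have "(\<Sum>u\<in>Basis. \<Sum>v\<in>Basis. indicator (sphere 0 1) x *\<^sub>R (F x * cnj (rot_deriv u v (rot_deriv u v p) x))) =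
        indicator (sphere 0 1) x *\<^sub>R (F x * cnj (\<Sum>u\<in>Basis. \<Sum>v\<in>Basis. rot_deriv u v (rot_deriv u v p) x))"
      by (simp add: scaleR_sum_right sum_distrib_left)
    then show "(- 1/2) * (\<Sum>u\<in>Basis. \<Sum>v\<in>Basis. indicator (sphere 0 1) x *\<^sub>R (F x * cnj (rot_deriv u v (rot_deriv u v p) x))) =
        (of_nat n * (of_nat n + of_nat CARD('d) - 2)) * (indicator (sphere 0 1) x *\<^sub>R (F x * cnj (p x)))"
      unfolding sum_rot_deriv_rot_deriv_Basis[OF p harm] by (simp add: scaleR_conv_of_real)
  qed
  also have "\<dots> = of_nat n * (of_nat n + of_nat CARD('d) - 2) * sphere_inner (on_sphere F) (on_sphere p)"
    unfolding sphere_inner_on_sphere by (rule integral_mult_right_zero)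
  finally show ?thesis .
qed

text \<open>Symmetry makes eigenfunctions for different eigenvalues orthogonal, and n(n + d - 2) is
  strictly increasing in \<open>n\<close>.\<close>

lemma spherical_harmonics_orthogonal:
  fixes Y Z :: "real^'d::finite \<Rightarrow> complex"
  assumes d: "CARD('d) \<ge> 2" and Y: "Y \<in> spherical_harmonics n" and Z: "Z \<in> spherical_harmonics m" and "n \<noteq> m"
  shows "sphere_inner Y Z = 0"
proof -
  obtain p where p: "p \<in> homogeneous_polys n" "\<And>x. laplacian p x = 0" "Y = on_sphere p"
    using Y by (auto simp: spherical_harmonics_def)
  obtain q where q: "q \<in> homogeneous_polys m" "\<And>x. laplacian q x = 0" "Z = on_sphere q"
    using Z by (auto simp: spherical_harmonics_def)
  have "angular_laplacian p x = of_nat n * (of_nat n + of_nat CARD('d) - 2) * p x" for x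
    unfolding angular_laplacian_def sum_rot_deriv_rot_deriv_Basis[OF p(1,2)] by simp
  then have "on_sphere (angular_laplacian p) = (\<lambda>x. of_nat n * (of_nat n + of_nat CARD('d) - 2) * Y x)"
    by (auto simp: on_sphere_def p(3))
  then have "of_nat n * (of_nat n + of_nat CARD('d) - 2) * sphere_inner Y Z =
      of_nat m * (of_nat m + of_nat CARD('d) - 2) * sphere_inner Y Z"
    using angular_laplacian_symmetric_harmonic[OF Ck_homogeneous_poly[OF p(1) open_Compl[OF closed_singleton]] q(1,2)]
    by (simp add: sphere_inner_scale_left p(3)[symmetric] q(3)[symmetric])
  moreover have "complex_of_nat n * (of_nat n + of_nat CARD('d) - 2) \<noteq> of_nat m * (of_nat m + of_nat CARD('d) - 2)"
  proof
    assume "complex_of_nat n * (of_nat n + of_nat CARD('d) - 2) = of_nat m * (of_nat m + of_nat CARD('d) - 2)"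
    moreover have "complex_of_nat k * (of_nat k + of_nat CARD('d) - 2) = of_nat (k * (k + (CARD('d) - 2)))" for k
      using d by (simp add: of_nat_diff)
    ultimately have "n * (n + (CARD('d) - 2)) = m * (m + (CARD('d) - 2))" by (simp only: of_nat_eq_iff)
    moreover have "n * (n + e) < m * (m + e)" if "n < m" for n m e :: nat
      using that by (intro mult_strict_mono') auto
    ultimately show False using \<open>n \<noteq> m\<close> by (metis less_irrefl linorder_neqE_nat)
  qed
  ultimately show ?thesis by (metis mult_cancel_right)
qed

section \<open>The generalized Funk--Radon transform on smooth functions\<close>

text \<open>The reciprocal is written as a power so that smoothness in \<open>v\<close> follows from that of \<open>powr\<close>.\<close>

definition householder :: "'a::euclidean_space \<Rightarrow> 'a \<Rightarrow> 'a" where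
  "householder v w = w - (2 * (v \<bullet> w) * (v \<bullet> v) powr (- 1)) *\<^sub>R v"

lemma orthogonal_transformation_householder:
  assumes "v \<noteq> 0"
  shows "orthogonal_transformation (householder v)"
  unfolding orthogonal_transformation
proof (intro conjI allI)
  have i: "(v \<bullet> v) powr (- 1) = 1 / (v \<bullet> v)" using assms by (simp add: powr_minus_divide)
  show "linear (householder v)"
    by (rule linearI) (simp_all add: householder_def algebra_simps inner_add_right)
  fix w
  have "householder v w \<bullet> householder v w = w \<bullet> w"
    using assms unfolding householder_def i
    by (simp add: inner_diff_left inner_diff_right inner_commute[of w v] field_simps power2_eq_square)
  then show "norm (householder v w) = norm w" by (simp add: norm_eq_sqrt_inner)
qed

lemma householder_maps:
  assumes "norm e = 1" "norm \<xi> = 1" "e \<noteq> \<xi>"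
  shows "householder (e - \<xi>) e = \<xi>"
proof -
  have "(e - \<xi>) \<bullet> (e - \<xi>) = 2 * ((e - \<xi>) \<bullet> e)"
  proof -
    have ee: "e \<bullet> e = 1" "\<xi> \<bullet> \<xi> = 1" using assms by (simp_all add: dot_square_norm)
    show ?thesis by (simp only: inner_diff_left inner_diff_right ee inner_commute[of \<xi> e]) simp
  qed
  moreover have "y * y powr (- 1) = 1" if "y > 0" for y :: real using that by (simp add: powr_minus_divide)
  moreover have "(e - \<xi>) \<bullet> (e - \<xi>) > 0" using assms by simp
  ultimately have P: "2 * ((e - \<xi>) \<bullet> e) * ((e - \<xi>) \<bullet> (e - \<xi>)) powr (- 1) = 1" by metis
  show ?thesis unfolding householder_def P by simp
qed

lemma open_sgn_neq: "open {y :: 'a::euclidean_space. y \<noteq> 0 \<and> sgn y \<noteq> e}"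
proof -
  have "continuous_on (- {0 :: 'a}) sgn"
    using Ck_sgn[OF open_Compl[OF closed_singleton], of 0 0] by simp
  then have "open (sgn -` (- {e}) \<inter> (- {0 :: 'a}))"
    by (subst (asm) continuous_on_open_vimage) auto
  moreover have "sgn -` (- {e}) \<inter> (- {0}) = {y. y \<noteq> 0 \<and> sgn y \<noteq> e}" by auto
  ultimately show ?thesis by simp
qed

text \<open>The domain of integration depends on \<open>\<xi>\<close>; locally a reflection that maps a fixed unit vector \<open>e\<close>
  to \<open>\<xi>\<close> depends smoothly on \<open>\<xi>\<close>.\<close>

lemma Ck_sphere_mean_local:
  fixes f :: "real^'d::finite \<Rightarrow> complex"
  assumes f: "f \<in> smooth_sphere" and d: "CARD('d) \<ge> 2" and e: "norm e = 1"
  shows "Ck k (\<lambda>z. sphere_mean f (sgn (snd z)) (fst z)) (I1 \<times> {x. x \<noteq> 0 \<and> sgn x \<noteq> e})"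
proof -
  let ?X = "{x. x \<noteq> 0 \<and> sgn x \<noteq> e} :: (real^'d) set"
  \<comment> \<open>Off the axis of \<open>e\<close> the transported cap point cannot vanish, as
    \<open>nz\<close> shows, so \<open>f\<close> composed with \<open>sgn\<close> is evaluated only
    where it is smooth; the equator \<open>?K\<close> lies inside.\<close>
  let ?W = "{w. w - (e \<bullet> w) *\<^sub>R e \<noteq> 0} :: (real^'d) set"
  let ?K = "sphere 0 1 \<inter> {w. e \<bullet> w = 0} :: (real^'d) set"
  let ?F = "\<lambda>x. f (sgn x)"
  let ?\<nu> = "equator_measure e"
  have oX: "open ?X" by (rule open_sgn_neq)
  have oW: "open ?W" by (intro open_Collect_neq continuous_intros)
  have K: "compact ?K" by (intro compact_Int_closed closed_hyperplane) auto
  have KW: "?K \<subseteq> ?W" by auto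
  have oIX: "open (I1 \<times> ?X)" by (intro open_Times oX) auto
  let ?U = "(I1 \<times> ?X) \<times> ?W"
  have oU: "open ?U" by (intro open_Times[OF oIX oW])
  let ?H = "\<lambda>z. householder (e - sgn (snd (fst z))) (snd z)"
  have Cx: "Ck k (\<lambda>z. sgn (snd (fst z))) ?U"
    by (rule Ck_compose[OF oU Ck_sgn[of "- {0}"] Ck_linear[OF oU]])
      (auto intro: bounded_linear_compose[OF bounded_linear_snd bounded_linear_fst])
  have Cw: "Ck k (\<lambda>z. snd z) ?U" by (rule Ck_linear[OF oU bounded_linear_snd])
  have Ct: "Ck k (\<lambda>z. fst (fst z)) ?U"
    by (rule Ck_linear[OF oU bounded_linear_compose[OF bounded_linear_fst bounded_linear_fst]])
  have Cv: "Ck k (\<lambda>z. e - sgn (snd (fst z))) ?U" by (intro Ck_diff Ck_const oU Cx)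
  have CH: "Ck k ?H ?U"
    unfolding householder_def
    by (intro Ck_diff Ck_scaleR Ck_mult Ck_const Ck_inner Ck_powr oU Cv Cw) auto
  have Ccap: "Ck k (\<lambda>z. cap_point (sgn (snd (fst z))) (fst (fst z)) (?H z)) ?U"
    by (rule Ck_cap_point_gen[OF oU Ct Cx CH]) auto
  have nz: "cap_point (sgn x) t (householder (e - sgn x) w) \<noteq> 0" if "t \<in> I1" "x \<in> ?X" "w \<in> ?W" for t x w
  proof
    assume z: "cap_point (sgn x) t (householder (e - sgn x) w) = 0"
    let ?c = "sqrt (1 - t\<^sup>2)" let ?T = "householder (e - sgn x)"
    have o: "orthogonal_transformation ?T" using that by (intro orthogonal_transformation_householder) auto
    have m: "?T e = sgn x" using that e by (intro householder_maps) (auto simp: norm_sgn)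
    have c: "?c > 0" using that abs_less_1_sq[of t] by auto
    have "?c *\<^sub>R ?T w = (- t) *\<^sub>R ?T e" using z by (simp add: cap_point_def m eq_neg_iff_add_eq_0 add.commute)
    then have "(1 / ?c) *\<^sub>R (?c *\<^sub>R ?T w) = (1 / ?c) *\<^sub>R ((- t) *\<^sub>R ?T e)" by simp
    then have "?T w = (- t / ?c) *\<^sub>R ?T e" using c by simp
    then have "?T w = ?T ((- t / ?c) *\<^sub>R e)"
      by (simp only: linear_scale[OF orthogonal_transformation_linear[OF o]])
    then have "w = (- t / ?c) *\<^sub>R e" using orthogonal_transformation_inj[OF o] by (auto dest: injD)
    then have "w - (e \<bullet> w) *\<^sub>R e = 0" using e by (simp add: dot_square_norm)
    with that show False by auto
  qed
  have CF: "Ck k (\<lambda>z. ?F (cap_point (sgn (snd (fst z))) (fst (fst z)) (?H z))) ?U"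
    by (rule Ck_compose[OF oU smooth_sphere_Ck[OF f] Ccap]) (use nz in auto)
  have "Ck k (\<lambda>z. \<integral>w. indicator ?K w *\<^sub>R (\<lambda>z. ?F (cap_point (sgn (snd (fst z))) (fst (fst z)) (?H z))) (z, w) \<partial>?\<nu>) (I1 \<times> ?X)"
    by (rule Ck_parametric_integral[OF finite_equator_measure[OF e] _ K KW oIX oW CF]) simp
  then show ?thesis
  proof (rule Ck_cong[OF oIX, rotated])
    fix z assume "z \<in> I1 \<times> ?X"
    then obtain t x where z: "z = (t, x)" "t \<in> I1" "x \<in> ?X" by (cases z) auto
    let ?T = "householder (e - sgn x)"
    have t: "\<bar>t\<bar> < 1" using z by auto
    have o: "orthogonal_transformation ?T" using z by (intro orthogonal_transformation_householder) auto
    have s: "norm (sgn x) = 1" using z by (simp add: norm_sgn)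
    have m: "?T e = sgn x" using z e s by (intro householder_maps) auto
    note mT = orthogonal_transformation_measurable[OF o]
    have mf: "f \<in> borel_measurable borel" by (rule borel_measurable_smooth_sphere[OF f])
    have mfc: "(\<lambda>w. f (cap_point (sgn x) t w)) \<in> borel_measurable borel"
      using measurable_compose[OF cap_point_measurable mf] .
    have "sphere_mean f (sgn x) t = (\<integral>w. f (cap_point (sgn x) t w) \<partial>distr ?\<nu> borel ?T)"
      by (simp add: sphere_mean_def equator_measure_orthogonal[OF o] m)
    also have "\<dots> = (\<integral>w. f (cap_point (sgn x) t (?T w)) \<partial>?\<nu>)"
      using mT mfc by (intro integral_distr) (simp_all cong: measurable_cong_sets)
    also have "\<dots> = (\<integral>w. indicator ?K w *\<^sub>R ?F (cap_point (sgn x) t (?T w)) \<partial>?\<nu>)"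
    proof (rule integral_cong_AE)
      have 1: "(\<lambda>w. f (cap_point (sgn x) t (?T w))) \<in> borel_measurable borel"
        using measurable_compose[OF mT mfc] .
      then show "(\<lambda>w. f (cap_point (sgn x) t (?T w))) \<in> borel_measurable ?\<nu>"
        by (simp cong: measurable_cong_sets)
      have "(\<lambda>w. sgn (cap_point (sgn x) t (?T w))) \<in> borel_measurable borel"
        using measurable_compose[OF measurable_compose[OF mT cap_point_measurable] measurable_sgn_euclidean] .
      from measurable_compose[OF this mf]
      have "(\<lambda>w. ?F (cap_point (sgn x) t (?T w))) \<in> borel_measurable borel" .
      then have "(\<lambda>w. indicator ?K w *\<^sub>R ?F (cap_point (sgn x) t (?T w))) \<in> borel_measurable borel"
        using K by (intro borel_measurable_scaleR borel_measurable_indicator) (auto simp: compact_imp_closed)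
      then show "(\<lambda>w. indicator ?K w *\<^sub>R ?F (cap_point (sgn x) t (?T w))) \<in> borel_measurable ?\<nu>"
        by (simp cong: measurable_cong_sets)
      show "AE w in ?\<nu>. f (cap_point (sgn x) t (?T w)) = indicator ?K w *\<^sub>R ?F (cap_point (sgn x) t (?T w))"
        using AE_equator_measure[OF e d]
      proof eventually_elim
        case (elim w)
        have "norm (?T w) = 1" using elim o by (simp add: orthogonal_transformation)
        moreover have "sgn x \<bullet> ?T w = 0"
        proof -
          have "sgn x \<bullet> ?T w = ?T e \<bullet> ?T w" by (simp only: m)
          also have "\<dots> = e \<bullet> w" using o by (simp only: orthogonal_transformation_def)
          finally show ?thesis using elim by simp
        qed
        ultimately have "norm (cap_point (sgn x) t (?T w)) = 1"
          using cap_point_sphere(1)[OF s t, of "?T w"] by simp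
        then show ?case using elim by (simp add: sgn_div_norm)
      qed
    qed
    finally show "(\<integral>w. indicator ?K w *\<^sub>R (\<lambda>z. ?F (cap_point (sgn (snd (fst z))) (fst (fst z)) (?H z))) (z, w) \<partial>?\<nu>) =
        sphere_mean f (sgn (snd z)) (fst z)"
      by (simp add: z)
  qed
qed

lemma Ck_sphere_mean:
  fixes f :: "real^'d::finite \<Rightarrow> complex"
  assumes f: "f \<in> smooth_sphere" and d: "CARD('d) \<ge> 2"
  shows "Ck k (\<lambda>z. sphere_mean f (sgn (snd z)) (fst z)) (I1 \<times> (- {0}))"
proof (rule Ck_local)
  fix z :: "real \<times> (real^'d)" assume "z \<in> I1 \<times> (- {0})"
  then obtain t x where z: "z = (t, x)" "t \<in> I1" "x \<noteq> 0" by (cases z) auto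
  \<comment> \<open>The reflection from \<open>?e\<close> degenerates only in the direction
    \<open>?e\<close> itself, and the antipode of \<open>x\<close> keeps a whole neighbourhood of
    \<open>x\<close> away from it.\<close>
  let ?e = "- sgn x"
  have e: "norm ?e = 1" using z by (simp add: norm_sgn)
  have ne: "sgn x \<noteq> - sgn x"
  proof
    assume "sgn x = - sgn x"
    then have "sgn x = 0" by (metis equation_minus_iff add_eq_0_iff2 scaleR_2 scaleR_eq_0_iff add.right_inverse zero_neq_numeral)
    then show False using z by (simp add: sgn_zero_iff)
  qed
  let ?X = "{y. y \<noteq> 0 \<and> sgn y \<noteq> ?e} :: (real^'d) set"
  have oX: "open ?X" by (rule open_sgn_neq)
  show "\<exists>W. open W \<and> z \<in> W \<and> Ck k (\<lambda>z. sphere_mean f (sgn (snd z)) (fst z)) W"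
    using z ne oX by (intro exI[of _ "I1 \<times> ?X"] conjI Ck_sphere_mean_local[OF f d e] open_Times) auto
qed

definition slice_fun :: "(real^'d::finite \<Rightarrow> complex) \<Rightarrow> real \<times> (real^'d) \<Rightarrow> complex" where
  "slice_fun f z = complex_of_real (cap_weight CARD('d) (fst z)) * sphere_mean f (sgn (snd z)) (fst z)"

text \<open>Derivatives in \<open>t\<close> are taken as joint derivatives in direction
  \<open>(1, 0)\<close>, so that smoothness in the second variable is inherited at every order;
  \<open>iter_deriv_slice\<close> identifies them with the one-variable derivatives of the
  transform.\<close>

primrec slice_deriv :: "nat \<Rightarrow> (real^'d::finite \<Rightarrow> complex) \<Rightarrow> real \<times> (real^'d) \<Rightarrow> complex" where
  "slice_deriv 0 f = slice_fun f"
| "slice_deriv (Suc j) f = (\<lambda>z. frechet_derivative (slice_deriv j f) (at z) (1, 0))"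

lemma open_slice_domain: "open (I1 \<times> (- {0 :: real^'d::finite}))"
  by (intro open_Times) auto

lemma Ck_slice_deriv:
  fixes f :: "real^'d::finite \<Rightarrow> complex"
  assumes f: "f \<in> smooth_sphere" and d: "CARD('d) \<ge> 2"
  shows "Ck k (slice_deriv j f) (I1 \<times> (- {0}))"
proof (induction j arbitrary: k)
  case 0
  have "Ck k (\<lambda>z. cap_weight CARD('d) (fst z)) (I1 \<times> (- {0 :: real^'d}))"
    by (rule Ck_compose[OF open_slice_domain Ck_cap_weight Ck_linear[OF open_slice_domain bounded_linear_fst]]) auto
  then have "Ck k (\<lambda>z. complex_of_real (cap_weight CARD('d) (fst z)) * sphere_mean f (sgn (snd z)) (fst z)) (I1 \<times> (- {0}))"
    by (intro Ck_mult Ck_of_real open_slice_domain Ck_sphere_mean[OF f d])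
  then show ?case by (simp add: slice_fun_def[abs_def])
next
  case (Suc j)
  from Suc[of "Suc k"] show ?case by simp
qed

lemma Ck_partial_derivative:
  fixes P :: "real \<times> (real^'d::finite) \<Rightarrow> complex"
  assumes "Ck (Suc 0) P (I1 \<times> (- {0}))" "t \<in> I1" "x \<noteq> 0"
  shows "((\<lambda>s. P (s, x)) has_vector_derivative frechet_derivative P (at (t, x)) (1, 0)) (at t)"
proof -
  have D: "(P has_derivative frechet_derivative P (at (t, x))) (at (t, x))"
    by (rule Ck_derivative[OF assms(1)]) (use assms in auto)
  interpret linear "frechet_derivative P (at (t, x))"
    by (rule bounded_linear.linear[OF has_derivative_bounded_linear[OF D]])
  have "((\<lambda>s::real. (s, x)) has_derivative (\<lambda>h. (h, 0))) (at t)"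
    by (auto intro!: derivative_eq_intros)
  from has_derivative_compose[OF this D]
  have D1: "((\<lambda>s. P (s, x)) has_derivative (\<lambda>h. frechet_derivative P (at (t, x)) (h, 0))) (at t)" .
  have "frechet_derivative P (at (t, x)) (h, 0) = h *\<^sub>R frechet_derivative P (at (t, x)) (1, 0)" for h
    using scaleR[of h "(1, 0)"] by simp
  then show ?thesis
    unfolding has_vector_derivative_def by (rule has_derivative_eq_rhs[OF D1 ext])
qed

lemma iter_deriv_slice:
  fixes f :: "real^'d::finite \<Rightarrow> complex"
  assumes f: "f \<in> smooth_sphere" and d: "CARD('d) \<ge> 2" and x: "x \<noteq> 0" and t: "t \<in> I1"
  shows "iter_deriv j (\<lambda>t. slice_fun f (t, x)) t = slice_deriv j f (t, x)"
  using t
proof (induction j arbitrary: t)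
  case (Suc j)
  have "vector_derivative (iter_deriv j (\<lambda>t. slice_fun f (t, x))) (at t) =
      vector_derivative (\<lambda>t. slice_deriv j f (t, x)) (at t)"
    by (rule vector_derivative_cong_open[where U = I1, OF _ Suc.prems Suc.IH]) auto
  also have "\<dots> = slice_deriv (Suc j) f (t, x)"
    using Ck_partial_derivative[OF Ck_slice_deriv[OF f d] Suc.prems x] by (simp add: vector_derivative_at)
  finally show ?case by simp
qed simp

text \<open>The power -1/2 in the transform and the dilation factor of
  \<open>subsphere_measure\<close> combine to \<open>cap_weight\<close>, which leaves
  \<open>CARD('d) - 1\<close> as the only constant. The right-hand side makes sense and is smooth
  off the sphere as well.\<close>

lemma funk_radon_eq:
  fixes f :: "real^'d::finite \<Rightarrow> complex"
  assumes f: "f \<in> smooth_sphere" and d: "CARD('d) \<ge> 3"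
  shows "funk_radon j f = on_sphere (\<lambda>x. (- 1) ^ j * of_nat (CARD('d) - 1) * slice_deriv j f (0, x))"
  unfolding funk_radon_def
proof (rule ext)
  fix \<xi> :: "real^'d"
  let ?g = "\<lambda>t. (1 - t\<^sup>2) powr (- 1/2) *\<^sub>R (\<integral>\<eta>. f \<eta> \<partial>subsphere_measure \<xi> t)"
  have d2: "CARD('d) \<ge> 2" using d by simp
  have "iter_deriv j ?g 0 = of_nat (CARD('d) - 1) * slice_deriv j f (0, \<xi>)" if \<xi>: "\<xi> \<in> sphere 0 1"
  proof -
    have nz: "\<xi> \<noteq> 0" and s: "sgn \<xi> = \<xi>" using \<xi> by (auto simp: sgn_div_norm)
    have g: "?g t = of_nat (CARD('d) - 1) * slice_fun f (t, \<xi>)" if "t \<in> I1" for t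
    proof -
      have t: "\<bar>t\<bar> \<le> 1" "\<bar>t\<bar> < 1" using that by auto
      have pos: "1 - t\<^sup>2 > 0" using abs_less_1_sq[OF t(2)] by simp
      have "sqrt (1 - t\<^sup>2) ^ (CARD('d) - 2) = (1 - t\<^sup>2) powr (1/2 * real (CARD('d) - 2))"
      proof -
        have s: "sqrt (1 - t\<^sup>2) = (1 - t\<^sup>2) powr (1/2)" using pos by (simp add: powr_half_sqrt)
        have "sqrt (1 - t\<^sup>2) ^ (CARD('d) - 2) = sqrt (1 - t\<^sup>2) powr real (CARD('d) - 2)"
          using pos by (simp add: powr_realpow)
        also have "\<dots> = ((1 - t\<^sup>2) powr (1/2)) powr real (CARD('d) - 2)" by (simp only: s)
        finally show ?thesis by (simp only: powr_powr)
      qed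
      then have w: "(1 - t\<^sup>2) powr (- 1/2) * sqrt (1 - t\<^sup>2) ^ (CARD('d) - 2) = cap_weight CARD('d) t"
        using d by (simp add: cap_weight_def powr_add[symmetric] of_nat_diff diff_divide_distrib)
      have "?g t = ((1 - t\<^sup>2) powr (- 1/2) * (real (CARD('d) - 1) * sqrt (1 - t\<^sup>2) ^ (CARD('d) - 2))) *\<^sub>R
          sphere_mean f \<xi> t"
        unfolding integral_subsphere_measure[OF borel_measurable_smooth_sphere[OF f] t(1)]
        by (simp add: sphere_mean_def cap_point_def[abs_def])
      also have "(1 - t\<^sup>2) powr (- 1/2) * (real (CARD('d) - 1) * sqrt (1 - t\<^sup>2) ^ (CARD('d) - 2)) =
          real (CARD('d) - 1) * cap_weight CARD('d) t"
        unfolding w[symmetric] by (simp only: mult_ac)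
      finally show ?thesis by (simp add: slice_fun_def s scaleR_conv_of_real)
    qed
    have Ck: "Ck k (\<lambda>t. slice_fun f (t, \<xi>)) I1" for k
    proof -
      have P: "Ck k (\<lambda>t. (t, \<xi>)) I1"
        by (intro Ck_Pair Ck_linear bounded_linear_ident Ck_const) auto
      have "Ck k (\<lambda>t. slice_deriv 0 f (t, \<xi>)) I1"
        by (rule Ck_compose[OF _ Ck_slice_deriv[OF f d2, where j = 0] P]) (use nz in auto)
      then show ?thesis by simp
    qed
    have "iter_deriv j ?g 0 = iter_deriv j (\<lambda>t. of_nat (CARD('d) - 1) * slice_fun f (t, \<xi>)) 0"
      by (rule iter_deriv_cong[where U = I1, OF _ g]) auto
    also have "\<dots> = of_nat (CARD('d) - 1) * iter_deriv j (\<lambda>t. slice_fun f (t, \<xi>)) 0"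
      by (rule iter_deriv_cmult[where U = I1, OF Ck]) auto
    also have "iter_deriv j (\<lambda>t. slice_fun f (t, \<xi>)) 0 = slice_deriv j f (0, \<xi>)"
      by (rule iter_deriv_slice[OF f d2 nz]) auto
    finally show ?thesis .
  qed
  note eq = this
  show "on_sphere (\<lambda>\<xi>. (- 1) ^ j * iter_deriv j (\<lambda>t. (1 - t\<^sup>2) powr (- 1/2) *\<^sub>R (\<integral>\<eta>. f \<eta> \<partial>subsphere_measure \<xi> t)) 0) \<xi> =
    on_sphere (\<lambda>x. (- 1) ^ j * of_nat (CARD('d) - 1) * slice_deriv j f (0, x)) \<xi>"
  proof (cases "\<xi> \<in> sphere 0 1")
    case True
    then show ?thesis by (simp only: on_sphere_def if_True eq[OF True] mult.assoc)
  next
    case False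
    then show ?thesis by (simp only: on_sphere_def if_False)
  qed
qed

lemma Ck_slice_deriv_at_0:
  fixes f :: "real^'d::finite \<Rightarrow> complex"
  assumes f: "f \<in> smooth_sphere" and d: "CARD('d) \<ge> 2"
  shows "Ck k (\<lambda>x. slice_deriv j f (0, x)) (- {0})"
proof -
  have P: "Ck k (\<lambda>x. (0 :: real, x)) (- {0 :: real^'d})"
    by (intro Ck_Pair Ck_const Ck_linear bounded_linear_ident) auto
  show ?thesis
    by (rule Ck_compose[OF open_Compl[OF closed_singleton] Ck_slice_deriv[OF f d, where j = j] P]) auto
qed

lemma funk_radon_smooth:
  fixes f :: "real^'d::finite \<Rightarrow> complex"
  assumes f: "f \<in> smooth_sphere" and d: "CARD('d) \<ge> 3"
  shows "funk_radon j f \<in> smooth_sphere"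
  unfolding funk_radon_eq[OF assms]
  by (rule smooth_sphere_on_sphere, intro Ck_mult Ck_const Ck_slice_deriv_at_0[OF f]) (use d in auto)

section \<open>Action on spherical harmonics\<close>

lemma smooth_sphere_bounded:
  assumes "f \<in> smooth_sphere"
  shows "\<exists>B\<ge>0. \<forall>x. cmod (f x) \<le> B"
proof -
  have "bounded (f ` sphere 0 1)"
    by (intro compact_imp_bounded compact_continuous_image continuous_on_smooth_sphere[OF assms]) auto
  then obtain B where B: "\<forall>x\<in>sphere 0 1. cmod (f x) \<le> B" by (auto simp: bounded_iff)
  have "cmod (f x) \<le> max B 0" for x
    using B smooth_sphere_outside[OF assms, of x] by (cases "x \<in> sphere 0 1") (auto simp: le_max_iff_disj)
  then show ?thesis by (intro exI[of _ "max B 0"]) auto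
qed

lemma integrable_cap_smooth:
  fixes f :: "real^'d::finite \<Rightarrow> complex"
  assumes f: "f \<in> smooth_sphere" and \<xi>: "norm \<xi> = 1"
  shows "integrable (equator_measure \<xi>) (\<lambda>w. f (cap_point \<xi> t w))"
proof -
  interpret finite_measure "equator_measure \<xi>" by (rule finite_equator_measure[OF \<xi>])
  obtain B where "\<forall>x. cmod (f x) \<le> B" using smooth_sphere_bounded[OF f] by blast
  then show ?thesis
    by (intro integrable_const_bound[of _ B] measurable_cap borel_measurable_smooth_sphere f) auto
qed

lemma sphere_mean_bound:
  fixes f :: "real^'d::finite \<Rightarrow> complex"
  assumes f: "f \<in> smooth_sphere" and \<xi>: "norm \<xi> = 1" and B: "\<And>x. cmod (f x) \<le> B"
  shows "cmod (sphere_mean f \<xi> t) \<le> B * equator_mass \<xi>"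
proof -
  interpret finite_measure "equator_measure \<xi>" by (rule finite_equator_measure[OF \<xi>])
  have "cmod (sphere_mean f \<xi> t) \<le> (\<integral>w. cmod (f (cap_point \<xi> t w)) \<partial>equator_measure \<xi>)"
    unfolding sphere_mean_def by (rule integral_norm_bound)
  also have "\<dots> \<le> (\<integral>w. B \<partial>equator_measure \<xi>)"
    using integrable_cap_smooth[OF f \<xi>, of t] B by (intro integral_mono integrable_norm) auto
  finally show ?thesis by (simp add: equator_mass_def mult.commute)
qed

lemma sphere_mean_add_scale:
  fixes f g :: "real^'d::finite \<Rightarrow> complex"
  assumes "f \<in> smooth_sphere" "g \<in> smooth_sphere" "norm \<xi> = 1"
  shows "sphere_mean (\<lambda>x. c * f x + g x) \<xi> t = c * sphere_mean f \<xi> t + sphere_mean g \<xi> t"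
  using integrable_cap_smooth[OF assms(1,3), of t] integrable_cap_smooth[OF assms(2,3), of t]
  by (simp add: sphere_mean_def)

definition mean_fun :: "real \<Rightarrow> (real^'d::finite \<Rightarrow> complex) \<Rightarrow> real^'d \<Rightarrow> complex" where
  "mean_fun t f = on_sphere (\<lambda>x. sphere_mean f x t)"

lemma mean_fun_smooth:
  fixes f :: "real^'d::finite \<Rightarrow> complex"
  assumes f: "f \<in> smooth_sphere" and d: "CARD('d) \<ge> 2" and t: "\<bar>t\<bar> < 1"
  shows "mean_fun t f \<in> smooth_sphere"
proof -
  have "Ck k (\<lambda>x. sphere_mean f (sgn x) t) (- {0})" for k
  proof -
    have P: "Ck k (\<lambda>x. (t, x)) (- {0 :: real^'d})"
      by (intro Ck_Pair Ck_const Ck_linear bounded_linear_ident) auto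
    have "Ck k (\<lambda>x. (\<lambda>z. sphere_mean f (sgn (snd z)) (fst z)) (t, x)) (- {0})"
      by (rule Ck_compose[OF open_Compl[OF closed_singleton] Ck_sphere_mean[OF f d] P]) (use t in auto)
    then show ?thesis by simp
  qed
  from smooth_sphere_on_sphere[OF this]
  have "on_sphere (\<lambda>x. sphere_mean f (sgn x) t) \<in> smooth_sphere" .
  also have "on_sphere (\<lambda>x. sphere_mean f (sgn x) t) = mean_fun t f"
    by (auto simp: on_sphere_def mean_fun_def sgn_div_norm)
  finally show ?thesis .
qed

lemma sphere_inner_bound:
  fixes g Y :: "real^'d::finite \<Rightarrow> complex"
  assumes g: "g \<in> smooth_sphere" and Y: "Y \<in> smooth_sphere" and B: "\<And>x. cmod (g x) \<le> B"
  shows "cmod (sphere_inner g Y) \<le> B * (\<integral>x. cmod (Y x) \<partial>sphere_measure)"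
proof -
  interpret finite_measure "sphere_measure :: (real^'d) measure" by (rule finite_sphere_measure)
  obtain C where "\<forall>x. cmod (Y x) \<le> C" using smooth_sphere_bounded[OF Y] by blast
  then have iY: "integrable sphere_measure Y"
    using borel_measurable_smooth_sphere[OF Y]
    by (intro integrable_const_bound[of _ C]) (auto cong: measurable_cong_sets)
  have "cmod (sphere_inner g Y) \<le> (\<integral>x. cmod (g x * cnj (Y x)) \<partial>sphere_measure)"
    unfolding sphere_inner_def by (rule integral_norm_bound)
  also have "\<dots> \<le> (\<integral>x. B * cmod (Y x) \<partial>sphere_measure)"
    using l2_integrable_mult[OF smooth_sphere_l2[OF g] smooth_sphere_l2[OF Y]] iY B
    by (intro integral_mono integrable_norm integrable_mult_right) (auto simp: norm_mult mult_right_mono)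
  finally show ?thesis by simp
qed

text \<open>The defect \<open>A\<close> is linear, bounded in the supremum norm and zero on every
  harmonic: within degree \<open>n\<close> by the Funk--Hecke constant, across degrees by
  orthogonality. Uniform density of the harmonics then forces it to vanish on all smooth
  functions.\<close>

lemma sphere_inner_mean_fun:
  fixes f Y :: "real^'d::finite \<Rightarrow> complex"
  assumes d: "CARD('d) \<ge> 3" and f: "f \<in> smooth_sphere" and t: "\<bar>t\<bar> < 1" and \<zeta>: "norm (\<zeta> :: real^'d) = 1"
    and Y: "Y \<in> spherical_harmonics n"
    and c: "\<And>p \<xi>. p \<in> homogeneous_polys n \<Longrightarrow> (\<forall>x. laplacian p x = 0) \<Longrightarrow> norm (\<xi> :: real^'d) = 1 \<Longrightarrow>
      sphere_mean p \<xi> t = c * p \<xi>"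
  shows "sphere_inner (mean_fun t f) Y = c * sphere_inner f Y"
proof -
  have d2: "CARD('d) \<ge> 2" using d by simp
  have YV: "Y \<in> smooth_sphere" by (rule spherical_harmonics_smooth[OF Y])
  note Y2 = smooth_sphere_l2[OF YV]
  define A where "A f = sphere_inner (mean_fun t f) Y - c * sphere_inner f Y" for f
  have lin: "A (\<lambda>x. k * f x + g x) = k * A f + A g" if fg: "f \<in> smooth_sphere" "g \<in> smooth_sphere" for k f g
  proof -
    have "mean_fun t (\<lambda>x. k * f x + g x) = (\<lambda>x. k * mean_fun t f x + mean_fun t g x)"
      using sphere_mean_add_scale[OF fg] by (auto simp: mean_fun_def on_sphere_def)
    then show ?thesis
      using sphere_inner_add_left[OF l2_scale[OF smooth_sphere_l2[OF fg(1)]] smooth_sphere_l2[OF fg(2)] Y2, of k]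
        sphere_inner_add_left[OF l2_scale[OF smooth_sphere_l2[OF mean_fun_smooth[OF fg(1) d2 t]]]
          smooth_sphere_l2[OF mean_fun_smooth[OF fg(2) d2 t]] Y2, of k]
      by (simp add: A_def sphere_inner_scale_left algebra_simps)
  qed
  have harm: "A h = 0" if h: "h \<in> spherical_harmonics m" for h m
  proof -
    obtain p where p: "p \<in> homogeneous_polys m" "\<forall>x. laplacian p x = 0" "h = on_sphere p"
      using h by (auto simp: spherical_harmonics_def)
    obtain k where k: "\<And>p \<xi>. p \<in> homogeneous_polys m \<Longrightarrow> (\<forall>x. laplacian p x = 0) \<Longrightarrow> norm (\<xi> :: real^'d) = 1 \<Longrightarrow>
        sphere_mean p \<xi> t = k * p \<xi>"
      using funk_hecke[OF d t \<zeta>, of m] by blast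
    have "sphere_mean h \<xi> t = k * h \<xi>" if \<xi>: "norm \<xi> = 1" for \<xi>
    proof -
      have "sphere_mean h \<xi> t = sphere_mean p \<xi> t"
        unfolding sphere_mean_def
      proof (rule integral_cong_AE)
        have "p \<in> borel_measurable borel"
          by (rule borel_measurable_continuous_onI[OF Ck_continuous[OF Ck_homogeneous_poly[OF p(1) open_UNIV, of 0]]])
        then show "(\<lambda>w. h (cap_point \<xi> t w)) \<in> borel_measurable (equator_measure \<xi>)"
          "(\<lambda>w. p (cap_point \<xi> t w)) \<in> borel_measurable (equator_measure \<xi>)"
          by (intro measurable_cap borel_measurable_smooth_sphere spherical_harmonics_smooth[OF h], intro measurable_cap)
        show "AE w in equator_measure \<xi>. h (cap_point \<xi> t w) = p (cap_point \<xi> t w)"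
          using AE_cap_point[OF \<xi> t d2] by eventually_elim (simp add: p(3) on_sphere_def)
      qed
      then show ?thesis using k[OF p(1,2) \<xi>] \<xi> by (simp add: p(3) on_sphere_def)
    qed
    then have M: "mean_fun t h = (\<lambda>x. k * h x)"
      using smooth_sphere_outside[OF spherical_harmonics_smooth[OF h]]
      by (auto simp: mean_fun_def on_sphere_def fun_eq_iff)
    show ?thesis
    proof (cases "m = n")
      case True
      show ?thesis
      \<comment> \<open>The constants \<open>k\<close> and \<open>c\<close> are compared at a point
        where \<open>p\<close> does not vanish; if there is none, both sides are 0.\<close>
      proof (cases "\<exists>\<xi>. norm \<xi> = 1 \<and> p \<xi> \<noteq> 0")
        case True
        then obtain \<xi> where "norm \<xi> = 1" "p \<xi> \<noteq> 0" by blast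
        then have "k = c" using k[OF p(1,2), of \<xi>] c[of p \<xi>] p \<open>m = n\<close> by simp
        then show ?thesis by (simp add: A_def M sphere_inner_scale_left)
      next
        case False
        then have h0: "h x = 0" for x by (auto simp: p(3) on_sphere_def)
        then have "mean_fun t h x = 0" for x using fun_cong[OF M, of x] by simp
        with h0 show ?thesis by (simp add: A_def sphere_inner_def)
      qed
    next
      case False
      then show ?thesis
        using spherical_harmonics_orthogonal[OF d2 h Y] by (simp add: A_def M sphere_inner_scale_left)
    qed
  qed
  have zero: "A g = 0 \<and> g \<in> smooth_sphere" if "g \<in> cfun.span (\<Union>m. spherical_harmonics m)" for g
    using that
  proof (induction rule: cfun.span_induct_alt)
    case base
    have "(\<lambda>x. 0) = (0 :: real^'d \<Rightarrow> complex)" by auto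
    moreover have "A (\<lambda>x. 0) = 0"
      using lin[OF smooth_sphere_zero smooth_sphere_zero, of "-1"] by simp
    ultimately show ?case using smooth_sphere_zero by simp
  next
    case (step k h g)
    then obtain m where h: "h \<in> spherical_harmonics m" by auto
    note hV = spherical_harmonics_smooth[OF h]
    have "A (\<lambda>x. k * h x + g x) = 0" using lin[OF hV, of g k] harm[OF h] step by simp
    moreover have "(\<lambda>x. k * h x) + g \<in> smooth_sphere" using step hV by (intro smooth_sphere_add smooth_sphere_scale) auto
    ultimately show ?case by (simp add: plus_fun_def)
  qed
  define I where "I = (\<integral>x. cmod (Y x) \<partial>sphere_measure)"
  have I: "I \<ge> 0" by (simp add: I_def)
  have bound: "cmod (A g) \<le> e * ((equator_mass \<zeta> + cmod c) * I)"
    if g: "g \<in> smooth_sphere" and e: "\<And>x. cmod (g x) \<le> e" for g e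
  proof -
    have e0: "e \<ge> 0" using e[of 0] norm_ge_zero order_trans by blast
    have "cmod (mean_fun t g x) \<le> e * equator_mass \<zeta>" for x
    proof (cases "x \<in> sphere 0 1")
      case True
      then have x: "norm x = 1" by simp
      from sphere_mean_bound[OF g x e, of t] show ?thesis
        using True by (simp add: mean_fun_def on_sphere_def equator_mass_unique[OF x \<zeta>])
    next
      case False
      then show ?thesis using e0 equator_mass_pos[OF \<zeta>] by (simp add: mean_fun_def on_sphere_def)
    qed
    then have "cmod (sphere_inner (mean_fun t g) Y) \<le> e * equator_mass \<zeta> * I"
      unfolding I_def by (rule sphere_inner_bound[OF mean_fun_smooth[OF g d2 t] YV])
    moreover have "cmod (c * sphere_inner g Y) \<le> cmod c * (e * I)"
      unfolding I_def norm_mult by (intro mult_left_mono sphere_inner_bound[OF g YV e]) auto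
    ultimately have "cmod (A g) \<le> e * equator_mass \<zeta> * I + cmod c * (e * I)"
      unfolding A_def by (intro norm_triangle_le_diff) linarith
    then show ?thesis by (simp add: algebra_simps)
  qed
  have "cmod (A f) \<le> e" if "e > 0" for e
  proof -
    define K where "K = (equator_mass \<zeta> + cmod c) * I"
    have K: "K \<ge> 0" using I equator_mass_pos[OF \<zeta>] by (simp add: K_def)
    define e' where "e' = e / (K + 1)"
    have e': "e' > 0" using that K by (simp add: e'_def)
    obtain g where g: "g \<in> cfun.span (\<Union>n. spherical_harmonics n)" "\<And>x. x \<in> sphere 0 1 \<Longrightarrow> cmod (f x - g x) < e'"
      using harmonics_dense[OF continuous_on_smooth_sphere[OF f] e'] by blast
    have gV: "g \<in> smooth_sphere" and Ag: "A g = 0" using zero[OF g(1)] by auto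
    have V: "(\<lambda>x. (- 1) * g x + f x) \<in> smooth_sphere"
      using smooth_sphere_add[OF smooth_sphere_scale[OF gV, of "-1"] f] by (simp add: plus_fun_def)
    have "cmod ((- 1) * g x + f x) \<le> e'" for x
      using g(2)[of x] smooth_sphere_outside[OF f, of x] smooth_sphere_outside[OF gV, of x] e'
      by (cases "x \<in> sphere 0 1") (auto simp: less_imp_le)
    from bound[OF V this] have "cmod (A f) \<le> e' * K"
      using lin[OF gV f, of "-1"] Ag by (simp add: K_def)
    also have "\<dots> \<le> e" using that K by (simp add: e'_def divide_le_eq algebra_simps)
    finally show ?thesis .
  qed
  then have "cmod (A f) \<le> 0" by (rule field_le_epsilon[of _ 0, simplified]) 
  then show ?thesis by (simp add: A_def)
qed

text \<open>Differentiation under the integral, one order at a time: the integrand is smooth jointly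
  in height and position, and the sphere is compact.\<close>

lemma iter_deriv_slice_inner:
  fixes f p :: "real^'d::finite \<Rightarrow> complex"
  assumes f: "f \<in> smooth_sphere" and d: "CARD('d) \<ge> 2" and p: "p \<in> homogeneous_polys n" and t: "t \<in> I1"
  shows "iter_deriv j (\<lambda>t. sphere_integral sphere_measure (\<lambda>x. slice_fun f (t, x) * cnj (p x))) t =
    sphere_integral sphere_measure (\<lambda>x. slice_deriv j f (t, x) * cnj (p x))"
  using t
proof (induction j arbitrary: t)
  case (Suc j)
  let ?\<mu> = "sphere_measure :: (real^'d) measure"
  let ?P = "\<lambda>z. slice_deriv j f z * cnj (p (snd z))"
  have CP: "Ck (Suc 0) ?P (I1 \<times> (- {0}))"
    by (intro Ck_mult Ck_cnj open_slice_domain Ck_slice_deriv[OF f d]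
        Ck_compose[OF open_slice_domain Ck_homogeneous_poly[OF p open_UNIV]]
        Ck_linear[OF open_slice_domain bounded_linear_snd]) auto
  have D: "((\<lambda>t. \<integral>x. indicator (sphere 0 1) x *\<^sub>R ?P (t, x) \<partial>?\<mu>) has_derivative
      (\<lambda>h. \<integral>x. indicator (sphere 0 1) x *\<^sub>R frechet_derivative ?P (at (t, x)) (h, 0) \<partial>?\<mu>)) (at t)"
    by (rule has_derivative_parametric[OF finite_sphere_measure _ _ _ _ CP Suc.prems]) auto
  have fd: "frechet_derivative ?P (at (t, x)) (h, 0) = h *\<^sub>R (slice_deriv (Suc j) f (t, x) * cnj (p x))"
    if x: "x \<in> sphere 0 1" for x h
  proof -
    have nz: "x \<noteq> 0" using x by auto
    have DP: "(?P has_derivative frechet_derivative ?P (at (t, x))) (at (t, x))"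
      by (rule Ck_derivative[OF CP]) (use Suc.prems nz in auto)
    interpret linear "frechet_derivative ?P (at (t, x))"
      by (rule bounded_linear.linear[OF has_derivative_bounded_linear[OF DP]])
    have "((\<lambda>s. ?P (s, x)) has_vector_derivative frechet_derivative ?P (at (t, x)) (1, 0)) (at t)"
      by (rule Ck_partial_derivative[OF CP Suc.prems nz])
    moreover have "((\<lambda>s. ?P (s, x)) has_vector_derivative slice_deriv (Suc j) f (t, x) * cnj (p x)) (at t)"
      using has_vector_derivative_mult_left[OF Ck_partial_derivative[OF Ck_slice_deriv[OF f d] Suc.prems nz]]
      by simp
    ultimately have "frechet_derivative ?P (at (t, x)) (1, 0) = slice_deriv (Suc j) f (t, x) * cnj (p x)"
      by (rule vector_derivative_unique_at)
    then show ?thesis using scaleR[of h "(1, 0)"] by simp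
  qed
  have "(\<lambda>h. \<integral>x. indicator (sphere 0 1) x *\<^sub>R frechet_derivative ?P (at (t, x)) (h, 0) \<partial>?\<mu>) =
    (\<lambda>h. h *\<^sub>R sphere_integral ?\<mu> (\<lambda>x. slice_deriv (Suc j) f (t, x) * cnj (p x)))"
  proof
    fix h
    have "(\<integral>x. indicator (sphere 0 1) x *\<^sub>R frechet_derivative ?P (at (t, x)) (h, 0) \<partial>?\<mu>) =
        (\<integral>x. h *\<^sub>R (indicator (sphere 0 1) x *\<^sub>R (slice_deriv (Suc j) f (t, x) * cnj (p x))) \<partial>?\<mu>)"
      by (intro Bochner_Integration.integral_cong refl) (auto simp: indicator_def fd simp del: slice_deriv.simps)
    then show "(\<integral>x. indicator (sphere 0 1) x *\<^sub>R frechet_derivative ?P (at (t, x)) (h, 0) \<partial>?\<mu>) =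
      h *\<^sub>R sphere_integral ?\<mu> (\<lambda>x. slice_deriv (Suc j) f (t, x) * cnj (p x))"
      by (simp only: integral_scaleR_right)
  qed
  with D have V: "((\<lambda>t. sphere_integral ?\<mu> (\<lambda>x. slice_deriv j f (t, x) * cnj (p x))) has_vector_derivative
      sphere_integral ?\<mu> (\<lambda>x. slice_deriv (Suc j) f (t, x) * cnj (p x))) (at t)"
    by (simp only: has_vector_derivative_def snd_conv)
  have "vector_derivative (iter_deriv j (\<lambda>t. sphere_integral ?\<mu> (\<lambda>x. slice_fun f (t, x) * cnj (p x)))) (at t) =
      vector_derivative (\<lambda>t. sphere_integral ?\<mu> (\<lambda>x. slice_deriv j f (t, x) * cnj (p x))) (at t)"
    by (rule vector_derivative_cong_open[where U = I1, OF _ Suc.prems Suc.IH]) auto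
  also have "\<dots> = sphere_integral ?\<mu> (\<lambda>x. slice_deriv (Suc j) f (t, x) * cnj (p x))"
    by (rule vector_derivative_at[OF V])
  finally show ?case by simp
qed simp

text \<open>At every height the same Funk--Hecke constant governs the pairing of the mean of
  \<open>f\<close> with \<open>Y\<close> and the mean of the polynomial \<open>p\<close> at a point
  \<xi>. Hence, as functions of \<open>t\<close>, the two differ only by the factor
  \<open>sphere_inner f Y / p \<xi>\<close>, and the derivatives are those already computed for
  \<open>p\<close>.\<close>

lemma funk_radon_coefficient:
  fixes f Y :: "real^'d::finite \<Rightarrow> complex"
  assumes d: "CARD('d) \<ge> 3" and f: "f \<in> smooth_sphere" and Y: "Y \<in> spherical_harmonics n"
    and \<zeta>: "norm (\<zeta> :: real^'d) = 1"
  shows "sphere_inner (funk_radon j f) Y =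
    complex_of_real ((- 1) ^ j * real (CARD('d) - 1) * equator_mass \<zeta> * funk_mult CARD('d) n j) * sphere_inner f Y"
proof -
  let ?\<mu> = "sphere_measure :: (real^'d) measure"
  let ?d = "CARD('d)"
  have d2: "?d \<ge> 2" using d by simp
  obtain p where p: "p \<in> homogeneous_polys n" "\<forall>x. laplacian p x = 0" "Y = on_sphere p"
    using Y by (auto simp: spherical_harmonics_def)
  define k where "k = (- 1) ^ j * complex_of_nat (?d - 1)"
  have 1: "sphere_inner (funk_radon j f) Y = k * sphere_integral ?\<mu> (\<lambda>x. slice_deriv j f (0, x) * cnj (p x))"
  proof -
    have "sphere_inner (funk_radon j f) Y = sphere_integral ?\<mu> (\<lambda>x. (k * slice_deriv j f (0, x)) * cnj (p x))"
      unfolding funk_radon_eq[OF f d] p(3) sphere_inner_on_sphere k_def ..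
    also have "\<dots> = (\<integral>x. k * (indicator (sphere 0 1) x *\<^sub>R (slice_deriv j f (0, x) * cnj (p x))) \<partial>?\<mu>)"
      by (intro Bochner_Integration.integral_cong refl) (simp add: indicator_def)
    finally show ?thesis by (simp only: integral_mult_right_zero)
  qed
  have 2: "sphere_integral ?\<mu> (\<lambda>x. slice_deriv j f (0, x) * cnj (p x)) =
      iter_deriv j (\<lambda>t. sphere_integral ?\<mu> (\<lambda>x. slice_fun f (t, x) * cnj (p x))) 0"
    by (rule iter_deriv_slice_inner[OF f d2 p(1), symmetric]) auto
  have slice: "sphere_integral ?\<mu> (\<lambda>x. slice_fun f (t, x) * cnj (p x)) =
      complex_of_real (cap_weight ?d t) * sphere_inner (mean_fun t f) Y" for t
  proof -
    have "sphere_integral ?\<mu> (\<lambda>x. slice_fun f (t, x) * cnj (p x)) = (\<integral>x. complex_of_real (cap_weight ?d t) *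
        (indicator (sphere 0 1) x *\<^sub>R (sphere_mean f x t * cnj (p x))) \<partial>?\<mu>)"
      by (intro Bochner_Integration.integral_cong refl) (auto simp: indicator_def slice_fun_def sgn_div_norm)
    then show ?thesis by (simp only: integral_mult_right_zero mean_fun_def p(3) sphere_inner_on_sphere)
  qed
  show ?thesis
  proof (cases "\<exists>\<xi>. norm \<xi> = 1 \<and> p \<xi> \<noteq> 0")
    case True
    then obtain \<xi> where \<xi>: "norm \<xi> = 1" "p \<xi> \<noteq> 0" by blast
    have eq: "sphere_integral ?\<mu> (\<lambda>x. slice_fun f (t, x) * cnj (p x)) =
        (sphere_inner f Y / p \<xi>) * (complex_of_real (cap_weight ?d t) * sphere_mean p \<xi> t)" if "t \<in> I1" for t
    proof -
      have t: "\<bar>t\<bar> < 1" using that by auto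
      obtain c where c: "\<And>p \<xi>. p \<in> homogeneous_polys n \<Longrightarrow> (\<forall>x. laplacian p x = 0) \<Longrightarrow> norm (\<xi> :: real^'d) = 1 \<Longrightarrow>
          sphere_mean p \<xi> t = c * p \<xi>"
        using funk_hecke[OF d t \<zeta>, of n] by blast
      have "sphere_inner (mean_fun t f) Y = c * sphere_inner f Y"
        by (rule sphere_inner_mean_fun[OF d f t \<zeta> Y]) (rule c)
      then show ?thesis
        unfolding slice c[OF p(1,2) \<xi>(1)] using \<xi>(2) by simp
    qed
    have Ck: "Ck k (\<lambda>t. complex_of_real (cap_weight ?d t) * sphere_mean p \<xi> t) I1" for k
      by (intro Ck_mult Ck_of_real Ck_cap_weight Ck_sphere_mean_poly[OF \<xi>(1) d2 p(1)]) auto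
    have "iter_deriv j (\<lambda>t. sphere_integral ?\<mu> (\<lambda>x. slice_fun f (t, x) * cnj (p x))) 0 =
        iter_deriv j (\<lambda>t. (sphere_inner f Y / p \<xi>) * (complex_of_real (cap_weight ?d t) * sphere_mean p \<xi> t)) 0"
      by (rule iter_deriv_cong[where U = I1, OF _ eq]) auto
    also have "\<dots> = (sphere_inner f Y / p \<xi>) * iter_deriv j (\<lambda>t. complex_of_real (cap_weight ?d t) * sphere_mean p \<xi> t) 0"
      by (rule iter_deriv_cmult[where U = I1, OF Ck]) auto
    also have "\<dots> = complex_of_real (funk_mult ?d n j * equator_mass \<zeta>) * sphere_inner f Y"
      using p(2) \<xi>(2) by (subst iter_deriv_sphere_mean[OF \<xi>(1) d p(1)])
        (auto simp: equator_mass_unique[OF \<xi>(1) \<zeta>])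
    finally show ?thesis unfolding 1 2 k_def by simp
  next
    case False
    then have "Y = (\<lambda>x. 0)" by (auto simp: p(3) on_sphere_def)
    then show ?thesis by (simp add: sphere_inner_def)
  qed
qed

section \<open>Fourier coefficients and Sobolev norms\<close>

lemma wterm_cong:
  "(\<And>n k. k \<in> {1..N n} \<Longrightarrow> a n k = b n k) \<Longrightarrow> wterm N w a = wterm N w b"
  by (auto simp: wterm_def fun_eq_iff)

lemma wnorm_cong:
  "(\<And>n k. k \<in> {1..N n} \<Longrightarrow> a n k = b n k) \<Longrightarrow> wnorm N w a = wnorm N w b"
  using wterm_cong[of N a b w] by (simp add: wnorm_def)

lemma (in weights) wnorm_tail:
  assumes "wfin a"
  shows "(\<lambda>m. wnorm N w (\<lambda>n k. if n < m then 0 else a n k)) \<longlonglongrightarrow> 0"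
proof -
  have t: "wterm N w (\<lambda>n k. if n < m then 0 else a n k) = (\<lambda>n. wterm N w a n - (if n \<in> {..<m} then wterm N w a n else 0))" for m
    by (auto simp: wterm_def fun_eq_iff)
  have s: "(\<lambda>n. wterm N w a n - (if n \<in> {..<m} then wterm N w a n else 0)) sums
      ((\<Sum>n. wterm N w a n) - (\<Sum>n<m. wterm N w a n))" for m
    by (intro sums_diff summable_sums assms sums_If_finite_set) auto
  have "wnorm N w (\<lambda>n k. if n < m then 0 else a n k) = sqrt ((\<Sum>n. wterm N w a n) - (\<Sum>n<m. wterm N w a n))" for m
    unfolding wnorm_def t sums_unique[OF s, symmetric] ..
  moreover have "(\<lambda>m. sqrt ((\<Sum>n. wterm N w a n) - (\<Sum>n<m. wterm N w a n))) \<longlonglongrightarrow> sqrt ((\<Sum>n. wterm N w a n) - (\<Sum>n. wterm N w a n))"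
    by (intro tendsto_intros summable_LIMSEQ assms)
  ultimately show ?thesis by simp
qed

lemma spherical_harmonics_minus:
  assumes "Y \<in> spherical_harmonics n"
  shows "Y (- x) = (- 1) ^ n * Y x"
proof -
  obtain p where p: "p \<in> homogeneous_polys n" "Y = on_sphere p" using assms by (auto simp: spherical_harmonics_def)
  show ?thesis using homogeneous_polys_homogeneous[OF p(1), of "-1" x] by (simp add: p(2) on_sphere_def)
qed

lemma sphere_inner_reflect:
  fixes f Y :: "real^'d::finite \<Rightarrow> complex"
  assumes "f \<in> smooth_sphere" and Y: "Y \<in> spherical_harmonics n"
  shows "sphere_inner (\<lambda>x. f (- x)) Y = (- 1) ^ n * sphere_inner f Y"
proof -
  have o: "orthogonal_transformation (uminus :: real^'d \<Rightarrow> real^'d)"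
    by (simp add: orthogonal_transformation_def linear_iff)
  have mf: "(\<lambda>x. f (- x) * cnj (Y x)) \<in> borel_measurable borel"
    using smooth_sphere_reflect[OF assms(1)] spherical_harmonics_smooth[OF Y]
    by (intro borel_measurable_times borel_measurable_cnj borel_measurable_smooth_sphere)
  have "sphere_inner (\<lambda>x. f (- x)) Y = (\<integral>x. f (- x) * cnj (Y x) \<partial>distr sphere_measure borel uminus)"
    by (simp add: sphere_inner_def sphere_measure_invariant[OF o])
  also have "\<dots> = (\<integral>x. f (- (- x)) * cnj (Y (- x)) \<partial>sphere_measure)"
    using orthogonal_transformation_measurable[OF o] mf
    by (intro integral_distr) (simp_all cong: measurable_cong_sets)
  also have "\<dots> = (\<integral>x. (- 1) ^ n * (f x * cnj (Y x)) \<partial>sphere_measure)"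
    by (simp add: spherical_harmonics_minus[OF Y] mult_ac)
  finally show ?thesis by (simp add: sphere_inner_def)
qed

lemma slice_deriv_linear:
  fixes f g :: "real^'d::finite \<Rightarrow> complex"
  assumes d: "CARD('d) \<ge> 2" and fg: "f \<in> smooth_sphere" "g \<in> smooth_sphere" and z: "z \<in> I1 \<times> (- {0})"
  shows "slice_deriv j (\<lambda>x. c * f x + g x) z = c * slice_deriv j f z + slice_deriv j g z"
  using z
proof (induction j arbitrary: z)
  case 0
  then have "norm (sgn (snd z)) = 1" by (auto simp: norm_sgn)
  from sphere_mean_add_scale[OF fg this, of c "fst z"] show ?case
    by (simp add: slice_fun_def algebra_simps)
next
  case (Suc j)
  have D: "slice_deriv j f differentiable at z" "slice_deriv j g differentiable at z"
    using Ck_slice_deriv[OF fg(1) d, of "Suc 0" j] Ck_slice_deriv[OF fg(2) d, of "Suc 0" j] Suc.prems by auto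
  have "frechet_derivative (slice_deriv j (\<lambda>x. c * f x + g x)) (at z) =
      frechet_derivative (\<lambda>z. c * slice_deriv j f z + slice_deriv j g z) (at z)"
    by (rule frechet_derivative_cong_open[OF open_slice_domain Suc.prems Suc.IH])
  then show ?case using D by (simp add: dirderiv_add dirderiv_mult frechet_derivative_const)
qed

lemma funk_radon_linear:
  fixes f g :: "real^'d::finite \<Rightarrow> complex"
  assumes d: "CARD('d) \<ge> 3" and fg: "f \<in> smooth_sphere" "g \<in> smooth_sphere"
  shows "funk_radon j (\<lambda>x. c * f x + g x) = (\<lambda>x. c * funk_radon j f x + funk_radon j g x)"
proof -
  have V: "(\<lambda>x. c * f x + g x) \<in> smooth_sphere"
    using smooth_sphere_add[OF smooth_sphere_scale[OF fg(1), of c] fg(2)] by (simp add: plus_fun_def)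
  have d2: "CARD('d) \<ge> 2" using d by simp
  show ?thesis
    unfolding funk_radon_eq[OF V d] funk_radon_eq[OF fg(1) d] funk_radon_eq[OF fg(2) d]
  proof
    fix x :: "real^'d"
    show "on_sphere (\<lambda>x. (- 1) ^ j * of_nat (CARD('d) - 1) * slice_deriv j (\<lambda>x. c * f x + g x) (0, x)) x =
      c * on_sphere (\<lambda>x. (- 1) ^ j * of_nat (CARD('d) - 1) * slice_deriv j f (0, x)) x +
      on_sphere (\<lambda>x. (- 1) ^ j * of_nat (CARD('d) - 1) * slice_deriv j g (0, x)) x"
    proof (cases "x \<in> sphere 0 1")
      case True
      then have "(0, x) \<in> I1 \<times> (- {0})" by auto
      from slice_deriv_linear[OF d2 fg this, of j c] True show ?thesis
        by (simp add: on_sphere_def algebra_simps)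
    qed (simp add: on_sphere_def)
  qed
qed

locale harmonic_basis =
  fixes Y :: "nat \<Rightarrow> nat \<Rightarrow> real^'d::finite \<Rightarrow> complex" and N :: "nat \<Rightarrow> nat" and \<delta> :: real
  assumes card_ge: "CARD('d) \<ge> 3" and onb: "harmonic_onb Y"
    and N_eq: "N = harmonic_dim TYPE('d)" and \<delta>_eq: "\<delta> = (real CARD('d) - 2) / 2"
begin



abbreviation "V \<equiv> smooth_sphere :: (real^'d \<Rightarrow> complex) set"

definition coef :: "(real^'d \<Rightarrow> complex) \<Rightarrow> nat \<Rightarrow> nat \<Rightarrow> complex" where
  "coef f n k = sphere_inner f (Y n k)"

definition wt :: "real \<Rightarrow> nat \<Rightarrow> real" where
  "wt s n = (real n + \<delta>) powr (2 * s)"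

lemma \<delta>: "\<delta> \<ge> 1/2"
  using card_ge by (simp add: \<delta>_eq)

lemma wt_pos: "wt s n > 0"
proof -
  have "real n + \<delta> > 0" using \<delta> of_nat_0_le_iff[of n] by linarith
  then show ?thesis by (simp add: wt_def)
qed

sublocale ws: weights N "wt s" for s
  by unfold_locales (simp add: wt_pos less_imp_le)

sublocale w1: weights N "\<lambda>_. 1"
  by unfold_locales simp

lemma Y_mem: "k \<in> {1..N n} \<Longrightarrow> Y n k \<in> spherical_harmonics n"
  using onb cfun.span_base[of "Y n k" "Y n ` {1..N n}"] by (auto simp: harmonic_onb_def N_eq)

lemma Y_V: "k \<in> {1..N n} \<Longrightarrow> Y n k \<in> V"
  by (rule spherical_harmonics_smooth[OF Y_mem])

lemma Y_l2: "k \<in> {1..N n} \<Longrightarrow> Y n k \<in> l2_sphere"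
  by (rule smooth_sphere_l2[OF Y_V])

lemma Y_ortho:
  assumes "k \<in> {1..N n}" "l \<in> {1..N m}"
  shows "sphere_inner (Y n k) (Y m l) = (if n = m \<and> k = l then 1 else 0)"
proof (cases "n = m")
  case True
  then show ?thesis using onb assms by (auto simp: harmonic_onb_def N_eq)
next
  case False
  then show ?thesis
    using spherical_harmonics_orthogonal[OF _ Y_mem[OF assms(1)] Y_mem[OF assms(2)]] card_ge by simp
qed

lemma coef_linear:
  assumes "f \<in> l2_sphere" "g \<in> l2_sphere" "k \<in> {1..N n}"
  shows "coef (\<lambda>x. c * f x + g x) n k = c * coef f n k + coef g n k"
  using sphere_inner_add_left[OF l2_scale[OF assms(1)] assms(2) Y_l2[OF assms(3)], of c]
  by (simp add: coef_def sphere_inner_scale_left)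

lemma coef_scale: "coef (\<lambda>x. c * f x) n k = c * coef f n k"
  by (simp add: coef_def sphere_inner_scale_left)

lemma coef_diff:
  assumes "f \<in> l2_sphere" "g \<in> l2_sphere" "k \<in> {1..N n}"
  shows "coef (f - g) n k = coef f n k - coef g n k"
  using sphere_inner_diff_left[OF assms(1,2) Y_l2[OF assms(3)]] by (simp add: coef_def fun_diff_def)

lemma coef_zero: "coef 0 n k = 0"
  by (simp add: coef_def sphere_inner_def)

lemma coef_Y: "k \<in> {1..N n} \<Longrightarrow> l \<in> {1..N m} \<Longrightarrow> coef (Y m l) n k = (if n = m \<and> k = l then 1 else 0)"
  by (auto simp: coef_def Y_ortho)

definition idx :: "nat \<Rightarrow> (nat \<times> nat) set" where
  "idx m = Sigma {..<m} (\<lambda>n. {1..N n})"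

lemma finite_idx: "finite (idx m)"
  by (simp add: idx_def)

lemma sum_idx: "(\<Sum>i\<in>idx m. g i) = (\<Sum>n<m. \<Sum>k=1..N n. g (n, k))" for g :: "nat \<times> nat \<Rightarrow> 'z::comm_monoid_add"
  unfolding idx_def by (subst sum.Sigma) auto

lemma bessel_wpart:
  assumes "f \<in> l2_sphere"
  shows "wpart N (\<lambda>_. 1) (coef f) m \<le> l2_norm f"
proof -
  have "(\<Sum>i\<in>idx m. (cmod (sphere_inner f (case i of (n, k) \<Rightarrow> Y n k)))\<^sup>2) \<le> (l2_norm f)\<^sup>2"
    by (rule bessel[OF finite_idx assms]) (auto simp: idx_def Y_l2 Y_ortho split: if_splits)
  then have "(\<Sum>n<m. wterm N (\<lambda>_. 1) (coef f) n) \<le> (l2_norm f)\<^sup>2"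
    by (simp add: sum_idx wterm_def coef_def)
  then have "wpart N (\<lambda>_. 1) (coef f) m \<le> sqrt ((l2_norm f)\<^sup>2)"
    unfolding wpart_def by (rule real_sqrt_le_mono)
  then show ?thesis by (simp add: l2_norm_nonneg)
qed

lemma bessel_wnorm:
  assumes "f \<in> l2_sphere"
  shows "w1.wfin (coef f)" "wnorm N (\<lambda>_. 1) (coef f) \<le> l2_norm f"
  using bessel_wpart[OF assms] by (auto intro: w1.wfinI w1.wnorm_leI)

definition spherical_laplacian :: "(real^'d \<Rightarrow> complex) \<Rightarrow> real^'d \<Rightarrow> complex" where
  "spherical_laplacian f = on_sphere (angular_laplacian (\<lambda>x. f (sgn x)))"

lemma spherical_laplacian_V: "f \<in> V \<Longrightarrow> spherical_laplacian f \<in> V"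
  unfolding spherical_laplacian_def by (intro smooth_sphere_on_sphere Ck_angular_laplacian smooth_sphere_Ck)

lemma coef_spherical_laplacian:
  assumes "f \<in> V" "k \<in> {1..N n}"
  shows "coef (spherical_laplacian f) n k = complex_of_real (real n * (real n + real CARD('d) - 2)) * coef f n k"
proof -
  obtain p where p: "p \<in> homogeneous_polys n" "\<And>x. laplacian p x = 0" "Y n k = on_sphere p"
    using Y_mem[OF assms(2)] by (auto simp: spherical_harmonics_def)
  have "on_sphere (\<lambda>x. f (sgn x)) = f"
    using smooth_sphere_outside[OF assms(1)] by (auto simp: on_sphere_def sgn_div_norm fun_eq_iff)
  then show ?thesis
    using angular_laplacian_symmetric_harmonic[OF smooth_sphere_Ck[OF assms(1)] p(1,2)]
    by (simp add: coef_def spherical_laplacian_def p(3))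
qed

lemma coef_spherical_laplacian_pow:
  assumes "f \<in> V"
  shows "(spherical_laplacian ^^ j) f \<in> V"
    and "k \<in> {1..N n} \<Longrightarrow> coef ((spherical_laplacian ^^ j) f) n k =
      complex_of_real ((real n * (real n + real CARD('d) - 2)) ^ j) * coef f n k"
proof -
  show V: "(spherical_laplacian ^^ j) f \<in> V" for j
    using assms by (induction j) (auto intro: spherical_laplacian_V)
  show "k \<in> {1..N n} \<Longrightarrow> coef ((spherical_laplacian ^^ j) f) n k =
      complex_of_real ((real n * (real n + real CARD('d) - 2)) ^ j) * coef f n k"
    by (induction j) (simp_all add: coef_spherical_laplacian[OF V] mult_ac)
qed

text \<open>Bessel's inequality is applied to a power of the spherical Laplacian of \<open>f\<close>.\<close>

lemma smooth_wfin:
  assumes f: "f \<in> V"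
  shows "ws.wfin s (coef f)"
proof -
  define j where "j = nat \<lceil>s\<rceil>"
  have j: "s \<le> real j" by (simp add: j_def) linarith
  let ?g = "(spherical_laplacian ^^ j) f"
  \<comment> \<open>For \<open>n = 0\<close> the eigenvalue is 0, but a single term does not affect
    summability. From \<open>n = 1\<close> on, n + \<delta> is at most (1 + \<delta>) n, and
    \<open>n\<close> is at most the eigenvalue.\<close>
  have bound: "wterm N (wt s) (coef f) n \<le> (1 + \<delta>) ^ (2 * j) * wterm N (\<lambda>_. 1) (coef ?g) n" if n: "n \<ge> 1" for n
  proof -
    let ?e = "real n * (real n + real CARD('d) - 2)"
    have n1: "real n \<ge> 1" using n by simp
    have "real n * 1 \<le> ?e" using n1 card_ge by (intro mult_left_mono) auto
    then have e: "real n \<le> ?e" by simp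
    have x1: "1 \<le> real n + \<delta>" using n1 \<delta> by linarith
    have "\<delta> * 1 \<le> \<delta> * real n" using n1 \<delta> by (intro mult_left_mono) linarith+
    then have "real n + \<delta> \<le> (1 + \<delta>) * real n" by (simp add: distrib_right)
    also have "\<dots> \<le> (1 + \<delta>) * ?e" by (rule mult_left_mono[OF e]) (use \<delta> in linarith)
    finally have x2: "real n + \<delta> \<le> (1 + \<delta>) * ?e" .
    have "wt s n \<le> (real n + \<delta>) powr (2 * real j)"
      unfolding wt_def using x1 j by (intro powr_mono) auto
    also have "\<dots> = (real n + \<delta>) ^ (2 * j)" using x1 by (subst powr_realpow[symmetric]) auto
    also have "\<dots> \<le> ((1 + \<delta>) * ?e) ^ (2 * j)" using x1 x2 by (intro power_mono) linarith+
    also have "\<dots> = (1 + \<delta>) ^ (2 * j) * (?e ^ j)\<^sup>2" by (simp add: power_mult_distrib power_mult[symmetric] mult.commute)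
    finally have w: "wt s n \<le> (1 + \<delta>) ^ (2 * j) * (?e ^ j)\<^sup>2" .
    have e0: "?e ^ j \<ge> 0" using e n1 by simp
    show ?thesis
      unfolding wterm_def sum_distrib_left
    proof (rule sum_mono)
      fix k assume k: "k \<in> {1..N n}"
      have "(cmod (coef ?g n k))\<^sup>2 = (?e ^ j)\<^sup>2 * (cmod (coef f n k))\<^sup>2"
        unfolding coef_spherical_laplacian_pow(2)[OF f k] norm_mult norm_of_real abs_of_nonneg[OF e0] by (rule power_mult_distrib)
      moreover have "wt s n * (cmod (coef f n k))\<^sup>2 \<le> (1 + \<delta>) ^ (2 * j) * (?e ^ j)\<^sup>2 * (cmod (coef f n k))\<^sup>2"
        by (rule mult_right_mono[OF w]) simp
      ultimately show "wt s n * (cmod (coef f n k))\<^sup>2 \<le> (1 + \<delta>) ^ (2 * j) * (1 * (cmod (coef ?g n k))\<^sup>2)"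
        by (simp only: mult_1_left mult.assoc)
    qed
  qed
  have "summable (\<lambda>n. (1 + \<delta>) ^ (2 * j) * wterm N (\<lambda>_. 1) (coef ?g) n)"
    by (intro summable_mult bessel_wnorm(1) smooth_sphere_l2 coef_spherical_laplacian_pow(1)[OF f])
  then show ?thesis
    by (rule summable_comparison_test'[of _ 1]) (use bound ws.wterm_nonneg in \<open>auto simp: abs_of_nonneg\<close>)
qed

section \<open>The Sobolev completion described by limits of coefficients\<close>

lemma sobolev_norm_eq: "sobolev_norm Y s f = wnorm N (wt s) (coef f)"
  by (simp add: sobolev_norm_def wnorm_def wterm_def wt_def coef_def flip: \<delta>_eq N_eq)

lemma sobolev_norm_diff:
  assumes "f \<in> V" "g \<in> V"
  shows "sobolev_norm Y s (f - g) = wnorm N (wt s) (\<lambda>n k. coef f n k - coef g n k)"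
  unfolding sobolev_norm_eq using assms by (intro wnorm_cong coef_diff smooth_sphere_l2)

lemma seminormed_sobolev: "seminormed_functions V (sobolev_norm Y s)"
proof
  fix f g assume fg: "f \<in> V" "g \<in> V"
  show "f + g \<in> V" using fg by (rule smooth_sphere_add)
  have "sobolev_norm Y s (f + g) = wnorm N (wt s) (\<lambda>n k. coef f n k + coef g n k)"
    unfolding sobolev_norm_eq
    using coef_linear[OF smooth_sphere_l2[OF fg(1)] smooth_sphere_l2[OF fg(2)], where c = 1]
    by (intro wnorm_cong) (simp add: plus_fun_def)
  then show "sobolev_norm Y s (f + g) \<le> sobolev_norm Y s f + sobolev_norm Y s g"
    using ws.wnorm_add(2)[OF smooth_wfin[OF fg(1)] smooth_wfin[OF fg(2)]] by (simp add: sobolev_norm_eq)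
next
  fix f c assume f: "f \<in> V"
  show "0 \<le> sobolev_norm Y s f" unfolding sobolev_norm_eq by (rule ws.wnorm_nonneg[OF smooth_wfin[OF f]])
  show "(\<lambda>x. c * f x) \<in> V" using f by (rule smooth_sphere_scale)
  show "sobolev_norm Y s (\<lambda>x. c * f x) = cmod c * sobolev_norm Y s f"
    using ws.wnorm_cmult(2)[OF smooth_wfin[OF f], of s c] by (simp add: sobolev_norm_eq coef_scale[abs_def])
qed (rule smooth_sphere_zero)

sublocale H: seminormed_functions V "sobolev_norm Y s" for s
  by (rule seminormed_sobolev)

text \<open>The coefficients of the element of the completion that \<open>X\<close> represents; for
  negative orders such an element need not be a function.\<close>

definition lcoef :: "(nat \<Rightarrow> real^'d \<Rightarrow> complex) \<Rightarrow> nat \<Rightarrow> nat \<Rightarrow> complex" where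
  "lcoef X n k = lim (\<lambda>i. coef (X i) n k)"

lemma coef_bound:
  assumes "f \<in> V" "g \<in> V" "k \<in> {1..N n}"
  shows "sqrt (wt s n) * cmod (coef f n k - coef g n k) \<le> sobolev_norm Y s (f - g)"
  unfolding sobolev_norm_diff[OF assms(1,2)]
  by (rule ws.wnorm_component[OF ws.wnorm_diff(1)[OF smooth_wfin[OF assms(1)] smooth_wfin[OF assms(2)]] assms(3)])

lemma coef_tendsto:
  assumes X: "X \<in> cauchy_seqs V (sobolev_norm Y s)" and k: "k \<in> {1..N n}"
  shows "(\<lambda>i. coef (X i) n k) \<longlonglongrightarrow> lcoef X n k"
proof -
  have "Cauchy (\<lambda>i. coef (X i) n k)"
  proof (rule CauchyI)
    fix e :: real assume e: "e > 0"
    have w: "sqrt (wt s n) > 0" by (simp add: wt_pos)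
    obtain M where M: "\<forall>i\<ge>M. \<forall>l\<ge>M. sobolev_norm Y s (X i - X l) < sqrt (wt s n) * e"
      using H.cauchyD[OF X, of "sqrt (wt s n) * e"] e w by auto
    have "norm (coef (X i) n k - coef (X l) n k) < e" if "i \<ge> M" "l \<ge> M" for i l
      using coef_bound[OF H.cauchy_mem[OF X] H.cauchy_mem[OF X] k, of s i l] M that w
      by (smt (verit, best) mult_le_cancel_left_pos)
    then show "\<exists>M. \<forall>m\<ge>M. \<forall>n'\<ge>M. norm (coef (X m) n k - coef (X n') n k) < e" by blast
  qed
  then show ?thesis unfolding lcoef_def by (simp add: Cauchy_convergent_iff convergent_LIMSEQ_iff)
qed

text \<open>The Cauchy estimate for \<open>X i - X l\<close> survives the limit in \<open>l\<close>
  by the Fatou property, which gives convergence of the coefficient arrays in the weighted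
  norm.\<close>

lemma lcoef_limit:
  assumes X: "X \<in> cauchy_seqs V (sobolev_norm Y s)"
  shows "ws.wfin s (lcoef X)"
    and "ws.wfin s (\<lambda>n k. coef (X i) n k - lcoef X n k)"
    and "(\<lambda>i. wnorm N (wt s) (\<lambda>n k. coef (X i) n k - lcoef X n k)) \<longlonglongrightarrow> 0"
proof -
  have V: "X i \<in> V" for i by (rule H.cauchy_mem[OF X])
  have fin: "ws.wfin s (coef (X i))" for i by (rule smooth_wfin[OF V])
  have key: "\<exists>M. \<forall>i\<ge>M. ws.wfin s (\<lambda>n k. coef (X i) n k - lcoef X n k) \<and>
      wnorm N (wt s) (\<lambda>n k. coef (X i) n k - lcoef X n k) \<le> e" if e: "e > 0" for e
  proof -
    obtain M where M: "\<forall>i\<ge>M. \<forall>l\<ge>M. sobolev_norm Y s (X i - X l) < e"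
      using H.cauchyD[OF X e] by blast
    have "ws.wfin s (\<lambda>n k. coef (X i) n k - lcoef X n k)"
      "wnorm N (wt s) (\<lambda>n k. coef (X i) n k - lcoef X n k) \<le> e" if i: "i \<ge> M" for i
    proof -
      have lim: "(\<lambda>l. (\<lambda>n k. coef (X i) n k - coef (X l) n k) n k) \<longlonglongrightarrow> coef (X i) n k - lcoef X n k"
        if "k \<in> {1..N n}" for n k
        by (intro tendsto_intros coef_tendsto[OF X that])
      have le: "ws.wfin s (\<lambda>n k. coef (X i) n k - coef (X l) n k) \<and>
          wnorm N (wt s) (\<lambda>n k. coef (X i) n k - coef (X l) n k) \<le> e" if "l \<ge> M" for l
        using M i that ws.wnorm_diff(1)[OF fin fin] sobolev_norm_diff[OF V V, of s i l] by (metis less_imp_le)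
      show "ws.wfin s (\<lambda>n k. coef (X i) n k - lcoef X n k)"
        "wnorm N (wt s) (\<lambda>n k. coef (X i) n k - lcoef X n k) \<le> e"
        using ws.wnorm_fatou[OF lim le] by auto
    qed
    then show ?thesis by blast
  qed
  obtain M where "ws.wfin s (\<lambda>n k. coef (X M) n k - lcoef X n k)" using key[of 1] by auto
  from ws.wnorm_diff(1)[OF fin[of M] this] show L: "ws.wfin s (lcoef X)" by simp
  show F: "ws.wfin s (\<lambda>n k. coef (X i) n k - lcoef X n k)" for i by (rule ws.wnorm_diff(1)[OF fin L])
  show "(\<lambda>i. wnorm N (wt s) (\<lambda>n k. coef (X i) n k - lcoef X n k)) \<longlonglongrightarrow> 0"
  proof (rule LIMSEQ_I)
    fix e :: real assume "e > 0"
    then obtain M where "\<forall>i\<ge>M. wnorm N (wt s) (\<lambda>n k. coef (X i) n k - lcoef X n k) \<le> e/2"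
      using key[of "e/2"] by auto
    then show "\<exists>M. \<forall>i\<ge>M. norm (wnorm N (wt s) (\<lambda>n k. coef (X i) n k - lcoef X n k) - 0) < e"
      using \<open>e > 0\<close> ws.wnorm_nonneg[OF F] by (intro exI[of _ M]) (force simp: abs_of_nonneg)
  qed
qed

text \<open>Norm convergence forces convergence of each coefficient since all weights are positive.
  Conversely, two sequences with the same limit array both approach it in norm, hence each other.
  Elements of the completion may therefore be compared coefficient by coefficient.\<close>

lemma cls_eq_lcoef:
  assumes X: "X \<in> cauchy_seqs V (sobolev_norm Y s)" and Z: "Z \<in> cauchy_seqs V (sobolev_norm Y s)"
  shows "H.cls s X = H.cls s Z \<longleftrightarrow> (\<forall>n. \<forall>k\<in>{1..N n}. lcoef X n k = lcoef Z n k)"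
  unfolding H.cls_eq_iff[OF assms]
proof
  assume lim: "(\<lambda>i. sobolev_norm Y s (X i - Z i)) \<longlonglongrightarrow> 0"
  show "\<forall>n. \<forall>k\<in>{1..N n}. lcoef X n k = lcoef Z n k"
  proof (intro allI ballI)
    fix n k assume k: "k \<in> {1..N n}"
    have "(\<lambda>i. sqrt (wt s n) * cmod (coef (X i) n k - coef (Z i) n k)) \<longlonglongrightarrow> 0"
      by (rule tendsto_sandwich[OF _ _ tendsto_const lim])
        (use coef_bound[OF H.cauchy_mem[OF X] H.cauchy_mem[OF Z] k] ws.w_nonneg[of s n] in \<open>auto intro!: always_eventually\<close>)
    moreover have "(\<lambda>i. sqrt (wt s n) * cmod (coef (X i) n k - coef (Z i) n k)) \<longlonglongrightarrow>
        sqrt (wt s n) * cmod (lcoef X n k - lcoef Z n k)"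
      by (intro tendsto_intros coef_tendsto[OF X k] coef_tendsto[OF Z k])
    ultimately have "sqrt (wt s n) * cmod (lcoef X n k - lcoef Z n k) = 0" by (rule LIMSEQ_unique[rotated])
    then show "lcoef X n k = lcoef Z n k" using wt_pos[of s n] by simp
  qed
next
  assume eq: "\<forall>n. \<forall>k\<in>{1..N n}. lcoef X n k = lcoef Z n k"
  have le: "sobolev_norm Y s (X i - Z i) \<le> wnorm N (wt s) (\<lambda>n k. coef (X i) n k - lcoef X n k) +
      wnorm N (wt s) (\<lambda>n k. coef (Z i) n k - lcoef Z n k)" for i
  proof -
    have "sobolev_norm Y s (X i - Z i) = wnorm N (wt s) (\<lambda>n k. (coef (X i) n k - lcoef X n k) - (coef (Z i) n k - lcoef Z n k))"
      unfolding sobolev_norm_diff[OF H.cauchy_mem[OF X] H.cauchy_mem[OF Z]] using eq by (intro wnorm_cong) auto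
    also have "\<dots> \<le> wnorm N (wt s) (\<lambda>n k. coef (X i) n k - lcoef X n k) +
      wnorm N (wt s) (\<lambda>n k. coef (Z i) n k - lcoef Z n k)"
      by (rule ws.wnorm_diff(2)[OF lcoef_limit(2)[OF X] lcoef_limit(2)[OF Z]])
    finally show ?thesis .
  qed
  show "(\<lambda>i. sobolev_norm Y s (X i - Z i)) \<longlonglongrightarrow> 0"
    by (rule tendsto_sandwich[OF _ _ tendsto_const tendsto_add_zero[OF lcoef_limit(3)[OF X] lcoef_limit(3)[OF Z]]])
      (auto intro!: always_eventually le H.nonneg H.diff_mem H.cauchy_mem[OF X] H.cauchy_mem[OF Z])
qed

lemma lcoef_const: "lcoef (\<lambda>i. f) = coef f"
  by (simp add: lcoef_def fun_eq_iff)

text \<open>The common form of all subspaces in the theorem: the even and odd parts, the nullspace,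
  and the closed span of harmonics of prescribed degrees.\<close>

definition supported :: "real \<Rightarrow> nat set \<Rightarrow> (nat \<Rightarrow> real^'d \<Rightarrow> complex) set set" where
  "supported s Z = {H.cls s X | X. X \<in> cauchy_seqs V (sobolev_norm Y s) \<and> (\<forall>n. n \<notin> Z \<longrightarrow> (\<forall>k\<in>{1..N n}. lcoef X n k = 0))}"

lemma cls_in_supported:
  assumes X: "X \<in> cauchy_seqs V (sobolev_norm Y s)"
  shows "H.cls s X \<in> supported s Z \<longleftrightarrow> (\<forall>n. n \<notin> Z \<longrightarrow> (\<forall>k\<in>{1..N n}. lcoef X n k = 0))"
proof
  assume "H.cls s X \<in> supported s Z"
  then obtain X' where X': "X' \<in> cauchy_seqs V (sobolev_norm Y s)" "H.cls s X = H.cls s X'"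
    "\<forall>n. n \<notin> Z \<longrightarrow> (\<forall>k\<in>{1..N n}. lcoef X' n k = 0)" by (auto simp: supported_def)
  from X'(3) cls_eq_lcoef[OF X X'(1)] X'(2) show "\<forall>n. n \<notin> Z \<longrightarrow> (\<forall>k\<in>{1..N n}. lcoef X n k = 0)" by metis
qed (use X in \<open>auto simp: supported_def\<close>)

lemma supported_subset: "supported s Z \<subseteq> fun_completion V (sobolev_norm Y s)"
  by (auto simp: supported_def H.cls_in_completion)

definition psum :: "(nat \<Rightarrow> nat \<Rightarrow> complex) \<Rightarrow> nat set \<Rightarrow> real^'d \<Rightarrow> complex" where
  "psum a S x = (\<Sum>n\<in>S. \<Sum>k=1..N n. a n k * Y n k x)"

lemma psum_span:
  assumes "S \<subseteq> Z"
  shows "psum a S \<in> cfun.span (\<Union>n\<in>Z. spherical_harmonics n)"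
proof -
  have s: "(\<lambda>x. \<Sum>i\<in>I. g i x) = (\<Sum>i\<in>I. g i)" for g :: "nat \<Rightarrow> real^'d \<Rightarrow> complex" and I
    by (induction I rule: infinite_finite_induct) (auto simp: fun_eq_iff)
  have "psum a S = (\<Sum>n\<in>S. \<Sum>k=1..N n. (\<lambda>x. a n k * Y n k x))"
    unfolding psum_def[abs_def] s ..
  also have "\<dots> \<in> cfun.span (\<Union>n\<in>Z. spherical_harmonics n)"
    using assms Y_mem by (intro cfun.span_sum cfun.span_scale cfun.span_base) auto
  finally show ?thesis .
qed

lemma span_V: "cfun.span (\<Union>n\<in>Z. spherical_harmonics n) \<subseteq> V"
  by (rule span_smooth_sphere) (auto intro: spherical_harmonics_smooth)

lemma psum_V: "psum a S \<in> V"
  using psum_span[OF subset_refl] span_V by blast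

lemma psum_l2: "psum a S \<in> l2_sphere"
  by (rule smooth_sphere_l2[OF psum_V])

lemma coef_psum:
  assumes "finite S" "k \<in> {1..N n}"
  shows "coef (psum a S) n k = (if n \<in> S then a n k else 0)"
proof -
  have "coef (psum a S) n k = sphere_inner (\<lambda>x. \<Sum>i\<in>Sigma S (\<lambda>n. {1..N n}). (case i of (n, k) \<Rightarrow> a n k) * (case i of (n, k) \<Rightarrow> Y n k) x) (Y n k)"
    unfolding coef_def psum_def[abs_def] using assms(1) by (subst sum.Sigma) (auto simp: split_beta')
  also have "\<dots> = (\<Sum>i\<in>Sigma S (\<lambda>n. {1..N n}). (case i of (n, k) \<Rightarrow> a n k) * sphere_inner (case i of (n, k) \<Rightarrow> Y n k) (Y n k))"
    by (rule sphere_inner_sum_left) (use assms in \<open>auto intro: Y_l2\<close>)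
  also have "\<dots> = (\<Sum>i\<in>Sigma S (\<lambda>n. {1..N n}). if i = (n, k) then a n k else 0)"
    by (intro sum.cong refl) (auto simp: Y_ortho[OF _ assms(2)] split: if_splits)
  also have "\<dots> = (if n \<in> S then a n k else 0)"
    using assms by (subst sum.delta) auto
  finally show ?thesis .
qed

lemma coef_span:
  assumes "g \<in> cfun.span (\<Union>n\<in>Z. spherical_harmonics n)" "n \<notin> Z" "k \<in> {1..N n}"
  shows "coef g n k = 0"
proof -
  have "coef g n k = 0 \<and> g \<in> V"
    using assms(1)
  proof (induction rule: cfun.span_induct_alt)
    case base
    show ?case using coef_zero smooth_sphere_zero by (simp add: zero_fun_def)
  next
    case (step c h g)
    then obtain m where m: "m \<in> Z" "h \<in> spherical_harmonics m" by auto
    have hV: "h \<in> V" using m by (auto intro: spherical_harmonics_smooth)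
    have "coef h n k = 0"
      unfolding coef_def using m assms(2) card_ge
      by (intro spherical_harmonics_orthogonal[OF _ m(2) Y_mem[OF assms(3)]]) auto
    then show ?case
      using step(2) hV coef_linear[OF smooth_sphere_l2[OF hV] smooth_sphere_l2 assms(3), of g c]
      by (auto simp: plus_fun_def intro: smooth_sphere_add[unfolded plus_fun_def] smooth_sphere_scale)
  qed
  then show ?thesis ..
qed

text \<open>Coefficients are continuous and vanish on the span outside \<open>Z\<close>, so they
  vanish on the closure. Conversely, the finite sums \<open>psum\<close> of the limit coefficients
  over degrees below \<open>m\<close> in \<open>Z\<close> approximate the element up to a tail that
  tends to 0.\<close>

lemma closure_span_harmonics:
  "ctopology V (sobolev_norm Y s) closure_of (cembed V (sobolev_norm Y s) ` cfun.span (\<Union>n\<in>Z. spherical_harmonics n)) =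
    supported s Z"
proof (rule set_eqI)
  fix A
  let ?p = "sobolev_norm Y s" let ?S = "cfun.span (\<Union>n\<in>Z. spherical_harmonics n)"
  have cl: "A \<in> ctopology V ?p closure_of (cembed V ?p ` ?S) \<longleftrightarrow>
      A \<in> fun_completion V ?p \<and> (\<forall>r>0. \<exists>g\<in>?S. cdist V ?p A (cembed V ?p g) < r)"
    unfolding H.ctopology_eq H.M.metric_closure_of
    using span_V[of Z] H.cembed_in[of _ s] by (auto simp: H.M.in_mball subset_iff)
  show "A \<in> ctopology V ?p closure_of (cembed V ?p ` ?S) \<longleftrightarrow> A \<in> supported s Z"
  proof (cases "A \<in> fun_completion V ?p")
    case True
    then obtain X where X: "X \<in> cauchy_seqs V ?p" "A = H.cls s X" by (rule H.completion_cases)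
    note V = H.cauchy_mem[OF X(1)]
    have dist: "(\<lambda>i. ?p (X i - g)) \<longlonglongrightarrow> cdist V ?p A (cembed V ?p g)" if "g \<in> V" for g
      unfolding X(2) H.cembed_eq by (rule H.tendsto_cdist[OF X(1) H.const_cauchy[OF that]])
    show ?thesis
      unfolding cl cls_in_supported[OF X(1), folded X(2)]
    proof (intro iffI conjI allI impI ballI)
      fix n k assume A: "A \<in> fun_completion V ?p \<and> (\<forall>r>0. \<exists>g\<in>?S. cdist V ?p A (cembed V ?p g) < r)"
        and n: "n \<notin> Z" and k: "k \<in> {1..N n}"
      have "sqrt (wt s n) * cmod (lcoef X n k) \<le> r" if r: "r > 0" for r
      proof -
        obtain g where g: "g \<in> ?S" "cdist V ?p A (cembed V ?p g) < r" using A r by blast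
        have gV: "g \<in> V" using g(1) span_V by blast
        have "sqrt (wt s n) * cmod (lcoef X n k) \<le> cdist V ?p A (cembed V ?p g)"
        proof (rule LIMSEQ_le[OF _ dist[OF gV]])
          show "(\<lambda>i. sqrt (wt s n) * cmod (coef (X i) n k)) \<longlonglongrightarrow> sqrt (wt s n) * cmod (lcoef X n k)"
            by (intro tendsto_intros coef_tendsto[OF X(1) k])
          show "\<exists>M. \<forall>i\<ge>M. sqrt (wt s n) * cmod (coef (X i) n k) \<le> ?p (X i - g)"
            using coef_bound[OF V gV k, of s] coef_span[OF g(1) n k] by auto
        qed
        with g(2) show ?thesis by linarith
      qed
      then have "sqrt (wt s n) * cmod (lcoef X n k) \<le> 0" by (rule field_le_epsilon[of _ 0, simplified])
      then show "lcoef X n k = 0" using wt_pos[of s n] by (simp add: mult_le_0_iff)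
    next
      fix r :: real
      assume z: "\<forall>n. n \<notin> Z \<longrightarrow> (\<forall>k\<in>{1..N n}. lcoef X n k = 0)" and r: "r > 0"
      obtain m where m: "wnorm N (wt s) (\<lambda>n k. if n < m then 0 else lcoef X n k) < r"
        using order_tendstoD(2)[OF ws.wnorm_tail[OF lcoef_limit(1)[OF X(1)]] r]
        by (auto simp: eventually_sequentially)
      let ?g = "psum (lcoef X) ({..<m} \<inter> Z)"
      have gS: "?g \<in> ?S" by (rule psum_span) auto
      have le: "?p (X i - ?g) \<le> wnorm N (wt s) (\<lambda>n k. coef (X i) n k - lcoef X n k) +
          wnorm N (wt s) (\<lambda>n k. if n < m then 0 else lcoef X n k)" for i
      proof -
        have fin: "ws.wfin s (\<lambda>n k. if n < m then 0 else lcoef X n k)"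
        proof (rule summable_comparison_test'[OF lcoef_limit(1)[OF X(1)], of 0])
          fix n
          have "norm (wterm N (wt s) (\<lambda>n k. if n < m then 0 else lcoef X n k) n) =
              wterm N (wt s) (\<lambda>n k. if n < m then 0 else lcoef X n k) n"
            by (simp add: abs_of_nonneg ws.wterm_nonneg)
          also have "\<dots> \<le> wterm N (wt s) (lcoef X) n"
            unfolding wterm_def using ws.w_nonneg[of s n] by (intro sum_mono) auto
          finally show "norm (wterm N (wt s) (\<lambda>n k. if n < m then 0 else lcoef X n k) n) \<le> wterm N (wt s) (lcoef X) n" .
        qed
        have "?p (X i - ?g) = wnorm N (wt s) (\<lambda>n k. (coef (X i) n k - lcoef X n k) + (if n < m then 0 else lcoef X n k))"
          unfolding sobolev_norm_diff[OF V psum_V] using z by (intro wnorm_cong) (auto simp: coef_psum)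
        also have "\<dots> \<le> wnorm N (wt s) (\<lambda>n k. coef (X i) n k - lcoef X n k) +
          wnorm N (wt s) (\<lambda>n k. if n < m then 0 else lcoef X n k)"
          by (rule ws.wnorm_add(2)[OF lcoef_limit(2)[OF X(1)] fin])
        finally show ?thesis .
      qed
      have "cdist V ?p A (cembed V ?p ?g) \<le> 0 + wnorm N (wt s) (\<lambda>n k. if n < m then 0 else lcoef X n k)"
        by (rule LIMSEQ_le[OF dist[OF psum_V] tendsto_add[OF lcoef_limit(3)[OF X(1)] tendsto_const]]) (use le in auto)
      with m gS show "\<exists>g\<in>?S. cdist V ?p A (cembed V ?p g) < r" by force
    qed (use True in auto)
  next
    case False
    then show ?thesis using cl supported_subset by blast
  qed
qed

lemma cauchy_reflect:
  assumes X: "X \<in> cauchy_seqs V (sobolev_norm Y s)" and c: "cmod c = 1"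
  shows "(\<lambda>i x. c * X i (- x)) \<in> cauchy_seqs V (sobolev_norm Y s)"
    and "k \<in> {1..N n} \<Longrightarrow> lcoef (\<lambda>i x. c * X i (- x)) n k = c * (- 1) ^ n * lcoef X n k"
proof -
  have co: "coef (\<lambda>x. c * f (- x)) n k = c * (- 1) ^ n * coef f n k" if "f \<in> V" "k \<in> {1..N n}" for f n k
    using sphere_inner_reflect[OF that(1) Y_mem[OF that(2)]] coef_scale[of c "\<lambda>x. f (- x)"]
    by (simp add: coef_def mult.assoc)
  have mem: "(\<lambda>x. c * f (- x)) \<in> V" if "f \<in> V" for f
    by (rule smooth_sphere_scale[OF smooth_sphere_reflect[OF that]])
  show "(\<lambda>i x. c * X i (- x)) \<in> cauchy_seqs V (sobolev_norm Y s)"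
  proof (rule H.cauchy_bounded_image[OF X, where B = 1])
    fix f g assume fg: "f \<in> V" "g \<in> V"
    have "wterm N (wt s) (\<lambda>n k. coef (\<lambda>x. c * f (- x)) n k - coef (\<lambda>x. c * g (- x)) n k) =
        wterm N (wt s) (\<lambda>n k. coef f n k - coef g n k)"
      unfolding wterm_def using fg c
      by (auto simp: fun_eq_iff co right_diff_distrib[symmetric] norm_mult norm_power intro!: sum.cong)
    then show "sobolev_norm Y s ((\<lambda>x. c * f (- x)) - (\<lambda>x. c * g (- x))) \<le> 1 * sobolev_norm Y s (f - g)"
      unfolding sobolev_norm_diff[OF mem[OF fg(1)] mem[OF fg(2)]] sobolev_norm_diff[OF fg] wnorm_def by simp
  qed (auto intro: mem)
  show "lcoef (\<lambda>i x. c * X i (- x)) n k = c * (- 1) ^ n * lcoef X n k" if k: "k \<in> {1..N n}"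
    unfolding lcoef_def[of "\<lambda>i x. c * X i (- x)"] co[OF H.cauchy_mem[OF X] k]
    by (intro limI tendsto_intros coef_tendsto[OF X k])
qed

text \<open>Reflection multiplies the coefficients of degree \<open>n\<close> by the parity sign, so
  invariance is equivalent to the vanishing of those with sign -1. This depends on the class only,
  so testing all representatives amounts to testing one. The unimodular \<open>c\<close> treats even
  and odd parts together.\<close>

lemma parity_part:
  assumes c: "cmod c = 1" and cpar: "\<And>n. c * (- 1) ^ n = (if n \<in> Z then 1 else - 1)"
  shows "{A \<in> fun_completion V (sobolev_norm Y s). \<forall>X\<in>A. (\<lambda>i x. c * X i (- x)) \<in> A} = supported s Z"
proof (rule set_eqI)
  fix A
  show "A \<in> {A \<in> fun_completion V (sobolev_norm Y s). \<forall>X\<in>A. (\<lambda>i x. c * X i (- x)) \<in> A} \<longleftrightarrow> A \<in> supported s Z"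
  proof (cases "A \<in> fun_completion V (sobolev_norm Y s)")
    case True
    then obtain X where X: "X \<in> cauchy_seqs V (sobolev_norm Y s)" "A = H.cls s X" by (rule H.completion_cases)
    have eq: "(\<lambda>i x. c * X' i (- x)) \<in> A \<longleftrightarrow> (\<forall>n. n \<notin> Z \<longrightarrow> (\<forall>k\<in>{1..N n}. lcoef X' n k = 0))"
      if X': "X' \<in> A" for X'
    proof -
      have XC: "X' \<in> cauchy_seqs V (sobolev_norm Y s)" "H.cls s X' = A" using H.cls_memD X' X(2) by auto
      note R = cauchy_reflect[OF XC(1) c]
      have "(\<lambda>i x. c * X' i (- x)) \<in> A \<longleftrightarrow> H.cls s (\<lambda>i x. c * X' i (- x)) = H.cls s X'"
        using H.cls_memD H.mem_cls[OF R(1)] XC by metis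
      also have "\<dots> \<longleftrightarrow> (\<forall>n. \<forall>k\<in>{1..N n}. c * (- 1) ^ n * lcoef X' n k = lcoef X' n k)"
        unfolding cls_eq_lcoef[OF R(1) XC(1)] by (simp add: R(2))
      also have "\<dots> \<longleftrightarrow> (\<forall>n. n \<notin> Z \<longrightarrow> (\<forall>k\<in>{1..N n}. lcoef X' n k = 0))"
        unfolding cpar by (intro iff_allI) (auto simp: complex_eq_iff)
      finally show ?thesis .
    qed
    have "(\<forall>X'\<in>A. (\<lambda>i x. c * X' i (- x)) \<in> A) \<longleftrightarrow> A \<in> supported s Z"
    proof -
      have "(\<forall>n. n \<notin> Z \<longrightarrow> (\<forall>k\<in>{1..N n}. lcoef X' n k = 0)) \<longleftrightarrow> A \<in> supported s Z" if "X' \<in> A" for X'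
        using cls_in_supported[of X' s Z] H.cls_memD[of X' s X] that X(2) by auto
      then show ?thesis using eq H.mem_cls[OF X(1)] X(2) by blast
    qed
    with True show ?thesis by simp
  next
    case False
    then show ?thesis using supported_subset by blast
  qed
qed

lemma odd_part_eq: "odd_part V (sobolev_norm Y s) = supported s {n. odd n}"
  using parity_part[of "-1" "{n. odd n}" s] by (simp add: odd_part_def)

lemma even_part_eq: "even_part V (sobolev_norm Y s) = supported s {n. even n}"
  using parity_part[of 1 "{n. even n}" s] by (simp add: even_part_def)

end

section \<open>Completeness of the space of square-integrable functions\<close>

lemma l2_diff': "f \<in> l2_sphere \<Longrightarrow> g \<in> l2_sphere \<Longrightarrow> f - g \<in> l2_sphere"
  unfolding fun_diff_def by (rule l2_diff)

lemma l2_norm_eq_0_AE: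
  assumes "f \<in> l2_sphere" "l2_norm f = 0"
  shows "AE x in sphere_measure. f x = 0"
proof -
  have "(\<integral>x. (cmod (f x))\<^sup>2 \<partial>sphere_measure) = 0" using assms(2) by (simp add: l2_norm_def)
  then show ?thesis
    by (subst (asm) integral_nonneg_eq_0_iff_AE[OF l2_integrable_square[OF assms(1)]]) auto
qed

lemma l2_norm_square: "(l2_norm f)\<^sup>2 = (\<integral>x. (cmod (f x))\<^sup>2 \<partial>sphere_measure)"
  by (simp add: l2_norm_def)

lemma l2_norm_scale: "l2_norm (\<lambda>x. c * f x) = cmod c * l2_norm f"
  by (simp add: l2_norm_def norm_mult power_mult_distrib real_sqrt_mult)

text \<open>The square of a + b is at most (1 + t) times that of a plus (1 + 1/t) times that of b,
  for every t > 0. The optimal t is the quotient of the two norms; the added e/2 keeps it positive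
  and finite.\<close>

lemma l2_norm_triangle:
  assumes f: "f \<in> l2_sphere" and g: "g \<in> l2_sphere"
  shows "l2_norm (f + g) \<le> l2_norm f + l2_norm g"
proof (rule field_le_epsilon)
  fix e :: real assume e: "e > 0"
  let ?a = "l2_norm f + e/2" let ?b = "l2_norm g + e/2"
  have pos: "?a > 0" "?b > 0" using e l2_norm_nonneg[of f] l2_norm_nonneg[of g] by linarith+
  define t where "t = ?b / ?a"
  have t: "t > 0" using pos by (simp add: t_def)
  have pw: "(cmod (f x + g x))\<^sup>2 \<le> (1 + t) * (cmod (f x))\<^sup>2 + (1 + 1/t) * (cmod (g x))\<^sup>2" for x
  proof -
    have "(cmod (f x + g x))\<^sup>2 \<le> (cmod (f x) + cmod (g x))\<^sup>2"
      by (intro power_mono norm_triangle_ineq) auto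
    also have "\<dots> = (1 + t) * (cmod (f x))\<^sup>2 + (1 + 1/t) * (cmod (g x))\<^sup>2 - (t * cmod (f x) - cmod (g x))\<^sup>2 / t"
      using t by (simp add: field_simps power2_eq_square)
    also have "\<dots> \<le> (1 + t) * (cmod (f x))\<^sup>2 + (1 + 1/t) * (cmod (g x))\<^sup>2" using t by simp
    finally show ?thesis .
  qed
  have "(l2_norm (f + g))\<^sup>2 \<le> (\<integral>x. (1 + t) * (cmod (f x))\<^sup>2 + (1 + 1/t) * (cmod (g x))\<^sup>2 \<partial>sphere_measure)"
    unfolding l2_norm_square plus_fun_def
    by (rule integral_mono) (use pw l2_integrable_square[OF f] l2_integrable_square[OF g] l2_integrable_square[OF l2_add[OF f g]] in auto)
  also have "\<dots> = (1 + t) * (l2_norm f)\<^sup>2 + (1 + 1/t) * (l2_norm g)\<^sup>2"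
    using l2_integrable_square[OF f] l2_integrable_square[OF g] by (simp add: l2_norm_square)
  also have "\<dots> \<le> (1 + t) * ?a\<^sup>2 + (1 + 1/t) * ?b\<^sup>2"
    using t e l2_norm_nonneg[of f] l2_norm_nonneg[of g] by (intro add_mono mult_left_mono power_mono) auto
  also have "\<dots> = (?a + ?b)\<^sup>2"
  proof -
    have "(1 + b / a) * a\<^sup>2 + (1 + 1 / (b / a)) * b\<^sup>2 = (a + b)\<^sup>2" if "a > 0" "b > 0" for a b :: real
      using that by (simp add: field_simps power2_eq_square)
    then show ?thesis unfolding t_def using pos by blast
  qed
  finally have "l2_norm (f + g) \<le> ?a + ?b" using pos by (metis power2_le_imp_le add_nonneg_nonneg less_imp_le)
  then show "l2_norm (f + g) \<le> l2_norm f + l2_norm g + e" by simp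
qed

lemma l2_norm_diff_triangle:
  assumes "f \<in> l2_sphere" "g \<in> l2_sphere" "h \<in> l2_sphere"
  shows "l2_norm (f - h) \<le> l2_norm (f - g) + l2_norm (g - h)"
  using l2_norm_triangle[OF l2_diff'[OF assms(1,2)] l2_diff'[OF assms(2,3)]] by simp

lemma l2_norm_minus_commute: "l2_norm (f - g) = l2_norm (g - f)"
  by (simp add: l2_norm_def norm_minus_commute)

text \<open>Pointwise, the modulus is either at most \<open>e\<close> or at most its square divided
  by \<open>e\<close>. With \<open>e\<close> free this makes sequences that are Cauchy in square
  mean also Cauchy in mean.\<close>

lemma l2_norm_L1_bound:
  fixes f :: "real^'d::finite \<Rightarrow> complex"
  assumes f: "f \<in> l2_sphere" and e: "e > 0"
  shows "integrable sphere_measure f"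
    and "(\<integral>x. cmod (f x) \<partial>sphere_measure) \<le> (l2_norm f)\<^sup>2 / e + e * measure (sphere_measure :: (real^'d) measure) UNIV"
proof -
  interpret finite_measure "sphere_measure :: (real^'d) measure" by (rule finite_sphere_measure)
  have le: "cmod (f x) \<le> (cmod (f x))\<^sup>2 / e + e" if "e > 0" for x and e :: real
  proof (cases "cmod (f x) \<le> e")
    case False
    then have "cmod (f x) * e \<le> cmod (f x) * cmod (f x)" by (intro mult_left_mono) auto
    then have "cmod (f x) \<le> (cmod (f x))\<^sup>2 / e" using that by (simp add: power2_eq_square field_simps)
    then show ?thesis using that by linarith
  qed (use that in \<open>simp add: add_increasing\<close>)
  have i: "integrable sphere_measure (\<lambda>x. (cmod (f x))\<^sup>2 / e + e)"
    using l2_integrable_square[OF f] by simp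
  show "integrable sphere_measure f"
    using le[OF e] e by (intro Bochner_Integration.integrable_bound[OF i l2_measurable_sphere[OF f]])
      (auto intro!: always_eventually simp: abs_of_nonneg)
  then have "(\<integral>x. cmod (f x) \<partial>sphere_measure) \<le> (\<integral>x. (cmod (f x))\<^sup>2 / e + e \<partial>sphere_measure)"
    by (intro integral_mono i le e) auto
  also have "\<dots> = (l2_norm f)\<^sup>2 / e + e * measure (sphere_measure :: (real^'d) measure) UNIV"
    using l2_integrable_square[OF f] by (simp add: l2_norm_square)
  finally show "(\<integral>x. cmod (f x) \<partial>sphere_measure) \<le> (l2_norm f)\<^sup>2 / e + e * measure (sphere_measure :: (real^'d) measure) UNIV" .
qed

lemma l2_fatou:
  fixes f :: "real^'d::finite \<Rightarrow> complex"
  assumes F: "\<And>i. F i \<in> l2_sphere" and f: "f \<in> borel_measurable borel"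
    and lim: "AE x in sphere_measure. (\<lambda>i. F i x) \<longlonglongrightarrow> f x"
    and le: "\<forall>\<^sub>F i in sequentially. l2_norm (F i) \<le> B" and B: "B \<ge> 0"
  shows "f \<in> l2_sphere" "l2_norm f \<le> B"
proof -
  have n: "(\<integral>\<^sup>+x. ennreal ((cmod (g x))\<^sup>2) \<partial>sphere_measure) = ennreal ((l2_norm g)\<^sup>2)" if "g \<in> l2_sphere" for g :: "real^'d \<Rightarrow> complex"
    unfolding l2_norm_square using l2_integrable_square[OF that] by (intro nn_integral_eq_integral) auto
  have "(\<integral>\<^sup>+x. ennreal ((cmod (f x))\<^sup>2) \<partial>sphere_measure) = (\<integral>\<^sup>+x. liminf (\<lambda>i. ennreal ((cmod (F i x))\<^sup>2)) \<partial>sphere_measure)"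
  proof (rule nn_integral_cong_AE)
    show "AE x in sphere_measure. ennreal ((cmod (f x))\<^sup>2) = liminf (\<lambda>i. ennreal ((cmod (F i x))\<^sup>2))"
      using lim
    proof (rule eventually_mono)
      fix x assume "(\<lambda>i. F i x) \<longlonglongrightarrow> f x"
      then have "(\<lambda>i. ennreal ((cmod (F i x))\<^sup>2)) \<longlonglongrightarrow> ennreal ((cmod (f x))\<^sup>2)" by (intro tendsto_intros)
      from lim_imp_Liminf[OF _ this] show "ennreal ((cmod (f x))\<^sup>2) = liminf (\<lambda>i. ennreal ((cmod (F i x))\<^sup>2))" by simp
    qed
  qed
  also have "\<dots> \<le> liminf (\<lambda>i. \<integral>\<^sup>+x. ennreal ((cmod (F i x))\<^sup>2) \<partial>sphere_measure)"
    by (intro nn_integral_liminf measurable_compose[OF borel_measurable_integrable[OF l2_integrable_square[OF F]] measurable_ennreal])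
  also have "\<dots> \<le> ennreal (B\<^sup>2)"
    using le by (intro Liminf_le) (auto elim!: eventually_mono simp: n[OF F] l2_norm_nonneg intro!: ennreal_leI power_mono)
  finally have fin: "(\<integral>\<^sup>+x. ennreal ((cmod (f x))\<^sup>2) \<partial>sphere_measure) \<le> ennreal (B\<^sup>2)" .
  have m: "(\<lambda>x. (cmod (f x))\<^sup>2) \<in> borel_measurable sphere_measure"
    using f by (simp cong: measurable_cong_sets)
  have "integrable sphere_measure (\<lambda>x. (cmod (f x))\<^sup>2)"
    by (rule integrableI_bounded[OF m]) (use fin in \<open>auto simp: le_less_trans\<close>)
  then show f2: "f \<in> l2_sphere" using f by (simp add: l2_sphere_def)
  have "(l2_norm f)\<^sup>2 \<le> B\<^sup>2" using fin B unfolding n[OF f2] by simp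
  then show "l2_norm f \<le> B" using B by (rule power2_le_imp_le)
qed

text \<open>Being Cauchy in mean, the sequence has a subsequence that converges almost everywhere.
  Its limit is measurable, and Fatou's lemma along the subsequence turns the Cauchy estimate into
  convergence in square mean.\<close>

lemma l2_complete:
  fixes X :: "nat \<Rightarrow> real^'d::finite \<Rightarrow> complex"
  assumes X: "\<And>i. X i \<in> l2_sphere"
    and cauchy: "\<And>e. e > 0 \<Longrightarrow> \<exists>M. \<forall>i\<ge>M. \<forall>l\<ge>M. l2_norm (X i - X l) < e"
  shows "\<exists>g\<in>l2_sphere. (\<lambda>i. l2_norm (X i - g)) \<longlonglongrightarrow> 0"
proof -
  let ?\<mu> = "sphere_measure :: (real^'d) measure"
  have XX: "X i - X l \<in> l2_sphere" for i l by (intro l2_diff' X)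
  have L1: "\<exists>M. \<forall>i\<ge>M. \<forall>l\<ge>M. (LINT x|?\<mu>. norm (X i x - X l x)) < e" if e: "e > 0" for e
  proof -
    define a where "a = e / (2 * (measure ?\<mu> UNIV + 1))"
    have a: "a > 0" using e by (simp add: a_def add_nonneg_pos)
    have "a * (measure ?\<mu> UNIV + 1) = e / 2"
      by (simp add: a_def divide_simps) (use measure_nonneg[of ?\<mu> UNIV] in linarith)
    then have a2: "a * measure ?\<mu> UNIV < e / 2" using a by (simp add: distrib_left)
    \<comment> \<open>Dividing the square by \<open>a\<close> then leaves e / 2, while
      \<open>a\<close> times the total mass stays below the other half.\<close>
    obtain M where M: "\<forall>i\<ge>M. \<forall>l\<ge>M. l2_norm (X i - X l) < sqrt (a * (e / 2))"
      using cauchy[of "sqrt (a * (e / 2))"] a e by auto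
    have "(LINT x|?\<mu>. norm (X i x - X l x)) < e" if "i \<ge> M" "l \<ge> M" for i l
    proof -
      have "(l2_norm (X i - X l))\<^sup>2 \<le> (sqrt (a * (e / 2)))\<^sup>2"
        using M that by (intro power_mono l2_norm_nonneg less_imp_le) auto
      also have "\<dots> = a * (e / 2)" using a e by simp
      finally have "(l2_norm (X i - X l))\<^sup>2 / a \<le> e / 2" using a by (simp add: field_simps)
      then show ?thesis using l2_norm_L1_bound(2)[OF XX a, of i l] a2 by (simp add: mult.commute)
    qed
    then show ?thesis by blast
  qed
  have int: "integrable ?\<mu> (X i)" for i by (rule l2_norm_L1_bound(1)[OF X zero_less_one])
  obtain r where r: "strict_mono r" "AE x in ?\<mu>. Cauchy (\<lambda>i. X (r i) x)"
    using cauchy_L1_AE_cauchy_subseq[of ?\<mu> X, OF int L1] by blast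
  define g where "g = (\<lambda>x. lim (\<lambda>i. X (r i) x))"
  have g: "g \<in> borel_measurable borel"
    unfolding g_def using X by (intro borel_measurable_lim_metric l2_measurable)
  have lim: "AE x in ?\<mu>. (\<lambda>i. X (r i) x) \<longlonglongrightarrow> g x"
    using r(2) by (rule eventually_mono) (simp add: g_def Cauchy_convergent_iff convergent_LIMSEQ_iff)
  have key: "X i - g \<in> l2_sphere \<and> l2_norm (X i - g) \<le> e"
    if M: "\<forall>i\<ge>M. \<forall>l\<ge>M. l2_norm (X i - X l) < e" and i: "i \<ge> M" and e: "e > 0" for M i e
  proof -
    have l: "AE x in ?\<mu>. (\<lambda>l. (X i - X (r l)) x) \<longlonglongrightarrow> (X i - g) x"
      using lim by (rule eventually_mono) (auto intro: tendsto_intros)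
    have ev: "\<forall>\<^sub>F l in sequentially. l2_norm (X i - X (r l)) \<le> e"
      using M i seq_suble[OF r(1)] by (intro eventually_sequentiallyI[of M]) (meson less_imp_le order_trans)

    have ms: "X i - g \<in> borel_measurable borel"
      unfolding fun_diff_def by (intro borel_measurable_diff g l2_measurable X)
    have XXr: "X i - X (r l) \<in> l2_sphere" for l by (rule XX)
    show ?thesis
      by (intro conjI l2_fatou[OF XXr ms l ev less_imp_le[OF e]])
  qed
  obtain M where M: "\<forall>i\<ge>M. \<forall>l\<ge>M. l2_norm (X i - X l) < 1" using cauchy[of 1] by auto
  have "X M - g \<in> l2_sphere" using key[OF M] by simp
  from l2_diff'[OF X[of M] this] have gl2: "g \<in> l2_sphere" by simp
  have "(\<lambda>i. l2_norm (X i - g)) \<longlonglongrightarrow> 0"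
  proof (rule LIMSEQ_I)
    fix e :: real assume e: "e > 0"
    obtain M where M: "\<forall>i\<ge>M. \<forall>l\<ge>M. l2_norm (X i - X l) < e/2" using cauchy[of "e/2"] e by auto
    have "norm (l2_norm (X i - g) - 0) < e" if "i \<ge> M" for i
      using key[OF M that] e l2_norm_nonneg[of "X i - g"] by auto
    then show "\<exists>M. \<forall>i\<ge>M. norm (l2_norm (X i - g) - 0) < e" by blast
  qed
  with gl2 show ?thesis by blast
qed

lemma on_sphere_polys_upto_span:
  "on_sphere ` polys_upto m = cfun.span (\<Union>n\<in>{..m}. spherical_harmonics n :: (real^'d::finite \<Rightarrow> complex) set)"
proof (rule subset_antisym)
  have "cfun.subspace (on_sphere ` polys_upto m :: (real^'d \<Rightarrow> complex) set)"
    unfolding cfun.subspace_def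
  proof (intro conjI ballI allI)
    show "(0 :: real^'d \<Rightarrow> complex) \<in> on_sphere ` polys_upto m"
      by (rule image_eqI[of _ _ 0]) (auto simp: on_sphere_def fun_eq_iff polys_upto_def cfun.span_zero)
  next
    fix f g :: "real^'d \<Rightarrow> complex" and c
    assume "f \<in> on_sphere ` polys_upto m"
    then obtain f' where f: "f' \<in> polys_upto m" "f = on_sphere f'" by blast
    have "(\<lambda>x. c * f x) = on_sphere (\<lambda>x. c * f' x)" by (auto simp: f on_sphere_def)
    then show "(\<lambda>x. c * f x) \<in> on_sphere ` polys_upto m"
      using f(1) cfun.span_scale[of f' _ c] unfolding polys_upto_def by (intro image_eqI)
    assume "g \<in> on_sphere ` polys_upto m"
    then obtain g' where g: "g' \<in> polys_upto m" "g = on_sphere g'" by blast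
    have "f + g = on_sphere (f' + g')" by (auto simp: f g on_sphere_def)
    then show "f + g \<in> on_sphere ` polys_upto m"
      using cfun.span_add[OF f(1)[unfolded polys_upto_def] g(1)[unfolded polys_upto_def]]
      unfolding polys_upto_def by (intro image_eqI)
  qed
  then show "cfun.span (\<Union>n\<in>{..m}. spherical_harmonics n) \<subseteq> (on_sphere ` polys_upto m :: (real^'d \<Rightarrow> complex) set)"
    by (intro cfun.span_minimal) (auto dest: spherical_harmonics_polys_upto[rotated])
qed (auto intro: on_sphere_polys_upto)

context harmonic_basis
begin

lemma lcoef_add:
  assumes "X \<in> cauchy_seqs V (sobolev_norm Y s)" "X' \<in> cauchy_seqs V (sobolev_norm Y s)" "k \<in> {1..N n}"
  shows "lcoef (\<lambda>i. X i + X' i) n k = lcoef X n k + lcoef X' n k"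
proof -
  have "coef (X i + X' i) n k = coef (X i) n k + coef (X' i) n k" for i
    using coef_linear[OF smooth_sphere_l2[OF H.cauchy_mem[OF assms(1)]]
        smooth_sphere_l2[OF H.cauchy_mem[OF assms(2)]] assms(3), where c = 1]
    by (simp add: plus_fun_def)
  then show ?thesis
    unfolding lcoef_def[of "\<lambda>i. X i + X' i"]
    by (simp add: limI tendsto_add coef_tendsto[OF assms(1,3)] coef_tendsto[OF assms(2,3)])
qed

text \<open>For the harder inclusion the part of degree up to \<open>m\<close> is split off as the
  finite sum \<open>psum (lcoef X) {..m}\<close>; it is the restriction of a polynomial, and what
  remains has its coefficients in \<open>P\<close> only.\<close>

lemma polys_plus_supported:
  "{cadd V (sobolev_norm Y s) A B | A B.
      A \<in> cembed V (sobolev_norm Y s) ` on_sphere ` polys_upto m \<and> B \<in> supported s P} =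
    supported s ({..m} \<union> P)" (is "?L = _")
proof (rule set_eqI)
  fix D
  let ?p = "sobolev_norm Y s"
  show "D \<in> ?L \<longleftrightarrow> D \<in> supported s ({..m} \<union> P)"
  proof
    assume "D \<in> ?L"
    then obtain g B where g: "g \<in> cfun.span (\<Union>n\<in>{..m}. spherical_harmonics n)"
      and B: "B \<in> supported s P" and D: "D = cadd V ?p (cembed V ?p g) B"
      unfolding on_sphere_polys_upto_span by blast
    obtain X where X: "X \<in> cauchy_seqs V ?p" "B = H.cls s X"
      using B supported_subset by (meson H.completion_cases subsetD)
    have gV: "g \<in> V" using g span_V by blast
    have D': "D = H.cls s (\<lambda>i. g + X i)"
      unfolding D X(2) H.cembed_eq by (rule H.cadd_cls[OF H.const_cauchy[OF gV] X(1)])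
    have "lcoef (\<lambda>i. g + X i) n k = 0" if "n \<notin> {..m} \<union> P" "k \<in> {1..N n}" for n k
      using lcoef_add[OF H.const_cauchy[OF gV] X(1) that(2)] coef_span[OF g _ that(2)] that
        B[unfolded X(2) cls_in_supported[OF X(1)]] by (simp add: lcoef_const)
    then show "D \<in> supported s ({..m} \<union> P)"
      unfolding D' cls_in_supported[OF H.cauchy_add[OF H.const_cauchy[OF gV] X(1)]] by blast
  next
    assume D: "D \<in> supported s ({..m} \<union> P)"
    obtain X where X: "X \<in> cauchy_seqs V ?p" "D = H.cls s X"
      using D supported_subset by (meson H.completion_cases subsetD)
    let ?g = "psum (lcoef X) {..m}" let ?h = "\<lambda>x. - 1 * psum (lcoef X) {..m} x"
    have hV: "?h \<in> V" by (rule smooth_sphere_scale[OF psum_V])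
    have h: "(\<lambda>i. ?h) \<in> cauchy_seqs V ?p" by (rule H.const_cauchy[OF hV])
    have hX: "(\<lambda>i. ?h + X i) \<in> cauchy_seqs V ?p" by (rule H.cauchy_add[OF h X(1)])
    have "lcoef (\<lambda>i. ?h + X i) n k = 0" if "n \<notin> P" "k \<in> {1..N n}" for n k
      using lcoef_add[OF h X(1) that(2)] coef_psum[of "{..m}", OF _ that(2), of "lcoef X"] that
        coef_scale[of "- 1" ?g n k] D[unfolded X(2) cls_in_supported[OF X(1)]]
      by (auto simp: lcoef_const)
    then have B: "H.cls s (\<lambda>i. ?h + X i) \<in> supported s P"
      unfolding cls_in_supported[OF hX] by blast
    have "D = H.cls s (\<lambda>i. ?g + (?h + X i))"
      unfolding X(2) by (rule arg_cong[where f = "H.cls s"]) (auto simp: fun_eq_iff)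
    then have "D = cadd V ?p (cembed V ?p ?g) (H.cls s (\<lambda>i. ?h + X i))"
      unfolding H.cembed_eq H.cadd_cls[OF H.const_cauchy[OF psum_V] hX] .
    moreover have "?g \<in> on_sphere ` polys_upto m"
      unfolding on_sphere_polys_upto_span by (rule psum_span) simp
    ultimately show "D \<in> ?L" using B by blast
  qed
qed

text \<open>Sign, dimension factor and equator mass are collected in one nonzero constant, so zeros
  and growth are those of \<open>funk_mult\<close>. Any unit vector \<zeta> serves, because all
  equators have the same mass.\<close>

lemma funk_radon_multiplier:
  "\<exists>\<mu> K. (\<forall>f\<in>V. \<forall>n. \<forall>k\<in>{1..N n}. coef (funk_radon j f) n k = complex_of_real (\<mu> n) * coef f n k) \<and>
    (\<forall>n. \<mu> n = 0 \<longleftrightarrow> odd (n + j) \<or> (int n \<le> int j - int CARD('d) + 1 \<and> odd CARD('d))) \<and>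
    (\<forall>n. \<bar>\<mu> n\<bar> \<le> K * (real n + \<delta>) powr (real j - \<delta>)) \<and> K \<ge> 0"
proof -
  define \<zeta> :: "real^'d" where "\<zeta> = axis undefined 1"
  have \<zeta>: "norm \<zeta> = 1" by (simp add: \<zeta>_def)
  define c where "c = (- 1) ^ j * real (CARD('d) - 1) * equator_mass \<zeta>"
  have c0: "c \<noteq> 0" using equator_mass_pos[OF \<zeta>] card_ge by (auto simp: c_def)
  obtain C where C: "C \<ge> 0" "\<And>n. \<bar>funk_mult CARD('d) n j\<bar> \<le> C * (real n + \<delta>) powr (real j - \<delta>)"
    using funk_mult_bound[OF card_ge, of j, folded \<delta>_eq] by blast
  have "\<bar>c * funk_mult CARD('d) n j\<bar> \<le> (\<bar>c\<bar> * C) * (real n + \<delta>) powr (real j - \<delta>)" for n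
    using mult_left_mono[OF C(2)[of n], of "\<bar>c\<bar>"] by (simp add: abs_mult mult.assoc)
  then show ?thesis
    using funk_radon_coefficient[OF card_ge _ Y_mem \<zeta>, of _ _ _ j] funk_mult_eq_0_iff[OF card_ge, of _ j] C(1) c0
    by (intro exI[of _ "\<lambda>n. c * funk_mult CARD('d) n j"] exI[of _ "\<bar>c\<bar> * C"])
      (simp add: coef_def c_def)
qed

end

locale funk_multiplier = harmonic_basis Y N \<delta>
  for Y :: "nat \<Rightarrow> nat \<Rightarrow> real^'d::finite \<Rightarrow> complex" and N \<delta> +
  fixes j :: nat and \<mu> :: "nat \<Rightarrow> real" and K :: real
  assumes coef_funk_radon: "f \<in> smooth_sphere \<Longrightarrow> k \<in> {1..N n} \<Longrightarrow>
      coef (funk_radon j f) n k = complex_of_real (\<mu> n) * coef f n k"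
    and \<mu>_bound: "\<bar>\<mu> n\<bar> \<le> K * (real n + \<delta>) powr (real j - \<delta>)"
    and K_nonneg: "K \<ge> 0"
begin

text \<open>The multiplier costs 2(j - \<delta>) in the exponent of the weight, and 2(s - j +
  \<delta>) + 2(j - \<delta>) = 2s: this fixes the order of the target space.\<close>

lemma multiplier_weight:
  "wt (s - real j + \<delta>) n * (cmod (complex_of_real (\<mu> n) * a))\<^sup>2 \<le> K\<^sup>2 * (wt s n * (cmod a)\<^sup>2)"
proof -
  let ?x = "real n + \<delta>"
  have x: "?x > 0" using \<delta> of_nat_0_le_iff[of n] by linarith
  have "(cmod (complex_of_real (\<mu> n) * a))\<^sup>2 = \<bar>\<mu> n\<bar>\<^sup>2 * (cmod a)\<^sup>2"
    by (simp add: norm_mult power_mult_distrib)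
  also have "\<dots> \<le> (K * ?x powr (real j - \<delta>))\<^sup>2 * (cmod a)\<^sup>2"
    by (intro mult_right_mono power_mono \<mu>_bound) auto
  finally have "wt (s - real j + \<delta>) n * (cmod (complex_of_real (\<mu> n) * a))\<^sup>2 \<le>
      wt (s - real j + \<delta>) n * ((K * ?x powr (real j - \<delta>))\<^sup>2 * (cmod a)\<^sup>2)"
    using wt_pos by (intro mult_left_mono) (auto simp: less_imp_le)
  also have "wt (s - real j + \<delta>) n * (?x powr (real j - \<delta>))\<^sup>2 = wt s n"
    using x by (simp add: wt_def power2_eq_square powr_add[symmetric] algebra_simps)
  then have "wt (s - real j + \<delta>) n * ((K * ?x powr (real j - \<delta>))\<^sup>2 * (cmod a)\<^sup>2) = K\<^sup>2 * (wt s n * (cmod a)\<^sup>2)"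
    by (simp add: power_mult_distrib mult_ac)
  finally show ?thesis .
qed

lemma bounded_operator_funk_radon:
  "bounded_operator V (sobolev_norm Y s) (sobolev_norm Y (s - real j + \<delta>)) (funk_radon j) K"
proof -
  have lin: "funk_radon j (\<lambda>x. c * f x + g x) = (\<lambda>x. c * funk_radon j f x + funk_radon j g x)"
    if "f \<in> V" "g \<in> V" for f g c using funk_radon_linear[OF card_ge that] .
  show ?thesis
  proof (intro bounded_operator.intro seminormed_sobolev bounded_operator_axioms.intro K_nonneg)
    fix f :: "real^'d \<Rightarrow> complex" and c assume f: "f \<in> V"
    show "funk_radon j f \<in> V" by (rule funk_radon_smooth[OF f card_ge])
    show "sobolev_norm Y (s - real j + \<delta>) (funk_radon j f) \<le> K * sobolev_norm Y s f"
      unfolding sobolev_norm_eq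
      by (rule wnorm_mono[OF ws.w_nonneg ws.w_nonneg _ K_nonneg smooth_wfin[OF f]])
        (simp add: coef_funk_radon[OF f] multiplier_weight del: of_real_mult norm_mult)
    have z: "(\<lambda>x :: real^'d. 0) \<in> V" using smooth_sphere_zero by (simp add: zero_fun_def)
    have "funk_radon j (\<lambda>x :: real^'d. 0) = (\<lambda>x. 0)"
      using lin[OF z z, of "-1"] by (simp add: fun_eq_iff)
    then show "funk_radon j (\<lambda>x. c * f x) = (\<lambda>x. c * funk_radon j f x)"
      using lin[OF f z, of c] by simp
    fix g assume "g \<in> V"
    from lin[OF f this, of 1] show "funk_radon j (f + g) = funk_radon j f + funk_radon j g"
      by (simp add: plus_fun_def)
  qed
qed

text \<open>The limit coefficients of the image are those of the preimage times
  \<open>\<mu> n\<close>, so the image is zero exactly if the coefficients vanish in every degree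
  where \<open>\<mu> n\<close> does not.\<close>

lemma nullspace_eq_supported:
  assumes T: "continuous_extension V (sobolev_norm Y s) (sobolev_norm Y (s - real j + \<delta>)) (funk_radon j) T"
  shows "{A \<in> fun_completion V (sobolev_norm Y s). T A = cembed V (sobolev_norm Y (s - real j + \<delta>)) 0} =
    supported s {n. \<mu> n = 0}"
proof (rule set_eqI)
  fix A
  let ?p = "sobolev_norm Y s" let ?r = "s - real j + \<delta>"
  interpret op: bounded_operator V ?p "sobolev_norm Y ?r" "funk_radon j" K
    by (rule bounded_operator_funk_radon)
  show "A \<in> {A \<in> fun_completion V ?p. T A = cembed V (sobolev_norm Y ?r) 0} \<longleftrightarrow> A \<in> supported s {n. \<mu> n = 0}"
  proof (cases "A \<in> fun_completion V ?p")
    case True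
    then obtain X where X: "X \<in> cauchy_seqs V ?p" "A = H.cls s X" by (rule H.completion_cases)
    note SX = op.S_cauchy[OF X(1)]
    have l: "lcoef (\<lambda>i. funk_radon j (X i)) n k = complex_of_real (\<mu> n) * lcoef X n k" if "k \<in> {1..N n}" for n k
      unfolding lcoef_def[of "\<lambda>i. funk_radon j (X i)"] coef_funk_radon[OF H.cauchy_mem[OF X(1)] that]
      by (intro limI tendsto_intros coef_tendsto[OF X(1) that])
    have "T A = cembed V (sobolev_norm Y ?r) 0 \<longleftrightarrow> H.cls ?r (\<lambda>i. funk_radon j (X i)) = H.cls ?r (\<lambda>_. 0)"
      unfolding X(2) op.continuous_extension_cls[OF T X(1)] H.cembed_eq ..
    also have "\<dots> \<longleftrightarrow> (\<forall>n. \<forall>k\<in>{1..N n}. complex_of_real (\<mu> n) * lcoef X n k = 0)"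
      unfolding cls_eq_lcoef[OF SX H.const_cauchy[OF smooth_sphere_zero]]
      by (simp add: l lcoef_const coef_zero)
    also have "\<dots> \<longleftrightarrow> A \<in> supported s {n. \<mu> n = 0}"
      unfolding X(2) cls_in_supported[OF X(1)] by auto
    finally show ?thesis using True by simp
  next
    case False
    then show ?thesis using supported_subset by blast
  qed
qed

end

section \<open>Fourier expansions in the space of square-integrable functions\<close>

lemma (in weights) wnorm_head: "wnorm N w (\<lambda>n k. if n < m then a n k else 0) = wpart N w a m"
proof -
  have "wterm N w (\<lambda>n k. if n < m then a n k else 0) = (\<lambda>n. if n \<in> {..<m} then wterm N w a n else 0)"
    by (auto simp: wterm_def fun_eq_iff)
  then have "(\<Sum>n. wterm N w (\<lambda>n k. if n < m then a n k else 0) n) = (\<Sum>n<m. wterm N w a n)"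
    using sums_unique[OF sums_If_finite_set[of "{..<m}" "wterm N w a"]] by simp
  then show ?thesis by (simp add: wnorm_def wpart_def)
qed

context harmonic_basis
begin

lemma psum_cong: "(\<And>n k. k \<in> {1..N n} \<Longrightarrow> a n k = b n k) \<Longrightarrow> psum a S = psum b S"
  by (auto simp: psum_def fun_eq_iff intro!: sum.cong)

lemma psum_add: "psum (\<lambda>n k. a n k + b n k) S = psum a S + psum b S"
  by (auto simp: psum_def fun_eq_iff sum.distrib distrib_right)

lemma psum_scale: "psum (\<lambda>n k. c * a n k) S = (\<lambda>x. c * psum a S x)"
  by (auto simp: psum_def fun_eq_iff sum_distrib_left mult.assoc)

lemma psum_diff: "psum (\<lambda>n k. a n k - b n k) S = psum a S - psum b S"
  by (auto simp: psum_def fun_eq_iff sum_subtractf left_diff_distrib)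



lemma l2_norm_psum: "l2_norm (psum a {..<m}) = wpart N (\<lambda>_. 1) a m"
proof -
  let ?e = "\<lambda>i. case i of (n, k) \<Rightarrow> Y n k" and ?a = "\<lambda>i. case i of (n, k) \<Rightarrow> - a n k"
  have "(l2_norm (\<lambda>x. 0 - (\<Sum>i\<in>idx m. ?a i * ?e i x)))\<^sup>2 = (l2_norm (\<lambda>x :: real^'d. 0))\<^sup>2
      - (\<Sum>i\<in>idx m. (cmod (sphere_inner (\<lambda>x. 0) (?e i)))\<^sup>2) + (\<Sum>i\<in>idx m. (cmod (sphere_inner (\<lambda>x. 0) (?e i) - ?a i))\<^sup>2)"
    by (rule l2_norm_diff_orthonormal[OF finite_idx l2_zero]) (auto simp: idx_def Y_l2 Y_ortho split: if_splits)
  also have "\<dots> = (\<Sum>n<m. wterm N (\<lambda>_. 1) a n)"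
    by (simp add: sum_idx wterm_def sphere_inner_def l2_norm_def)
  also have "(\<lambda>x. 0 - (\<Sum>i\<in>idx m. ?a i * ?e i x)) = psum a {..<m}"
    by (simp add: fun_eq_iff sum_idx psum_def sum_negf)
  finally show ?thesis unfolding wpart_def by (metis l2_norm_nonneg real_sqrt_unique)
qed

lemma psum_cauchy:
  assumes "w1.wfin a" "e > 0"
  shows "\<exists>M. \<forall>i\<ge>M. \<forall>l\<ge>M. l2_norm (psum a {..<i} - psum a {..<l}) < e"
proof -
  obtain M where M: "wnorm N (\<lambda>_. 1) (\<lambda>n k. if n < M then 0 else a n k) < e"
    using order_tendstoD(2)[OF w1.wnorm_tail[OF assms(1)] assms(2)] by (auto simp: eventually_sequentially)
  let ?t = "\<lambda>n k. if n < M then 0 else a n k"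
  have fin: "w1.wfin ?t"
    by (rule wnorm_mono(1)[of "\<lambda>_. 1" "\<lambda>_. 1" _ _ 1, OF _ _ _ _ assms(1)]) auto
  have *: "l2_norm (psum a {..<i} - psum a {..<l}) < e" if "M \<le> l" "l \<le> i" for i l
  proof -
    have "psum a {..<i} - psum a {..<l} = psum (\<lambda>n k. if n < l then 0 else a n k) {..<i}"
    proof
      fix x
      let ?f = "\<lambda>n. \<Sum>k=1..N n. a n k * Y n k x"
      have "psum a {..<i} x = psum a {..<l} x + (\<Sum>n\<in>{l..<i}. ?f n)"
        unfolding psum_def lessThan_atLeast0 using that by (intro sum.atLeastLessThan_concat[symmetric]) auto
      also have "(\<Sum>n\<in>{l..<i}. ?f n) = psum (\<lambda>n k. if n < l then 0 else a n k) {..<i} x"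
        unfolding psum_def by (rule sum.mono_neutral_cong_left) auto
      finally show "(psum a {..<i} - psum a {..<l}) x = psum (\<lambda>n k. if n < l then 0 else a n k) {..<i} x"
        by simp
    qed
    then have "l2_norm (psum a {..<i} - psum a {..<l}) = wpart N (\<lambda>_. 1) (\<lambda>n k. if n < l then 0 else a n k) i"
      by (simp add: l2_norm_psum)
    also have "\<dots> \<le> 1 * wpart N (\<lambda>_. 1) ?t i" by (rule wpart_mono) (use that in auto)
    also have "\<dots> \<le> wnorm N (\<lambda>_. 1) ?t" using w1.wpart_le_wnorm[OF fin] by simp
    finally show ?thesis using M by simp
  qed
  then have "l2_norm (psum a {..<i} - psum a {..<l}) < e" if "M \<le> l" "M \<le> i" for i l
    using that l2_norm_minus_commute by (metis linear)
  then show ?thesis by blast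
qed

text \<open>The limit is unique only almost everywhere, so a representative is chosen and its
  linearity holds only in that sense. Arrays with the same relevant entries receive the same
  representative, as \<open>fourier_sum_cong\<close> records.\<close>

definition fourier_sum :: "(nat \<Rightarrow> nat \<Rightarrow> complex) \<Rightarrow> real^'d \<Rightarrow> complex" where
  "fourier_sum a = (SOME g. g \<in> l2_sphere \<and> (\<lambda>m. l2_norm (psum a {..<m} - g)) \<longlonglongrightarrow> 0)"

lemma fourier_sum:
  assumes "w1.wfin a"
  shows "fourier_sum a \<in> l2_sphere" "(\<lambda>m. l2_norm (psum a {..<m} - fourier_sum a)) \<longlonglongrightarrow> 0"
proof -
  have "\<exists>g\<in>l2_sphere. (\<lambda>m. l2_norm (psum a {..<m} - g)) \<longlonglongrightarrow> 0"
    by (rule l2_complete[OF psum_l2 psum_cauchy[OF assms]])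
  then have "\<exists>g. g \<in> l2_sphere \<and> (\<lambda>m. l2_norm (psum a {..<m} - g)) \<longlonglongrightarrow> 0" by blast
  note S = someI_ex[OF this, folded fourier_sum_def]
  show "fourier_sum a \<in> l2_sphere" by (rule conjunct1[OF S])
  show "(\<lambda>m. l2_norm (psum a {..<m} - fourier_sum a)) \<longlonglongrightarrow> 0" by (rule conjunct2[OF S])
qed

lemma fourier_sum_cong: "(\<And>n k. k \<in> {1..N n} \<Longrightarrow> a n k = b n k) \<Longrightarrow> fourier_sum a = fourier_sum b"
  using psum_cong[of a b] by (simp add: fourier_sum_def)

text \<open>One limit \<open>g\<close> is arbitrary and the other is the chosen one: equal arrays
  then give uniqueness almost everywhere, and different arrays the norm estimate.\<close>

lemma fourier_sum_diff_le:
  assumes a: "w1.wfin a" and g: "g \<in> l2_sphere" and lim: "(\<lambda>m. l2_norm (psum a {..<m} - g)) \<longlonglongrightarrow> 0"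
    and b: "w1.wfin b"
  shows "l2_norm (g - fourier_sum b) \<le> wnorm N (\<lambda>_. 1) (\<lambda>n k. a n k - b n k)"
proof -
  let ?w = "wnorm N (\<lambda>_. 1) (\<lambda>n k. a n k - b n k)"
  note fb = fourier_sum[OF b]
  have "l2_norm (g - fourier_sum b) \<le> l2_norm (psum a {..<m} - g) + ?w + l2_norm (psum b {..<m} - fourier_sum b)" for m
  proof -
    have "l2_norm (g - fourier_sum b) \<le> l2_norm (g - psum a {..<m}) + l2_norm (psum a {..<m} - fourier_sum b)"
      by (rule l2_norm_diff_triangle[OF g psum_l2 fb(1)])
    moreover have "l2_norm (psum a {..<m} - fourier_sum b) \<le>
        l2_norm (psum a {..<m} - psum b {..<m}) + l2_norm (psum b {..<m} - fourier_sum b)"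
      by (rule l2_norm_diff_triangle[OF psum_l2 psum_l2 fb(1)])
    moreover have "l2_norm (psum a {..<m} - psum b {..<m}) \<le> ?w"
      unfolding psum_diff[symmetric] l2_norm_psum by (rule w1.wpart_le_wnorm[OF w1.wnorm_diff(1)[OF a b]])
    ultimately show ?thesis using l2_norm_minus_commute[of g "psum a {..<m}"] by linarith
  qed
  moreover have "(\<lambda>m. l2_norm (psum a {..<m} - g) + ?w + l2_norm (psum b {..<m} - fourier_sum b)) \<longlonglongrightarrow> 0 + ?w + 0"
    by (intro tendsto_intros lim fb(2))
  ultimately show ?thesis using LIMSEQ_le_const[of _ "0 + ?w + 0" "l2_norm (g - fourier_sum b)"] by auto
qed

lemma fourier_sum_unique:
  assumes a: "w1.wfin a" and g: "g \<in> l2_sphere" and lim: "(\<lambda>m. l2_norm (psum a {..<m} - g)) \<longlonglongrightarrow> 0"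
  shows "AE x in sphere_measure. fourier_sum a x = g x"
proof -
  have "l2_norm (g - fourier_sum a) \<le> 0"
    using fourier_sum_diff_le[OF a g lim a] by (simp add: wnorm_def wterm_def)
  then have "l2_norm (g - fourier_sum a) = 0" using l2_norm_nonneg[of "g - fourier_sum a"] by linarith
  from l2_norm_eq_0_AE[OF l2_diff'[OF g fourier_sum(1)[OF a]] this] show ?thesis
    by (rule eventually_mono) simp
qed

lemma fourier_sum_diff:
  assumes "w1.wfin a" "w1.wfin b"
  shows "l2_norm (fourier_sum a - fourier_sum b) \<le> wnorm N (\<lambda>_. 1) (\<lambda>n k. a n k - b n k)"
  by (rule fourier_sum_diff_le[OF assms(1) fourier_sum[OF assms(1)] assms(2)])

lemma fourier_sum_norm:
  assumes a: "w1.wfin a"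
  shows "l2_norm (fourier_sum a) \<le> wnorm N (\<lambda>_. 1) a"
proof -
  let ?z = "\<lambda>n k. 0 :: complex"
  have z: "w1.wfin ?z" by (simp add: wterm_def[abs_def])
  have pz: "psum ?z S = (\<lambda>x. 0)" for S by (simp add: psum_def fun_eq_iff)
  have "AE x in sphere_measure. fourier_sum ?z x = 0"
    by (rule fourier_sum_unique[OF z l2_zero]) (simp add: pz l2_norm_def fun_diff_def)
  then have "AE x in sphere_measure. (fourier_sum a - fourier_sum ?z) x = fourier_sum a x"
    by (rule eventually_mono) simp
  then have "l2_norm (fourier_sum a - fourier_sum ?z) = l2_norm (fourier_sum a)"
    by (rule l2_norm_cong_AE[OF l2_diff'[OF fourier_sum(1)[OF a] fourier_sum(1)[OF z]] fourier_sum(1)[OF a]])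
  then show ?thesis using fourier_sum_diff[OF a z] by simp
qed

lemma fourier_sum_add:
  assumes a: "w1.wfin a" and b: "w1.wfin b"
  shows "AE x in sphere_measure. fourier_sum (\<lambda>n k. a n k + b n k) x = fourier_sum a x + fourier_sum b x"
proof -
  note A = fourier_sum[OF a] and B = fourier_sum[OF b]
  have S: "fourier_sum a + fourier_sum b \<in> l2_sphere" unfolding plus_fun_def by (rule l2_add[OF A(1) B(1)])
  have le: "l2_norm (psum (\<lambda>n k. a n k + b n k) {..<m} - (fourier_sum a + fourier_sum b)) \<le>
      l2_norm (psum a {..<m} - fourier_sum a) + l2_norm (psum b {..<m} - fourier_sum b)" for m
  proof -
    have eq: "psum (\<lambda>n k. a n k + b n k) {..<m} - (fourier_sum a + fourier_sum b) =
        (psum a {..<m} - fourier_sum a) + (psum b {..<m} - fourier_sum b)" by (simp add: psum_add)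
    show ?thesis unfolding eq by (rule l2_norm_triangle[OF l2_diff'[OF psum_l2 A(1)] l2_diff'[OF psum_l2 B(1)]])
  qed
  have "(\<lambda>m. l2_norm (psum (\<lambda>n k. a n k + b n k) {..<m} - (fourier_sum a + fourier_sum b))) \<longlonglongrightarrow> 0"
    by (rule tendsto_sandwich[OF _ _ tendsto_const tendsto_add_zero[OF A(2) B(2)]])
      (auto intro!: always_eventually le l2_norm_nonneg)
  from fourier_sum_unique[OF w1.wnorm_add(1)[OF a b] S this] show ?thesis by simp
qed

lemma fourier_sum_scale:
  assumes a: "w1.wfin a"
  shows "AE x in sphere_measure. fourier_sum (\<lambda>n k. c * a n k) x = c * fourier_sum a x"
proof (rule fourier_sum_unique[OF w1.wnorm_cmult(1)[OF a] l2_scale[OF fourier_sum(1)[OF a]]])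
  have "psum (\<lambda>n k. c * a n k) {..<m} - (\<lambda>x. c * fourier_sum a x) = (\<lambda>x. c * (psum a {..<m} - fourier_sum a) x)" for m
    by (simp add: psum_scale fun_eq_iff right_diff_distrib)
  then show "(\<lambda>m. l2_norm (psum (\<lambda>n k. c * a n k) {..<m} - (\<lambda>x. c * fourier_sum a x))) \<longlonglongrightarrow> 0"
    using tendsto_mult_right_zero[OF fourier_sum(2)[OF a], of "cmod c"] by (simp only: l2_norm_scale)
qed

lemma psum_coef_span:
  assumes "g \<in> cfun.span (\<Union>n. spherical_harmonics n)"
  shows "\<forall>\<^sub>F m in sequentially. psum (coef g) {..<m} = g"
proof -
  let ?B = "\<Union>n. Y n ` {1..N n}"
  have "spherical_harmonics n \<subseteq> cfun.span ?B" for n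
  proof -
    have "spherical_harmonics n = cfun.span (Y n ` {1..N n})" using onb by (simp add: harmonic_onb_def N_eq)
    also have "\<dots> \<subseteq> cfun.span ?B" by (intro cfun.span_mono) auto
    finally show ?thesis .
  qed
  then have "cfun.span (\<Union>n. spherical_harmonics n) \<subseteq> cfun.span ?B"
    by (intro cfun.span_minimal) auto
  then have "g \<in> cfun.span ?B" using assms by blast
  then have "(\<forall>\<^sub>F m in sequentially. psum (coef g) {..<m} = g) \<and> g \<in> V"
  proof (induction rule: cfun.span_induct_alt)
    case base
    show ?case
      using smooth_sphere_zero[unfolded zero_fun_def] coef_zero[unfolded zero_fun_def]
      by (simp add: psum_def fun_eq_iff zero_fun_def)
  next
    case (step c h g)
    then obtain n k where h: "k \<in> {1..N n}" "h = Y n k" by auto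
    have hV: "h \<in> V" using h Y_V by simp
    have gV: "g \<in> V" using step by blast
    have "psum (coef h) {..<m} = h" if "n < m" for m
    proof
      fix x
      have d: "psum (coef h) {..<m} x = psum (\<lambda>i l. if i = n \<and> l = k then 1 else 0) {..<m} x"
        unfolding h(2) by (rule fun_cong[OF psum_cong]) (auto simp: coef_Y[OF _ h(1)])
      have "(\<Sum>l=1..N i. (if i = n \<and> l = k then 1 else 0) * Y i l x) = (if i = n then h x else 0)" for i
        using h by (cases "i = n") (auto simp: mult_delta_left)
      then have eq: "psum (\<lambda>i l. if i = n \<and> l = k then 1 else 0) {..<m} x = h x"
        unfolding psum_def using that by simp
      from d eq show "psum (coef h) {..<m} x = h x" by (rule trans)
    qed
    then have H: "\<forall>\<^sub>F m in sequentially. psum (coef h) {..<m} = h"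
      by (intro eventually_sequentiallyI[of "Suc n"]) simp
    have lin: "psum (coef ((\<lambda>x. c * h x) + g)) {..<m} = (\<lambda>x. c * psum (coef h) {..<m} x) + psum (coef g) {..<m}" for m
      unfolding psum_scale[symmetric] psum_add[symmetric]
      using coef_linear[OF smooth_sphere_l2[OF hV] smooth_sphere_l2[OF gV], of _ _ c]
      by (intro psum_cong) (simp add: plus_fun_def)
    have "\<forall>\<^sub>F m in sequentially. psum (coef ((\<lambda>x. c * h x) + g)) {..<m} = (\<lambda>x. c * h x) + g"
      using H step(2)[THEN conjunct1] by eventually_elim (simp add: lin)
    then show ?case using smooth_sphere_add[OF smooth_sphere_scale[OF hV] gV] by blast
  qed
  then show ?thesis ..
qed

text \<open>A finite sum \<open>g\<close> of harmonics close to \<open>f\<close> equals its own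
  partial sums from some index on, so the partial sums of \<open>f\<close> differ from
  \<open>g\<close> by those of \<open>f - g\<close>, which Bessel's inequality bounds. Two errors
  below e / 3 suffice.\<close>

lemma psum_coef_tendsto:
  assumes f: "f \<in> V"
  shows "(\<lambda>m. l2_norm (psum (coef f) {..<m} - f)) \<longlonglongrightarrow> 0"
proof (rule LIMSEQ_I)
  fix e :: real assume e: "e > 0"
  interpret finite_measure "sphere_measure :: (real^'d) measure" by (rule finite_sphere_measure)
  let ?\<sigma> = "measure (sphere_measure :: (real^'d) measure) UNIV"
  define c where "c = e / (3 * (sqrt ?\<sigma> + 1))"
  have c: "c > 0" using e by (simp add: c_def add_nonneg_pos)
  obtain g where g: "g \<in> cfun.span (\<Union>n. spherical_harmonics n)" and fg: "\<And>x. x \<in> sphere 0 1 \<Longrightarrow> cmod (f x - g x) < c"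
    using harmonics_dense[OF continuous_on_smooth_sphere[OF f] c] by blast
  have gV: "g \<in> V" using g span_V[of UNIV] by auto
  note l2 = smooth_sphere_l2[OF f] smooth_sphere_l2[OF gV]
  have "cmod ((f - g) x) \<le> c" for x
    using fg[of x] c smooth_sphere_outside[OF f, of x] smooth_sphere_outside[OF gV, of x]
    by (cases "x \<in> sphere 0 1") auto
  then have "(\<integral>x. (cmod ((f - g) x))\<^sup>2 \<partial>sphere_measure) \<le> (\<integral>x. c\<^sup>2 \<partial>(sphere_measure :: (real^'d) measure))"
    by (intro integral_mono l2_integrable_square l2_diff' l2 power_mono) auto
  then have "(l2_norm (f - g))\<^sup>2 \<le> (c * sqrt ?\<sigma>)\<^sup>2"
    by (simp add: l2_norm_square power_mult_distrib mult.commute)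
  then have "l2_norm (f - g) \<le> c * sqrt ?\<sigma>" using c by (intro power2_le_imp_le[of "l2_norm (f - g)"]) auto
  also have "\<dots> < c * (sqrt ?\<sigma> + 1)" using c by simp
  also have "\<dots> = e / 3"
    by (simp add: c_def divide_simps) (use real_sqrt_ge_zero[OF measure_nonneg, of "sphere_measure :: (real^'d) measure" UNIV] in linarith)
  finally have d: "l2_norm (f - g) < e / 3" .
  obtain M where M: "\<And>m. m \<ge> M \<Longrightarrow> psum (coef g) {..<m} = g"
    using psum_coef_span[OF g] by (auto simp: eventually_sequentially)
  have "norm (l2_norm (psum (coef f) {..<m} - f) - 0) < e" if m: "m \<ge> M" for m
  proof -
    have "psum (coef f) {..<m} - psum (coef g) {..<m} = psum (coef (f - g)) {..<m}"
      unfolding psum_diff[symmetric] by (rule psum_cong) (simp add: coef_diff[OF l2])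
    then have eq: "psum (coef f) {..<m} - g = psum (coef (f - g)) {..<m}" unfolding M[OF m] .
    have "l2_norm (psum (coef f) {..<m} - g) \<le> l2_norm (f - g)"
      unfolding eq l2_norm_psum by (rule bessel_wpart[OF l2_diff'[OF l2]])
    moreover have "l2_norm (psum (coef f) {..<m} - f) \<le> l2_norm (psum (coef f) {..<m} - g) + l2_norm (g - f)"
      by (rule l2_norm_diff_triangle[OF psum_l2 l2(2,1)])
    ultimately show ?thesis
      using d l2_norm_minus_commute[of g f] l2_norm_nonneg[of "psum (coef f) {..<m} - f"] by simp
  qed
  then show "\<exists>M. \<forall>m\<ge>M. norm (l2_norm (psum (coef f) {..<m} - f) - 0) < e" by blast
qed

text \<open>Bessel's inequality bounds every coefficient along the sequence. The countably many
  index pairs are enumerated by \<open>prod_decode\<close>, and a diagonal subsequence makes all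
  coefficients converge.\<close>

lemma coef_subseq:
  fixes F :: "nat \<Rightarrow> real^'d \<Rightarrow> complex"
  assumes F: "\<And>i. F i \<in> l2_sphere" and C: "\<And>i. l2_norm (F i) \<le> C"
  shows "\<exists>r a. strict_mono r \<and> (\<forall>n. \<forall>k\<in>{1..N n}. (\<lambda>i. coef (F (r i)) n k) \<longlonglongrightarrow> a n k)"
proof -
  define P where "P = (\<lambda>m (s :: nat \<Rightarrow> nat). case prod_decode m of (n, k) \<Rightarrow> k \<in> {1..N n} \<longrightarrow> convergent (\<lambda>i. coef (F (s i)) n k))"
  interpret subseqs P
  proof
    fix m and s :: "nat \<Rightarrow> nat" assume s: "strict_mono s"
    obtain n k where nk: "prod_decode m = (n, k)" by (cases "prod_decode m")
    show "\<exists>r'. strict_mono r' \<and> P m (s \<circ> r')"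
    proof (cases "k \<in> {1..N n}")
      case True
      have "cmod (coef (F i) n k) \<le> C" for i
        using w1.wnorm_component[OF bessel_wnorm(1)[OF F] True, of i] bessel_wnorm(2)[OF F, of i] C[of i] by simp
      then have "bounded (range (\<lambda>i. coef (F (s i)) n k))" by (auto simp: bounded_iff)
      then obtain l r' where "strict_mono r'" "((\<lambda>i. coef (F (s i)) n k) \<circ> r') \<longlonglongrightarrow> l"
        using bounded_imp_convergent_subsequence by blast
      then show ?thesis by (auto simp: P_def nk o_def convergent_def)
    next
      case False
      then show ?thesis using strict_mono_id by (auto simp: P_def nk)
    qed
  qed
  have conv: "convergent (\<lambda>i. coef (F (diagseq i)) n k)" if k: "k \<in> {1..N n}" for n k
  proof -
    have "P (prod_encode (n, k)) (diagseq \<circ> ((+) (Suc (prod_encode (n, k)))))"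
    proof (rule diagseq_holds)
      fix r s :: "nat \<Rightarrow> nat" and m assume r: "strict_mono r" and P: "P m s"
      obtain n k where nk: "prod_decode m = (n, k)" by (cases "prod_decode m")
      show "P m (s \<circ> r)"
        using P convergent_subseq_convergent[OF _ r, of "\<lambda>i. coef (F (s i)) n k"] by (auto simp: P_def nk o_def)
    qed
    then have "convergent (\<lambda>i. coef (F (diagseq (i + Suc (prod_encode (n, k))))) n k)"
      using k by (simp add: P_def o_def add.commute)
    then show ?thesis
      using convergent_ignore_initial_segment[of "\<lambda>i. coef (F (diagseq i)) n k" "Suc (prod_encode (n, k))"] by simp
  qed
  then show ?thesis
    using subseq_diagseq
    by (intro exI[of _ diagseq] exI[of _ "\<lambda>n k. lim (\<lambda>i. coef (F (diagseq i)) n k)"])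
      (simp add: convergent_LIMSEQ_iff)
qed

end

context funk_multiplier
begin

definition l2_extension :: "(real^'d \<Rightarrow> complex) \<Rightarrow> real^'d \<Rightarrow> complex" where
  "l2_extension f = fourier_sum (\<lambda>n k. complex_of_real (\<mu> n) * coef f n k)"

lemma \<mu>_le:
  assumes j: "real j \<le> \<delta>"
  shows "\<bar>\<mu> n\<bar> \<le> K * \<delta> powr (real j - \<delta>)"
proof -
  have "(real n + \<delta>) powr (real j - \<delta>) \<le> \<delta> powr (real j - \<delta>)"
    using j \<delta> by (intro powr_mono2') auto
  from order_trans[OF \<mu>_bound mult_left_mono[OF this K_nonneg]] show ?thesis .
qed

lemma multiplier_wnorm:
  assumes j: "real j \<le> \<delta>" and a: "w1.wfin a"
  shows "w1.wfin (\<lambda>n k. complex_of_real (\<mu> n) * a n k)"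
    and "wnorm N (\<lambda>_. 1) (\<lambda>n k. complex_of_real (\<mu> n) * a n k) \<le> K * \<delta> powr (real j - \<delta>) * wnorm N (\<lambda>_. 1) a"
proof -
  have le: "1 * (cmod (complex_of_real (\<mu> n) * z))\<^sup>2 \<le> (K * \<delta> powr (real j - \<delta>))\<^sup>2 * (1 * (cmod z)\<^sup>2)" for n z
  proof -
    have "\<bar>\<mu> n\<bar>\<^sup>2 \<le> (K * \<delta> powr (real j - \<delta>))\<^sup>2" by (intro power_mono \<mu>_le[OF j]) auto
    from mult_right_mono[OF this, of "(cmod z)\<^sup>2"] show ?thesis by (simp add: norm_mult power_mult_distrib)
  qed
  have K0: "K * \<delta> powr (real j - \<delta>) \<ge> 0" using K_nonneg by simp
  show "w1.wfin (\<lambda>n k. complex_of_real (\<mu> n) * a n k)"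
    "wnorm N (\<lambda>_. 1) (\<lambda>n k. complex_of_real (\<mu> n) * a n k) \<le> K * \<delta> powr (real j - \<delta>) * wnorm N (\<lambda>_. 1) a"
    by (rule wnorm_mono[OF _ _ le K0 a]; simp)+
qed

lemma l2_continuous_extension_l2_extension:
  assumes j: "real j \<le> \<delta>"
  shows "l2_continuous_extension (funk_radon j) l2_extension"
  unfolding l2_continuous_extension_def
proof (intro conjI ballI allI)
  let ?B = "K * \<delta> powr (real j - \<delta>)"
  have B: "?B \<ge> 0" using K_nonneg by simp
  note m = multiplier_wnorm[OF j bessel_wnorm(1)]
  show "l2_extension f \<in> l2_sphere" if "f \<in> l2_sphere" for f
    unfolding l2_extension_def by (rule fourier_sum(1)[OF m(1)[OF that]])
  show "\<exists>C. \<forall>f\<in>l2_sphere. l2_norm (l2_extension f) \<le> C * l2_norm f"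
  proof (intro exI ballI)
    fix f :: "real^'d \<Rightarrow> complex" assume f: "f \<in> l2_sphere"
    show "l2_norm (l2_extension f) \<le> ?B * l2_norm f"
      unfolding l2_extension_def
      using fourier_sum_norm[OF m(1)[OF f]] m(2)[OF f] mult_left_mono[OF bessel_wnorm(2)[OF f] B] by linarith
  qed
next
  fix f g :: "real^'d \<Rightarrow> complex" assume f: "f \<in> l2_sphere" and g: "g \<in> l2_sphere"
  note m = multiplier_wnorm(1)[OF j bessel_wnorm(1)]
  have "l2_extension (f + g) = fourier_sum (\<lambda>n k. complex_of_real (\<mu> n) * coef f n k + complex_of_real (\<mu> n) * coef g n k)"
    unfolding l2_extension_def
    by (rule fourier_sum_cong) (use coef_linear[OF f g, where c = 1] in \<open>simp add: plus_fun_def distrib_left\<close>)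
  then show "AE x in sphere_measure. l2_extension (f + g) x = l2_extension f x + l2_extension g x"
    using fourier_sum_add[OF m[OF f] m[OF g]] by (simp add: l2_extension_def)
next
  fix c and f :: "real^'d \<Rightarrow> complex" assume f: "f \<in> l2_sphere"
  have "l2_extension (\<lambda>y. c * f y) = fourier_sum (\<lambda>n k. c * (complex_of_real (\<mu> n) * coef f n k))"
    unfolding l2_extension_def by (rule fourier_sum_cong) (simp add: coef_scale)
  then show "AE x in sphere_measure. l2_extension (\<lambda>y. c * f y) x = c * l2_extension f x"
    using fourier_sum_scale[OF multiplier_wnorm(1)[OF j bessel_wnorm(1)[OF f]], of c] by (simp add: l2_extension_def)
next
  fix f :: "real^'d \<Rightarrow> complex" assume f: "f \<in> smooth_sphere"
  have S: "funk_radon j f \<in> V" by (rule funk_radon_smooth[OF f card_ge])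
  have "l2_extension f = fourier_sum (coef (funk_radon j f))"
    unfolding l2_extension_def by (rule fourier_sum_cong) (simp add: coef_funk_radon[OF f])
  then show "AE x in sphere_measure. l2_extension f x = funk_radon j f x"
    using fourier_sum_unique[OF bessel_wnorm(1)[OF smooth_sphere_l2[OF S]] smooth_sphere_l2[OF S] psum_coef_tendsto[OF S]]
    by simp
qed

lemma \<mu>_tendsto_0:
  assumes j: "real j < \<delta>"
  shows "\<mu> \<longlonglongrightarrow> 0"
proof (rule Lim_null_comparison)
  show "\<forall>\<^sub>F n in sequentially. norm (\<mu> n) \<le> K * (real n + \<delta>) powr (real j - \<delta>)"
    using \<mu>_bound by simp
  have "filterlim (\<lambda>n. real n + \<delta>) at_top sequentially"
    by (intro filterlim_tendsto_add_at_top[OF tendsto_const, of _ _ \<delta>, simplified add.commute[of \<delta>]] filterlim_real_sequentially)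
  from tendsto_neg_powr[OF _ this, of "real j - \<delta>"] j
  show "(\<lambda>n. K * (real n + \<delta>) powr (real j - \<delta>)) \<longlonglongrightarrow> 0"
    by (intro tendsto_mult_right_zero) simp
qed

text \<open>The multipliers tend to 0, so the degrees from \<open>m\<close> on contribute at most
  \<open>t * C\<close>, uniformly in \<open>i\<close>; the finitely many remaining entries tend to 0
  one by one.\<close>

lemma multiplier_wnorm_tendsto_0:
  assumes j: "real j < \<delta>" and a: "\<And>i. w1.wfin (a i)" "\<And>i. wnorm N (\<lambda>_. 1) (a i) \<le> C"
    and lim: "\<And>n k. k \<in> {1..N n} \<Longrightarrow> (\<lambda>i. a i n k) \<longlonglongrightarrow> 0"
  shows "(\<lambda>i. wnorm N (\<lambda>_. 1) (\<lambda>n k. complex_of_real (\<mu> n) * a i n k)) \<longlonglongrightarrow> 0"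
proof (rule LIMSEQ_I)
  fix e :: real assume e: "e > 0"
  have C: "C \<ge> 0" using a(2)[of 0] w1.wnorm_nonneg[OF a(1)[of 0]] by linarith
  define t where "t = e / (2 * (C + 1))"
  have t: "t > 0" using e C by (simp add: t_def)
  have tC: "t * C < e / 2"
  proof -
    have "t * C < t * (C + 1)" using t by simp
    also have "\<dots> = e / 2" using C by (simp add: t_def divide_simps)
    finally show ?thesis .
  qed
  obtain m where m: "\<And>n. n \<ge> m \<Longrightarrow> \<bar>\<mu> n\<bar> < t"
    using LIMSEQ_D[OF \<mu>_tendsto_0[OF j] t] by auto
  let ?b = "\<lambda>i n k. complex_of_real (\<mu> n) * a i n k"
  note b = multiplier_wnorm(1)[OF less_imp_le[OF j] a(1)]
  have "(\<lambda>i. wpart N (\<lambda>_. 1) (?b i) m) \<longlonglongrightarrow> sqrt (\<Sum>n<m. \<Sum>k=1..N n. 1 * (cmod (complex_of_real (\<mu> n) * 0))\<^sup>2)"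
    unfolding wpart_def wterm_def by (intro tendsto_intros lim)
  then have "(\<lambda>i. wpart N (\<lambda>_. 1) (?b i) m) \<longlonglongrightarrow> 0" by simp
  from LIMSEQ_D[OF this, of "e/2"] e obtain M where M: "\<And>i. i \<ge> M \<Longrightarrow> \<bar>wpart N (\<lambda>_. 1) (?b i) m\<bar> < e / 2"
    by auto
  have "norm (wnorm N (\<lambda>_. 1) (?b i) - 0) < e" if i: "i \<ge> M" for i
  proof -
    let ?h = "\<lambda>n k. if n < m then ?b i n k else 0" and ?t = "\<lambda>n k. if n < m then 0 else ?b i n k"
    have h: "w1.wfin ?h" by (rule wnorm_mono(1)[of "\<lambda>_. 1" "\<lambda>_. 1" _ _ 1, OF _ _ _ _ b[of i]]) auto
    have tl: "1 * (cmod (?t n k))\<^sup>2 \<le> t\<^sup>2 * (1 * (cmod (a i n k))\<^sup>2)" for n k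
    proof (cases "n < m")
      case False
      then have "\<bar>\<mu> n\<bar>\<^sup>2 \<le> t\<^sup>2" using m[of n] by (intro power_mono) auto
      from mult_right_mono[OF this, of "(cmod (a i n k))\<^sup>2"] False show ?thesis
        by (simp add: norm_mult power_mult_distrib)
    qed simp
    have T: "w1.wfin ?t" "wnorm N (\<lambda>_. 1) ?t \<le> t * wnorm N (\<lambda>_. 1) (a i)"
      by (rule wnorm_mono[OF _ _ tl less_imp_le[OF t] a(1)]; simp)+
    have "wnorm N (\<lambda>_. 1) (?b i) = wnorm N (\<lambda>_. 1) (\<lambda>n k. ?h n k + ?t n k)" by (rule wnorm_cong) simp
    also have "\<dots> \<le> wnorm N (\<lambda>_. 1) ?h + wnorm N (\<lambda>_. 1) ?t" by (rule w1.wnorm_add(2)[OF h T(1)])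
    also have "\<dots> \<le> wpart N (\<lambda>_. 1) (?b i) m + t * C"
      unfolding w1.wnorm_head by (intro add_left_mono order_trans[OF T(2)] mult_left_mono a(2) less_imp_le[OF t])
    also have "\<dots> < e" using M[OF i] tC by linarith
    finally show ?thesis using w1.wnorm_nonneg[OF b[of i]] by simp
  qed
  then show "\<exists>M. \<forall>i\<ge>M. norm (wnorm N (\<lambda>_. 1) (?b i) - 0) < e" by blast
qed

text \<open>A bounded sequence has a subsequence with convergent coefficients, whose limit array is
  square summable by the Fatou property. Multiplication by a null sequence upgrades this entrywise
  convergence to convergence in norm.\<close>

lemma l2_compact_l2_extension:
  assumes j: "real j < \<delta>"
  shows "l2_compact l2_extension"
  unfolding l2_compact_def
proof (intro allI impI, elim conjE exE)
  fix F :: "nat \<Rightarrow> real^'d \<Rightarrow> complex" and C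
  assume F: "\<forall>i. F i \<in> l2_sphere" and C: "\<forall>i. l2_norm (F i) \<le> C"
  obtain r \<beta> where r: "strict_mono r" and lim: "\<And>n k. k \<in> {1..N n} \<Longrightarrow> (\<lambda>i. coef (F (r i)) n k) \<longlonglongrightarrow> \<beta> n k"
    using coef_subseq[of F C] F C by blast
  have fin: "w1.wfin (coef (F i))" "wnorm N (\<lambda>_. 1) (coef (F i)) \<le> C" for i
    using bessel_wnorm[OF F[rule_format, of i]] C[rule_format, of i] by (auto intro: order_trans)
  have \<beta>: "w1.wfin \<beta>" "wnorm N (\<lambda>_. 1) \<beta> \<le> C"
    using w1.wnorm_fatou[OF lim, where M = 0 and B = C] fin by simp_all
  let ?b = "\<lambda>n k. complex_of_real (\<mu> n) * \<beta> n k"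
  note mult = multiplier_wnorm(1)[OF less_imp_le[OF j]]
  let ?a = "\<lambda>i n k. coef (F (r i)) n k - \<beta> n k"
  have a: "w1.wfin (?a i)" "wnorm N (\<lambda>_. 1) (?a i) \<le> C + C" for i
    using w1.wnorm_diff[OF fin(1)[of "r i"] \<beta>(1)] fin(2)[of "r i"] \<beta>(2) by auto
  have "(\<lambda>i. ?a i n k) \<longlonglongrightarrow> 0" if "k \<in> {1..N n}" for n k
    using tendsto_diff[OF lim[OF that] tendsto_const, of "\<beta> n k"] by simp
  from multiplier_wnorm_tendsto_0[OF j a this]
  have z: "(\<lambda>i. wnorm N (\<lambda>_. 1) (\<lambda>n k. complex_of_real (\<mu> n) * ?a i n k)) \<longlonglongrightarrow> 0" by simp
  have le: "l2_norm (l2_extension (F (r i)) - fourier_sum ?b) \<le> wnorm N (\<lambda>_. 1) (\<lambda>n k. complex_of_real (\<mu> n) * ?a i n k)" for i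
    using fourier_sum_diff[OF mult[OF fin(1)] mult[OF \<beta>(1)], of "r i"]
    by (simp add: l2_extension_def right_diff_distrib)
  have "(\<lambda>i. l2_norm (l2_extension (F (r i)) - fourier_sum ?b)) \<longlonglongrightarrow> 0"
    by (rule tendsto_sandwich[OF _ _ tendsto_const z]) (auto intro!: always_eventually le l2_norm_nonneg)
  with fourier_sum(1)[OF mult[OF \<beta>(1)]] r
  show "\<exists>g\<in>l2_sphere. \<exists>r. strict_mono r \<and> (\<lambda>i. l2_norm (l2_extension (F (r i)) - g)) \<longlonglongrightarrow> 0" by blast
qed

end

theorem theorem3p4:
  fixes Y :: "nat \<Rightarrow> nat \<Rightarrow> real^'d \<Rightarrow> complex" and s :: real and j :: nat
  assumes "CARD('d) \<ge> 3" and "harmonic_onb Y"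
  defines "d \<equiv> CARD('d)"
    and "p \<equiv> sobolev_norm Y s"
    and "q \<equiv> sobolev_norm Y (s - real j + (real CARD('d) - 2) / 2)"
    and "V \<equiv> smooth_sphere :: (real^'d \<Rightarrow> complex) set"
  shows "(\<exists>!T. continuous_extension V p q (funk_radon j) T) \<and>
    (real j < (real d - 2) / 2 \<longrightarrow>
       (\<exists>T. l2_continuous_extension (funk_radon j :: (real^'d \<Rightarrow> complex) \<Rightarrow> _) T \<and> l2_compact T)) \<and>
    (\<forall>T. continuous_extension V p q (funk_radon j) T \<longrightarrow>
       {A \<in> fun_completion V p. T A = cembed V q 0} =
         ctopology V p closure_of
           (cembed V p ` cfun.span (\<Union>n\<in>{n. odd (n + j) \<or> (int n \<le> int j - int d + 1 \<and> odd d)}.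
              spherical_harmonics n)) \<and>
       {A \<in> fun_completion V p. T A = cembed V q 0} =
         (if odd d \<and> j \<ge> d - 1
          then {cadd V p A B | A B. A \<in> cembed V p ` on_sphere ` polys_upto (j - (d - 1)) \<and>
                  B \<in> (if even j then odd_part V p else even_part V p)}
          else if even j then odd_part V p else even_part V p))"
proof -
  define \<delta> where "\<delta> = (real CARD('d) - 2) / 2"
  interpret harmonic_basis Y "harmonic_dim TYPE('d)" \<delta>
    by unfold_locales (simp_all add: assms(1,2) \<delta>_def)
  obtain \<mu> K where coef: "\<forall>f\<in>smooth_sphere. \<forall>n. \<forall>k\<in>{1..harmonic_dim TYPE('d) n}. coef (funk_radon j f) n k = complex_of_real (\<mu> n) * coef f n k"
    and zero: "\<forall>n. \<mu> n = 0 \<longleftrightarrow> odd (n + j) \<or> (int n \<le> int j - int CARD('d) + 1 \<and> odd CARD('d))"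
    and bound: "\<forall>n. \<bar>\<mu> n\<bar> \<le> K * (real n + \<delta>) powr (real j - \<delta>)" "K \<ge> 0"
    using funk_radon_multiplier[of j] by blast
  interpret funk_multiplier Y "harmonic_dim TYPE('d)" \<delta> j \<mu> K
    by unfold_locales (use coef bound in auto)
  let ?Z = "{n. odd (n + j) \<or> (int n \<le> int j - int d + 1 \<and> odd d)}"
  have Z: "{n. \<mu> n = 0} = ?Z" using zero by (simp add: d_def)
  \<comment> \<open>Every subspace in the claim is brought to the form \<open>supported s\<close> of
    a set of degrees, so the remaining equalities are between sets of natural numbers.\<close>
  have null: "{A \<in> fun_completion V p. T A = cembed V q 0} = supported s ?Z"
    if "continuous_extension V p q (funk_radon j) T" for T
    using nullspace_eq_supported[of s T] that unfolding V_def p_def q_def \<delta>_def[symmetric] Z .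
  have par: "(if even j then odd_part V p else even_part V p) = supported s {n. odd (n + j)}"
    unfolding V_def p_def odd_part_eq even_part_eq by auto
  have "supported s ?Z = (if odd d \<and> j \<ge> d - 1
      then {cadd V p A B | A B. A \<in> cembed V p ` on_sphere ` polys_upto (j - (d - 1)) \<and>
              B \<in> (if even j then odd_part V p else even_part V p)}
      else if even j then odd_part V p else even_part V p)"
  proof (cases "odd d \<and> j \<ge> d - 1")
    case True
    \<comment> \<open>Here the natural subtraction \<open>j - (d - 1)\<close> does not truncate, so
      it agrees with the integer bound on \<open>n\<close>.\<close>
    then have "d \<ge> 1" "int n \<le> int j - int d + 1 \<longleftrightarrow> n \<le> j - (d - 1)" for n by (auto simp: d_def)
    then have "?Z = {..j - (d - 1)} \<union> {n. odd (n + j)}" using True by auto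
    then show ?thesis
      unfolding par if_P[OF True] unfolding V_def p_def unfolding polys_plus_supported by (rule arg_cong)
  next
    case False
    \<comment> \<open>If \<open>d\<close> is odd, then j < d - 1 makes the integer bound on
      \<open>n\<close> negative, so no degree is added beyond those of the wrong parity.\<close>
    then have "?Z = {n. odd (n + j)}" by auto
    then show ?thesis unfolding if_not_P[OF False] par by (rule arg_cong)
  qed
  moreover have "\<exists>!T. continuous_extension V p q (funk_radon j) T"
    using bounded_operator.ex1_continuous_extension[OF bounded_operator_funk_radon[of s]]
    unfolding V_def p_def q_def \<delta>_def .
  moreover have "\<exists>T. l2_continuous_extension (funk_radon j :: (real^'d \<Rightarrow> complex) \<Rightarrow> _) T \<and> l2_compact T"
    if "real j < (real d - 2) / 2"
    using that l2_continuous_extension_l2_extension l2_compact_l2_extension unfolding d_def \<delta>_def[symmetric]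
    by (intro exI[of _ l2_extension]) auto
  moreover have "ctopology V p closure_of (cembed V p ` cfun.span (\<Union>n\<in>?Z. spherical_harmonics n)) = supported s ?Z"
    unfolding V_def p_def by (rule closure_span_harmonics)
  ultimately show ?thesis using null by presburger
qed

end
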